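(* Let $G$ and $H$ be étale Lie groupoids and let $P$ be a principal $H$-bundle over $G$, with maps $\pi\colon P\to G_0$ and $\phi\colon P\to H_0$. Let $\mathcal{C}^\infty_c(P)_{\ast}$ be the principal bundle associated to the locally grouplike principal $\mathcal{C}^\infty_c(G)$-$\mathcal{C}^\infty_c(H)$-bimodule $\mathcal{C}^\infty_c(P)$, regarded as a principal $H$-bundle over $G$ via the natural isomorphisms $G\cong\mathcal{G}_{sp}(\mathcal{C}^\infty_c(G))$ and $H\cong\mathcal{G}_{sp}(\mathcal{C}^\infty_c(H))$. Then the map $\Phi\colon P\to\mathcal{C}^\infty_c(P)_{\ast}$ given by $\Phi(p)=f_{\pi(p)}$, where $f\in G_w(\mathcal{C}^\infty_c(P))$ is any weakly grouplike element whose germ at $p$ is $f_p=1$ and $f_{\pi(p)}$ is its class in $\mathcal{C}^\infty_c(P)_{\pi(p)}$, is an isomorphism of principal $H$-bundles over $G$.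
   Context: **Conventions.** $\mathbb{F}$ is $\mathbb{R}$ or $\mathbb{C}$. Manifolds and maps are smooth; manifolds need not be Hausdorff. **Groupoids and principal bundles.** A Lie groupoid $G$ over a Hausdorff manifold $G_0$ is a groupoid with object manifold $G_0$ and arrow manifold $G$ (possibly non-Hausdorff, with Hausdorff source fibres), all structure maps smooth, source $s$ a submersion, target $t$; $g'g$ is defined when $s(g')=t(g)$; $1_x$ is the identity at $x$. It is étale if all structure maps are local diffeomorphisms. A bisection of an étale $G$ is an open $U\subset G$ with $s|_U,t|_U$ injective; $\tau_U=t|_U\circ(s|_U)^{-1}\colon s(U)\to t(U)$. A left action of $G$ on $P$ along $\pi\colon P\to G_0$ is a smooth map $\mu\colon G\times^{s,\pi}_{G_0}P\to P$, $(g,p)\mapsto g\cdot p$, with $\pi(g\cdot p)=t(g)$, $1_{\pi(p)}\cdot p=p$, $g'\cdot(g\cdot p)=(g'g)\cdot p$; right actions are analogous. A principal $H$-bundle over $G$ is a manifold $P$ with a left action $\mu$ of $G$ along a surjective submersion $\pi\colon P\to G_0$ and a right action $\eta$ of $H$ along $\phi\colon P\to H_0$ such that $\phi(g\cdot p)=\phi(p)$, $\pi(p\cdot h)=\pi(p)$, $g\cdot(p\cdot h)=(g\cdot p)\cdot h$ and $(\mathrm{pr}_1,\eta)\colon P\times^{\phi,t}_{H_0}H\to P\times^{\pi,\pi}_{G_0}P$ is a diffeomorphism. Isomorphisms are equivariant diffeomorphisms (commuting with $\pi,\phi$ and both actions). For étale $G,H$, $\pi$ is a local diffeomorphism. **Functions.**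 For a manifold $P$, $\mathcal{C}^\infty_c(P)$ is the space of (not necessarily continuous) sections of the sheaf of germs of smooth $\mathbb{F}$-valued functions which are finite sums of extensions by zero of compactly supported smooth functions on Hausdorff open subsets; $f_p$ denotes the germ (value of the section) at $p\in P$. For a local diffeomorphism $\pi\colon P\to M$, $M$ Hausdorff, an open $U\subset P$ is $\pi$-elementary if $\pi|_U$ is injective; $f_0\circ\pi|_U$ ($f_0\in\mathcal{C}^\infty_c(\pi(U))$) is viewed in $\mathcal{C}^\infty_c(P)$ by extension by zero; such functions span $\mathcal{C}^\infty_c(P)$. **Bimodule of a bundle.** For étale $G,H$ and a principal $H$-bundle $P$ over $G$, the actions of $\mathcal{C}^\infty_c(G)$ and $\mathcal{C}^\infty_c(H)$ on $\mathcal{C}^\infty_c(P)$ are given on $f=f_0\circ\pi|_U$, $u=u_0\circ t|_{U_u}$, $v=v_0\circ t|_{U_v}$ ($U$ $\pi$-elementary, $U_u\subset G$, $U_v\subset H$ bisections) by $uf=(u_0(f_0\circ\tau_{U_u}^{-1}))\circ\pi|_{\mu(U_u\times_{G_0}U)}$ and $fv=(f_0(v_0\circ\phi\circ(\pi|_U)^{-1}))\circ\pi|_{\eta(U\times_{H_0}U_v)}$, extended bilinearly. Taking $P=G$ with translation actions ($\pi=t$, $\phi=s$) gives the convolution product on $\mathcal{C}^\infty_c(G)$, which contains $\mathcal{C}^\infty_c(G_0)$ as a commutative subalgebra (functions supported on units). $\mathcal{C}^\infty_c(P)$ is a left $\mathcal{C}^\infty_c(G_0)$-coalgebra (counital, coassociative,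 over $\mathcal{C}^\infty_c(G_0)$) by $\epsilon(f_0\circ\pi|_U)=f_0$ and $\Delta(f_0\circ\pi|_U)=(f_0\circ\pi|_U)\otimes(u_0'\circ\pi|_U)$ for any $u_0'\in\mathcal{C}^\infty_c(\pi(U))$ with $u_0'f_0=f_0$. In particular $\mathcal{C}^\infty_c(G)$ is a left $\mathcal{C}^\infty_c(G_0)$-coalgebra via $t$; put $S(u)=u\circ\mathrm{inv}$ on it. **Local coalgebras and grouplike elements.** Let $C$ be a left $\mathcal{C}^\infty_c(M)$-coalgebra, $M$ a Hausdorff manifold, $x\in M$. $\mathcal{C}^\infty_c(M)_x$ is the algebra of germs at $x$; $C_x=C/\{c\mid f_0c=0\text{ for some }f_0\in\mathcal{C}^\infty_c(M)\text{ with germ }(f_0)_x=1\}$ is a left $\mathcal{C}^\infty_c(M)_x$-coalgebra with induced $\Delta_x,\epsilon_x$; $c_x$ is the class of $c$. $G(C_x)=\{\zeta\in C_x\mid\Delta_x(\zeta)=\zeta\otimes\zeta,\ \epsilon_x(\zeta)=1\}$. $G_w(C)=\{c\in C\mid\Delta(c)=c\otimes c'\text{ for some }c'\in C\}$ is the set of weakly grouplike elements. An element $c$ is normalised on an open $W\subset M$ if $\epsilon(c)|_W=1$. Every element of $G(C_x)$ is $c_x$ for some $c\in G_w(C)$ normalised on a neighbourhood of $x$, and conversely such $c$ have $c_x\in G(C_x)$. $G_w(\mathcal{C}^\infty_c(P))$ consists of the functions with compact support in a $\pi$-elementary open set. For $A=\mathcal{C}^\infty_c(G)$, $G^S_w(A)$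 is the set of $a\in A$ such that for some $a'$, $\Delta(a)=a\otimes a'$ and $\Delta(S(a))=S(a')\otimes S(a)$; it consists of the functions with compact support in a bisection. **Spectral constructions.** For a left $\mathcal{C}^\infty_c(M)$-coalgebra $C$, $M$ a Hausdorff manifold, $\mathcal{E}_{sp}(C)=\bigsqcup_{x\in M}G(C_x)$ with projection $\pi_{sp}$ to $M$, topologised by the basis of sets $c_W=\{c_x\mid x\in W\}$ ($W$ open, $c\in G_w(C)$ normalised on $W$), with the smooth structure making $\pi_{sp}$ a local diffeomorphism. The spectral groupoid $\mathcal{G}_{sp}(A)$ of $A=\mathcal{C}^\infty_c(G)$ has objects $G_0$, arrow manifold $\mathcal{E}_{sp}(A)$, $t=\pi_{sp}$; each arrow with target $y$ is $a_y$ with $a\in G_w^S(A)$ normalised on a neighbourhood $W_a$ of $y$; there is a diffeomorphism $\tau_{W_a,a}\colon V_{W_a,a}\to W_a$ from an open subset of $G_0$ determined by $u_0a=a(u_0\circ\tau_{W_a,a})$ for all $u_0\in\mathcal{C}^\infty_c(W_a)$, and $s(a_y)=\tau_{W_a,a}^{-1}(y)$; $a'_{y'}a_y=(a'a)_{y'}$. The natural isomorphism $G\to\mathcal{G}_{sp}(\mathcal{C}^\infty_c(G))$ of Lie groupoids sends $g$ to $u_{t(g)}$, for any $u\in G_w^S(\mathcal{C}^\infty_c(G))$ with germ $u_g=1$. **The bundle $\mathcal{M}_\ast$.** For $\mathcal{M}=\mathcal{C}^\infty_c(P)$, $A=\mathcal{C}^\infty_c(G)$, $B=\mathcal{C}^\infty_c(H)$: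 $\mathcal{M}_\ast=\mathcal{E}_{sp}(\mathcal{M})$ with projection $\pi_{sp}\colon\mathcal{M}_\ast\to G_0$; moment map $\mathcal{M}_\ast\to H_0$ sending $m_x$ ($m\in G_w(\mathcal{M})$ normalised near $x$) to the unique $z\in H_0$ with $\epsilon(mv_0)(x)=v_0(z)$ for all $v_0\in\mathcal{C}^\infty_c(H_0)$; actions $a_y\cdot m_x=(am)_y$ for $a_y\in\mathcal{G}_{sp}(A)$ with $s(a_y)=x$, and $m_x\cdot b_z=(mb)_x$ for $b_z\in\mathcal{G}_{sp}(B)$ with target $z$ equal to the moment of $m_x$ ($a\in G^S_w(A)$, $b\in G^S_w(B)$, $m\in G_w(\mathcal{M})$ normalised near $y,z,x$ respectively). These make $\mathcal{M}_\ast$ a principal $\mathcal{G}_{sp}(B)$-bundle over $\mathcal{G}_{sp}(A)$. *)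

theory Defs
  imports "HOL-Analysis.Analysis" "HOL-Library.Poly_Mapping"
begin

section \<open>Smooth manifolds\<close>

text \<open>
  On an open subset of a finite-dimensional space this is the usual notion of a \<open>C\<^sup>k\<close>-map:
  the derivative is \<open>C\<^sup>k\<^sup>-\<^sup>1\<close> in every fixed direction.
\<close>

primrec Ck_on :: "nat \<Rightarrow> 'e::real_normed_vector set \<Rightarrow> ('e \<Rightarrow> 'f::real_normed_vector) \<Rightarrow> bool" where
  "Ck_on 0 S f \<longleftrightarrow> continuous_on S f"
| "Ck_on (Suc k) S f \<longleftrightarrow>
     (\<exists>f'. (\<forall>x\<in>S. (f has_derivative f' x) (at x)) \<and> (\<forall>v. Ck_on k S (\<lambda>x. f' x v)))"

definition smooth_on :: "'e::real_normed_vector set \<Rightarrow> ('e \<Rightarrow> 'f::real_normed_vector) \<Rightarrow> bool" where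
  "smooth_on S f \<longleftrightarrow> (\<forall>k. Ck_on k S f)"

text \<open>
  A manifold is a (not necessarily Hausdorff or second countable) topological space with a smooth
  atlas. The charts take values in a finite-dimensional real inner product space \<open>'e\<close>; the type class
  \<open>euclidean_space\<close> is not used because it excludes dimension \<open>0\<close>. The underlying set is
  the carrier of the topology, and points of the type outside it are irrelevant throughout.
\<close>

record ('a, 'e) manifold =
  mtop :: "'a topology"
  atlas :: "('a set \<times> ('a \<Rightarrow> 'e)) set"

abbreviation pts :: "('a, 'e, 'z) manifold_scheme \<Rightarrow> 'a set" where
  "pts M \<equiv> topspace (mtop M)"

definition is_manifold :: "('a, 'e::real_inner) manifold \<Rightarrow> bool" where
  "is_manifold M \<longleftrightarrow>
     (\<exists>B :: 'e set. finite B \<and> span B = UNIV) \<and>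
     (\<forall>(U, \<phi>)\<in>atlas M. openin (mtop M) U \<and> open (\<phi> ` U) \<and>
        homeomorphic_map (subtopology (mtop M) U) (top_of_set (\<phi> ` U)) \<phi>) \<and>
     (\<Union>(U, \<phi>)\<in>atlas M. U) = pts M \<and>
     (\<forall>(U, \<phi>)\<in>atlas M. \<forall>(V, \<psi>)\<in>atlas M. smooth_on (\<phi> ` (U \<inter> V)) (\<psi> \<circ> inv_into U \<phi>))"

definition prod_manifold :: "('a, 'e) manifold \<Rightarrow> ('b, 'f) manifold \<Rightarrow> ('a \<times> 'b, 'e \<times> 'f) manifold" where
  "prod_manifold M N = \<lparr>mtop = prod_topology (mtop M) (mtop N),
     atlas = {(U \<times> V, map_prod \<phi> \<psi>) | U V \<phi> \<psi>. (U, \<phi>) \<in> atlas M \<and> (V, \<psi>) \<in> atlas N}\<rparr>"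

text \<open>
  Smoothness of a map on an arbitrary subset \<open>A\<close> of a manifold: in charts it extends locally to a
  smooth map on an open set. If \<open>A\<close> is open, or an embedded submanifold (such as a fibre product
  along a submersion inside the product), this is smoothness for the manifold structure of \<open>A\<close>.
\<close>

definition smooth_map :: "('a, 'e::real_inner) manifold \<Rightarrow> 'a set \<Rightarrow> ('b, 'f::real_inner) manifold \<Rightarrow> ('a \<Rightarrow> 'b) \<Rightarrow> bool" where
  "smooth_map M A N f \<longleftrightarrow> A \<subseteq> pts M \<and> f ` A \<subseteq> pts N \<and>
     (\<forall>p\<in>A. \<exists>(U, \<phi>)\<in>atlas M. \<exists>(V, \<psi>)\<in>atlas N. p \<in> U \<and> f p \<in> V \<and>
        (\<exists>S F. open S \<and> \<phi> p \<in> S \<and> smooth_on S F \<and>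
           (\<forall>q\<in>A \<inter> U. \<phi> q \<in> S \<longrightarrow> f q \<in> V \<and> \<psi> (f q) = F (\<phi> q))))"

definition smooth_function :: "('a, 'e::real_inner) manifold \<Rightarrow> 'a set \<Rightarrow> ('a \<Rightarrow> 'k::real_normed_vector) \<Rightarrow> bool" where
  "smooth_function M A f \<longleftrightarrow> A \<subseteq> pts M \<and>
     (\<forall>p\<in>A. \<exists>(U, \<phi>)\<in>atlas M. p \<in> U \<and>
        (\<exists>S F. open S \<and> \<phi> p \<in> S \<and> smooth_on S F \<and>
           (\<forall>q\<in>A \<inter> U. \<phi> q \<in> S \<longrightarrow> f q = F (\<phi> q))))"

definition diffeo :: "('a, 'e::real_inner) manifold \<Rightarrow> 'a set \<Rightarrow> ('b, 'f::real_inner) manifold \<Rightarrow> 'b set \<Rightarrow> ('a \<Rightarrow> 'b) \<Rightarrow> bool" where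
  "diffeo M A N B f \<longleftrightarrow> bij_betw f A B \<and> smooth_map M A N f \<and> smooth_map N B M (inv_into A f)"

definition local_diffeo :: "('a, 'e::real_inner) manifold \<Rightarrow> 'a set \<Rightarrow> ('b, 'f::real_inner) manifold \<Rightarrow> ('a \<Rightarrow> 'b) \<Rightarrow> bool" where
  "local_diffeo M A N f \<longleftrightarrow>
     (\<forall>p\<in>A. \<exists>U V. openin (subtopology (mtop M) A) U \<and> p \<in> U \<and> openin (mtop N) V \<and> diffeo M U N V f)"

definition submersion :: "('a, 'e::real_inner) manifold \<Rightarrow> ('b, 'f::real_inner) manifold \<Rightarrow> ('a \<Rightarrow> 'b) \<Rightarrow> bool" where
  "submersion M N f \<longleftrightarrow> smooth_map M (pts M) N f \<and>
     (\<forall>p\<in>pts M. \<exists>(U, \<phi>)\<in>atlas M. \<exists>(V, \<psi>)\<in>atlas N. p \<in> U \<and> f p \<in> V \<and>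
        (\<exists>D. ((\<psi> \<circ> f \<circ> inv_into U \<phi>) has_derivative D) (at (\<phi> p)) \<and> surj D))"


section \<open>Lie groupoids and principal bundles\<close>

record ('x, 'e, 'g, 'd) groupoid =
  objs :: "('x, 'e) manifold"
  arrs :: "('g, 'd) manifold"
  src :: "'g \<Rightarrow> 'x"
  tgt :: "'g \<Rightarrow> 'x"
  mlt :: "'g \<Rightarrow> 'g \<Rightarrow> 'g"
  unt :: "'x \<Rightarrow> 'g"
  ivs :: "'g \<Rightarrow> 'g"

definition composable :: "('x, 'e, 'g, 'd) groupoid \<Rightarrow> ('g \<times> 'g) set" where
  "composable G = {(g', g). g' \<in> pts (arrs G) \<and> g \<in> pts (arrs G) \<and> src G g' = tgt G g}"

definition is_groupoid :: "('x, 'e, 'g, 'd) groupoid \<Rightarrow> bool" where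
  "is_groupoid G \<longleftrightarrow>
     src G ` pts (arrs G) \<subseteq> pts (objs G) \<and> tgt G ` pts (arrs G) \<subseteq> pts (objs G) \<and>
     (\<forall>(g', g)\<in>composable G. mlt G g' g \<in> pts (arrs G) \<and>
        src G (mlt G g' g) = src G g \<and> tgt G (mlt G g' g) = tgt G g') \<and>
     (\<forall>g'' g' g. (g'', g') \<in> composable G \<and> (g', g) \<in> composable G \<longrightarrow>
        mlt G g'' (mlt G g' g) = mlt G (mlt G g'' g') g) \<and>
     (\<forall>x\<in>pts (objs G). unt G x \<in> pts (arrs G) \<and> src G (unt G x) = x \<and> tgt G (unt G x) = x) \<and>
     (\<forall>g\<in>pts (arrs G). mlt G g (unt G (src G g)) = g \<and> mlt G (unt G (tgt G g)) g = g) \<and>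
     (\<forall>g\<in>pts (arrs G). ivs G g \<in> pts (arrs G) \<and> src G (ivs G g) = tgt G g \<and> tgt G (ivs G g) = src G g \<and>
        mlt G g (ivs G g) = unt G (tgt G g) \<and> mlt G (ivs G g) g = unt G (src G g))"

definition lie_groupoid :: "('x, 'e::real_inner, 'g, 'd::real_inner) groupoid \<Rightarrow> bool" where
  "lie_groupoid G \<longleftrightarrow> is_groupoid G \<and>
     is_manifold (objs G) \<and> Hausdorff_space (mtop (objs G)) \<and> is_manifold (arrs G) \<and>
     (\<forall>x\<in>pts (objs G). Hausdorff_space (subtopology (mtop (arrs G)) {g \<in> pts (arrs G). src G g = x})) \<and>
     submersion (arrs G) (objs G) (src G) \<and>
     smooth_map (arrs G) (pts (arrs G)) (objs G) (tgt G) \<and>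
     smooth_map (objs G) (pts (objs G)) (arrs G) (unt G) \<and>
     smooth_map (arrs G) (pts (arrs G)) (arrs G) (ivs G) \<and>
     smooth_map (prod_manifold (arrs G) (arrs G)) (composable G) (arrs G) (\<lambda>(g', g). mlt G g' g)"

definition etale_groupoid :: "('x, 'e::real_inner, 'g, 'd::real_inner) groupoid \<Rightarrow> bool" where
  "etale_groupoid G \<longleftrightarrow> lie_groupoid G \<and>
     local_diffeo (arrs G) (pts (arrs G)) (objs G) (src G) \<and>
     local_diffeo (arrs G) (pts (arrs G)) (objs G) (tgt G) \<and>
     local_diffeo (objs G) (pts (objs G)) (arrs G) (unt G) \<and>
     local_diffeo (arrs G) (pts (arrs G)) (arrs G) (ivs G) \<and>
     local_diffeo (prod_manifold (arrs G) (arrs G)) (composable G) (arrs G) (\<lambda>(g', g). mlt G g' g)"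

definition bisection :: "('x, 'e, 'g, 'd) groupoid \<Rightarrow> 'g set \<Rightarrow> bool" where
  "bisection G U \<longleftrightarrow> openin (mtop (arrs G)) U \<and> inj_on (src G) U \<and> inj_on (tgt G) U"

definition bisection_map :: "('x, 'e, 'g, 'd) groupoid \<Rightarrow> 'g set \<Rightarrow> 'x \<Rightarrow> 'x" where
  "bisection_map G U = tgt G \<circ> inv_into U (src G)"

record ('p, 'q, 'x, 'g, 'y, 'h) bibundle =
  bspace :: "('p, 'q) manifold"
  bproj :: "'p \<Rightarrow> 'x"
  bmom :: "'p \<Rightarrow> 'y"
  lact :: "'g \<Rightarrow> 'p \<Rightarrow> 'p"
  ract :: "'p \<Rightarrow> 'h \<Rightarrow> 'p"

definition left_fibre_product :: "('x, 'e, 'g, 'd) groupoid \<Rightarrow> ('p, 'q, 'x, 'g, 'y, 'h) bibundle \<Rightarrow> ('g \<times> 'p) set" where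
  "left_fibre_product G P = {(g, p). g \<in> pts (arrs G) \<and> p \<in> pts (bspace P) \<and> src G g = bproj P p}"

definition right_fibre_product :: "('y, 'f, 'h, 'c) groupoid \<Rightarrow> ('p, 'q, 'x, 'g, 'y, 'h) bibundle \<Rightarrow> ('p \<times> 'h) set" where
  "right_fibre_product H P = {(p, h). p \<in> pts (bspace P) \<and> h \<in> pts (arrs H) \<and> bmom P p = tgt H h}"

definition left_action :: "('x, 'e::real_inner, 'g, 'd::real_inner) groupoid \<Rightarrow> ('p, 'q::real_inner, 'x, 'g, 'y, 'h) bibundle \<Rightarrow> bool" where
  "left_action G P \<longleftrightarrow>
     smooth_map (prod_manifold (arrs G) (bspace P)) (left_fibre_product G P) (bspace P) (\<lambda>(g, p). lact P g p) \<and>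
     (\<forall>(g, p)\<in>left_fibre_product G P. bproj P (lact P g p) = tgt G g) \<and>
     (\<forall>p\<in>pts (bspace P). lact P (unt G (bproj P p)) p = p) \<and>
     (\<forall>g' g p. (g', g) \<in> composable G \<and> (g, p) \<in> left_fibre_product G P \<longrightarrow>
        lact P g' (lact P g p) = lact P (mlt G g' g) p)"

definition right_action :: "('y, 'f::real_inner, 'h, 'c::real_inner) groupoid \<Rightarrow> ('p, 'q::real_inner, 'x, 'g, 'y, 'h) bibundle \<Rightarrow> bool" where
  "right_action H P \<longleftrightarrow>
     smooth_map (prod_manifold (bspace P) (arrs H)) (right_fibre_product H P) (bspace P) (\<lambda>(p, h). ract P p h) \<and>
     (\<forall>(p, h)\<in>right_fibre_product H P. bmom P (ract P p h) = src H h) \<and>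
     (\<forall>p\<in>pts (bspace P). ract P p (unt H (bmom P p)) = p) \<and>
     (\<forall>p h h'. (p, h) \<in> right_fibre_product H P \<and> (h, h') \<in> composable H \<longrightarrow>
        ract P (ract P p h) h' = ract P p (mlt H h h'))"

definition principal_bundle ::
  "('x, 'e::real_inner, 'g, 'd::real_inner) groupoid \<Rightarrow> ('y, 'f::real_inner, 'h, 'c::real_inner) groupoid \<Rightarrow>
   ('p, 'q::real_inner, 'x, 'g, 'y, 'h) bibundle \<Rightarrow> bool" where
  "principal_bundle G H P \<longleftrightarrow>
     is_manifold (bspace P) \<and>
     submersion (bspace P) (objs G) (bproj P) \<and> bproj P ` pts (bspace P) = pts (objs G) \<and>
     smooth_map (bspace P) (pts (bspace P)) (objs H) (bmom P) \<and>
     left_action G P \<and> right_action H P \<and>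
     (\<forall>(g, p)\<in>left_fibre_product G P. bmom P (lact P g p) = bmom P p) \<and>
     (\<forall>(p, h)\<in>right_fibre_product H P. bproj P (ract P p h) = bproj P p) \<and>
     (\<forall>g p h. (g, p) \<in> left_fibre_product G P \<and> (p, h) \<in> right_fibre_product H P \<longrightarrow>
        lact P g (ract P p h) = ract P (lact P g p) h) \<and>
     diffeo (prod_manifold (bspace P) (arrs H)) (right_fibre_product H P)
       (prod_manifold (bspace P) (bspace P))
       {(p, p'). p \<in> pts (bspace P) \<and> p' \<in> pts (bspace P) \<and> bproj P p = bproj P p'}
       (\<lambda>(p, h). (p, ract P p h))"

definition principal_bundle_iso ::
  "('x, 'e::real_inner, 'g, 'd::real_inner) groupoid \<Rightarrow> ('y, 'f::real_inner, 'h, 'c::real_inner) groupoid \<Rightarrow>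
   ('p, 'q::real_inner, 'x, 'g, 'y, 'h) bibundle \<Rightarrow> ('r, 's::real_inner, 'x, 'g, 'y, 'h) bibundle \<Rightarrow> ('p \<Rightarrow> 'r) \<Rightarrow> bool" where
  "principal_bundle_iso G H P Q \<Phi> \<longleftrightarrow>
     principal_bundle G H P \<and> principal_bundle G H Q \<and>
     diffeo (bspace P) (pts (bspace P)) (bspace Q) (pts (bspace Q)) \<Phi> \<and>
     (\<forall>p\<in>pts (bspace P). bproj Q (\<Phi> p) = bproj P p \<and> bmom Q (\<Phi> p) = bmom P p) \<and>
     (\<forall>(g, p)\<in>left_fibre_product G P. \<Phi> (lact P g p) = lact Q g (\<Phi> p)) \<and>
     (\<forall>(p, h)\<in>right_fibre_product H P. \<Phi> (ract P p h) = ract Q (\<Phi> p) h)"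

definition translation_bundle :: "('x, 'e, 'g, 'd) groupoid \<Rightarrow> ('g, 'd, 'x, 'g, 'x, 'g) bibundle" where
  "translation_bundle G =
     \<lparr>bspace = arrs G, bproj = tgt G, bmom = src G, lact = mlt G, ract = mlt G\<rparr>"


section \<open>Compactly supported functions\<close>

text \<open>
  The ground field is a type \<open>'k\<close> of class \<open>real_normed_field\<close>; by the Gelfand--Mazur theorem
  these are exactly the real and the complex numbers.

  A germ at \<open>p\<close> is represented by the set of its representatives, and a (not necessarily continuous)
  section of the sheaf of germs by the function assigning to each point its germ. Outside the
  carrier the germ is the empty set.
\<close>

type_synonym ('p, 'k) germ_section = "'p \<Rightarrow> ('p \<Rightarrow> 'k) set"

definition germ :: "'p topology \<Rightarrow> 'p \<Rightarrow> ('p \<Rightarrow> 'k) \<Rightarrow> ('p \<Rightarrow> 'k) set" where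
  "germ X p f = {g. \<exists>V. openin X V \<and> p \<in> V \<and> (\<forall>q\<in>V. g q = f q)}"

definition ext_zero :: "'p topology \<Rightarrow> 'p set \<Rightarrow> ('p \<Rightarrow> 'k::zero) \<Rightarrow> ('p, 'k) germ_section" where
  "ext_zero X U f = (\<lambda>p. germ X p (if p \<in> U then f else (\<lambda>_. 0)))"

definition sec_add :: "'p topology \<Rightarrow> ('p, 'k::plus) germ_section \<Rightarrow> ('p, 'k) germ_section \<Rightarrow> ('p, 'k) germ_section" where
  "sec_add X c d = (\<lambda>p. \<Union>f\<in>c p. \<Union>g\<in>d p. germ X p (\<lambda>q. f q + g q))"

inductive_set Cc :: "('p, 'e::real_inner) manifold \<Rightarrow> ('p, 'k::real_normed_field) germ_section set"
  for P :: "('p, 'e) manifold" where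
  zero: "ext_zero (mtop P) {} (\<lambda>_. 0) \<in> Cc P"
| add: "\<lbrakk>c \<in> Cc P; openin (mtop P) U; Hausdorff_space (subtopology (mtop P) U);
         smooth_function P U f; compactin (mtop P) K; K \<subseteq> U; \<forall>p\<in>U - K. f p = 0\<rbrakk>
        \<Longrightarrow> sec_add (mtop P) c (ext_zero (mtop P) U f) \<in> Cc P"

text \<open>
  On an open subset \<open>W\<close> of a Hausdorff manifold \<open>M\<close>, sections as above are the same as ordinary
  smooth functions on \<open>M\<close> with compact support contained in \<open>W\<close>.
\<close>

definition Cc0 :: "('x, 'e::real_inner) manifold \<Rightarrow> 'x set \<Rightarrow> ('x \<Rightarrow> 'k::real_normed_field) set" where
  "Cc0 M W = {f. smooth_function M (pts M) f \<and> (\<exists>K. compactin (mtop M) K \<and> K \<subseteq> W \<and> (\<forall>x. x \<notin> K \<longrightarrow> f x = 0))}"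

definition elementary :: "('p, 'q) manifold \<Rightarrow> ('p \<Rightarrow> 'x) \<Rightarrow> 'p set \<Rightarrow> bool" where
  "elementary P \<pi> U \<longleftrightarrow> openin (mtop P) U \<and> inj_on \<pi> U"

definition elem_fun :: "('p, 'q) manifold \<Rightarrow> ('p \<Rightarrow> 'x) \<Rightarrow> 'p set \<Rightarrow> ('x \<Rightarrow> 'k::zero) \<Rightarrow> ('p, 'k) germ_section" where
  "elem_fun P \<pi> U f0 = ext_zero (mtop P) U (f0 \<circ> \<pi>)"


section \<open>Coalgebras, localisation and grouplike elements\<close>

record ('r, 'c) rmodule =
  scal :: "'r set"
  carr :: "'c set"
  vzero :: 'c
  vadd :: "'c \<Rightarrow> 'c \<Rightarrow> 'c"
  vsmul :: "'r \<Rightarrow> 'c \<Rightarrow> 'c"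

text \<open>
  The tensor square of a module over its commutative ring of scalars: the free abelian group on
  pairs modulo the subgroup generated by the usual relations. For \<open>C\<^sub>c\<close>-modules compatibility with
  scalars from the ground field is automatic, by the presence of local units.
\<close>

inductive_set tensor_null :: "('r, 'c, 'z) rmodule_scheme \<Rightarrow> ('c \<times> 'c \<Rightarrow>\<^sub>0 int) set"
  for C :: "('r, 'c, 'z) rmodule_scheme" where
  zero: "0 \<in> tensor_null C"
| diff: "\<lbrakk>s \<in> tensor_null C; t \<in> tensor_null C\<rbrakk> \<Longrightarrow> s - t \<in> tensor_null C"
| add_left: "\<lbrakk>a \<in> carr C; b \<in> carr C; c \<in> carr C\<rbrakk> \<Longrightarrow>
    frag_of (vadd C a b, c) - frag_of (a, c) - frag_of (b, c) \<in> tensor_null C"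
| add_right: "\<lbrakk>a \<in> carr C; b \<in> carr C; c \<in> carr C\<rbrakk> \<Longrightarrow>
    frag_of (a, vadd C b c) - frag_of (a, b) - frag_of (a, c) \<in> tensor_null C"
| balanced: "\<lbrakk>r \<in> scal C; a \<in> carr C; b \<in> carr C\<rbrakk> \<Longrightarrow>
    frag_of (vsmul C r a, b) - frag_of (a, vsmul C r b) \<in> tensor_null C"

definition tensor_class :: "('r, 'c, 'z) rmodule_scheme \<Rightarrow> ('c \<times> 'c \<Rightarrow>\<^sub>0 int) \<Rightarrow> ('c \<times> 'c \<Rightarrow>\<^sub>0 int) set" where
  "tensor_class C t = {t'. t' - t \<in> tensor_null C}"

definition tensor :: "('r, 'c, 'z) rmodule_scheme \<Rightarrow> 'c \<Rightarrow> 'c \<Rightarrow> ('c \<times> 'c \<Rightarrow>\<^sub>0 int) set" where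
  "tensor C a b = tensor_class C (frag_of (a, b))"

record ('r, 'c) coalgebra = "('r, 'c) rmodule" +
  comul :: "'c \<Rightarrow> ('c \<times> 'c \<Rightarrow>\<^sub>0 int) set"
  cou :: "'c \<Rightarrow> 'r"

text \<open>The left coalgebra \<open>C\<^sub>c(P)\<close> over \<open>C\<^sub>c(M)\<close> for a local diffeomorphism \<open>\<pi>\<close> from \<open>P\<close> to \<open>M\<close>.\<close>

definition Cc_module :: "('x, 'e::real_inner) manifold \<Rightarrow> ('p, 'q::real_inner) manifold \<Rightarrow> ('p \<Rightarrow> 'x) \<Rightarrow>
    ('x \<Rightarrow> 'k::real_normed_field, ('p, 'k) germ_section) rmodule" where
  "Cc_module M P \<pi> =
     \<lparr>scal = Cc0 M (pts M), carr = Cc P, vzero = ext_zero (mtop P) {} (\<lambda>_. 0), vadd = sec_add (mtop P),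
      vsmul = (\<lambda>f0 c p. \<Union>f\<in>c p. germ (mtop P) p (\<lambda>q. f0 (\<pi> q) * f q))\<rparr>"

definition Cc_counit :: "('x, 'e::real_inner) manifold \<Rightarrow> ('p, 'q::real_inner) manifold \<Rightarrow> ('p \<Rightarrow> 'x) \<Rightarrow>
    ('p, 'k::real_normed_field) germ_section \<Rightarrow> ('x \<Rightarrow> 'k)" where
  "Cc_counit M P \<pi> = (SOME \<epsilon>.
     (\<forall>c\<in>Cc P. \<forall>d\<in>Cc P. \<epsilon> (sec_add (mtop P) c d) = (\<lambda>x. \<epsilon> c x + \<epsilon> d x)) \<and>
     (\<forall>U f0. elementary P \<pi> U \<and> f0 \<in> Cc0 M (\<pi> ` U) \<longrightarrow> \<epsilon> (elem_fun P \<pi> U f0) = f0))"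

definition Cc_comult :: "('x, 'e::real_inner) manifold \<Rightarrow> ('p, 'q::real_inner) manifold \<Rightarrow> ('p \<Rightarrow> 'x) \<Rightarrow>
    ('p, 'k::real_normed_field) germ_section \<Rightarrow>
    (('p, 'k) germ_section \<times> ('p, 'k) germ_section \<Rightarrow>\<^sub>0 int) set" where
  "Cc_comult M P \<pi> = (SOME \<Delta>.
     (\<forall>c\<in>Cc P. \<forall>d\<in>Cc P. \<Delta> (sec_add (mtop P) c d) = {s + t | s t. s \<in> \<Delta> c \<and> t \<in> \<Delta> d}) \<and>
     (\<forall>U f0 u0. elementary P \<pi> U \<and> f0 \<in> Cc0 M (\<pi> ` U) \<and> u0 \<in> Cc0 M (\<pi> ` U) \<and> (\<forall>x. u0 x * f0 x = f0 x) \<longrightarrow>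
        \<Delta> (elem_fun P \<pi> U f0) = tensor (Cc_module M P \<pi>) (elem_fun P \<pi> U f0) (elem_fun P \<pi> U u0)))"

definition Cc_coalgebra :: "('x, 'e::real_inner) manifold \<Rightarrow> ('p, 'q::real_inner) manifold \<Rightarrow> ('p \<Rightarrow> 'x) \<Rightarrow>
    ('x \<Rightarrow> 'k::real_normed_field, ('p, 'k) germ_section) coalgebra" where
  "Cc_coalgebra M P \<pi> =
     rmodule.extend (Cc_module M P \<pi>) (coalgebra.fields (Cc_comult M P \<pi>) (Cc_counit M P \<pi>))"

text \<open>Below, \<open>C\<close> is a left coalgebra over \<open>C\<^sub>c(M)\<close>, where \<open>M\<close> has the topology \<open>X\<close>.\<close>

definition null_at :: "('x \<Rightarrow> 'k::real_normed_field, 'c, 'z) rmodule_scheme \<Rightarrow> 'x topology \<Rightarrow> 'x \<Rightarrow> 'c set" where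
  "null_at C X x = {c \<in> carr C. \<exists>f0\<in>scal C. germ X x f0 = germ X x (\<lambda>_. 1) \<and> vsmul C f0 c = vzero C}"

definition cls :: "('x \<Rightarrow> 'k::real_normed_field, 'c, 'z) rmodule_scheme \<Rightarrow> 'x topology \<Rightarrow> 'x \<Rightarrow> 'c \<Rightarrow> 'c set" where
  "cls C X x c = vadd C c ` null_at C X x"

definition local_module :: "('x \<Rightarrow> 'k::real_normed_field, 'c, 'z) rmodule_scheme \<Rightarrow> 'x topology \<Rightarrow> 'x \<Rightarrow>
    (('x \<Rightarrow> 'k) set, 'c set) rmodule" where
  "local_module C X x =
     \<lparr>scal = germ X x ` scal C, carr = cls C X x ` carr C, vzero = cls C X x (vzero C),
      vadd = (\<lambda>\<zeta> \<xi>. {vadd C a b | a b. a \<in> \<zeta> \<and> b \<in> \<xi>}),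
      vsmul = (\<lambda>\<rho> \<zeta>. \<Union>f0\<in>\<rho> \<inter> scal C. \<Union>c\<in>\<zeta>. cls C X x (vsmul C f0 c))\<rparr>"

definition local_coalgebra :: "('x \<Rightarrow> 'k::real_normed_field, 'c) coalgebra \<Rightarrow> 'x topology \<Rightarrow> 'x \<Rightarrow>
    (('x \<Rightarrow> 'k) set, 'c set) coalgebra" where
  "local_coalgebra C X x =
     rmodule.extend (local_module C X x) (coalgebra.fields
       (\<lambda>\<zeta>. \<Union>c\<in>\<zeta>. \<Union>t\<in>comul C c. tensor_class (local_module C X x)
          (frag_extend (\<lambda>(a, b). frag_of (cls C X x a, cls C X x b)) t))
       (\<lambda>\<zeta>. \<Union>c\<in>\<zeta>. germ X x (cou C c)))"

definition grouplike_at :: "('x \<Rightarrow> 'k::real_normed_field, 'c) coalgebra \<Rightarrow> 'x topology \<Rightarrow> 'x \<Rightarrow> 'c set set" where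
  "grouplike_at C X x = {\<zeta> \<in> carr (local_coalgebra C X x).
     comul (local_coalgebra C X x) \<zeta> = tensor (local_coalgebra C X x) \<zeta> \<zeta> \<and>
     cou (local_coalgebra C X x) \<zeta> = germ X x (\<lambda>_. 1)}"

definition weakly_grouplike :: "('r, 'c) coalgebra \<Rightarrow> 'c set" where
  "weakly_grouplike C = {c \<in> carr C. \<exists>c'\<in>carr C. comul C c = tensor C c c'}"

definition normalised_on :: "('x \<Rightarrow> 'k::real_normed_field, 'c) coalgebra \<Rightarrow> 'x set \<Rightarrow> 'c \<Rightarrow> bool" where
  "normalised_on C W c \<longleftrightarrow> (\<forall>x\<in>W. cou C c x = 1)"

definition normalised_near :: "('x \<Rightarrow> 'k::real_normed_field, 'c) coalgebra \<Rightarrow> 'x topology \<Rightarrow> 'x \<Rightarrow> 'c \<Rightarrow> bool" where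
  "normalised_near C X x c \<longleftrightarrow> (\<exists>W. openin X W \<and> x \<in> W \<and> normalised_on C W c)"


section \<open>The spectral sheaf\<close>

definition spectral_space :: "('x \<Rightarrow> 'k::real_normed_field, 'c) coalgebra \<Rightarrow> 'x topology \<Rightarrow> ('x \<times> 'c set) set" where
  "spectral_space C X = (SIGMA x:topspace X. grouplike_at C X x)"

definition spectral_basic :: "('x \<Rightarrow> 'k::real_normed_field, 'c) coalgebra \<Rightarrow> 'x topology \<Rightarrow> 'x set \<Rightarrow> 'c \<Rightarrow> ('x \<times> 'c set) set" where
  "spectral_basic C X W c = (\<lambda>x. (x, cls C X x c)) ` W"

text \<open>
  The basic sets cover the spectral space; adding the whole space to the generating family only makes
  the carrier of the topology evident. The charts are the charts of \<open>M\<close> composed with the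
  projection, restricted to the basic sets.
\<close>

definition spectral_manifold :: "('x \<Rightarrow> 'k::real_normed_field, 'c) coalgebra \<Rightarrow> ('x, 'e) manifold \<Rightarrow>
    ('x \<times> 'c set, 'e) manifold" where
  "spectral_manifold C M =
     \<lparr>mtop = topology_generated_by (insert (spectral_space C (mtop M))
        {spectral_basic C (mtop M) W c | W c.
           openin (mtop M) W \<and> c \<in> weakly_grouplike C \<and> normalised_on C W c}),
      atlas = {(spectral_basic C (mtop M) W c, \<phi> \<circ> fst) | W c U \<phi>.
           (U, \<phi>) \<in> atlas M \<and> W \<subseteq> U \<and>
           openin (mtop M) W \<and> c \<in> weakly_grouplike C \<and> normalised_on C W c}\<rparr>"


section \<open>The convolution algebra and its bimodules\<close>

abbreviation bundle_coalgebra :: "('x, 'e::real_inner, 'g, 'd) groupoid \<Rightarrow> ('p, 'q::real_inner, 'x, 'g, 'y, 'h) bibundle \<Rightarrow>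
    ('x \<Rightarrow> 'k::real_normed_field, ('p, 'k) germ_section) coalgebra" where
  "bundle_coalgebra G P \<equiv> Cc_coalgebra (objs G) (bspace P) (bproj P)"

abbreviation groupoid_coalgebra :: "('x, 'e::real_inner, 'g, 'd::real_inner) groupoid \<Rightarrow>
    ('x \<Rightarrow> 'k::real_normed_field, ('g, 'k) germ_section) coalgebra" where
  "groupoid_coalgebra G \<equiv> Cc_coalgebra (objs G) (arrs G) (tgt G)"

definition biadditive_on :: "'a set \<Rightarrow> ('a \<Rightarrow> 'a \<Rightarrow> 'a) \<Rightarrow> 'b set \<Rightarrow> ('b \<Rightarrow> 'b \<Rightarrow> 'b) \<Rightarrow> ('c \<Rightarrow> 'c \<Rightarrow> 'c) \<Rightarrow>
    ('a \<Rightarrow> 'b \<Rightarrow> 'c) \<Rightarrow> bool" where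
  "biadditive_on A plA B plB plC F \<longleftrightarrow>
     (\<forall>a\<in>A. \<forall>a'\<in>A. \<forall>b\<in>B. F (plA a a') b = plC (F a b) (F a' b)) \<and>
     (\<forall>a\<in>A. \<forall>b\<in>B. \<forall>b'\<in>B. F a (plB b b') = plC (F a b) (F a b'))"

text \<open>
  Both module structures are the biadditive extensions of the given formulas on generators
  (which are closed under multiplication by scalars, so the extensions are bilinear).
\<close>

definition left_module_act :: "('x, 'e::real_inner, 'g, 'd::real_inner) groupoid \<Rightarrow>
    ('p, 'q::real_inner, 'x, 'g, 'y, 'h) bibundle \<Rightarrow>
    ('g, 'k::real_normed_field) germ_section \<Rightarrow> ('p, 'k) germ_section \<Rightarrow> ('p, 'k) germ_section" where
  "left_module_act G P = (SOME F.
     biadditive_on (Cc (arrs G)) (sec_add (mtop (arrs G))) (Cc (bspace P)) (sec_add (mtop (bspace P)))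
       (sec_add (mtop (bspace P))) F \<and>
     (\<forall>U' u0 U f0. bisection G U' \<and> u0 \<in> Cc0 (objs G) (tgt G ` U') \<and>
        elementary (bspace P) (bproj P) U \<and> f0 \<in> Cc0 (objs G) (bproj P ` U) \<longrightarrow>
        F (elem_fun (arrs G) (tgt G) U' u0) (elem_fun (bspace P) (bproj P) U f0) =
        elem_fun (bspace P) (bproj P)
          {lact P g p | g p. g \<in> U' \<and> p \<in> U \<and> src G g = bproj P p}
          (\<lambda>y. if y \<in> tgt G ` U' then u0 y * f0 (inv_into (src G ` U') (bisection_map G U') y) else 0)))"

definition right_module_act :: "('x, 'e::real_inner, 'g, 'd::real_inner) groupoid \<Rightarrow>
    ('y, 'f::real_inner, 'h, 'c::real_inner) groupoid \<Rightarrow> ('p, 'q::real_inner, 'x, 'g, 'y, 'h) bibundle \<Rightarrow>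
    ('p, 'k::real_normed_field) germ_section \<Rightarrow> ('h, 'k) germ_section \<Rightarrow> ('p, 'k) germ_section" where
  "right_module_act G H P = (SOME F.
     biadditive_on (Cc (bspace P)) (sec_add (mtop (bspace P))) (Cc (arrs H)) (sec_add (mtop (arrs H)))
       (sec_add (mtop (bspace P))) F \<and>
     (\<forall>U f0 V v0. elementary (bspace P) (bproj P) U \<and> f0 \<in> Cc0 (objs G) (bproj P ` U) \<and>
        bisection H V \<and> v0 \<in> Cc0 (objs H) (tgt H ` V) \<longrightarrow>
        F (elem_fun (bspace P) (bproj P) U f0) (elem_fun (arrs H) (tgt H) V v0) =
        elem_fun (bspace P) (bproj P)
          {ract P p h | p h. p \<in> U \<and> h \<in> V \<and> bmom P p = tgt H h}
          (\<lambda>y. if y \<in> bproj P ` U then f0 y * v0 (bmom P (inv_into U (bproj P) y)) else 0)))"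

definition conv :: "('x, 'e::real_inner, 'g, 'd::real_inner) groupoid \<Rightarrow>
    ('g, 'k::real_normed_field) germ_section \<Rightarrow> ('g, 'k) germ_section \<Rightarrow> ('g, 'k) germ_section" where
  "conv G = left_module_act G (translation_bundle G)"

text \<open>The inclusion of the functions on the objects as functions supported on the units.\<close>

definition base_incl :: "('x, 'e::real_inner, 'g, 'd::real_inner) groupoid \<Rightarrow> ('x \<Rightarrow> 'k::real_normed_field) \<Rightarrow> ('g, 'k) germ_section" where
  "base_incl G v0 = elem_fun (arrs G) (tgt G) (unt G ` pts (objs G)) v0"

definition antipode :: "('x, 'e::real_inner, 'g, 'd::real_inner) groupoid \<Rightarrow> ('g, 'k::real_normed_field) germ_section \<Rightarrow> ('g, 'k) germ_section" where
  "antipode G a = (\<lambda>g. \<Union>f\<in>a (ivs G g). germ (mtop (arrs G)) g (f \<circ> ivs G))"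

definition S_weakly_grouplike :: "('x, 'e::real_inner, 'g, 'd::real_inner) groupoid \<Rightarrow> ('g, 'k::real_normed_field) germ_section set" where
  "S_weakly_grouplike G = {a \<in> Cc (arrs G). \<exists>a'\<in>Cc (arrs G).
     comul (groupoid_coalgebra G) a = tensor (groupoid_coalgebra G) a a' \<and>
     comul (groupoid_coalgebra G) (antipode G a) =
       tensor (groupoid_coalgebra G) (antipode G a') (antipode G a)}"


section \<open>The spectral groupoid and the spectral bundle\<close>

type_synonym ('x, 'p, 'k) spectral_point = "'x \<times> ('p, 'k) germ_section set"

abbreviation arrow_class :: "('x, 'e::real_inner, 'g, 'd::real_inner) groupoid \<Rightarrow> 'x \<Rightarrow>
    ('g, 'k::real_normed_field) germ_section \<Rightarrow> ('x, 'g, 'k) spectral_point" where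
  "arrow_class G y a \<equiv> (y, cls (groupoid_coalgebra G) (mtop (objs G)) y a)"

abbreviation point_class :: "('x, 'e::real_inner, 'g, 'd::real_inner) groupoid \<Rightarrow>
    ('p, 'q::real_inner, 'x, 'g, 'y, 'h) bibundle \<Rightarrow> 'x \<Rightarrow>
    ('p, 'k::real_normed_field) germ_section \<Rightarrow> ('x, 'p, 'k) spectral_point" where
  "point_class G P x m \<equiv> (x, cls (bundle_coalgebra G P) (mtop (objs G)) x m)"

definition represents_arrow :: "('x, 'e::real_inner, 'g, 'd::real_inner) groupoid \<Rightarrow>
    ('g, 'k::real_normed_field) germ_section \<Rightarrow> ('x, 'g, 'k) spectral_point \<Rightarrow> bool" where
  "represents_arrow G a \<alpha> \<longleftrightarrow> a \<in> S_weakly_grouplike G \<and>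
     normalised_near (groupoid_coalgebra G) (mtop (objs G)) (fst \<alpha>) a \<and> \<alpha> = arrow_class G (fst \<alpha>) a"

definition represents_point :: "('x, 'e::real_inner, 'g, 'd::real_inner) groupoid \<Rightarrow>
    ('p, 'q::real_inner, 'x, 'g, 'y, 'h) bibundle \<Rightarrow>
    ('p, 'k::real_normed_field) germ_section \<Rightarrow> ('x, 'p, 'k) spectral_point \<Rightarrow> bool" where
  "represents_point G P m \<xi> \<longleftrightarrow> m \<in> weakly_grouplike (bundle_coalgebra G P) \<and>
     normalised_near (bundle_coalgebra G P) (mtop (objs G)) (fst \<xi>) m \<and> \<xi> = point_class G P (fst \<xi>) m"

text \<open>The source of the arrow \<open>a\<^sub>y\<close> is \<open>\<tau>\<^sup>-\<^sup>1(y)\<close>, where \<open>\<tau>\<close> is the diffeomorphism with \<open>u\<^sub>0 a = a (u\<^sub>0 \<circ> \<tau>)\<close>.\<close>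

definition spectral_src :: "('x, 'e::real_inner, 'g, 'd::real_inner) groupoid \<Rightarrow>
    ('x, 'g, 'k::real_normed_field) spectral_point \<Rightarrow> 'x" where
  "spectral_src G \<alpha> = (THE x. \<exists>a W V \<tau>.
     represents_arrow G a \<alpha> \<and> openin (mtop (objs G)) W \<and> fst \<alpha> \<in> W \<and>
     normalised_on (groupoid_coalgebra G) W a \<and>
     openin (mtop (objs G)) V \<and> diffeo (objs G) V (objs G) W \<tau> \<and>
     (\<forall>u0\<in>Cc0 (objs G) W.
        conv G (base_incl G u0) a = conv G a (base_incl G (\<lambda>x'. if x' \<in> V then u0 (\<tau> x') else 0))) \<and>
     x = inv_into V \<tau> (fst \<alpha>))"

definition spectral_groupoid :: "('x, 'e::real_inner, 'g, 'd::real_inner) groupoid \<Rightarrow>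
    ('x, 'e, ('x, 'g, 'k::real_normed_field) spectral_point, 'e) groupoid" where
  "spectral_groupoid G =
     \<lparr>objs = objs G,
      arrs = spectral_manifold (groupoid_coalgebra G) (objs G),
      src = spectral_src G,
      tgt = fst,
      mlt = (\<lambda>\<alpha>' \<alpha>. THE \<beta>. \<exists>a' a. represents_arrow G a' \<alpha>' \<and> represents_arrow G a \<alpha> \<and>
               spectral_src G \<alpha>' = fst \<alpha> \<and> \<beta> = arrow_class G (fst \<alpha>') (conv G a' a)),
      unt = (\<lambda>x. THE \<beta>. \<exists>u0\<in>Cc0 (objs G) (pts (objs G)).
               germ (mtop (objs G)) x u0 = germ (mtop (objs G)) x (\<lambda>_. 1) \<and>
               \<beta> = arrow_class G x (base_incl G u0)),
      ivs = (\<lambda>\<alpha>. THE \<beta>. \<exists>a. represents_arrow G a \<alpha> \<and>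
               \<beta> = arrow_class G (spectral_src G \<alpha>) (antipode G a))\<rparr>"

definition natural_iso :: "('x, 'e::real_inner, 'g, 'd::real_inner) groupoid \<Rightarrow> 'g \<Rightarrow>
    ('x, 'g, 'k::real_normed_field) spectral_point" where
  "natural_iso G g = (THE \<alpha>. \<exists>u\<in>S_weakly_grouplike G.
     u g = germ (mtop (arrs G)) g (\<lambda>_. 1) \<and> \<alpha> = arrow_class G (tgt G g) u)"

definition spectral_moment :: "('x, 'e::real_inner, 'g, 'd::real_inner) groupoid \<Rightarrow>
    ('y, 'f::real_inner, 'h, 'c::real_inner) groupoid \<Rightarrow> ('p, 'q::real_inner, 'x, 'g, 'y, 'h) bibundle \<Rightarrow>
    ('x, 'p, 'k::real_normed_field) spectral_point \<Rightarrow> 'y" where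
  "spectral_moment G H P \<xi> = (THE z. z \<in> pts (objs H) \<and>
     (\<exists>m. represents_point G P m \<xi> \<and>
        (\<forall>v0\<in>Cc0 (objs H) (pts (objs H)).
           cou (bundle_coalgebra G P) (right_module_act G H P m (base_incl H v0)) (fst \<xi>) = v0 z)))"

text \<open>The principal bundle of \<open>C\<^sub>c(P)\<close> for the spectral groupoids of \<open>G\<close> and \<open>H\<close>.\<close>

definition spectral_bundle :: "('x, 'e::real_inner, 'g, 'd::real_inner) groupoid \<Rightarrow>
    ('y, 'f::real_inner, 'h, 'c::real_inner) groupoid \<Rightarrow> ('p, 'q::real_inner, 'x, 'g, 'y, 'h) bibundle \<Rightarrow>
    (('x, 'p, 'k::real_normed_field) spectral_point, 'e, 'x, ('x, 'g, 'k) spectral_point,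
     'y, ('y, 'h, 'k) spectral_point) bibundle" where
  "spectral_bundle G H P =
     \<lparr>bspace = spectral_manifold (bundle_coalgebra G P) (objs G),
      bproj = fst,
      bmom = spectral_moment G H P,
      lact = (\<lambda>\<alpha> \<xi>. THE \<theta>. \<exists>a m. represents_arrow G a \<alpha> \<and> represents_point G P m \<xi> \<and>
                src (spectral_groupoid G) \<alpha> = fst \<xi> \<and>
                \<theta> = point_class G P (tgt (spectral_groupoid G) \<alpha>) (left_module_act G P a m)),
      ract = (\<lambda>\<xi> \<beta>. THE \<theta>. \<exists>m b. represents_point G P m \<xi> \<and> represents_arrow H b \<beta> \<and>
                spectral_moment G H P \<xi> = tgt (spectral_groupoid H) \<beta> \<and>
                \<theta> = point_class G P (fst \<xi>) (right_module_act G H P m b))\<rparr>"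

definition pull_bundle :: "('g \<Rightarrow> 'g') \<Rightarrow> ('h \<Rightarrow> 'h') \<Rightarrow> ('p, 'q, 'x, 'g', 'y, 'h') bibundle \<Rightarrow>
    ('p, 'q, 'x, 'g, 'y, 'h) bibundle" where
  "pull_bundle \<psi> \<psi>' Q = \<lparr>bspace = bspace Q, bproj = bproj Q, bmom = bmom Q,
     lact = (\<lambda>g. lact Q (\<psi> g)), ract = (\<lambda>q h. ract Q q (\<psi>' h))\<rparr>"

definition associated_bundle :: "('x, 'e::real_inner, 'g, 'd::real_inner) groupoid \<Rightarrow>
    ('y, 'f::real_inner, 'h, 'c::real_inner) groupoid \<Rightarrow> ('p, 'q::real_inner, 'x, 'g, 'y, 'h) bibundle \<Rightarrow>
    (('x, 'p, 'k::real_normed_field) spectral_point, 'e, 'x, 'g, 'y, 'h) bibundle" where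
  "associated_bundle G H P = pull_bundle (natural_iso G) (natural_iso H) (spectral_bundle G H P)"

end

theory Submission
  imports Defs
begin

text \<open>
  Write \<open>M\<close> for the base. Call \<open>c\<close> a delta at \<open>p\<close> if its germ at \<open>p\<close> is \<open>1\<close> and its germs at the other points
  of the fibre of \<open>p\<close> vanish. Evaluating a tensor on pairs of germs turns \<open>\<Delta>(c) = c \<otimes> c'\<close> into orthogonality
  relations between the germs of \<open>c\<close> over a point, which force a weakly grouplike element that is normalised
  near \<open>x\<close> to be a delta at exactly one point over \<open>x\<close>. As the class of \<open>c\<close> at \<open>x\<close> amounts to the family of its
  germs over \<open>x\<close>, sending \<open>p\<close> to the class of any delta at \<open>p\<close> is a bijection onto the spectral space, and a
  diffeomorphism because being a delta is an open condition along the sheets of \<open>P\<close>. Both module actions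
  are convolutions along a partial composition, and the convolution of a delta at \<open>a\<close> with a delta at \<open>b\<close>
  is a delta at the composite of \<open>a\<close> and \<open>b\<close>. This identifies source, moment map and actions of the spectral
  bundle with those of \<open>P\<close>, and the principal bundle structure is transported along the diffeomorphism.
  That \<open>\<pi>\<close> is a local diffeomorphism uses that the units of \<open>H\<close> form an open set.
\<close>

section \<open>Calculus of smooth maps\<close>

text \<open>Counit, comultiplication and both module actions are chosen by \<open>SOME\<close> from
  conditions on elementary functions, so each must first be shown to exist: an assignment on
  elementary functions has to depend only on the section to which they add up. As \<open>P\<close>
  need not be Hausdorff, cutting off on \<open>P\<close> may destroy continuity, and sheets may
  intersect without coinciding over their common image. Sections are therefore represented by formal
  sums of sheets paired with functions on the Hausdorff base, and formal sums are compared germ by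
  germ. The finitely many germs over one base point control a whole neighbourhood, and
  multiplication by functions on the base patches the local statements together.

  A principal bundle supplies its projection as a submersion, while the function spaces need local
  inverses. Model spaces may have dimension 0 and no equality of dimensions is given, so calculus up
  to an inverse function theorem is developed for inner product spaces with a finite spanning set;
  the local injectivity of the projection is extracted from the division map of the bundle.\<close>

lemma Ck_on_subset: "Ck_on k S f \<Longrightarrow> T \<subseteq> S \<Longrightarrow> Ck_on k T f"
proof (induction k arbitrary: f)
  case 0
  then show ?case by (auto intro: continuous_on_subset)
next
  case (Suc k)
  then show ?case by (auto; blast)
qed

lemma Ck_on_SucD: "Ck_on (Suc k) S f \<Longrightarrow> Ck_on k S f"
proof (induction k arbitrary: f)
  case 0
  then show ?case
    by (auto intro!: continuous_at_imp_continuous_on dest: has_derivative_continuous)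
next
  case (Suc k)
  obtain f' where f': "\<forall>x\<in>S. (f has_derivative f' x) (at x)" "\<forall>v. Ck_on (Suc k) S (\<lambda>x. f' x v)"
    using Suc.prems by (subst (asm) Ck_on.simps(2)) blast
  then have "\<forall>v. Ck_on k S (\<lambda>x. f' x v)" using Suc.IH by blast
  with f' show ?case by auto
qed

text \<open>\<open>Ck_on\<close> takes derivatives in the full space, not within \<open>S\<close>,
  so agreement on \<open>S\<close> carries them over only because \<open>S\<close> is open.\<close>

lemma Ck_on_cong:
  assumes "open S" "\<And>x. x \<in> S \<Longrightarrow> f x = g x" "Ck_on k S f"
  shows "Ck_on k S g"
proof (cases k)
  case 0
  then show ?thesis using assms continuous_on_eq by auto
next
  case (Suc m)
  then obtain f' where f': "\<forall>x\<in>S. (f has_derivative f' x) (at x)" "\<forall>v. Ck_on m S (\<lambda>x. f' x v)"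
    using assms by auto
  have "(g has_derivative f' x) (at x)" if "x \<in> S" for x
    using has_derivative_transform_within_open[OF f'(1)[rule_format, OF that] assms(1) that] assms(2) by blast
  then show ?thesis using f' Suc by auto
qed

lemma Ck_on_local:
  assumes "\<And>x. x \<in> S \<Longrightarrow> \<exists>T. open T \<and> x \<in> T \<and> Ck_on k (S \<inter> T) f" "open S"
  shows "Ck_on k S f"
  using assms(1)
proof (induction k arbitrary: f)
  case 0
  have "continuous (at x) f" if x: "x \<in> S" for x
  proof -
    obtain T where "open T" "x \<in> T" "continuous_on (S \<inter> T) f" using 0[OF x] by auto
    then show ?thesis using x \<open>open S\<close> by (metis IntI continuous_on_eq_continuous_at open_Int)
  qed
  then show ?case by (simp add: continuous_at_imp_continuous_on)
next
  case (Suc k)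
  have ex: "\<exists>T f'. open T \<and> x \<in> T \<and> (\<forall>y\<in>S\<inter>T. (f has_derivative f' y) (at y)) \<and> (\<forall>v. Ck_on k (S \<inter> T) (\<lambda>y. f' y v))"
    if "x \<in> S" for x
    using Suc.prems[OF that] by auto
  \<comment> \<open>The local derivatives come from separate existential witnesses; uniqueness of
    the derivative at a point glues them into this single family, to which the induction hypothesis
    applies.\<close>
  define D where "D x = frechet_derivative f (at x)" for x
  have "Ck_on k S (\<lambda>x. D x v)" for v
  proof (rule Suc.IH)
    fix x assume "x \<in> S"
    then obtain T f' where T: "open T" "x \<in> T" "\<forall>y\<in>S\<inter>T. (f has_derivative f' y) (at y)" "\<forall>v. Ck_on k (S \<inter> T) (\<lambda>y. f' y v)"
      using ex by blast
    have eq: "D y = f' y" if "y \<in> S \<inter> T" for y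
      using T that D_def frechet_derivative_at by metis
    have "Ck_on k (S \<inter> T) (\<lambda>y. D y v)"
      by (rule Ck_on_cong[OF _ _ T(4)[rule_format, of v]]) (use eq T \<open>open S\<close> in auto)
    then show "\<exists>T. open T \<and> x \<in> T \<and> Ck_on k (S \<inter> T) (\<lambda>x. D x v)" using T by blast
  qed
  moreover have "(f has_derivative D x) (at x)" if x: "x \<in> S" for x
    using ex[OF x] x D_def frechet_derivative_at by (metis IntI)
  ultimately show ?case by auto
qed

lemma Ck_on_const: "Ck_on k S (\<lambda>x. c)"
proof (induction k arbitrary: c)
  case (Suc k)
  then show ?case by (auto intro!: exI[of _ "\<lambda>_ _. 0"])
qed simp

lemma Ck_on_bounded_linear_comp:
  assumes "bounded_linear L" "Ck_on k S f"
  shows "Ck_on k S (\<lambda>x. L (f x))"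
  using assms(2)
proof (induction k arbitrary: f)
  case 0
  then show ?case using assms(1) by (auto intro: bounded_linear.continuous_on)
next
  case (Suc k)
  then obtain f' where f': "\<forall>x\<in>S. (f has_derivative f' x) (at x)" "\<forall>v. Ck_on k S (\<lambda>x. f' x v)"
    by auto
  then have "\<forall>x\<in>S. ((\<lambda>x. L (f x)) has_derivative (\<lambda>v. L (f' x v))) (at x)"
    using bounded_linear.has_derivative[OF assms(1)] by blast
  moreover have "\<forall>v. Ck_on k S (\<lambda>x. L (f' x v))" using Suc.IH f' by blast
  ultimately show ?case by (auto intro!: exI[of _ "\<lambda>x v. L (f' x v)"])
qed

lemma Ck_on_id: "Ck_on k S (\<lambda>x. x)"
  by (cases k) (auto intro!: exI[of _ "\<lambda>_ v. v"] Ck_on_const)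

lemma Ck_on_add:
  assumes "Ck_on k S f" "Ck_on k S g"
  shows "Ck_on k S (\<lambda>x. f x + g x)"
  using assms
proof (induction k arbitrary: f g)
  case 0
  then show ?case by (auto intro: continuous_on_add)
next
  case (Suc k)
  then obtain f' g' where f': "\<forall>x\<in>S. (f has_derivative f' x) (at x)" "\<forall>v. Ck_on k S (\<lambda>x. f' x v)"
    and g': "\<forall>x\<in>S. (g has_derivative g' x) (at x)" "\<forall>v. Ck_on k S (\<lambda>x. g' x v)"
    by auto
  then show ?case using Suc.IH
    by (auto intro!: exI[of _ "\<lambda>x v. f' x v + g' x v"] has_derivative_add)
qed

lemma Ck_on_sum: "finite I \<Longrightarrow> (\<And>i. i \<in> I \<Longrightarrow> Ck_on k S (f i)) \<Longrightarrow> Ck_on k S (\<lambda>x. \<Sum>i\<in>I. f i x)"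
  by (induction rule: finite_induct) (auto intro: Ck_on_const Ck_on_add)

lemma Ck_on_bilinear:
  assumes bl: "bounded_bilinear pr" and "Ck_on k S f" "Ck_on k S g"
  shows "Ck_on k S (\<lambda>x. pr (f x) (g x))"
  using assms(2,3)
proof (induction k arbitrary: f g)
  case 0
  then show ?case by (auto intro: bounded_bilinear.continuous_on[OF bl])
next
  case (Suc k)
  then obtain f' g' where f': "\<forall>x\<in>S. (f has_derivative f' x) (at x)" "\<forall>v. Ck_on k S (\<lambda>x. f' x v)"
    and g': "\<forall>x\<in>S. (g has_derivative g' x) (at x)" "\<forall>v. Ck_on k S (\<lambda>x. g' x v)"
    by auto
  have "Ck_on k S f" "Ck_on k S g" using Suc.prems Ck_on_SucD by blast+
  then have "Ck_on k S (\<lambda>x. pr (f x) (g' x v) + pr (f' x v) (g x))" for v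
    using f' g' Suc.IH by (intro Ck_on_add) blast+
  moreover have "((\<lambda>x. pr (f x) (g x)) has_derivative (\<lambda>v. pr (f x) (g' x v) + pr (f' x v) (g x))) (at x)"
    if "x \<in> S" for x
    using bounded_bilinear.FDERIV[OF bl] f' g' that by blast
  ultimately show ?case
    by (auto intro!: exI[of _ "\<lambda>x v. pr (f x) (g' x v) + pr (f' x v) (g x)"])
qed

lemma Ck_on_Pair:
  assumes "Ck_on k S f" "Ck_on k S g"
  shows "Ck_on k S (\<lambda>x. (f x, g x))"
proof -
  have "Ck_on k S (\<lambda>x. (f x, 0) + (0, g x))"
    by (intro Ck_on_add Ck_on_bounded_linear_comp[OF _ assms(1)] Ck_on_bounded_linear_comp[OF _ assms(2)])
      (auto intro: bounded_linear_Pair bounded_linear_ident bounded_linear_zero)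
  then show ?thesis by simp
qed

text \<open>A finite normalised tight frame, which replaces an orthonormal basis.\<close>

definition frame :: "'e::real_inner set \<Rightarrow> bool" where
  "frame C \<longleftrightarrow> finite C \<and> (\<forall>v. (\<Sum>b\<in>C. (v \<bullet> b) *\<^sub>R b) = v)"

text \<open>Gram-Schmidt gives an orthogonal spanning set; discarding 0 and normalising turns the
  orthogonal expansion into the frame identity. In dimension 0 the frame is empty.\<close>

lemma frame_exists:
  assumes "finite B" "span B = (UNIV :: 'e::real_inner set)"
  shows "\<exists>C :: 'e set. frame C"
proof -
  obtain C0 :: "'e set" where C0: "finite C0" "span C0 = UNIV" "pairwise orthogonal C0"
    using basis_orthogonal[OF assms(1)] assms(2) by metis
  define C where "C = C0 - {0}"
  have C: "finite C" "span C = UNIV" "pairwise orthogonal C" "0 \<notin> C"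
    using C0 by (auto simp: C_def pairwise_def span_delete_0)
  have exp: "(\<Sum>b\<in>C. ((v \<bullet> b) / (b \<bullet> b)) *\<^sub>R b) = v" for v
  proof -
    obtain r where r: "v = (\<Sum>b\<in>C. r b *\<^sub>R b)"
      using C span_finite[OF C(1)] by (metis (no_types, lifting) UNIV_I imageE)
    have "v \<bullet> b = r b * (b \<bullet> b)" if b: "b \<in> C" for b
    proof -
      have "v \<bullet> b = (\<Sum>c\<in>C. r c * (c \<bullet> b))" by (simp add: r inner_sum_left)
      also have "\<dots> = (\<Sum>c\<in>C. if c = b then r b * (b \<bullet> b) else 0)"
        using C b by (intro sum.cong) (auto simp: pairwise_def orthogonal_def)
      finally show ?thesis using C b by simp
    qed
    then have "(\<Sum>b\<in>C. ((v \<bullet> b) / (b \<bullet> b)) *\<^sub>R b) = (\<Sum>b\<in>C. r b *\<^sub>R b)"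
      using C by (intro sum.cong) auto
    then show ?thesis using r by simp
  qed
  define D where "D = (\<lambda>b. b /\<^sub>R norm b) ` C"
  have inj: "inj_on (\<lambda>b. b /\<^sub>R norm b) C"
  proof (rule inj_onI, rule ccontr)
    fix b c assume bc: "b \<in> C" "c \<in> C" "b /\<^sub>R norm b = c /\<^sub>R norm c" "b \<noteq> c"
    then have "b \<bullet> c = 0" using C by (auto simp: pairwise_def orthogonal_def)
    then have "(b /\<^sub>R norm b) \<bullet> (c /\<^sub>R norm c) = 0" by simp
    then have "(b /\<^sub>R norm b) \<bullet> (b /\<^sub>R norm b) = 0" using bc by simp
    then show False using bc C by auto
  qed
  have "(\<Sum>b\<in>D. (v \<bullet> b) *\<^sub>R b) = v" for v
  proof -
    have "(\<Sum>b\<in>D. (v \<bullet> b) *\<^sub>R b) = (\<Sum>b\<in>C. ((v \<bullet> b) / (b \<bullet> b)) *\<^sub>R b)"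
      unfolding D_def using inj C
      by (auto simp: sum.reindex dot_square_norm power2_eq_square divide_simps intro!: sum.cong)
    then show ?thesis using exp by simp
  qed
  then show ?thesis using C by (intro exI[of _ D]) (auto simp: frame_def D_def)
qed

lemma frame_linear_expand:
  assumes "frame (C :: 'e set)" "linear (L :: 'e::real_inner \<Rightarrow> 'f::real_normed_vector)"
  shows "L v = (\<Sum>b\<in>C. (v \<bullet> b) *\<^sub>R L b)"
proof -
  have "L v = L (\<Sum>b\<in>C. (v \<bullet> b) *\<^sub>R b)" using assms by (simp add: frame_def)
  also have "\<dots> = (\<Sum>b\<in>C. (v \<bullet> b) *\<^sub>R L b)"
    using assms(2) by (simp add: linear_sum linear_scale)
  finally show ?thesis .
qed

lemma frame_bounded_linear:
  assumes "frame (C :: 'e set)" "linear (L :: 'e::real_inner \<Rightarrow> 'f::real_normed_vector)"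
  shows "bounded_linear L"
proof -
  have "bounded_linear (\<lambda>v. \<Sum>b\<in>C. (v \<bullet> b) *\<^sub>R L b)"
    by (intro bounded_linear_sum bounded_linear_scaleR_const bounded_linear_inner_left)
  then show ?thesis using frame_linear_expand[OF assms] by (metis (no_types, lifting) ext)
qed

text \<open>Regularity of \<open>A\<close> is known only in each fixed direction. Expanding the
  moving vector \<open>w x\<close> along the frame leaves finitely many fixed directions, with
  coefficients as regular as \<open>w\<close>.\<close>

lemma Ck_on_apply_linear:
  fixes A :: "'d::real_normed_vector \<Rightarrow> 'e::real_inner \<Rightarrow> 'f::real_normed_vector"
  assumes "frame (C :: 'e set)" "open S" "\<And>x. x \<in> S \<Longrightarrow> linear (A x)" "\<And>v. Ck_on k S (\<lambda>x. A x v)" "Ck_on k S w"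
  shows "Ck_on k S (\<lambda>x. A x (w x))"
proof -
  have "Ck_on k S (\<lambda>x. \<Sum>b\<in>C. (w x \<bullet> b) *\<^sub>R A x b)"
    using assms(1,4,5)
    by (intro Ck_on_sum Ck_on_bilinear[OF bounded_bilinear_scaleR]
        Ck_on_bounded_linear_comp[OF bounded_linear_inner_left]) (auto simp: frame_def)
  then show ?thesis
    by (rule Ck_on_cong[OF assms(2), rotated]) (use frame_linear_expand[OF assms(1) assms(3)] in auto)
qed

text \<open>By the chain rule the derivative in direction \<open>v\<close> is
  \<open>g' (f x)\<close> applied to the moving vector \<open>f' x v\<close>, which is why the
  middle space must have a frame. The induction hypothesis is used for \<open>g'\<close> in fixed
  directions.\<close>

lemma Ck_on_compose:
  fixes f :: "'e::real_normed_vector \<Rightarrow> 'f::real_inner"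
  assumes C: "frame (C :: 'f set)" and "open S"
  shows "Ck_on k S f \<Longrightarrow> f ` S \<subseteq> T \<Longrightarrow> Ck_on k T g \<Longrightarrow> Ck_on k S (\<lambda>x. g (f x))"
proof (induction k arbitrary: f g)
  case 0
  then show ?case by (auto intro: continuous_on_compose2)
next
  case (Suc k)
  then obtain f' g' where f': "\<forall>x\<in>S. (f has_derivative f' x) (at x)" "\<forall>v. Ck_on k S (\<lambda>x. f' x v)"
    and g': "\<forall>x\<in>T. (g has_derivative g' x) (at x)" "\<forall>v. Ck_on k T (\<lambda>x. g' x v)"
    by auto
  have "Ck_on k S (\<lambda>x. g' (f x) (f' x v))" for v
  proof (rule Ck_on_apply_linear[OF C \<open>open S\<close>])
    show "linear (g' (f x))" if "x \<in> S" for x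
      using g' that Suc.prems by (meson has_derivative_linear image_subset_iff)
    show "Ck_on k S (\<lambda>x. g' (f x) v)" for v
      using Suc.IH[of f "\<lambda>x. g' x v"] Suc.prems g' Ck_on_SucD by blast
    show "Ck_on k S (\<lambda>x. f' x v)" using f' by blast
  qed
  moreover have "((\<lambda>x. g (f x)) has_derivative (\<lambda>v. g' (f x) (f' x v))) (at x)" if "x \<in> S" for x
    using has_derivative_compose[of f "f' x" x UNIV g "g' (f x)"] f' g' that Suc.prems by auto
  ultimately show ?case by (auto intro!: exI[of _ "\<lambda>x v. g' (f x) (f' x v)"])
qed

section \<open>Permanence properties of \<open>smooth_on\<close>\<close>

lemma smooth_on_subset: "smooth_on S f \<Longrightarrow> T \<subseteq> S \<Longrightarrow> smooth_on T f"
  unfolding smooth_on_def using Ck_on_subset by blast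

lemma smooth_on_cong: "open S \<Longrightarrow> smooth_on S f \<Longrightarrow> (\<And>x. x \<in> S \<Longrightarrow> f x = g x) \<Longrightarrow> smooth_on S g"
  unfolding smooth_on_def using Ck_on_cong by metis

lemma smooth_on_local:
  assumes "open S" "\<And>x. x \<in> S \<Longrightarrow> \<exists>T. open T \<and> x \<in> T \<and> smooth_on (S \<inter> T) f"
  shows "smooth_on S f"
  unfolding smooth_on_def
proof
  fix k show "Ck_on k S f" by (rule Ck_on_local[OF _ assms(1)]) (use assms(2) in \<open>auto simp: smooth_on_def; blast\<close>)
qed

lemma smooth_on_const: "smooth_on S (\<lambda>x. c)"
  by (simp add: smooth_on_def Ck_on_const)

lemma smooth_on_id: "smooth_on S (\<lambda>x. x)"
  by (simp add: smooth_on_def Ck_on_id)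

lemma smooth_on_add: "smooth_on S f \<Longrightarrow> smooth_on S g \<Longrightarrow> smooth_on S (\<lambda>x. f x + g x)"
  by (simp add: smooth_on_def Ck_on_add)

lemma smooth_on_bilinear:
  "bounded_bilinear pr \<Longrightarrow> smooth_on S f \<Longrightarrow> smooth_on S g \<Longrightarrow> smooth_on S (\<lambda>x. pr (f x) (g x))"
  by (simp add: smooth_on_def Ck_on_bilinear)

lemma smooth_on_bounded_linear_comp:
  "bounded_linear L \<Longrightarrow> smooth_on S f \<Longrightarrow> smooth_on S (\<lambda>x. L (f x))"
  by (simp add: smooth_on_def Ck_on_bounded_linear_comp)

lemma smooth_on_Pair: "smooth_on S f \<Longrightarrow> smooth_on S g \<Longrightarrow> smooth_on S (\<lambda>x. (f x, g x))"
  by (simp add: smooth_on_def Ck_on_Pair)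

lemma smooth_on_compose:
  fixes f :: "'e::real_normed_vector \<Rightarrow> 'f::real_inner"
  assumes "frame (C :: 'f set)" "open S" "smooth_on S f" "f ` S \<subseteq> T" "smooth_on T g"
  shows "smooth_on S (\<lambda>x. g (f x))"
  using assms Ck_on_compose[OF assms(1,2)] unfolding smooth_on_def by blast

lemma smooth_on_continuous: "smooth_on S f \<Longrightarrow> continuous_on S f"
  unfolding smooth_on_def by (metis Ck_on.simps(1))

section \<open>Finite-dimensional inner product spaces\<close>

text \<open>Frame coefficients on a ball are bounded by Cauchy-Schwarz, so the ball is a closed
  subset of a finite sum of segments, which is compact.\<close>

lemma frame_compact_cball:
  fixes a :: "'e::real_inner"
  assumes "frame (C :: 'e set)"
  shows "compact (cball a r)"
proof -
  have comp: "finite C' \<Longrightarrow> compact {\<Sum>b\<in>C'. c b *\<^sub>R b |c. \<forall>b\<in>C'. \<bar>c b\<bar> \<le> R}" for C' :: "'e set" and R :: real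
  proof (induction C' rule: finite_induct)
    case empty
    then show ?case by simp
  next
    case (insert b C')
    let ?A = "(\<lambda>t. t *\<^sub>R b) ` {-R..R}"
    have A: "compact ?A"
      by (intro compact_continuous_image continuous_intros) auto
    have "{\<Sum>b\<in>insert b C'. c b *\<^sub>R b |c. \<forall>b\<in>insert b C'. \<bar>c b\<bar> \<le> R} =
       {x + y |x y. x \<in> ?A \<and> y \<in> {\<Sum>b\<in>C'. c b *\<^sub>R b |c. \<forall>b\<in>C'. \<bar>c b\<bar> \<le> R}}" (is "?L = ?R")
    proof
      show "?L \<subseteq> ?R"
      proof
        fix z assume "z \<in> ?L"
        then obtain c where c: "\<forall>b\<in>insert b C'. \<bar>c b\<bar> \<le> R" "z = (\<Sum>b\<in>insert b C'. c b *\<^sub>R b)" by blast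
        then have "z = c b *\<^sub>R b + (\<Sum>b\<in>C'. c b *\<^sub>R b)" "c b *\<^sub>R b \<in> ?A"
          using insert by (auto intro!: image_eqI[of _ _ "c b"])
        then show "z \<in> ?R" using c by blast
      qed
      show "?R \<subseteq> ?L"
      proof
        fix z assume "z \<in> ?R"
        then obtain t c where tc: "t \<in> {-R..R}" "\<forall>b\<in>C'. \<bar>c b\<bar> \<le> R" "z = t *\<^sub>R b + (\<Sum>b\<in>C'. c b *\<^sub>R b)" by blast
        define d where "d = c(b := t)"
        have "(\<Sum>b\<in>C'. d b *\<^sub>R b) = (\<Sum>b\<in>C'. c b *\<^sub>R b)"
          using insert by (intro sum.cong) (auto simp: d_def)
        then have "z = (\<Sum>b\<in>insert b C'. d b *\<^sub>R b)" using insert tc by (simp add: d_def)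
        moreover have "\<forall>b\<in>insert b C'. \<bar>d b\<bar> \<le> R" using tc by (auto simp: d_def)
        ultimately show "z \<in> ?L" by blast
      qed
    qed
    then show ?case using compact_sums[OF A insert.IH] by simp
  qed
  define M where "M = (\<Sum>b\<in>C. norm b)"
  define R where "R = (norm a + r) * M"
  have "cball a r \<subseteq> {\<Sum>b\<in>C. c b *\<^sub>R b |c. \<forall>b\<in>C. \<bar>c b\<bar> \<le> R}"
  proof
    fix x assume x: "x \<in> cball a r"
    then have nx: "norm x \<le> norm a + r"
      by (metis dist_commute dist_norm mem_cball norm_triangle_sub order_trans add_left_mono)
    have "\<bar>x \<bullet> b\<bar> \<le> R" if "b \<in> C" for b
    proof -
      have "norm b \<le> M" using assms that unfolding M_def frame_def by (auto intro: member_le_sum)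
      then show ?thesis unfolding R_def
        using nx Cauchy_Schwarz_ineq2[of x b] mult_mono[OF nx \<open>norm b \<le> M\<close>]
        by (smt (verit) norm_ge_zero)
    qed
    moreover have "x = (\<Sum>b\<in>C. (x \<bullet> b) *\<^sub>R b)" using assms by (simp add: frame_def)
    ultimately show "x \<in> {\<Sum>b\<in>C. c b *\<^sub>R b |c. \<forall>b\<in>C. \<bar>c b\<bar> \<le> R}" by fastforce
  qed
  then have "cball a r = {\<Sum>b\<in>C. c b *\<^sub>R b |c. \<forall>b\<in>C. \<bar>c b\<bar> \<le> R} \<inter> cball a r" by blast
  moreover have "finite C" using assms by (simp add: frame_def)
  ultimately show ?thesis using compact_Int_closed[OF comp[of C R] closed_cball[of a r]] by simp
qed

lemma frame_complete:
  assumes "frame (C :: 'e::real_inner set)" shows "complete (cball (a::'e) r)"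
  using frame_compact_cball[OF assms] compact_imp_complete by blast

text \<open>Inverting a smoothly varying linear isomorphism: \<open>- A\<^sup>-\<^sup>1 A' A\<^sup>-\<^sup>1\<close> is the derivative of the inverse.\<close>

lemma Ck_on_inverse_linear:
  fixes A :: "'d::real_inner \<Rightarrow> 'e::real_inner \<Rightarrow> 'e"
  assumes D: "frame (D :: 'd set)" and C: "frame (C :: 'e set)" and S: "open S"
    and lin: "\<And>x. x \<in> S \<Longrightarrow> linear (A x)" "\<And>x. x \<in> S \<Longrightarrow> linear (B x)"
    and inv: "\<And>x v. x \<in> S \<Longrightarrow> A x (B x v) = v" "\<And>x v. x \<in> S \<Longrightarrow> B x (A x v) = v"
    and bd: "\<And>x v. x \<in> S \<Longrightarrow> norm (B x v) \<le> K * norm v"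
  shows "(\<And>v. Ck_on k S (\<lambda>x. A x v)) \<Longrightarrow> Ck_on k S (\<lambda>x. B x v)"
proof (induction k arbitrary: v)
  case 0
  have "isCont (\<lambda>x. B x v) z" if z: "z \<in> S" for z
  proof -
    let ?w = "B z v"
    have c: "isCont (\<lambda>x. A x ?w) z" using 0 S z by (simp add: continuous_on_eq_continuous_at)
    have "((\<lambda>x. K * norm (A z ?w - A x ?w)) \<longlongrightarrow> K * norm (A z ?w - A z ?w)) (at z)"
      using c by (intro tendsto_intros) (auto simp: isCont_def)
    then have t: "((\<lambda>x. K * norm (A z ?w - A x ?w)) \<longlongrightarrow> 0) (at z)" by simp
    have "\<forall>\<^sub>F x in at z. x \<in> S" using S z eventually_at_topological by blast
    then have "\<forall>\<^sub>F x in at z. norm (B x v - B z v) \<le> K * norm (A z ?w - A x ?w)"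
    proof eventually_elim
      case (elim x)
      \<comment> \<open>Resolvent identity: with the uniform bound \<open>K\<close> on the inverses
        it reduces continuity of the inverse to continuity of \<open>A\<close> in the one direction
        \<open>?w\<close>.\<close>
      have "B x v - B z v = B x (A z ?w - A x ?w)"
        using elim z inv lin by (simp add: linear_diff)
      then show ?case using bd elim by metis
    qed
    then have "((\<lambda>x. B x v - B z v) \<longlongrightarrow> 0) (at z)" by (rule Lim_null_comparison[OF _ t])
    then show ?thesis by (simp add: isCont_def LIM_zero_iff)
  qed
  then show ?case by (simp add: continuous_at_imp_continuous_on)
next
  case (Suc k)
  have "\<exists>a. \<forall>b. (\<forall>x\<in>S. ((\<lambda>x. A x b) has_derivative a b x) (at x)) \<and> (\<forall>u. Ck_on k S (\<lambda>x. a b x u))"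
    using Suc.prems by (intro choice) auto
  then obtain a where a: "\<And>b x. x \<in> S \<Longrightarrow> ((\<lambda>x. A x b) has_derivative a b x) (at x)"
    "\<And>b u. Ck_on k S (\<lambda>x. a b x u)" by blast
  have ab: "\<And>b x. x \<in> S \<Longrightarrow> linear (a b x)" using a has_derivative_linear by blast
  \<comment> \<open>The derivatives were chosen separately for each direction \<open>b\<close>;
    linearity in \<open>b\<close> is recovered from uniqueness of derivatives.\<close>
  have alin: "linear (\<lambda>b. a b x u)" if "x \<in> S" for x u
  proof
    fix b c r
    have "((\<lambda>x. A x b + A x c) has_derivative (\<lambda>u. a b x u + a c x u)) (at x)"
      using a that by (intro has_derivative_add) auto
    then have "((\<lambda>x. A x (b + c)) has_derivative (\<lambda>u. a b x u + a c x u)) (at x)"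
      using lin by (rule_tac has_derivative_transform_within_open[OF _ S that]) (auto simp: linear_add)
    then show "a (b + c) x u = a b x u + a c x u" using a that has_derivative_unique by metis
    have "((\<lambda>x. r *\<^sub>R A x b) has_derivative (\<lambda>u. r *\<^sub>R a b x u)) (at x)"
      using a that by (intro has_derivative_scaleR_right) auto
    then have "((\<lambda>x. A x (r *\<^sub>R b)) has_derivative (\<lambda>u. r *\<^sub>R a b x u)) (at x)"
      using lin by (rule_tac has_derivative_transform_within_open[OF _ S that]) (auto simp: linear_scale)
    then show "a (r *\<^sub>R b) x u = r *\<^sub>R a b x u" using a that has_derivative_unique by metis
  qed
  have Bk: "Ck_on k S (\<lambda>x. B x v)" for v using Suc.IH Suc.prems Ck_on_SucD by blast
  have Bc: "isCont (\<lambda>x. B x v) z" if "z \<in> S" for z v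
  proof -
    have "Ck_on 0 S (\<lambda>x. B x v)" using Bk by (induction k) (auto dest: Ck_on_SucD simp del: Ck_on.simps)
    then show ?thesis using S that by (simp add: continuous_on_eq_continuous_at)
  qed
  define b' where "b' x u = - B x (a (B x v) x u)" for x u
  have "Ck_on k S (\<lambda>x. b' x u)" for u
  proof -
    have "Ck_on k S (\<lambda>x. B x (a (B x v) x u))"
      by (rule Ck_on_apply_linear[OF C S lin(2) Bk], assumption, rule Ck_on_apply_linear[OF C S alin a(2) Bk], assumption)
    then show ?thesis unfolding b'_def
      using Ck_on_bounded_linear_comp[OF bounded_linear_minus[OF bounded_linear_ident]] by blast
  qed
  moreover have "((\<lambda>x. B x v) has_derivative b' z) (at z)" if z: "z \<in> S" for z
  proof -
    let ?w = "B z v"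
    have linb: "linear (b' z)"
      using lin ab z unfolding b'_def
      by (intro linear_compose_neg linear_compose[of "a ?w z" "B z", unfolded o_def]) auto
    let ?R = "\<lambda>y. A y ?w - A z ?w - a ?w z (y - z)"
    have R: "((\<lambda>y. norm (?R y) / norm (y - z)) \<longlongrightarrow> 0) (at z)"
      using a(1)[OF z, of ?w] unfolding has_derivative_iff_norm by simp
    have Bt: "((\<lambda>y. B y c - B z c) \<longlongrightarrow> 0) (at z)" for c
      using Bc[OF z, of c] by (simp add: isCont_def LIM_zero_iff)
    \<comment> \<open>The majorant of the difference quotient. Its first summand bounds the
      remainder \<open>?R\<close> of \<open>A\<close> carried through \<open>B y\<close>; the second
      bounds the variation of \<open>B\<close> on the images of the frame vectors of
      \<open>D\<close> under the derivative of \<open>A\<close>.\<close>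
    have "((\<lambda>y. \<bar>K\<bar> * (norm (?R y) / norm (y - z)) + (\<Sum>b\<in>D. norm b * norm (B y (a ?w z b) - B z (a ?w z b)))) \<longlongrightarrow>
        \<bar>K\<bar> * 0 + (\<Sum>b\<in>D. norm b * norm (0::'e))) (at z)"
      by (intro tendsto_intros R Bt)
    then have T: "((\<lambda>y. \<bar>K\<bar> * (norm (?R y) / norm (y - z)) + (\<Sum>b\<in>D. norm b * norm (B y (a ?w z b) - B z (a ?w z b)))) \<longlongrightarrow> 0) (at z)"
      by simp
    have "\<forall>\<^sub>F x in at z. x \<in> S \<and> x \<noteq> z" using S z eventually_at_topological by blast
    then have "\<forall>\<^sub>F y in at z. norm (norm (B y v - B z v - b' z (y - z)) / norm (y - z)) \<le>
       \<bar>K\<bar> * (norm (?R y) / norm (y - z)) + (\<Sum>b\<in>D. norm b * norm (B y (a ?w z b) - B z (a ?w z b)))"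
    proof eventually_elim
      case (elim y)
      then have y: "y \<in> S" "y \<noteq> z" by auto
      have 1: "B y v - B z v = - B y (A y ?w - A z ?w)"
        using y z inv lin by (simp add: linear_diff)
      have 2: "A y ?w - A z ?w = ?R y + a ?w z (y - z)" by simp
      have "B y (a ?w z (y - z)) - B z (a ?w z (y - z)) =
          (\<Sum>b\<in>D. ((y - z) \<bullet> b) *\<^sub>R B y (a ?w z b)) - (\<Sum>b\<in>D. ((y - z) \<bullet> b) *\<^sub>R B z (a ?w z b))"
        using frame_linear_expand[OF D linear_compose[OF ab[OF z, of ?w] lin(2)[OF z]], of "y - z"]
          frame_linear_expand[OF D linear_compose[OF ab[OF z, of ?w] lin(2)[OF y(1)]], of "y - z"] by simp
      then have 3: "B y (a ?w z (y - z)) - B z (a ?w z (y - z)) =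
          (\<Sum>b\<in>D. ((y - z) \<bullet> b) *\<^sub>R (B y (a ?w z b) - B z (a ?w z b)))"
        by (simp add: sum_subtractf scaleR_diff_right)
      have "B y v - B z v - b' z (y - z) = - B y (?R y) - (B y (a ?w z (y - z)) - B z (a ?w z (y - z)))"
        unfolding 1 b'_def using linear_add[OF lin(2)[OF y(1)], of "?R y" "a ?w z (y - z)"] by simp
      then have "norm (B y v - B z v - b' z (y - z)) \<le> norm (B y (?R y)) + norm (\<Sum>b\<in>D. ((y - z) \<bullet> b) *\<^sub>R (B y (a ?w z b) - B z (a ?w z b)))"
        unfolding 3 using norm_triangle_ineq4[of "- B y (?R y)"] by simp
      moreover have "norm (B y (?R y)) \<le> \<bar>K\<bar> * norm (?R y)"
        using bd[OF y(1), of "?R y"] by (smt (verit) mult_right_mono norm_ge_zero)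
      moreover have "norm (\<Sum>b\<in>D. ((y - z) \<bullet> b) *\<^sub>R (B y (a ?w z b) - B z (a ?w z b))) \<le>
           (\<Sum>b\<in>D. norm (y - z) * (norm b * norm (B y (a ?w z b) - B z (a ?w z b))))"
        using Cauchy_Schwarz_ineq2 by (intro sum_norm_le) (auto simp: mult.assoc[symmetric] intro!: mult_right_mono)
      ultimately have "norm (B y v - B z v - b' z (y - z)) \<le> \<bar>K\<bar> * norm (?R y) +
         norm (y - z) * (\<Sum>b\<in>D. norm b * norm (B y (a ?w z b) - B z (a ?w z b)))"
        by (simp add: sum_distrib_left)
      then show ?case using y by (simp add: field_simps)
    qed
    then have "((\<lambda>y. norm (B y v - B z v - b' z (y - z)) / norm (y - z)) \<longlongrightarrow> 0) (at z)"
      by (rule Lim_null_comparison[OF _ T])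
    then show ?thesis using frame_bounded_linear[OF D linb] unfolding has_derivative_iff_norm by simp
  qed
  ultimately show ?case by auto
qed

text \<open>The inverse function theorem through the contraction \<open>x - f x + y\<close>, whose
  derivative is small near \<open>a\<close> because that of \<open>f\<close> at \<open>a\<close> is
  the identity. The inverse is stated from the right only, in the form needed for local sections of
  a submersion.\<close>

lemma smooth_local_inverse:
  fixes f :: "'e::real_inner \<Rightarrow> 'e"
  assumes C: "frame (C :: 'e set)" and S: "open S" "a \<in> S" and f: "smooth_on S f"
    and d: "(f has_derivative (\<lambda>v. v)) (at a)"
  shows "\<exists>T g. open T \<and> f a \<in> T \<and> smooth_on T g \<and> g (f a) = a \<and> g ` T \<subseteq> S \<and> (\<forall>y\<in>T. f (g y) = y)"
proof -
  have "Ck_on (Suc k) S f" for k using f by (auto simp: smooth_on_def simp del: Ck_on.simps)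
  define D where "D x = frechet_derivative f (at x)" for x
  have D: "(f has_derivative D x) (at x)" "Ck_on k S (\<lambda>x. D x v)" if "x \<in> S" for x k v
  proof -
    obtain f' where f': "\<forall>x\<in>S. (f has_derivative f' x) (at x)" "\<forall>v. Ck_on k S (\<lambda>x. f' x v)"
      using \<open>Ck_on (Suc k) S f\<close> by auto
    then have "\<And>x. x \<in> S \<Longrightarrow> f' x = D x" using D_def frechet_derivative_at by metis
    then show "(f has_derivative D x) (at x)" "Ck_on k S (\<lambda>x. D x v)"
      using that f' Ck_on_cong[OF S(1) _ f'(2)[rule_format, of v]] by auto
  qed
  have Dk: "Ck_on k S (\<lambda>x. D x v)" for k v using D S by blast
  have Da: "D a v = v" for v using D(1)[OF S(2)] d has_derivative_unique by metis
  have lD: "linear (D x)" if "x \<in> S" for x using D that has_derivative_linear by blast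
  \<comment> \<open>\<open>q x\<close> bounds the operator norm of the identity minus
    \<open>D x\<close>, since a linear map is controlled by its values on the frame; it vanishes at
    \<open>a\<close>.\<close>
  define q where "q x = (\<Sum>b\<in>C. norm b * norm (b - D x b))" for x
  have "continuous_on S q" unfolding q_def using Dk[of 0] by (intro continuous_intros) auto
  moreover have "q a = 0" using Da by (simp add: q_def)
  ultimately have "(q \<longlongrightarrow> 0) (nhds a)"
    using S by (metis continuous_on_eq_continuous_at isCont_def tendsto_at_iff_tendsto_nhds)
  then have "\<forall>\<^sub>F x in nhds a. q x < 1/2" by (rule order_tendstoD) simp
  then have "\<forall>\<^sub>F x in nhds a. x \<in> S \<and> q x < 1/2"
    using S by (auto intro: eventually_conj eventually_nhds_in_open)
  then obtain e where e: "e > 0" "\<And>x. dist x a < e \<Longrightarrow> x \<in> S \<and> q x < 1/2"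
    unfolding eventually_nhds_metric by blast
  \<comment> \<open>Halving puts the closed ball of radius \<open>r\<close> inside the open ball of
    radius \<open>e\<close>.\<close>
  define r where "r = e / 2"
  have r: "r > 0" "\<And>x. x \<in> cball a r \<Longrightarrow> x \<in> S \<and> q x < 1/2"
    using e by (auto simp: r_def dist_commute)
  have near: "norm (v - D x v) \<le> 1/2 * norm v" if x: "x \<in> cball a r" for x v
  proof -
    have "linear (\<lambda>v. v - D x v)"
      using lD r x by (intro linear_compose_sub linear_ident) auto
    then have "v - D x v = (\<Sum>b\<in>C. (v \<bullet> b) *\<^sub>R (b - D x b))" using frame_linear_expand[OF C] by blast
    also have "norm \<dots> \<le> (\<Sum>b\<in>C. norm v * (norm b * norm (b - D x b)))"
      using Cauchy_Schwarz_ineq2 by (intro sum_norm_le) (auto simp: mult.assoc[symmetric] intro!: mult_right_mono)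
    also have "\<dots> = norm v * q x" by (simp add: q_def sum_distrib_left)
    also have "\<dots> \<le> norm v * (1/2)" using r(2)[OF x] by (intro mult_left_mono) auto
    finally show ?thesis by simp
  qed
  have contr: "dist (x - f x) (x' - f x') \<le> 1/2 * dist x x'" if "x \<in> cball a r" "x' \<in> cball a r" for x x'
  proof -
    have "norm ((x - f x) - (x' - f x')) \<le> 1/2 * norm (x - x')"
    proof (rule differentiable_bound[where f' = "\<lambda>x v. v - D x v" and S = "cball a r"])
      fix x assume x: "x \<in> cball a r"
      then show "((\<lambda>x. x - f x) has_derivative (\<lambda>v. v - D x v)) (at x within cball a r)"
        using has_derivative_at_withinI[OF has_derivative_diff[OF has_derivative_ident D(1)]] r(2) by blast
      show "onorm (\<lambda>v. v - D x v) \<le> 1/2"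
        by (intro onorm_bound near[OF x]) simp
    qed (use that in auto)
    then show ?thesis by (simp add: dist_norm)
  qed
  have compl: "complete (cball a r)" using frame_complete[OF C] .
  \<comment> \<open>The contraction factor 1/2 uses up \<open>r/2\<close> of the radius; the other
    half is the allowed distance of \<open>y\<close> from \<open>f a\<close>, so that the closed
    ball is mapped into itself.\<close>
  define T where "T = ball (f a) (r/2)"
  have fix1: "\<exists>!x\<in>cball a r. x - f x + y = x" if y: "y \<in> T" for y
  proof (rule Banach_fix[OF compl, where c = "1/2"])
    show "(\<lambda>x. x - f x + y) ` cball a r \<subseteq> cball a r"
    proof safe
      fix x assume x: "x \<in> cball a r"
      have "x - f x + y - a = ((x - f x) - (a - f a)) + (y - f a)" by simp
      then have "norm (x - f x + y - a) \<le> norm ((x - f x) - (a - f a)) + norm (y - f a)"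
        by (metis norm_triangle_ineq)
      moreover have "norm ((x - f x) - (a - f a)) \<le> 1/2 * r"
        using contr[OF x, of a] x r(1) by (auto simp: dist_norm norm_minus_commute)
      moreover have "norm (y - f a) < r/2" using y by (simp add: T_def dist_norm norm_minus_commute)
      ultimately have "norm (x - f x + y - a) \<le> r" by linarith
      then show "x - f x + y \<in> cball a r" by (simp add: dist_norm norm_minus_commute)
    qed
  qed (use r contr in \<open>auto simp: dist_norm\<close>)
  define g where "g y = (THE x. x \<in> cball a r \<and> x - f x + y = x)" for y
  have g: "g y \<in> cball a r" "f (g y) = y" if "y \<in> T" for y
  proof -
    have "g y \<in> cball a r \<and> g y - f (g y) + y = g y"
      unfolding g_def by (rule theI'[OF fix1[OF that]])
    then show "g y \<in> cball a r" "f (g y) = y" by auto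
  qed
  have fa: "f a \<in> T" "open T" using r by (auto simp: T_def)
  have ga: "g (f a) = a"
    unfolding g_def by (rule the1_equality[OF fix1[OF fa(1)]]) (use r(1) in auto)
  have lip: "norm (g y - g z) \<le> 2 * norm (y - z)" if "y \<in> T" "z \<in> T" for y z
  proof -
    have "norm ((g y - f (g y)) - (g z - f (g z))) \<le> 1/2 * norm (g y - g z)"
      using contr[of "g y" "g z"] g that by (auto simp: dist_norm)
    moreover have "g y - g z = ((g y - f (g y)) - (g z - f (g z))) + (y - z)" using g that by simp
    then have "norm (g y - g z) \<le> norm ((g y - f (g y)) - (g z - f (g z))) + norm (y - z)"
      using norm_triangle_ineq by metis
    ultimately show ?thesis by simp
  qed
  have Dinj: "norm v \<le> 2 * norm (D x v)" if x: "x \<in> cball a r" for x v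
    using near[OF x, of v] norm_triangle_ineq2[of v "v - D x v"] by simp
  \<comment> \<open>Surjectivity of \<open>D x\<close> is again a fixed point statement, for
    \<open>v - D x v + w\<close>. The whole space is complete because Cauchy sequences are bounded
    and closed balls are complete.\<close>
  have Dsurj: "\<exists>v. D x v = w" if x: "x \<in> cball a r" for x w
  proof -
    have "complete (UNIV :: 'e set)"
    proof (rule completeI)
      fix s :: "nat \<Rightarrow> 'e" assume s: "Cauchy s"
      then have "bounded (range s)" by (rule cauchy_imp_bounded)
      then obtain c R where "range s \<subseteq> cball c R" using bounded_subset_cball by metis
      then show "\<exists>l\<in>UNIV. s \<longlonglongrightarrow> l"
        using frame_complete[OF C, of c R] s unfolding complete_def by blast
    qed
    moreover have "dist (u - D x u + w) (v - D x v + w) \<le> 1/2 * dist u v" for u v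
      using near[OF x, of "u - v"] linear_diff[OF lD, of x u v] r(2)[OF x] by (simp add: dist_norm algebra_simps)
    ultimately have "\<exists>!v\<in>UNIV. v - D x v + w = v"
      by (intro Banach_fix[where c = "1/2"]) auto
    then obtain v where "v - D x v + w = v" by blast
    then have "D x v = w" by (simp add: algebra_simps)
    then show ?thesis by blast
  qed
  define B where "B y w = (SOME v. D (g y) v = w)" for y w
  have B: "D (g y) (B y w) = w" if "y \<in> T" for y w
    unfolding B_def using Dsurj[OF g(1)[OF that]] by (rule someI_ex)
  have gS: "g y \<in> S" if "y \<in> T" for y using g r that by blast
  have B': "B y (D (g y) v) = v" if y: "y \<in> T" for y v
  proof -
    have "norm (B y (D (g y) v) - v) \<le> 2 * norm (D (g y) (B y (D (g y) v) - v))"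
      using Dinj g y by blast
    also have "D (g y) (B y (D (g y) v) - v) = 0"
      using lD[OF gS[OF y]] B[OF y] by (simp add: linear_diff)
    finally show ?thesis by simp
  qed
  have Bl: "linear (B y)" if y: "y \<in> T" for y
  proof
    fix u v c
    have l: "linear (D (g y))" using lD[OF gS[OF y]] .
    have "B y (u + v) = B y (D (g y) (B y u + B y v))" using B[OF y] l by (simp add: linear_add)
    then show "B y (u + v) = B y u + B y v" using B'[OF y] by simp
    have "B y (c *\<^sub>R u) = B y (D (g y) (c *\<^sub>R B y u))" using B[OF y] l by (simp add: linear_scale)
    then show "B y (c *\<^sub>R u) = c *\<^sub>R B y u" using B'[OF y] by simp
  qed
  have Bb: "norm (B y v) \<le> 2 * norm v" if "y \<in> T" for y v
    using Dinj[OF g(1)[OF that], of "B y v"] B[OF that] by simp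
  have gc: "isCont g y" if y: "y \<in> T" for y
  proof -
    have "((\<lambda>z. 2 * norm (z - y)) \<longlongrightarrow> 2 * norm (y - y)) (at y)" by (intro tendsto_intros)
    then have t: "((\<lambda>z. 2 * norm (z - y)) \<longlongrightarrow> 0) (at y)" by simp
    have "\<forall>\<^sub>F z in at y. z \<in> T" using fa(2) y eventually_at_topological by blast
    then have "\<forall>\<^sub>F z in at y. norm (g z - g y) \<le> 2 * norm (z - y)" by eventually_elim (use lip y in blast)
    then have "((\<lambda>z. g z - g y) \<longlongrightarrow> 0) (at y)" by (rule Lim_null_comparison[OF _ t])
    then show ?thesis by (simp add: isCont_def LIM_zero_iff)
  qed
  have gd: "(g has_derivative B y) (at y)" if y: "y \<in> T" for y
    by (rule has_derivative_inverse_basic[OF D(1)[OF gS[OF y]] frame_bounded_linear[OF C Bl[OF y]] _ gc[OF y] fa(2) y])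
      (use B' y g in auto)
  \<comment> \<open>Bootstrapping: the derivative of \<open>g\<close> at \<open>y\<close> is the
    inverse of \<open>D (g y)\<close>, so regularity \<open>k\<close> of \<open>g\<close> gives
    regularity \<open>k\<close> of its derivative by \<open>Ck_on_inverse_linear\<close>.\<close>
  have "Ck_on k T g" for k
  proof (induction k)
    case 0
    show ?case using gc by (simp add: continuous_at_imp_continuous_on)
  next
    case (Suc k)
    have "Ck_on k T (\<lambda>y. D (g y) v)" for v
      by (rule Ck_on_compose[OF C fa(2) Suc _ Dk]) (use gS in auto)
    then have Dg: "\<And>v. Ck_on k T (\<lambda>y. D (g y) v)" .
    have "Ck_on k T (\<lambda>y. B y v)" for v
      by (rule Ck_on_inverse_linear[where A = "\<lambda>y. D (g y)" and K = 2, OF C C fa(2)])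
        (rule lD[OF gS] Bl B B' Bb Dg; assumption?)+
    then show ?case using gd by auto
  qed
  then have "smooth_on T g" by (simp add: smooth_on_def)
  then show ?thesis using fa ga gS g(2) by blast
qed

section \<open>Bump functions\<close>

text \<open>The classical flat function \<open>exp (- 1 / t)\<close>, divided by powers of
  \<open>t\<close> so that the family is stable under differentiation up to linear
  combinations.\<close>

definition flat :: "nat \<Rightarrow> real \<Rightarrow> real" where
  "flat n t = (if t \<le> 0 then 0 else exp (- 1 / t) / t ^ n)"

lemma flat_tendsto_0: "(flat n \<longlongrightarrow> 0) (at 0)"
proof -
  have "((\<lambda>t. inverse t ^ n / exp (inverse t)) \<longlongrightarrow> 0) (at_right (0::real))"
    by (rule filterlim_compose[OF tendsto_power_div_exp_0 filterlim_inverse_at_top_right])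
  then have "(flat n \<longlongrightarrow> 0) (at_right 0)"
  proof (rule Lim_transform_eventually)
    show "\<forall>\<^sub>F t in at_right 0. inverse t ^ n / exp (inverse t) = flat n t"
      unfolding eventually_at_right_field
      by (intro exI[of _ 1]) (auto simp: flat_def exp_minus field_simps)
  qed
  moreover have "(flat n \<longlongrightarrow> 0) (at_left 0)"
    by (rule Lim_transform_eventually[OF tendsto_const])
      (auto simp: flat_def eventually_at_left_field intro!: exI[of _ "-1"])
  ultimately show ?thesis by (simp add: filterlim_split_at)
qed

lemma flat_has_derivative:
  "(flat n has_derivative (\<lambda>v. (flat (n + 2) t - real n * flat (n + 1) t) * v)) (at t)"
proof -
  consider "t < 0" | "t = 0" | "t > 0" by linarith
  then have "(flat n has_field_derivative (flat (n + 2) t - real n * flat (n + 1) t)) (at t)"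
  proof cases
    case 1
    have "((\<lambda>x. 0) has_field_derivative 0) (at t)" by simp
    then have "(flat n has_field_derivative 0) (at t)"
      by (rule has_field_derivative_transform_within_open[of _ _ _ "{..<0}"]) (use 1 in \<open>auto simp: flat_def\<close>)
    then show ?thesis using 1 by (simp add: flat_def)
  next
    case 2
    \<comment> \<open>At 0 the difference quotient of \<open>flat n\<close> is
      \<open>flat (Suc n)\<close> itself.\<close>
    have "((\<lambda>h. flat (Suc n) h) \<longlongrightarrow> 0) (at 0)" by (rule flat_tendsto_0)
    then have "((\<lambda>h. (flat n (0 + h) - flat n 0) / h) \<longlongrightarrow> 0) (at 0)"
      by (rule Lim_transform_eventually) (auto simp: flat_def eventually_at_filter intro!: always_eventually)
    then have "(flat n has_field_derivative 0) (at 0)" by (simp add: DERIV_def)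
    then show ?thesis using 2 by (simp add: flat_def)
  next
    case 3
    have "((\<lambda>t. exp (- 1 / t) / t ^ n) has_field_derivative
       (exp (- 1 / t) * (1 / t\<^sup>2) * t ^ n - exp (- 1 / t) * (real n * t ^ (n - 1))) / (t ^ n * t ^ n)) (at t)"
      using 3 by (auto intro!: derivative_eq_intros simp: power2_eq_square field_simps)
    also have "(exp (- 1 / t) * (1 / t\<^sup>2) * t ^ n - exp (- 1 / t) * (real n * t ^ (n - 1))) / (t ^ n * t ^ n) =
       flat (n + 2) t - real n * flat (n + 1) t"
      using 3 by (cases n) (auto simp: flat_def field_simps power2_eq_square)
    finally have "((\<lambda>t. exp (- 1 / t) / t ^ n) has_field_derivative (flat (n + 2) t - real n * flat (n + 1) t)) (at t)" .
    then show ?thesis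
      by (rule has_field_derivative_transform_within_open[of _ _ _ "{0<..}"]) (use 3 in \<open>auto simp: flat_def\<close>)
  qed
  then show ?thesis by (simp add: has_field_derivative_def)
qed

lemma smooth_on_flat: "smooth_on S (flat n)"
proof -
  have "Ck_on k S (flat n)" for k
  proof (induction k arbitrary: n)
    case 0
    show ?case
      using has_derivative_continuous[OF flat_has_derivative] by (simp add: continuous_at_imp_continuous_on)
  next
    case (Suc k)
    have "Ck_on k S (\<lambda>t. (flat (n + 2) t + (- real n) * flat (n + 1) t) * v)" for v
      by (intro Ck_on_bounded_linear_comp[OF bounded_linear_mult_left] Ck_on_add Suc
          Ck_on_bounded_linear_comp[OF bounded_linear_mult_right])
    then have "\<forall>v. Ck_on k S (\<lambda>t. (flat (n + 2) t - real n * flat (n + 1) t) * v)" by simp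
    then show ?case
      using flat_has_derivative by (auto simp del: add_2_eq_Suc' add_2_eq_Suc One_nat_def intro!: exI[of _ "\<lambda>t v. (flat (n + 2) t - real n * flat (n + 1) t) * v"])
  qed
  then show ?thesis by (simp add: smooth_on_def)
qed

lemma frame_real: "frame {1 :: real}"
  by (simp add: frame_def)

lemma smooth_on_inverse: "smooth_on {0 <..} (inverse :: real \<Rightarrow> real)"
proof -
  have "Ck_on k {0 <..} (inverse :: real \<Rightarrow> real)" for k
  proof (induction k)
    case 0
    show ?case by (auto intro!: continuous_on_inverse continuous_on_id)
  next
    case (Suc k)
    have "Ck_on k {0 <..} (\<lambda>x. - (inverse x * v * inverse x) :: real)" for v
      by (intro Ck_on_bounded_linear_comp[OF bounded_linear_minus[OF bounded_linear_ident]]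
          Ck_on_bilinear[OF bounded_bilinear_mult] Ck_on_bounded_linear_comp[OF bounded_linear_mult_left] Suc)
    moreover have "(inverse has_derivative (\<lambda>v. - (inverse x * v * inverse x))) (at x)" if "x > 0" for x :: real
      by (rule has_derivative_inverse') (use that in simp)
    ultimately show ?case by (auto intro!: exI[of _ "\<lambda>x v. - (inverse x * v * inverse x)"])
  qed
  then show ?thesis by (simp add: smooth_on_def)
qed

lemma bump_function_exists:
  fixes a :: "'e::real_inner"
  assumes "frame (C :: 'e set)" "r > 0"
  shows "\<exists>\<rho> :: 'e \<Rightarrow> real. smooth_on UNIV \<rho> \<and> (\<forall>x\<in>ball a (r/2). \<rho> x = 1) \<and> (\<forall>x. x \<notin> cball a r \<longrightarrow> \<rho> x = 0)"
proof -
  define s where "s x = ((x - a) \<bullet> (x - a)) * inverse (r\<^sup>2)" for x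
  have aff: "smooth_on UNIV (\<lambda>x. c * s x + d)" for c d
    unfolding s_def
    by (intro smooth_on_add smooth_on_const smooth_on_bounded_linear_comp[OF bounded_linear_mult_left]
        smooth_on_bounded_linear_comp[OF bounded_linear_mult_right] smooth_on_bilinear[OF bounded_bilinear_inner])
      (use smooth_on_add[OF smooth_on_id smooth_on_const, of UNIV "- a"] in auto)
  \<comment> \<open>\<open>p\<close> is positive exactly for \<open>s x < 1\<close> and
    \<open>m\<close> exactly for \<open>s x > 1/4\<close>, so their sum never vanishes and the
    quotient of \<open>p\<close> by it is 1 on the inner ball. The constant 1/4 is the square of the
    ratio of the radii \<open>r/2\<close> and \<open>r\<close>.\<close>
  define p where "p x = flat 0 ((- 1) * s x + 1)" for x
  define m where "m x = flat 0 (1 * s x + (- 1/4))" for x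
  have pm: "smooth_on UNIV p" "smooth_on UNIV m"
    unfolding p_def m_def by (rule smooth_on_compose[OF frame_real open_UNIV aff _ smooth_on_flat[of UNIV]]; simp)+
  have pos: "p x + m x > 0" for x
    unfolding p_def m_def by (cases "s x < 1") (auto simp: flat_def intro: add_nonneg_pos add_pos_nonneg)
  have "smooth_on UNIV (\<lambda>x. p x * inverse (p x + m x))"
    by (intro smooth_on_bilinear[OF bounded_bilinear_mult] pm
        smooth_on_compose[OF frame_real open_UNIV smooth_on_add[OF pm] _ smooth_on_inverse])
      (use pos in auto)
  moreover have "p x * inverse (p x + m x) = 1" if "x \<in> ball a (r/2)" for x
  proof -
    have "norm (x - a) < r/2" using that by (simp add: dist_norm norm_minus_commute)
    then have "(norm (x - a))\<^sup>2 < (r/2)\<^sup>2" by (intro power_strict_mono) auto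
    then have "s x < 1/4" using assms(2) by (simp add: s_def dot_square_norm field_simps power_divide)
    then have "m x = 0" by (simp add: m_def flat_def)
    then show ?thesis using pos[of x] by simp
  qed
  moreover have "p x * inverse (p x + m x) = 0" if "x \<notin> cball a r" for x
  proof -
    have "norm (x - a) > r" using that by (simp add: dist_norm norm_minus_commute)
    then have "(norm (x - a))\<^sup>2 > r\<^sup>2" using assms(2) by (intro power_strict_mono) auto
    then have "s x > 1" using assms(2) by (simp add: s_def dot_square_norm field_simps)
    then show ?thesis by (simp add: p_def flat_def)
  qed
  ultimately show ?thesis by blast
qed

section \<open>Smooth functions and maps on manifolds\<close>

lemma manifold_frame:
  assumes "is_manifold (M :: ('a, 'e::real_inner) manifold)"
  shows "\<exists>C :: 'e set. frame C"
proof -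
  obtain B :: "'e set" where "finite B" "span B = UNIV" using assms unfolding is_manifold_def by (elim conjE exE)
  then show ?thesis by (rule frame_exists)
qed

lemma
  assumes "is_manifold M" "(U, \<phi>) \<in> atlas M"
  shows chart_openin: "openin (mtop M) U"
    and chart_open_range: "open (\<phi> ` U)"
    and chart_homeomorphic: "homeomorphic_map (subtopology (mtop M) U) (top_of_set (\<phi> ` U)) \<phi>"
  using assms unfolding is_manifold_def by auto

lemma chart_subset: "is_manifold M \<Longrightarrow> (U, \<phi>) \<in> atlas M \<Longrightarrow> U \<subseteq> pts M"
  using chart_openin openin_subset by blast

lemma chart_inj:
  assumes "is_manifold M" "(U, \<phi>) \<in> atlas M"
  shows "inj_on \<phi> U"
  using homeomorphic_imp_injective_map[OF chart_homeomorphic[OF assms]] chart_subset[OF assms]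
  by (simp add: inf_absorb2)

lemma chart_inv: "is_manifold M \<Longrightarrow> (U, \<phi>) \<in> atlas M \<Longrightarrow> q \<in> U \<Longrightarrow> inv_into U \<phi> (\<phi> q) = q"
  using chart_inj inv_into_f_f by metis

lemma chart_exists: "is_manifold M \<Longrightarrow> p \<in> pts M \<Longrightarrow> \<exists>U \<phi>. (U, \<phi>) \<in> atlas M \<and> p \<in> U"
  unfolding is_manifold_def by blast

lemma chart_transition:
  "is_manifold M \<Longrightarrow> (U, \<phi>) \<in> atlas M \<Longrightarrow> (V, \<psi>) \<in> atlas M \<Longrightarrow> smooth_on (\<phi> ` (U \<inter> V)) (\<psi> \<circ> inv_into U \<phi>)"
  unfolding is_manifold_def by fast

lemma chart_open_image:
  assumes "is_manifold M" "(U, \<phi>) \<in> atlas M" "openin (mtop M) W"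
  shows "open (\<phi> ` (U \<inter> W))"
proof -
  have "openin (subtopology (mtop M) U) (U \<inter> W)"
    using assms(3) openin_subtopology by blast
  then have "openin (top_of_set (\<phi> ` U)) (\<phi> ` (U \<inter> W))"
    using homeomorphic_map_openness[OF chart_homeomorphic[OF assms(1,2)]] chart_subset[OF assms(1,2)]
    by (metis inf_le1 topspace_subtopology_subset)
  then show ?thesis using chart_open_range[OF assms(1,2)] openin_open_eq by blast
qed

lemma chart_open_preimage:
  assumes "is_manifold M" "(U, \<phi>) \<in> atlas M" "open S"
  shows "openin (mtop M) {q \<in> U. \<phi> q \<in> S}"
proof -
  have "continuous_map (subtopology (mtop M) U) (top_of_set (\<phi> ` U)) \<phi>"
    using chart_homeomorphic[OF assms(1,2)] homeomorphic_imp_continuous_map by blast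
  then have "continuous_map (subtopology (mtop M) U) euclidean \<phi>"
    by (simp add: continuous_map_in_subtopology)
  then have "openin (subtopology (mtop M) U) {q \<in> topspace (subtopology (mtop M) U). \<phi> q \<in> S}"
    by (rule openin_continuous_map_preimage) (use assms(3) open_openin in blast)
  moreover have "topspace (subtopology (mtop M) U) = U"
    using chart_subset[OF assms(1,2)] by (simp add: inf_absorb2)
  ultimately have "openin (subtopology (mtop M) U) {q \<in> U. \<phi> q \<in> S}"
    by (simp del: topspace_subtopology)
  then show ?thesis using chart_openin[OF assms(1,2)] openin_trans_full by blast
qed

section \<open>Vector-valued smooth functions on subsets of a manifold\<close>

lemma bex_pair_iff: "(\<exists>(U, \<phi>)\<in>X. Q U \<phi>) \<longleftrightarrow> (\<exists>U \<phi>. (U, \<phi>) \<in> X \<and> Q U \<phi>)"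
  by auto

lemma smooth_functionD:
  assumes "smooth_function M A f" "p \<in> A"
  obtains U \<phi> S F where "(U, \<phi>) \<in> atlas M" "p \<in> U" "open S" "\<phi> p \<in> S" "smooth_on S F"
    "\<And>q. q \<in> A \<Longrightarrow> q \<in> U \<Longrightarrow> \<phi> q \<in> S \<Longrightarrow> f q = F (\<phi> q)"
proof -
  from assms have "\<exists>U \<phi>. (U, \<phi>) \<in> atlas M \<and> p \<in> U \<and>
        (\<exists>S F. open S \<and> \<phi> p \<in> S \<and> smooth_on S F \<and> (\<forall>q\<in>A \<inter> U. \<phi> q \<in> S \<longrightarrow> f q = F (\<phi> q)))"
    unfolding smooth_function_def bex_pair_iff by blast
  then show ?thesis using that by (elim exE conjE) (metis IntI)
qed

lemma smooth_functionI:
  assumes "A \<subseteq> pts M" "\<And>p. p \<in> A \<Longrightarrow> \<exists>U \<phi> S F. (U, \<phi>) \<in> atlas M \<and> p \<in> U \<and> open S \<and> \<phi> p \<in> S \<and> smooth_on S F \<and>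
    (\<forall>q. q \<in> A \<longrightarrow> q \<in> U \<longrightarrow> \<phi> q \<in> S \<longrightarrow> f q = F (\<phi> q))"
  shows "smooth_function M A f"
proof -
  have "\<exists>U \<phi>. (U, \<phi>) \<in> atlas M \<and> p \<in> U \<and>
        (\<exists>S F. open S \<and> \<phi> p \<in> S \<and> smooth_on S F \<and> (\<forall>q\<in>A \<inter> U. \<phi> q \<in> S \<longrightarrow> f q = F (\<phi> q)))"
    if "p \<in> A" for p
    using assms(2)[OF that] by (elim exE conjE) (metis IntE)
  then show ?thesis unfolding smooth_function_def bex_pair_iff using assms(1) by blast
qed

lemma smooth_function_subset_cong:
  assumes f: "smooth_function M A f" and "B \<subseteq> A" "\<And>p. p \<in> B \<Longrightarrow> f p = g p"
  shows "smooth_function M B g"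
proof (rule smooth_functionI)
  show "B \<subseteq> pts M" using assms unfolding smooth_function_def by blast
  fix p assume p: "p \<in> B"
  obtain U \<phi> S F where U: "(U, \<phi>) \<in> atlas M" "p \<in> U" "open S" "\<phi> p \<in> S" "smooth_on S F"
    "\<And>q. q \<in> A \<Longrightarrow> q \<in> U \<Longrightarrow> \<phi> q \<in> S \<Longrightarrow> f q = F (\<phi> q)"
    by (rule smooth_functionD[OF f, of p]) (use p assms(2) in auto)
  have "\<forall>q. q \<in> B \<longrightarrow> q \<in> U \<longrightarrow> \<phi> q \<in> S \<longrightarrow> g q = F (\<phi> q)"
    using U(6) assms(2,3) by (metis subsetD)
  then show "\<exists>U \<phi> S F. (U, \<phi>) \<in> atlas M \<and> p \<in> U \<and> open S \<and> \<phi> p \<in> S \<and> smooth_on S F \<and>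
    (\<forall>q. q \<in> B \<longrightarrow> q \<in> U \<longrightarrow> \<phi> q \<in> S \<longrightarrow> g q = F (\<phi> q))" using U by blast
qed

lemmas smooth_function_subset = smooth_function_subset_cong[OF _ _ refl]
lemmas smooth_function_cong = smooth_function_subset_cong[OF _ subset_refl]

lemma smooth_function_local:
  assumes M: "is_manifold M" and "A \<subseteq> pts M"
    and "\<And>p. p \<in> A \<Longrightarrow> \<exists>W. openin (mtop M) W \<and> p \<in> W \<and> smooth_function M (A \<inter> W) f"
  shows "smooth_function M A f"
proof (rule smooth_functionI[OF assms(2)])
  fix p assume p: "p \<in> A"
  then obtain W where W: "openin (mtop M) W" "p \<in> W" "smooth_function M (A \<inter> W) f" using assms(3) by blast
  obtain U \<phi> S F where U: "(U, \<phi>) \<in> atlas M" "p \<in> U" "open S" "\<phi> p \<in> S" "smooth_on S F"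
    "\<And>q. q \<in> A \<inter> W \<Longrightarrow> q \<in> U \<Longrightarrow> \<phi> q \<in> S \<Longrightarrow> f q = F (\<phi> q)"
    by (rule smooth_functionD[OF W(3), of p]) (use p W in auto)
  have "q \<in> W" if "q \<in> U" "\<phi> q \<in> \<phi> ` (U \<inter> W)" for q
    using that chart_inj[OF M U(1)] by (auto dest: inj_onD)
  then show "\<exists>U \<phi> S F. (U, \<phi>) \<in> atlas M \<and> p \<in> U \<and> open S \<and> \<phi> p \<in> S \<and> smooth_on S F \<and>
    (\<forall>q. q \<in> A \<longrightarrow> q \<in> U \<longrightarrow> \<phi> q \<in> S \<longrightarrow> f q = F (\<phi> q))"
    using U W chart_open_image[OF M U(1) W(1)]
    by (intro exI[of _ U] exI[of _ \<phi>] exI[of _ "S \<inter> \<phi> ` (U \<inter> W)"] exI[of _ F])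
      (auto intro: smooth_on_subset)
qed

text \<open>The definition provides some chart at each point; transition maps carry the local
  extension to the prescribed one. With \<open>A\<close> open this turns the algebra of smooth
  functions into that on open sets of the model space.\<close>

lemma smooth_function_chart:
  assumes M: "is_manifold M" and A: "openin (mtop M) A" and f: "smooth_function M A f" and U: "(U, \<phi>) \<in> atlas M"
  shows "smooth_on (\<phi> ` (U \<inter> A)) (\<lambda>x. f (inv_into U \<phi> x))"
proof (rule smooth_on_local[OF chart_open_image[OF M U A]])
  fix x assume "x \<in> \<phi> ` (U \<inter> A)"
  then obtain p where p: "p \<in> U" "p \<in> A" "x = \<phi> p" by blast
  obtain V \<psi> S F where V: "(V, \<psi>) \<in> atlas M" "p \<in> V" "open S" "\<psi> p \<in> S" "smooth_on S F"
    "\<And>q. q \<in> A \<Longrightarrow> q \<in> V \<Longrightarrow> \<psi> q \<in> S \<Longrightarrow> f q = F (\<psi> q)"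
    by (rule smooth_functionD[OF f p(2)]) blast
  define W where "W = {q \<in> V. \<psi> q \<in> S} \<inter> A"
  have W: "openin (mtop M) W" unfolding W_def using chart_open_preimage[OF M V(1,3)] A by blast
  have T: "open (\<phi> ` (U \<inter> W))" by (rule chart_open_image[OF M U W])
  obtain C :: "'b set" where C: "frame C" using manifold_frame[OF M] by blast
  have "smooth_on (\<phi> ` (U \<inter> W)) (\<lambda>x. F ((\<psi> \<circ> inv_into U \<phi>) x))"
  proof (rule smooth_on_compose[OF C T smooth_on_subset[OF chart_transition[OF M U V(1)]] _ V(5)])
    show "\<phi> ` (U \<inter> W) \<subseteq> \<phi> ` (U \<inter> V)" by (auto simp: W_def)
    show "(\<psi> \<circ> inv_into U \<phi>) ` \<phi> ` (U \<inter> W) \<subseteq> S" using chart_inv[OF M U] by (auto simp: W_def)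
  qed
  then have "smooth_on (\<phi> ` (U \<inter> W)) (\<lambda>x. f (inv_into U \<phi> x))"
    by (rule smooth_on_cong[OF T]) (use V(6) chart_inv[OF M U] in \<open>auto simp: W_def\<close>)
  then show "\<exists>T. open T \<and> x \<in> T \<and> smooth_on (\<phi> ` (U \<inter> A) \<inter> T) (\<lambda>x. f (inv_into U \<phi> x))"
    using T p V by (intro exI[of _ "\<phi> ` (U \<inter> W)"]) (auto simp: W_def intro: smooth_on_subset)
qed

lemma smooth_function_chartI:
  assumes M: "is_manifold M" and A: "openin (mtop M) A"
    and f: "\<And>U \<phi>. (U, \<phi>) \<in> atlas M \<Longrightarrow> smooth_on (\<phi> ` (U \<inter> A)) (\<lambda>x. f (inv_into U \<phi> x))"
  shows "smooth_function M A f"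
proof (rule smooth_functionI)
  show "A \<subseteq> pts M" using A openin_subset by blast
  fix p assume p: "p \<in> A"
  then obtain U \<phi> where U: "(U, \<phi>) \<in> atlas M" "p \<in> U"
    using chart_exists[OF M] A openin_subset by blast
  then show "\<exists>U \<phi> S F. (U, \<phi>) \<in> atlas M \<and> p \<in> U \<and> open S \<and> \<phi> p \<in> S \<and> smooth_on S F \<and>
    (\<forall>q. q \<in> A \<longrightarrow> q \<in> U \<longrightarrow> \<phi> q \<in> S \<longrightarrow> f q = F (\<phi> q))"
    using p f[OF U(1)] chart_open_image[OF M U(1) A] chart_inv[OF M U(1)]
    by (intro exI[of _ U] exI[of _ \<phi>] exI[of _ "\<phi> ` (U \<inter> A)"] exI[of _ "\<lambda>x. f (inv_into U \<phi> x)"]) auto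
qed

lemma smooth_function_const: "is_manifold M \<Longrightarrow> openin (mtop M) A \<Longrightarrow> smooth_function M A (\<lambda>_. c)"
  by (rule smooth_function_chartI) (auto intro: smooth_on_const)

lemma smooth_function_bounded_linear:
  "is_manifold M \<Longrightarrow> openin (mtop M) A \<Longrightarrow> bounded_linear L \<Longrightarrow> smooth_function M A f \<Longrightarrow> smooth_function M A (\<lambda>x. L (f x))"
  by (rule smooth_function_chartI) (auto intro!: smooth_on_bounded_linear_comp[of L] smooth_function_chart)

lemma smooth_function_add:
  "is_manifold M \<Longrightarrow> openin (mtop M) A \<Longrightarrow> smooth_function M A f \<Longrightarrow> smooth_function M A g \<Longrightarrow>
   smooth_function M A (\<lambda>x. f x + g x)"
  by (rule smooth_function_chartI) (auto intro!: smooth_on_add smooth_function_chart)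

lemma smooth_function_mult:
  fixes f g :: "'a \<Rightarrow> 'k::real_normed_algebra"
  shows "is_manifold M \<Longrightarrow> openin (mtop M) A \<Longrightarrow> smooth_function M A f \<Longrightarrow> smooth_function M A g \<Longrightarrow>
   smooth_function M A (\<lambda>x. f x * g x)"
  by (rule smooth_function_chartI) (auto intro!: smooth_on_bilinear[OF bounded_bilinear_mult] smooth_function_chart)

lemma smooth_function_of_chart:
  assumes M: "is_manifold M" and U: "(U, \<phi>) \<in> atlas M"
  shows "smooth_function M U \<phi>"
proof (rule smooth_functionI[OF chart_subset[OF M U]])
  fix p assume "p \<in> U"
  then show "\<exists>U' \<phi>' S F. (U', \<phi>') \<in> atlas M \<and> p \<in> U' \<and> open S \<and> \<phi>' p \<in> S \<and> smooth_on S F \<and>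
    (\<forall>q. q \<in> U \<longrightarrow> q \<in> U' \<longrightarrow> \<phi>' q \<in> S \<longrightarrow> \<phi> q = F (\<phi>' q))"
    using U smooth_on_id by (intro exI[of _ U] exI[of _ \<phi>] exI[of _ UNIV] exI[of _ "\<lambda>x. x"]) auto
qed

lemma smooth_function_continuous_at:
  assumes M: "is_manifold M" and f: "smooth_function M A f" and p: "p \<in> A" and S: "open S" "f p \<in> S"
  shows "\<exists>W. openin (mtop M) W \<and> p \<in> W \<and> (\<forall>q\<in>A \<inter> W. f q \<in> S)"
proof -
  obtain V \<psi> T F where V: "(V, \<psi>) \<in> atlas M" "p \<in> V" "open T" "\<psi> p \<in> T" "smooth_on T F"
    "\<And>q. q \<in> A \<Longrightarrow> q \<in> V \<Longrightarrow> \<psi> q \<in> T \<Longrightarrow> f q = F (\<psi> q)"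
    by (rule smooth_functionD[OF f p]) blast
  have "open (T \<inter> F -` S)"
    using smooth_on_continuous[OF V(5)] V(3) S(1) continuous_on_open_vimage by (metis inf_commute)
  then have "openin (mtop M) {q \<in> V. \<psi> q \<in> T \<inter> F -` S}" by (rule chart_open_preimage[OF M V(1)])
  then show ?thesis using V p S by (intro exI[of _ "{q \<in> V. \<psi> q \<in> T \<inter> F -` S}"]) auto
qed

section \<open>Smooth maps between manifolds\<close>

lemma smooth_mapD:
  assumes "smooth_map M A N f" "p \<in> A"
  obtains U \<phi> V \<psi> S F where "(U, \<phi>) \<in> atlas M" "p \<in> U" "(V, \<psi>) \<in> atlas N" "f p \<in> V"
    "open S" "\<phi> p \<in> S" "smooth_on S F"
    "\<And>q. q \<in> A \<Longrightarrow> q \<in> U \<Longrightarrow> \<phi> q \<in> S \<Longrightarrow> f q \<in> V \<and> \<psi> (f q) = F (\<phi> q)"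
proof -
  from assms have "\<exists>U \<phi>. (U, \<phi>) \<in> atlas M \<and> (\<exists>V \<psi>. (V, \<psi>) \<in> atlas N \<and> p \<in> U \<and> f p \<in> V \<and>
        (\<exists>S F. open S \<and> \<phi> p \<in> S \<and> smooth_on S F \<and> (\<forall>q\<in>A \<inter> U. \<phi> q \<in> S \<longrightarrow> f q \<in> V \<and> \<psi> (f q) = F (\<phi> q))))"
    unfolding smooth_map_def bex_pair_iff by blast
  then show ?thesis using that by (elim exE conjE) (metis IntI)
qed

lemma smooth_map_subset_pts: "smooth_map M A N f \<Longrightarrow> A \<subseteq> pts M" "smooth_map M A N f \<Longrightarrow> f ` A \<subseteq> pts N"
  unfolding smooth_map_def by auto

lemma smooth_function_compose:
  fixes N :: "('b, 'f::real_inner) manifold"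
  assumes N: "is_manifold N" and f: "smooth_map M A N f" and g: "smooth_function N B g" and AB: "f ` A \<subseteq> B"
  shows "smooth_function M A (\<lambda>x. g (f x))"
proof (rule smooth_functionI[OF smooth_map_subset_pts(1)[OF f]])
  fix p assume p: "p \<in> A"
  obtain U \<phi> V \<psi> S F where U: "(U, \<phi>) \<in> atlas M" "p \<in> U" "(V, \<psi>) \<in> atlas N" "f p \<in> V"
    "open S" "\<phi> p \<in> S" "smooth_on S F"
    "\<And>q. q \<in> A \<Longrightarrow> q \<in> U \<Longrightarrow> \<phi> q \<in> S \<Longrightarrow> f q \<in> V \<and> \<psi> (f q) = F (\<phi> q)"
    by (rule smooth_mapD[OF f p]) blast
  obtain V' \<psi>' S' G where V: "(V', \<psi>') \<in> atlas N" "f p \<in> V'" "open S'" "\<psi>' (f p) \<in> S'" "smooth_on S' G"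
    "\<And>q. q \<in> B \<Longrightarrow> q \<in> V' \<Longrightarrow> \<psi>' q \<in> S' \<Longrightarrow> g q = G (\<psi>' q)"
    by (rule smooth_functionD[OF g, of "f p"]) (use p AB in auto)
  obtain C :: "'f set" where C: "frame C" using manifold_frame[OF N] by blast
  define W where "W = V \<inter> {q \<in> V'. \<psi>' q \<in> S'}"
  have W: "openin (mtop N) W"
    unfolding W_def using chart_openin[OF N U(3)] chart_open_preimage[OF N V(1,3)] by blast
  have oW: "open (\<psi> ` (V \<inter> W))" by (rule chart_open_image[OF N U(3) W])
  have t: "smooth_on (\<psi> ` (V \<inter> W)) (\<psi>' \<circ> inv_into V \<psi>)"
    by (rule smooth_on_subset[OF chart_transition[OF N U(3) V(1)]]) (auto simp: W_def)
  have inv: "inv_into V \<psi> (\<psi> y) = y" if "y \<in> W" for y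
    using that chart_inv[OF N U(3)] by (auto simp: W_def)
  have G: "smooth_on (\<psi> ` (V \<inter> W)) (\<lambda>y. G ((\<psi>' \<circ> inv_into V \<psi>) y))"
    by (rule smooth_on_compose[OF C oW t _ V(5)]) (use inv in \<open>auto simp: W_def\<close>)
  \<comment> \<open>Off the chart image of \<open>A\<close> the function \<open>F\<close> is an
    arbitrary smooth extension, so its domain is cut down until its values lie in the part of the
    chart where \<open>G\<close> can be applied.\<close>
  define T where "T = S \<inter> F -` (\<psi> ` (V \<inter> W))"
  have T: "open T" unfolding T_def
    using smooth_on_continuous[OF U(7)] U(5) oW continuous_on_open_vimage by (metis inf_commute)
  have "smooth_on T (\<lambda>x. G ((\<psi>' \<circ> inv_into V \<psi>) (F x)))"
    by (rule smooth_on_compose[OF C T smooth_on_subset[OF U(7)] _ G]) (auto simp: T_def)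
  moreover have "\<phi> p \<in> T" using U p V by (auto simp: T_def W_def) (metis (no_types, lifting) IntI U(8) image_eqI mem_Collect_eq)
  moreover have "g (f q) = G ((\<psi>' \<circ> inv_into V \<psi>) (F (\<phi> q)))" if q: "q \<in> A" "q \<in> U" "\<phi> q \<in> T" for q
  proof -
    have fq: "f q \<in> V" "\<psi> (f q) = F (\<phi> q)" using U(8) q by (auto simp: T_def)
    then obtain y where "y \<in> V \<inter> W" "\<psi> (f q) = \<psi> y" using q by (auto simp: T_def)
    then have "f q \<in> W" using fq chart_inj[OF N U(3)] by (metis Int_iff inj_onD)
    then show ?thesis using V(6)[of "f q"] q AB fq(1) inv[of "f q"]
      by (auto simp: W_def simp flip: fq(2))
  qed
  ultimately show "\<exists>U \<phi> S F. (U, \<phi>) \<in> atlas M \<and> p \<in> U \<and> open S \<and> \<phi> p \<in> S \<and> smooth_on S F \<and>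
    (\<forall>q. q \<in> A \<longrightarrow> q \<in> U \<longrightarrow> \<phi> q \<in> S \<longrightarrow> g (f q) = F (\<phi> q))"
    using U(1,2) T by blast
qed

text \<open>Phrased with neighbourhoods in \<open>M\<close> because \<open>A\<close> may be a fibre
  product, where preimages are only relatively open.\<close>

lemma smooth_map_continuous_at:
  assumes M: "is_manifold M" and N: "is_manifold N" and f: "smooth_map M A N f" and p: "p \<in> A"
    and S: "openin (mtop N) S" "f p \<in> S"
  shows "\<exists>W. openin (mtop M) W \<and> p \<in> W \<and> (\<forall>q\<in>A \<inter> W. f q \<in> S)"
proof -
  obtain U \<phi> V \<psi> T F where U: "(U, \<phi>) \<in> atlas M" "p \<in> U" "(V, \<psi>) \<in> atlas N" "f p \<in> V"
    "open T" "\<phi> p \<in> T" "smooth_on T F"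
    "\<And>q. q \<in> A \<Longrightarrow> q \<in> U \<Longrightarrow> \<phi> q \<in> T \<Longrightarrow> f q \<in> V \<and> \<psi> (f q) = F (\<phi> q)"
    by (rule smooth_mapD[OF f p]) blast
  let ?T = "T \<inter> F -` (\<psi> ` (V \<inter> S))"
  have "open ?T"
    using smooth_on_continuous[OF U(7)] U(5) chart_open_image[OF N U(3) S(1)] continuous_on_open_vimage
    by (metis inf_commute)
  then have o: "openin (mtop M) {q \<in> U. \<phi> q \<in> ?T}" by (rule chart_open_preimage[OF M U(1)])
  have "f q \<in> S" if q: "q \<in> A" "q \<in> U" "\<phi> q \<in> ?T" for q
  proof -
    have fq: "f q \<in> V" "\<psi> (f q) = F (\<phi> q)" using U(8) q by auto
    then obtain y where "y \<in> V \<inter> S" "\<psi> (f q) = \<psi> y" using q by auto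
    then show ?thesis using fq chart_inj[OF N U(3)] by (metis Int_iff inj_onD)
  qed
  moreover have "\<phi> p \<in> ?T" using U p S by (metis (mono_tags, lifting) IntI image_eqI vimage_eq)
  ultimately show ?thesis using o U(2) by (intro exI[of _ "{q \<in> U. \<phi> q \<in> ?T}"]) auto
qed

lemma continuous_map_subtopologyI:
  assumes "A \<subseteq> topspace X" "f ` A \<subseteq> topspace Y"
    and "\<And>p S. p \<in> A \<Longrightarrow> openin Y S \<Longrightarrow> f p \<in> S \<Longrightarrow> \<exists>W. openin X W \<and> p \<in> W \<and> (\<forall>q\<in>A \<inter> W. f q \<in> S)"
  shows "continuous_map (subtopology X A) Y f"
proof -
  have "openin (subtopology X A) {x \<in> A. f x \<in> S}" if S: "openin Y S" for S
  proof (subst openin_subopen, safe)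
    fix p assume p: "p \<in> A" "f p \<in> S"
    then obtain W where "openin X W" "p \<in> W" "\<forall>q\<in>A \<inter> W. f q \<in> S" using assms(3) S by blast
    then show "\<exists>T. openin (subtopology X A) T \<and> p \<in> T \<and> T \<subseteq> {x \<in> A. f x \<in> S}"
      using p by (intro exI[of _ "W \<inter> A"]) (auto simp: openin_subtopology)
  qed
  then show ?thesis
    using assms(1,2) unfolding continuous_map_def topspace_subtopology inf_absorb2[OF assms(1)] by auto
qed

lemma smooth_map_continuous:
  assumes "is_manifold M" "is_manifold N" "smooth_map M A N f"
  shows "continuous_map (subtopology (mtop M) A) (mtop N) f"
  by (rule continuous_map_subtopologyI)
    (use smooth_map_subset_pts[OF assms(3)] smooth_map_continuous_at[OF assms] in auto)

text \<open>Smoothness into a manifold reduces to that of a vector-valued function in one target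
  chart; the local extension supplied by \<open>smooth_functionD\<close> is then restricted to the
  chart image of \<open>W\<close>.\<close>

lemma smooth_mapI:
  assumes M: "is_manifold M" and "A \<subseteq> pts M" "f ` A \<subseteq> pts N"
    and loc: "\<And>p. p \<in> A \<Longrightarrow> \<exists>W V \<psi>. openin (mtop M) W \<and> p \<in> W \<and> (V, \<psi>) \<in> atlas N \<and> f ` (A \<inter> W) \<subseteq> V \<and>
      smooth_function M (A \<inter> W) (\<lambda>x. \<psi> (f x))"
  shows "smooth_map M A N f"
  unfolding smooth_map_def
proof (intro conjI ballI assms(2,3))
  fix p assume p: "p \<in> A"
  then obtain W V \<psi> where W: "openin (mtop M) W" "p \<in> W" "(V, \<psi>) \<in> atlas N" "f ` (A \<inter> W) \<subseteq> V"
    "smooth_function M (A \<inter> W) (\<lambda>x. \<psi> (f x))" using loc by meson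
  obtain U \<phi> S F where U: "(U, \<phi>) \<in> atlas M" "p \<in> U" "open S" "\<phi> p \<in> S" "smooth_on S F"
    "\<And>q. q \<in> A \<inter> W \<Longrightarrow> q \<in> U \<Longrightarrow> \<phi> q \<in> S \<Longrightarrow> \<psi> (f q) = F (\<phi> q)"
    by (rule smooth_functionD[OF W(5), of p]) (use p W in auto)
  have "q \<in> W" if "q \<in> U" "\<phi> q \<in> \<phi> ` (U \<inter> W)" for q
    using that chart_inj[OF M U(1)] by (auto dest: inj_onD)
  then have "open (S \<inter> \<phi> ` (U \<inter> W)) \<and> \<phi> p \<in> S \<inter> \<phi> ` (U \<inter> W) \<and> smooth_on (S \<inter> \<phi> ` (U \<inter> W)) F \<and>
     (\<forall>q\<in>A \<inter> U. \<phi> q \<in> S \<inter> \<phi> ` (U \<inter> W) \<longrightarrow> f q \<in> V \<and> \<psi> (f q) = F (\<phi> q))"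
    using U W chart_open_image[OF M U(1) W(1)] by (auto intro: smooth_on_subset)
  then show "\<exists>(U, \<phi>)\<in>atlas M. \<exists>(V, \<psi>)\<in>atlas N. p \<in> U \<and> f p \<in> V \<and>
        (\<exists>S F. open S \<and> \<phi> p \<in> S \<and> smooth_on S F \<and>
           (\<forall>q\<in>A \<inter> U. \<phi> q \<in> S \<longrightarrow> f q \<in> V \<and> \<psi> (f q) = F (\<phi> q)))"
    using U(1,2) W p by blast
qed

lemma smooth_map_subset_cong:
  assumes f: "smooth_map M A N f" and B: "B \<subseteq> A" and eq: "\<And>p. p \<in> B \<Longrightarrow> f p = g p"
  shows "smooth_map M B N g"
  unfolding smooth_map_def
proof (intro conjI ballI)
  show "B \<subseteq> pts M" using smooth_map_subset_pts(1)[OF f] B by blast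
  show "g ` B \<subseteq> pts N" using smooth_map_subset_pts(2)[OF f] B eq by (metis image_cong image_mono subset_trans)
  fix p assume p: "p \<in> B"
  obtain U \<phi> V \<psi> S F where U: "(U, \<phi>) \<in> atlas M" "p \<in> U" "(V, \<psi>) \<in> atlas N" "f p \<in> V"
    "open S" "\<phi> p \<in> S" "smooth_on S F"
    "\<And>q. q \<in> A \<Longrightarrow> q \<in> U \<Longrightarrow> \<phi> q \<in> S \<Longrightarrow> f q \<in> V \<and> \<psi> (f q) = F (\<phi> q)"
    by (rule smooth_mapD[OF f, of p]) (use p B in auto)
  have "\<forall>q\<in>B \<inter> U. \<phi> q \<in> S \<longrightarrow> g q \<in> V \<and> \<psi> (g q) = F (\<phi> q)"
  proof (intro ballI impI)
    fix q assume q: "q \<in> B \<inter> U" "\<phi> q \<in> S"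
    then show "g q \<in> V \<and> \<psi> (g q) = F (\<phi> q)" using U(8)[of q] B eq[of q] by auto
  qed
  then show "\<exists>(U, \<phi>)\<in>atlas M. \<exists>(V, \<psi>)\<in>atlas N. p \<in> U \<and> g p \<in> V \<and>
        (\<exists>S F. open S \<and> \<phi> p \<in> S \<and> smooth_on S F \<and>
           (\<forall>q\<in>B \<inter> U. \<phi> q \<in> S \<longrightarrow> g q \<in> V \<and> \<psi> (g q) = F (\<phi> q)))"
    using U eq[OF p] unfolding bex_pair_iff by metis
qed

lemmas smooth_map_subset = smooth_map_subset_cong[OF _ _ refl]

lemma smooth_map_chart:
  assumes N: "is_manifold N" and f: "smooth_map M A N f" and V: "(V, \<psi>) \<in> atlas N" and "B \<subseteq> A" "f ` B \<subseteq> V"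
  shows "smooth_function M B (\<lambda>x. \<psi> (f x))"
proof -
  have "smooth_map M B N f" by (rule smooth_map_subset[OF f \<open>B \<subseteq> A\<close>])
  then show ?thesis using smooth_function_compose[OF N _ smooth_function_of_chart[OF N V]] assms(5) by blast
qed

lemma smooth_map_local:
  assumes M: "is_manifold M" and N: "is_manifold N" and "A \<subseteq> pts M"
    and "\<And>p. p \<in> A \<Longrightarrow> \<exists>W. openin (mtop M) W \<and> p \<in> W \<and> smooth_map M (A \<inter> W) N f"
  shows "smooth_map M A N f"
proof (rule smooth_mapI[OF M assms(3)])
  show "f ` A \<subseteq> pts N"
  proof
    fix y assume "y \<in> f ` A"
    then obtain p where "p \<in> A" "y = f p" by blast
    then obtain W where "p \<in> W" "smooth_map M (A \<inter> W) N f" using assms(4) by blast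
    then show "y \<in> pts N" using smooth_map_subset_pts(2) \<open>p \<in> A\<close> \<open>y = f p\<close> by blast
  qed
  fix p assume p: "p \<in> A"
  then obtain W where W: "openin (mtop M) W" "p \<in> W" "smooth_map M (A \<inter> W) N f" using assms(4) by blast
  then have "f p \<in> pts N" using smooth_map_subset_pts(2)[OF W(3)] p by blast
  then obtain V \<psi> where V: "(V, \<psi>) \<in> atlas N" "f p \<in> V" using chart_exists[OF N] by blast
  obtain W' where W': "openin (mtop M) W'" "p \<in> W'" "\<forall>q\<in>(A \<inter> W) \<inter> W'. f q \<in> V"
    using smooth_map_continuous_at[OF M N W(3) _ chart_openin[OF N V(1)] V(2)] p W by blast
  then have "f ` (A \<inter> (W \<inter> W')) \<subseteq> V" by auto
  moreover have "smooth_function M (A \<inter> (W \<inter> W')) (\<lambda>x. \<psi> (f x))"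
    by (rule smooth_map_chart[OF N W(3) V(1) _ calculation]) auto
  ultimately show "\<exists>W V \<psi>. openin (mtop M) W \<and> p \<in> W \<and> (V, \<psi>) \<in> atlas N \<and> f ` (A \<inter> W) \<subseteq> V \<and>
      smooth_function M (A \<inter> W) (\<lambda>x. \<psi> (f x))"
    using W W' V by (intro exI[of _ "W \<inter> W'"] exI[of _ V] exI[of _ \<psi>]) auto
qed

lemma smooth_map_compose:
  assumes M: "is_manifold M" and N: "is_manifold N" and L: "is_manifold L"
    and f: "smooth_map M A N f" and g: "smooth_map N B L g" and AB: "f ` A \<subseteq> B"
  shows "smooth_map M A L (\<lambda>x. g (f x))"
proof (rule smooth_mapI[OF M smooth_map_subset_pts(1)[OF f]])
  show "(\<lambda>x. g (f x)) ` A \<subseteq> pts L" using smooth_map_subset_pts(2)[OF g] AB by blast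
  fix p assume p: "p \<in> A"
  then have gp: "g (f p) \<in> pts L" using smooth_map_subset_pts(2)[OF g] AB by blast
  then obtain V \<psi> where V: "(V, \<psi>) \<in> atlas L" "g (f p) \<in> V" using chart_exists[OF L] by blast
  obtain W where W: "openin (mtop N) W" "f p \<in> W" "\<forall>q\<in>B \<inter> W. g q \<in> V"
    using smooth_map_continuous_at[OF N L g _ chart_openin[OF L V(1)] V(2)] AB p by blast
  obtain T where T: "openin (mtop M) T" "p \<in> T" "\<forall>q\<in>A \<inter> T. f q \<in> W"
    using smooth_map_continuous_at[OF M N f p W(1,2)] by blast
  have s: "smooth_function N (B \<inter> W) (\<lambda>x. \<psi> (g x))"
    by (rule smooth_map_chart[OF L g V(1)]) (use W in auto)
  have "smooth_function M (A \<inter> T) (\<lambda>x. \<psi> (g (f x)))"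
    by (rule smooth_function_compose[OF N smooth_map_subset[OF f] s]) (use T AB in auto)
  moreover have "(\<lambda>x. g (f x)) ` (A \<inter> T) \<subseteq> V" using T W AB by auto
  ultimately show "\<exists>W V \<psi>. openin (mtop M) W \<and> p \<in> W \<and> (V, \<psi>) \<in> atlas L \<and> (\<lambda>x. g (f x)) ` (A \<inter> W) \<subseteq> V \<and>
      smooth_function M (A \<inter> W) (\<lambda>x. \<psi> (g (f x)))"
    using T V by blast
qed

section \<open>Compactly supported smooth functions and partitions\<close>

text \<open>The zero extension beyond \<open>U\<close> need not be smooth, nor continuous, since compact sets need not be closed.\<close>

definition csupp :: "('p, 'e::real_inner) manifold \<Rightarrow> 'p set \<Rightarrow> 'p set \<Rightarrow> ('p \<Rightarrow> 'k::real_normed_field) set" where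
  "csupp P U W = {f. smooth_function P U f \<and> (\<exists>K. compactin (mtop P) K \<and> K \<subseteq> W \<and> (\<forall>p. p \<notin> K \<longrightarrow> f p = 0))}"

lemma Cc0_csupp: "Cc0 M W = csupp M (pts M) W"
  by (simp add: Cc0_def csupp_def)

lemma csuppD:
  assumes "f \<in> csupp P U W"
  shows "smooth_function P U f" "\<exists>K. compactin (mtop P) K \<and> K \<subseteq> W \<and> (\<forall>p. p \<notin> K \<longrightarrow> f p = 0)" "p \<notin> W \<Longrightarrow> f p = 0"
  using assms by (auto simp: csupp_def)

lemma csuppI:
  "smooth_function P U f \<Longrightarrow> compactin (mtop P) K \<Longrightarrow> K \<subseteq> W \<Longrightarrow> (\<And>p. p \<notin> K \<Longrightarrow> f p = 0) \<Longrightarrow> f \<in> csupp P U W"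
  by (auto simp: csupp_def)

lemma csupp_mono: "f \<in> csupp P U W \<Longrightarrow> W \<subseteq> W' \<Longrightarrow> f \<in> csupp P U W'"
  by (auto simp: csupp_def)

lemma csupp_zero: "is_manifold P \<Longrightarrow> openin (mtop P) U \<Longrightarrow> (\<lambda>_. 0) \<in> csupp P U W"
  by (rule csuppI[of _ _ _ "{}"]) (auto intro: smooth_function_const)

lemma csupp_add:
  assumes "is_manifold P" "openin (mtop P) U" "f \<in> csupp P U W" "g \<in> csupp P U W"
  shows "(\<lambda>p. f p + g p) \<in> csupp P U W"
proof -
  obtain K L where K: "compactin (mtop P) K" "K \<subseteq> W" "\<forall>p. p \<notin> K \<longrightarrow> f p = 0"
    and L: "compactin (mtop P) L" "L \<subseteq> W" "\<forall>p. p \<notin> L \<longrightarrow> g p = 0"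
    using csuppD(2)[OF assms(3)] csuppD(2)[OF assms(4)] by blast
  show ?thesis
    by (rule csuppI[of _ _ _ "K \<union> L"])
      (use K L in \<open>auto intro: smooth_function_add[OF assms(1,2)] csuppD(1)[OF assms(3)] csuppD(1)[OF assms(4)] compactin_Un\<close>)
qed

lemma csupp_mult:
  assumes "is_manifold P" "openin (mtop P) U" "f \<in> csupp P U W" "smooth_function P U g"
  shows "(\<lambda>p. f p * g p) \<in> csupp P U W" "(\<lambda>p. g p * f p) \<in> csupp P U W"
proof -
  obtain K where K: "compactin (mtop P) K" "K \<subseteq> W" "\<forall>p. p \<notin> K \<longrightarrow> f p = 0"
    using csuppD(2)[OF assms(3)] by blast
  show "(\<lambda>p. f p * g p) \<in> csupp P U W" "(\<lambda>p. g p * f p) \<in> csupp P U W"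
    by (rule csuppI[of _ _ _ K]; use K csuppD(1)[OF assms(3)] assms in \<open>auto intro: smooth_function_mult\<close>)+
qed

lemma csupp_minus:
  assumes "is_manifold P" "openin (mtop P) U" "f \<in> csupp P U W"
  shows "(\<lambda>p. - f p) \<in> csupp P U W"
  using csupp_mult(1)[OF assms smooth_function_const[OF assms(1,2), of "-1"]] by simp

text \<open>A compact set is closed only relative to a Hausdorff open set, so the complement is
  taken in \<open>U\<close> and not in the whole space.\<close>

lemma compactin_open_complement:
  assumes "openin X U" "Hausdorff_space (subtopology X U)" "compactin X K" "K \<subseteq> U"
  shows "openin X (U - K)"
proof -
  have "compactin (subtopology X U) K" using assms(3,4) by (simp add: compactin_subtopology)
  then have "closedin (subtopology X U) K" using compactin_imp_closedin assms(2) by blast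
  moreover have "topspace (subtopology X U) = U" using openin_subset[OF assms(1)] by (simp add: inf_absorb2)
  ultimately have "openin (subtopology X U) (U - K)" by (metis closedin_def)
  then show ?thesis using assms(1) openin_trans_full by blast
qed

lemma compactin_diff_open: "compactin X K \<Longrightarrow> openin X W \<Longrightarrow> compactin X (K - W)"
proof -
  assume "compactin X K" "openin X W"
  then have "compactin X (K \<inter> (topspace X - W))" by (intro compact_Int_closedin) auto
  moreover have "K \<inter> (topspace X - W) = K - W" using compactin_subset_topspace[OF \<open>compactin X K\<close>] by blast
  ultimately show ?thesis by simp
qed

text \<open>A Euclidean bump in a chart is extended by 0. Away from its support \<open>K\<close>,
  smoothness uses that \<open>U - K\<close> is open, which is where the Hausdorff property of
  \<open>U\<close> enters; smoothness is claimed on \<open>U\<close> only.\<close>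

lemma manifold_bump:
  fixes P :: "('p, 'e::real_inner) manifold"
  assumes P: "is_manifold P" and U: "openin (mtop P) U" "Hausdorff_space (subtopology (mtop P) U)"
    and N: "openin (mtop P) N" "N \<subseteq> U" "p \<in> N"
  shows "\<exists>\<rho> :: 'p \<Rightarrow> 'k::real_normed_field. \<rho> \<in> csupp P U N \<and> (\<exists>W. openin (mtop P) W \<and> p \<in> W \<and> (\<forall>q\<in>W. \<rho> q = 1))"
proof -
  obtain C \<phi> where C: "(C, \<phi>) \<in> atlas P" "p \<in> C"
    using chart_exists[OF P] N openin_subset by blast
  obtain B :: "'e set" where B: "frame B" using manifold_frame[OF P] by blast
  have op: "open (\<phi> ` (C \<inter> N))" by (rule chart_open_image[OF P C(1) N(1)])
  have "\<phi> p \<in> \<phi> ` (C \<inter> N)" using C N by blast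
  then obtain r where r: "r > 0" "cball (\<phi> p) r \<subseteq> \<phi> ` (C \<inter> N)"
    using op open_contains_cball by metis
  obtain \<beta> :: "'e \<Rightarrow> real" where \<beta>: "smooth_on UNIV \<beta>" "\<forall>x\<in>ball (\<phi> p) (r/2). \<beta> x = 1" "\<forall>x. x \<notin> cball (\<phi> p) r \<longrightarrow> \<beta> x = 0"
    using bump_function_exists[OF B r(1)] by blast
  define K where "K = {q \<in> C. \<phi> q \<in> cball (\<phi> p) r}"
  have inj: "inj_on \<phi> C" by (rule chart_inj[OF P C(1)])
  have KN: "K \<subseteq> C \<inter> N" unfolding K_def using r(2) inj by (auto dest: inj_onD)
  have im: "\<phi> ` K = cball (\<phi> p) r" unfolding K_def using r(2) by blast
  have "compactin (top_of_set (\<phi> ` C)) (\<phi> ` K)"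
    unfolding compactin_subtopology using frame_compact_cball[OF B] im KN by (auto simp: K_def)
  then have "compactin (subtopology (mtop P) C) K"
    using homeomorphic_map_compactness[OF chart_homeomorphic[OF P C(1)], of K] chart_subset[OF P C(1)] KN
    by (simp add: inf_absorb2)
  then have cK: "compactin (mtop P) K" by (simp add: compactin_subtopology)
  define \<rho> :: "'p \<Rightarrow> 'k" where "\<rho> q = (if q \<in> K then of_real (\<beta> (\<phi> q)) else 0)" for q
  have 1: "\<rho> q = of_real (\<beta> (\<phi> q))" if "q \<in> C" for q
    using that \<beta>(3) by (auto simp: \<rho>_def K_def)
  have sC: "smooth_function P C \<rho>"
  proof (rule smooth_function_cong)
    show "smooth_function P C (\<lambda>q. of_real (\<beta> (\<phi> q)) :: 'k)"
    proof (rule smooth_function_bounded_linear[OF P chart_openin[OF P C(1)] bounded_linear_of_real])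
      show "smooth_function P C (\<lambda>q. \<beta> (\<phi> q))"
      proof (rule smooth_functionI[OF chart_subset[OF P C(1)]])
        fix q assume "q \<in> C"
        then show "\<exists>U' \<phi>' S F. (U', \<phi>') \<in> atlas P \<and> q \<in> U' \<and> open S \<and> \<phi>' q \<in> S \<and> smooth_on S F \<and>
          (\<forall>q. q \<in> C \<longrightarrow> q \<in> U' \<longrightarrow> \<phi>' q \<in> S \<longrightarrow> \<beta> (\<phi> q) = F (\<phi>' q))"
          using C \<beta>(1) by (intro exI[of _ C] exI[of _ \<phi>] exI[of _ UNIV] exI[of _ \<beta>]) auto
      qed
    qed
  qed (simp add: 1)
  have "smooth_function P U \<rho>"
  proof (rule smooth_function_local[OF P openin_subset[OF U(1)]])
    fix q assume q: "q \<in> U"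
    show "\<exists>W. openin (mtop P) W \<and> q \<in> W \<and> smooth_function P (U \<inter> W) \<rho>"
    proof (cases "q \<in> K")
      case True
      then show ?thesis
        using KN chart_openin[OF P C(1)] smooth_function_subset[OF sC, of "U \<inter> C"] by (intro exI[of _ C]) auto
    next
      case False
      have o: "openin (mtop P) (U - K)" using compactin_open_complement[OF U cK] KN N by blast
      have "smooth_function P (U - K) \<rho>"
        by (rule smooth_function_cong[OF smooth_function_const[OF P o, of 0]]) (auto simp: \<rho>_def)
      then show ?thesis using o q False by (intro exI[of _ "U - K"]) (auto intro: smooth_function_subset)
    qed
  qed
  then have "\<rho> \<in> csupp P U N" by (rule csuppI[OF _ cK]) (use KN in \<open>auto simp: \<rho>_def\<close>)
  moreover have "openin (mtop P) {q \<in> C. \<phi> q \<in> ball (\<phi> p) (r/2)}" by (rule chart_open_preimage[OF P C(1)]) simp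
  ultimately show ?thesis
    using \<beta>(2) r(1) C 1 by (intro exI[of _ \<rho>] conjI exI[of _ "{q \<in> C. \<phi> q \<in> ball (\<phi> p) (r/2)}"]) auto
qed

text \<open>Splitting \<open>f\<close> as \<open>\<rho> f + (1 - \<rho>) f\<close> along a finite cover replaces partitions of unity.\<close>

lemma csupp_induct:
  fixes f :: "'p \<Rightarrow> 'k::real_normed_field"
  assumes P: "is_manifold P" and U: "openin (mtop P) U" "Hausdorff_space (subtopology (mtop P) U)"
    and f: "f \<in> csupp P U U" and Q0: "Q (\<lambda>_. 0)"
    and Qadd: "\<And>f g. f \<in> csupp P U U \<Longrightarrow> g \<in> csupp P U U \<Longrightarrow> Q f \<Longrightarrow> Q g \<Longrightarrow> Q (\<lambda>p. f p + g p)"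
    and loc: "\<And>p. p \<in> U \<Longrightarrow> \<exists>N. openin (mtop P) N \<and> p \<in> N \<and> N \<subseteq> U \<and> (\<forall>g\<in>csupp P U N. Q g)"
  shows "Q f"
proof -
  have "\<exists>W (\<rho> :: 'p \<Rightarrow> 'k) N. openin (mtop P) W \<and> p \<in> W \<and> (\<forall>q\<in>W. \<rho> q = 1) \<and> \<rho> \<in> csupp P U N \<and> N \<subseteq> U \<and> (\<forall>g\<in>csupp P U N. Q g)"
    if p: "p \<in> U" for p
    using loc[OF p] manifold_bump[OF P U, where ?'k = 'k] by (metis (no_types, lifting))
  then obtain W and \<rho> :: "'p \<Rightarrow> 'p \<Rightarrow> 'k" and N where W: "\<And>p. p \<in> U \<Longrightarrow> openin (mtop P) (W p) \<and> p \<in> W p"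
    and \<rho>: "\<And>p q. p \<in> U \<Longrightarrow> q \<in> W p \<Longrightarrow> \<rho> p q = 1" "\<And>p. p \<in> U \<Longrightarrow> \<rho> p \<in> csupp P U (N p) \<and> N p \<subseteq> U \<and> (\<forall>g\<in>csupp P U (N p). Q g)"
    by metis
  have main: "finite F \<Longrightarrow> F \<subseteq> U \<Longrightarrow> smooth_function P U f \<Longrightarrow> compactin (mtop P) K \<Longrightarrow> K \<subseteq> U \<Longrightarrow> K \<subseteq> (\<Union>p\<in>F. W p) \<Longrightarrow>
      (\<And>p. p \<notin> K \<Longrightarrow> f p = 0) \<Longrightarrow> Q f" for F K f
  proof (induction F arbitrary: f K rule: finite_induct)
    case empty
    then have "f = (\<lambda>_. 0)" by auto
    then show ?case using Q0 by simp
  next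
    case (insert p F)
    have p: "p \<in> U" using insert by blast
    have sr: "smooth_function P U (\<rho> p)" "\<rho> p \<in> csupp P U (N p)" using \<rho>(2)[OF p] csuppD(1) by blast+
    have s1: "smooth_function P U (\<lambda>q. 1 + - \<rho> p q)"
      using csuppD(1)[OF csupp_minus[OF P U(1) sr(2)]]
      by (intro smooth_function_add[OF P U(1)] smooth_function_const[OF P U(1)])
    have fU: "f \<in> csupp P U U" using insert.prems by (intro csuppI[of _ _ _ K]) auto
    have a: "(\<lambda>q. \<rho> p q * f q) \<in> csupp P U (N p)"
      by (rule csupp_mult(1)[OF P U(1) sr(2)]) (use insert.prems in auto)
    \<comment> \<open>The remainder vanishes on \<open>W p\<close>, where \<open>\<rho> p\<close> is
      1, so its support is covered by the sets \<open>W\<close> of the remaining points.\<close>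
    have "Q (\<lambda>q. f q * (1 + - \<rho> p q))"
    proof (rule insert.IH)
      show "smooth_function P U (\<lambda>q. f q * (1 + - \<rho> p q))"
        by (rule smooth_function_mult[OF P U(1) insert.prems(2) s1])
      show "compactin (mtop P) (K - W p)" by (rule compactin_diff_open) (use insert.prems W p in auto)
      show "f q * (1 + - \<rho> p q) = 0" if "q \<notin> K - W p" for q
        using that insert.prems(6) \<rho>(1)[OF p] by (cases "q \<in> K") auto
    qed (use insert.prems in auto)
    moreover have "Q (\<lambda>q. \<rho> p q * f q)" using a \<rho>(2)[OF p] by blast
    ultimately have "Q (\<lambda>q. \<rho> p q * f q + f q * (1 + - \<rho> p q))"
      using a \<rho>(2)[OF p] csupp_mult(1)[OF P U(1) fU s1] by (intro Qadd) (auto intro: csupp_mono)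
    then show ?case by (simp add: algebra_simps)
  qed
  obtain K where K: "compactin (mtop P) K" "K \<subseteq> U" "\<And>p. p \<notin> K \<Longrightarrow> f p = 0" using csuppD(2)[OF f] by blast
  have "K \<subseteq> \<Union> (W ` K)" "\<And>V. V \<in> W ` K \<Longrightarrow> openin (mtop P) V" using W K(2) by fast+
  then have "\<exists>\<F>. finite \<F> \<and> \<F> \<subseteq> W ` K \<and> K \<subseteq> \<Union>\<F>"
    using compactinD[OF K(1)] by meson
  then obtain F where "finite F" "F \<subseteq> K" "K \<subseteq> (\<Union>p\<in>F. W p)"
    by (metis finite_subset_image)
  then show ?thesis using main[of F f K] K csuppD(1)[OF f] by auto
qed

lemma csupp_unit:
  assumes P: "is_manifold P" and U: "openin (mtop P) U" "Hausdorff_space (subtopology (mtop P) U)"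
    and W: "openin (mtop P) W" "W \<subseteq> U" and K: "compactin (mtop P) K" "K \<subseteq> W"
  shows "\<exists>u :: 'p \<Rightarrow> 'k::real_normed_field. u \<in> csupp P U W \<and> (\<exists>N. openin (mtop P) N \<and> K \<subseteq> N \<and> (\<forall>q\<in>N. u q = 1))"
proof -
  have "\<exists>N (\<rho> :: 'p \<Rightarrow> 'k). openin (mtop P) N \<and> p \<in> N \<and> (\<forall>q\<in>N. \<rho> q = 1) \<and> \<rho> \<in> csupp P U W" if "p \<in> W" for p
    using manifold_bump[OF P U W that, where ?'k = 'k] by blast
  then obtain N and \<rho> :: "'p \<Rightarrow> 'p \<Rightarrow> 'k" where N: "\<And>p. p \<in> W \<Longrightarrow> openin (mtop P) (N p) \<and> p \<in> N p"
    and \<rho>: "\<And>p q. p \<in> W \<Longrightarrow> q \<in> N p \<Longrightarrow> \<rho> p q = 1" "\<And>p. p \<in> W \<Longrightarrow> \<rho> p \<in> csupp P U W"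
    by metis
  have main: "finite F \<Longrightarrow> F \<subseteq> W \<Longrightarrow> \<exists>u. u \<in> csupp P U W \<and> (\<forall>q\<in>\<Union>p\<in>F. N p. u q = (1::'k))" for F
  proof (induction F rule: finite_induct)
    case empty
    then show ?case using csupp_zero[OF P U(1)] by auto
  next
    case (insert p F)
    then obtain u where u: "u \<in> csupp P U W" "\<forall>q\<in>\<Union>p\<in>F. N p. u q = (1::'k)" by auto
    have p: "p \<in> W" using insert by blast
    \<comment> \<open>This is \<open>1 - (1 - \<rho> p q) * (1 - u q)\<close>, hence 1 wherever
      \<open>\<rho> p\<close> or \<open>u\<close> is.\<close>
    have "(\<lambda>q. \<rho> p q + (u q + - (\<rho> p q * u q))) \<in> csupp P U W"
      using \<rho>(2)[OF p] u csuppD(1)[OF u(1)]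
      by (intro csupp_add[OF P U(1)] csupp_minus[OF P U(1)] csupp_mult(1)[OF P U(1)])
    moreover have "\<forall>q\<in>\<Union>p\<in>insert p F. N p. \<rho> p q + (u q + - (\<rho> p q * u q)) = 1"
      using u \<rho>(1)[OF p] by auto
    ultimately show ?case by blast
  qed
  have "K \<subseteq> \<Union> (N ` K)" "\<And>V. V \<in> N ` K \<Longrightarrow> openin (mtop P) V" using N K(2) by fast+
  then have "\<exists>\<F>. finite \<F> \<and> \<F> \<subseteq> N ` K \<and> K \<subseteq> \<Union>\<F>"
    using compactinD[OF K(1)] by meson
  then obtain F where F: "finite F" "F \<subseteq> K" "K \<subseteq> (\<Union>p\<in>F. N p)"
    by (metis finite_subset_image)
  moreover obtain u where "u \<in> csupp P U W" "\<forall>q\<in>\<Union>p\<in>F. N p. u q = (1::'k)"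
    using main[of F] F K by auto
  moreover have "openin (mtop P) (\<Union>p\<in>F. N p)" using N F K by blast
  ultimately show ?thesis by blast
qed

section \<open>Germs\<close>

lemma germ_outside: "p \<notin> topspace X \<Longrightarrow> germ X p f = {}"
  unfolding germ_def using openin_subset by blast

lemma germ_self: "p \<in> topspace X \<Longrightarrow> f \<in> germ X p f"
  unfolding germ_def by blast

lemma germ_eqI: "openin X V \<Longrightarrow> p \<in> V \<Longrightarrow> (\<And>q. q \<in> V \<Longrightarrow> f q = g q) \<Longrightarrow> germ X p f = germ X p g"
proof -
  assume V: "openin X V" "p \<in> V" "\<And>q. q \<in> V \<Longrightarrow> f q = g q"
  have "germ X p f \<subseteq> germ X p g" if "\<And>q. q \<in> V \<Longrightarrow> f q = g q" for f g
  proof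
    fix h assume "h \<in> germ X p f"
    then obtain W where "openin X W" "p \<in> W" "\<forall>q\<in>W. h q = f q" unfolding germ_def by blast
    then show "h \<in> germ X p g" unfolding germ_def using V(1,2) that
      by (intro CollectI exI[of _ "W \<inter> V"]) auto
  qed
  then show ?thesis using V(3) by (metis subset_antisym)
qed

lemma germ_memD: "g \<in> germ X p f \<Longrightarrow> germ X p g = germ X p f"
proof -
  assume "g \<in> germ X p f"
  then obtain V where "openin X V" "p \<in> V" "\<And>q. q \<in> V \<Longrightarrow> g q = f q" unfolding germ_def by auto
  then show ?thesis by (rule germ_eqI)
qed

lemma germ_eqD:
  assumes "germ X p f = germ X p g" "p \<in> topspace X"
  obtains V where "openin X V" "p \<in> V" "\<And>q. q \<in> V \<Longrightarrow> f q = g q"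
proof -
  have "f \<in> germ X p g" using assms germ_self by metis
  then show ?thesis unfolding germ_def using that by blast
qed

lemma germ_eq_value: "germ X p f = germ X p g \<Longrightarrow> p \<in> topspace X \<Longrightarrow> f p = g p"
  by (metis germ_eqD)

lemma germ_binop:
  assumes "germ X p f = germ X p f'" "germ X p g = germ X p g'"
  shows "germ X p (\<lambda>q. F (f q) (g q)) = germ X p (\<lambda>q. F (f' q) (g' q))"
proof (cases "p \<in> topspace X")
  case True
  obtain V where V: "openin X V" "p \<in> V" "\<And>q. q \<in> V \<Longrightarrow> f q = f' q" using germ_eqD assms(1) True by metis
  obtain W where W: "openin X W" "p \<in> W" "\<And>q. q \<in> W \<Longrightarrow> g q = g' q" using germ_eqD assms(2) True by metis
  show ?thesis by (rule germ_eqI[of _ "V \<inter> W"]) (use V W in auto)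
qed (simp add: germ_outside)

lemma germ_sum:
  assumes "\<And>i. i \<in> I \<Longrightarrow> germ X p (f i) = germ X p (g i)"
  shows "germ X p (\<lambda>q. \<Sum>i\<in>I. f i q) = germ X p (\<lambda>q. \<Sum>i\<in>I. g i q)"
  using assms
proof (induction I rule: infinite_finite_induct)
  case (insert i I)
  then show ?case using germ_binop[of X p "f i" "g i" "\<lambda>q. \<Sum>i\<in>I. f i q" "\<lambda>q. \<Sum>i\<in>I. g i q" "(+)"] by simp
qed auto

text \<open>Operations on sections are defined by unions over all representatives; the union
  collapses because every choice yields the same germ. Outside the carrier all germs are empty, and
  so are both sides.\<close>

lemma germ_Union:
  assumes "c = germ X p f" "d = germ X p g"
  shows "(\<Union>f\<in>c. \<Union>g\<in>d. germ X p (\<lambda>q. F (f q) (g q))) = germ X p (\<lambda>q. F (f q) (g q))"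
proof (cases "p \<in> topspace X")
  case True
  have "germ X p (\<lambda>q. F (f' q) (g' q)) = germ X p (\<lambda>q. F (f q) (g q))" if "f' \<in> c" "g' \<in> d" for f' g'
  proof -
    have "germ X p f' = germ X p f" by (rule germ_memD) (use that(1) assms(1) in simp)
    moreover have "germ X p g' = germ X p g" by (rule germ_memD) (use that(2) assms(2) in simp)
    ultimately show ?thesis by (rule germ_binop)
  qed
  moreover have "f \<in> c" "g \<in> d" using assms True germ_self by auto
  ultimately show ?thesis by blast
qed (use assms in \<open>simp add: germ_outside\<close>)

lemma germ_Union1:
  assumes "c = germ X p f"
  shows "(\<Union>f\<in>c. germ X p (\<lambda>q. F q (f q))) = germ X p (\<lambda>q. F q (f q))"
proof (cases "p \<in> topspace X")
  case True
  have "germ X p (\<lambda>q. F q (f' q)) = germ X p (\<lambda>q. F q (f q))" if f': "f' \<in> c" for f'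
  proof -
    have "germ X p f' = germ X p f" by (rule germ_memD) (use assms f' in simp)
    then obtain V where V: "openin X V" "p \<in> V" "\<And>q. q \<in> V \<Longrightarrow> f' q = f q" using germ_eqD True by metis
    then show ?thesis by (intro germ_eqI[of _ V]) auto
  qed
  moreover have "f \<in> c" using assms True germ_self by auto
  ultimately show ?thesis by blast
qed (use assms in \<open>simp add: germ_outside\<close>)

lemma sec_add_germ:
  "c p = germ X p f \<Longrightarrow> d p = germ X p g \<Longrightarrow> sec_add X c d p = germ X p (\<lambda>q. f q + g q)"
  unfolding sec_add_def by (rule germ_Union)

section \<open>Spaces etale over a Hausdorff manifold\<close>

text \<open>Used with the bundle projection and with the target and the source of a groupoid, so
  that bundles and arrow spaces share one theory. Only the base is assumed to be Hausdorff.\<close>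

locale etale_space =
  fixes M :: "('x, 'e::real_inner) manifold" and P :: "('p, 'q::real_inner) manifold" and \<pi> :: "'p \<Rightarrow> 'x"
  assumes M: "is_manifold M" and haus: "Hausdorff_space (mtop M)" and P: "is_manifold P"
    and ld: "local_diffeo P (pts P) M \<pi>"
begin

abbreviation XM where "XM \<equiv> mtop M"
abbreviation XP where "XP \<equiv> mtop P"
abbreviation el where "el \<equiv> elementary P \<pi>"
abbreviation elem where "elem \<equiv> elem_fun P \<pi>"
abbreviation coalg :: "('x \<Rightarrow> 'k::real_normed_field, ('p, 'k) germ_section) coalgebra" where "coalg \<equiv> Cc_coalgebra M P \<pi>"
abbreviation cmodl :: "('x \<Rightarrow> 'k::real_normed_field, ('p, 'k) germ_section) rmodule" where "cmodl \<equiv> Cc_module M P \<pi>"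

lemma ldD:
  assumes "p \<in> pts P"
  obtains U V where "openin XP U" "p \<in> U" "openin XM V" "bij_betw \<pi> U V" "smooth_map P U M \<pi>"
    "smooth_map M V P (inv_into U \<pi>)"
  using ld assms unfolding local_diffeo_def diffeo_def by (auto simp: subtopology_topspace)

lemma M_local: "openin XM (pts M)" "Hausdorff_space (subtopology XM (pts M))"
  using haus by (auto simp: subtopology_topspace)

lemma compact_openin_diff: "compactin XM K \<Longrightarrow> openin XM (pts M - K)"
  using compactin_imp_closedin[OF haus] by blast

lemma smooth_pi: "smooth_map P (pts P) M \<pi>"
proof (rule smooth_map_local[OF P M subset_refl])
  fix p assume "p \<in> pts P"
  then obtain U where "openin XP U" "p \<in> U" "smooth_map P U M \<pi>" by (elim ldD)
  then show "\<exists>W. openin XP W \<and> p \<in> W \<and> smooth_map P (pts P \<inter> W) M \<pi>"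
    by (intro exI[of _ U]) (auto intro: smooth_map_subset)
qed

lemma pi_pts: "p \<in> pts P \<Longrightarrow> \<pi> p \<in> pts M"
  using smooth_map_subset_pts(2)[OF smooth_pi] by blast

lemma continuous_pi: "continuous_map XP XM \<pi>"
  using smooth_map_continuous[OF P M smooth_pi] by (simp add: subtopology_topspace)

lemma open_preimage: "openin XM W \<Longrightarrow> openin XP {p \<in> pts P. \<pi> p \<in> W}"
  by (rule openin_continuous_map_preimage[OF continuous_pi])

lemma open_image:
  assumes "openin XP W"
  shows "openin XM (\<pi> ` W)"
proof (subst openin_subopen, safe)
  fix p assume p: "p \<in> W"
  then have "p \<in> pts P" using assms openin_subset by blast
  then obtain U V where U: "openin XP U" "p \<in> U" "openin XM V" "bij_betw \<pi> U V"
    "smooth_map M V P (inv_into U \<pi>)" by (elim ldD)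
  have ip: "inv_into U \<pi> (\<pi> p) = p" using U(2,4) bij_betw_inv_into_left by metis
  then obtain T where T: "openin XM T" "\<pi> p \<in> T" "\<forall>q\<in>V \<inter> T. inv_into U \<pi> q \<in> W"
    using smooth_map_continuous_at[OF M P U(5) _ assms, of "\<pi> p"] U(2,4) p by (auto dest: bij_betwE)
  have "V \<inter> T \<subseteq> \<pi> ` W"
  proof
    fix y assume y: "y \<in> V \<inter> T"
    then have "\<pi> (inv_into U \<pi> y) = y" using U(4) bij_betw_inv_into_right by (metis IntE)
    then show "y \<in> \<pi> ` W" using T(3) y by (metis image_eqI)
  qed
  then show "\<exists>T. openin XM T \<and> \<pi> p \<in> T \<and> T \<subseteq> \<pi> ` W"
    using T U bij_betwE[OF U(4)] by (intro exI[of _ "V \<inter> T"]) auto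
qed

lemma el_open: "el U \<Longrightarrow> openin XP U"
  by (simp add: elementary_def)

lemma el_inj: "el U \<Longrightarrow> inj_on \<pi> U"
  by (simp add: elementary_def)

lemma el_injD: "el U \<Longrightarrow> p \<in> U \<Longrightarrow> q \<in> U \<Longrightarrow> \<pi> p = \<pi> q \<Longrightarrow> p = q"
  using el_inj inj_onD by metis

lemma el_pts: "el U \<Longrightarrow> U \<subseteq> pts P"
  using el_open openin_subset by blast

lemma el_image_open: "el U \<Longrightarrow> openin XM (\<pi> ` U)"
  using el_open open_image by blast

lemma el_subset: "el U \<Longrightarrow> openin XP V \<Longrightarrow> V \<subseteq> U \<Longrightarrow> el V"
  by (auto simp: elementary_def intro: inj_on_subset)

lemma el_exists:
  assumes "openin XP W" "p \<in> W"
  shows "\<exists>U. el U \<and> p \<in> U \<and> U \<subseteq> W"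
proof -
  have "p \<in> pts P" using assms openin_subset by blast
  then obtain U V where "openin XP U" "p \<in> U" "bij_betw \<pi> U V" by (elim ldD)
  then have "el U" "p \<in> U" by (auto simp: elementary_def bij_betw_def)
  then show ?thesis using assms by (intro exI[of _ "U \<inter> W"]) (auto intro: el_subset openin_Int el_open)
qed

lemma el_empty: "el {}"
  by (simp add: elementary_def)

lemma el_restrict: "el U \<Longrightarrow> openin XM W \<Longrightarrow> el (U \<inter> {p \<in> pts P. \<pi> p \<in> W})"
  using el_subset[of U "U \<inter> {p \<in> pts P. \<pi> p \<in> W}"] el_open open_preimage openin_Int by blast

definition sectn :: "'p set \<Rightarrow> 'x \<Rightarrow> 'p" where "sectn U = inv_into U \<pi>"

lemma sectn: "el U \<Longrightarrow> p \<in> U \<Longrightarrow> sectn U (\<pi> p) = p"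
  unfolding sectn_def by (simp add: el_inj)

lemma sectn_in: "y \<in> \<pi> ` U \<Longrightarrow> sectn U y \<in> U" "y \<in> \<pi> ` U \<Longrightarrow> \<pi> (sectn U y) = y"
  unfolding sectn_def by (auto intro: inv_into_into simp: f_inv_into_f)

text \<open>An elementary set need not be one of the sets on which \<open>ld\<close> provides an
  inverse, but locally the two inverses agree by injectivity.\<close>

lemma smooth_sectn:
  assumes U: "el U"
  shows "smooth_map M (\<pi> ` U) P (sectn U)"
proof (rule smooth_map_local[OF M P openin_subset[OF el_image_open[OF U]]])
  fix y assume "y \<in> \<pi> ` U"
  then obtain p where p: "p \<in> U" "y = \<pi> p" by blast
  then have "p \<in> pts P" using el_pts[OF U] by blast
  then obtain T V where T: "openin XP T" "p \<in> T" "openin XM V" "bij_betw \<pi> T V"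
    "smooth_map M V P (inv_into T \<pi>)" by (elim ldD)
  let ?W = "\<pi> ` (U \<inter> T)"
  have "smooth_map M (\<pi> ` U \<inter> ?W) P (sectn U)"
  proof (rule smooth_map_subset_cong[OF T(5)])
    show "\<pi> ` U \<inter> ?W \<subseteq> V" using bij_betwE[OF T(4)] by auto
    fix z assume "z \<in> \<pi> ` U \<inter> ?W"
    then obtain q where q: "q \<in> U" "q \<in> T" "z = \<pi> q" by auto
    then show "inv_into T \<pi> z = sectn U z" using bij_betw_inv_into_left[OF T(4)] sectn[OF U] by metis
  qed
  moreover have "openin XM ?W" using open_image el_open[OF U] T(1) by blast
  ultimately show "\<exists>W. openin XM W \<and> y \<in> W \<and> smooth_map M (\<pi> ` U \<inter> W) P (sectn U)"
    using p T(2) by blast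
qed

text \<open>Distinct points of a sheet have distinct images, which the base separates; preimages of
  the separating sets do the rest.\<close>

lemma el_Hausdorff:
  assumes U: "el U"
  shows "Hausdorff_space (subtopology XP U)"
  unfolding Hausdorff_space_def
proof (intro allI impI)
  fix p q assume "p \<in> topspace (subtopology XP U) \<and> q \<in> topspace (subtopology XP U) \<and> p \<noteq> q"
  then have pq: "p \<in> U" "q \<in> U" "p \<noteq> q" "p \<in> pts P" "q \<in> pts P" by auto
  then have "\<pi> p \<noteq> \<pi> q" using el_injD[OF U] by blast
  then obtain A B where AB: "openin XM A" "openin XM B" "\<pi> p \<in> A" "\<pi> q \<in> B" "disjnt A B"
    using haus pi_pts pq unfolding Hausdorff_space_def by meson
  have "openin (subtopology XP U) ({p \<in> pts P. \<pi> p \<in> C} \<inter> U)" if "openin XM C" for C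
    using open_preimage[OF that] by (auto simp: openin_subtopology)
  then show "\<exists>A B. openin (subtopology XP U) A \<and> openin (subtopology XP U) B \<and> p \<in> A \<and> q \<in> B \<and> disjnt A B"
    using AB pq by (intro exI[of _ "{p \<in> pts P. \<pi> p \<in> A} \<inter> U"] exI[of _ "{p \<in> pts P. \<pi> p \<in> B} \<inter> U"]) (auto simp: disjnt_iff)
qed

text \<open>Openness of \<open>\<pi>\<close> gives one implication, continuity the other. From here
  on germs on \<open>P\<close> are computed on the base.\<close>

lemma germ_pull:
  assumes p: "p \<in> pts P"
  shows "germ XP p (\<lambda>q. f (\<pi> q)) = germ XP p (\<lambda>q. g (\<pi> q)) \<longleftrightarrow> germ XM (\<pi> p) f = germ XM (\<pi> p) g"
proof
  assume A: "germ XP p (\<lambda>q. f (\<pi> q)) = germ XP p (\<lambda>q. g (\<pi> q))"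
  obtain V where V: "openin XP V" "p \<in> V" "\<And>q. q \<in> V \<Longrightarrow> f (\<pi> q) = g (\<pi> q)"
    using germ_eqD[OF A p] by metis
  show "germ XM (\<pi> p) f = germ XM (\<pi> p) g"
    by (rule germ_eqI[OF open_image[OF V(1)]]) (use V in auto)
next
  assume A: "germ XM (\<pi> p) f = germ XM (\<pi> p) g"
  obtain V where V: "openin XM V" "\<pi> p \<in> V" "\<And>q. q \<in> V \<Longrightarrow> f q = g q"
    using germ_eqD[OF A pi_pts[OF p]] by metis
  show "germ XP p (\<lambda>q. f (\<pi> q)) = germ XP p (\<lambda>q. g (\<pi> q))"
    by (rule germ_eqI[OF open_preimage[OF V(1)]]) (use V p in auto)
qed

section \<open>Sections described by germs on the base\<close>

text \<open>Only the germ of \<open>h p\<close> at \<open>\<pi> p\<close> matters.\<close>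

definition sect :: "('p \<Rightarrow> 'x \<Rightarrow> 'k) \<Rightarrow> ('p, 'k) germ_section" where
  "sect h = (\<lambda>p. germ XP p (\<lambda>q. h p (\<pi> q)))"

lemma sect_eq_iff: "sect h = sect k \<longleftrightarrow> (\<forall>p\<in>pts P. germ XM (\<pi> p) (h p) = germ XM (\<pi> p) (k p))"
proof -
  have "sect h = sect k \<longleftrightarrow> (\<forall>p. germ XP p (\<lambda>q. h p (\<pi> q)) = germ XP p (\<lambda>q. k p (\<pi> q)))"
    by (simp add: sect_def fun_eq_iff)
  also have "\<dots> \<longleftrightarrow> (\<forall>p\<in>pts P. germ XP p (\<lambda>q. h p (\<pi> q)) = germ XP p (\<lambda>q. k p (\<pi> q)))"
    using germ_outside[of _ XP] by metis
  also have "\<dots> \<longleftrightarrow> (\<forall>p\<in>pts P. germ XM (\<pi> p) (h p) = germ XM (\<pi> p) (k p))"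
    by (intro ball_cong refl germ_pull)
  finally show ?thesis .
qed

lemma sect_at_eq_iff: "p \<in> pts P \<Longrightarrow> sect h p = sect k p \<longleftrightarrow> germ XM (\<pi> p) (h p) = germ XM (\<pi> p) (k p)"
  unfolding sect_def by (rule germ_pull)

lemma sec_add_sect: "sec_add XP (sect h) (sect k) = sect (\<lambda>p y. h p y + k p y)"
proof
  fix p show "sec_add XP (sect h) (sect k) p = sect (\<lambda>p y. h p y + k p y) p"
    using sec_add_germ[of "sect h" p XP "\<lambda>q. h p (\<pi> q)" "sect k" "\<lambda>q. k p (\<pi> q)"] by (simp add: sect_def)
qed

lemma elem_fun_sect: "elem U f = sect (\<lambda>p. if p \<in> U then f else (\<lambda>_. 0))"
  by (auto simp: elem_fun_def ext_zero_def sect_def o_def fun_eq_iff)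

section \<open>Formal sums of elementary functions\<close>

definition valid :: "('p set \<times> ('x \<Rightarrow> 'k::real_normed_field)) list \<Rightarrow> bool" where
  "valid L \<longleftrightarrow> (\<forall>(U, f)\<in>set L. el U \<and> f \<in> Cc0 M (\<pi> ` U))"

text \<open>The point \<open>p\<close> selects the terms and \<open>y\<close> is the variable on the
  base. Keeping them apart makes every \<open>lsum L p\<close> a smooth function on all of
  \<open>M\<close>, although the zero extensions along \<open>P\<close> may be
  discontinuous.\<close>

definition lsum :: "('p set \<times> ('x \<Rightarrow> 'k::real_normed_field)) list \<Rightarrow> 'p \<Rightarrow> 'x \<Rightarrow> 'k" where
  "lsum L p y = (\<Sum>(U, f)\<leftarrow>L. if p \<in> U then f y else 0)"

lemma valid_simps [simp]:
  "valid []" "valid ((U, f) # L) \<longleftrightarrow> el U \<and> f \<in> Cc0 M (\<pi> ` U) \<and> valid L" "valid (L @ L') \<longleftrightarrow> valid L \<and> valid L'"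
  by (auto simp: valid_def)

lemma validD: "valid L \<Longrightarrow> (U, f) \<in> set L \<Longrightarrow> el U \<and> f \<in> Cc0 M (\<pi> ` U)"
  by (auto simp: valid_def)

lemma lsum_simps [simp]:
  "lsum [] p y = 0" "lsum ((U, f) # L) p y = (if p \<in> U then f y else 0) + lsum L p y"
  "lsum (L @ L') p y = lsum L p y + lsum L' p y"
  by (auto simp: lsum_def)

lemma lsum_append: "lsum (L @ L') = (\<lambda>p y. lsum L p y + lsum L' p y)"
  by (simp add: fun_eq_iff)

lemma Cc0_add: "f \<in> Cc0 M W \<Longrightarrow> g \<in> Cc0 M W \<Longrightarrow> (\<lambda>y. f y + g y) \<in> Cc0 M W"
  unfolding Cc0_csupp by (rule csupp_add[OF M openin_topspace])

lemma Cc0_zero: "(\<lambda>_. 0) \<in> Cc0 M W"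
  unfolding Cc0_csupp by (rule csupp_zero[OF M openin_topspace])

lemma Cc0_minus: "f \<in> Cc0 M W \<Longrightarrow> (\<lambda>y. - f y) \<in> Cc0 M W"
  unfolding Cc0_csupp by (rule csupp_minus[OF M openin_topspace])

lemma Cc0_smooth: "f \<in> Cc0 M W \<Longrightarrow> smooth_function M (pts M) f"
  by (simp add: Cc0_def)

lemma Cc0_mult: "f \<in> Cc0 M W \<Longrightarrow> smooth_function M (pts M) g \<Longrightarrow> (\<lambda>y. f y * g y) \<in> Cc0 M W"
  "f \<in> Cc0 M W \<Longrightarrow> smooth_function M (pts M) g \<Longrightarrow> (\<lambda>y. g y * f y) \<in> Cc0 M W"
  unfolding Cc0_csupp by (rule csupp_mult[OF M openin_topspace]; assumption)+

lemma Cc0_mono: "f \<in> Cc0 M W \<Longrightarrow> W \<subseteq> W' \<Longrightarrow> f \<in> Cc0 M W'"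
  unfolding Cc0_csupp by (rule csupp_mono)

lemma Cc0_pts: "f \<in> Cc0 M W \<Longrightarrow> f \<in> Cc0 M (pts M)"
  unfolding Cc0_def using compactin_subset_topspace by blast

lemma Cc0_outside: "f \<in> Cc0 M W \<Longrightarrow> y \<notin> W \<Longrightarrow> f y = 0"
  unfolding Cc0_csupp by (rule csuppD(3))

lemma lsum_Cc0: "valid L \<Longrightarrow> lsum L p \<in> Cc0 M (pts M)"
proof (induction L)
  case Nil
  then show ?case using Cc0_zero[of "pts M"] by (simp add: lsum_def[abs_def])
next
  case (Cons a L)
  obtain U f where a: "a = (U, f)" by force
  have "(\<lambda>y. (if p \<in> U then f else (\<lambda>_. 0)) y + lsum L p y) \<in> Cc0 M (pts M)"
    using Cons a by (intro Cc0_add) (auto intro: Cc0_zero Cc0_pts)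
  moreover have "(\<lambda>y. (if p \<in> U then f else (\<lambda>_. 0)) y + lsum L p y) = lsum (a # L) p" by (auto simp: a)
  ultimately show ?case by simp
qed

lemma Cc0_unit:
  assumes "compactin XM K" "K \<subseteq> W" "openin XM W"
  shows "\<exists>u :: 'x \<Rightarrow> 'k::real_normed_field. u \<in> Cc0 M W \<and> (\<exists>N. openin XM N \<and> K \<subseteq> N \<and> (\<forall>y\<in>N. u y = 1))"
  unfolding Cc0_csupp using csupp_unit[OF M M_local assms(3) openin_subset[OF assms(3)] assms(1,2)] .

lemma Cc0_local_unit:
  assumes "openin XM W" "x \<in> W"
  shows "\<exists>u :: 'x \<Rightarrow> 'k::real_normed_field. u \<in> Cc0 M W \<and> (\<exists>N. openin XM N \<and> x \<in> N \<and> (\<forall>y\<in>N. u y = 1))"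
proof -
  have "compactin XM {x}" using assms openin_subset by (intro finite_imp_compactin) auto
  then show ?thesis using Cc0_unit[of "{x}" W] assms by auto
qed

lemma Cc0_unit_of:
  assumes "f \<in> Cc0 M W" "g \<in> Cc0 M W" "openin XM W"
  shows "\<exists>u\<in>Cc0 M W. (\<forall>y. u y * f y = f y) \<and> (\<forall>y. u y * g y = (g y :: 'k::real_normed_field))"
proof -
  obtain K L where K: "compactin XM K" "K \<subseteq> W" "\<forall>y. y \<notin> K \<longrightarrow> f y = 0"
    and L: "compactin XM L" "L \<subseteq> W" "\<forall>y. y \<notin> L \<longrightarrow> g y = 0"
    using assms unfolding Cc0_def by auto
  obtain u :: "'x \<Rightarrow> 'k" where u: "u \<in> Cc0 M W" "\<forall>y\<in>K \<union> L. u y = 1"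
    using Cc0_unit[of "K \<union> L" W, where ?'k = 'k] K L assms(3) compactin_Un by (metis le_sup_iff subsetD)
  have "u y * f y = f y" "u y * g y = g y" for y
    using u(2) K(3) L(3) by (cases "y \<in> K"; cases "y \<in> L"; force)+
  then show ?thesis using u by blast
qed

text \<open>A function supported in a sheet descends to the base. Extending by 0 from
  \<open>U\<close> or from the larger Hausdorff set \<open>W\<close> gives the same section, because
  the support is relatively closed in \<open>W\<close>.\<close>

lemma el_fun_Cc0:
  assumes U: "el U" and Uo: "openin XP W" "Hausdorff_space (subtopology XP W)" "U \<subseteq> W" and g: "g \<in> csupp P W U"
  shows "(\<lambda>y. if y \<in> \<pi> ` U then g (sectn U y) else 0) \<in> Cc0 M (\<pi> ` U)"
    and "ext_zero XP W g = elem U (\<lambda>y. if y \<in> \<pi> ` U then g (sectn U y) else 0)"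
proof -
  let ?g = "\<lambda>y. if y \<in> \<pi> ` U then g (sectn U y) else 0"
  obtain K where K: "compactin XP K" "K \<subseteq> U" "\<forall>p. p \<notin> K \<longrightarrow> g p = 0" using csuppD(2)[OF g] by blast
  have cK: "compactin XM (\<pi> ` K)" by (rule image_compactin[OF K(1) continuous_pi])
  have sg: "smooth_function P W g" by (rule csuppD(1)[OF g])
  have s1: "smooth_function M (\<pi> ` U) ?g"
    by (rule smooth_function_cong[OF smooth_function_compose[OF P smooth_sectn[OF U] smooth_function_subset[OF sg Uo(3)]]])
      (auto intro: sectn_in)
  have off: "?g y = 0" if "y \<notin> \<pi> ` K" for y
  proof (cases "y \<in> \<pi> ` U")
    case True
    then have "sectn U y \<notin> K" using that sectn_in(2) by (metis imageI)
    then show ?thesis using K(3) by simp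
  qed simp
  have s2: "smooth_function M (pts M - \<pi> ` K) ?g"
    by (rule smooth_function_cong[OF smooth_function_const[OF M compact_openin_diff[OF cK], of 0]]) (use off in auto)
  have "smooth_function M (pts M) ?g"
  proof (rule smooth_function_local[OF M subset_refl])
    fix y assume y: "y \<in> pts M"
    show "\<exists>W. openin XM W \<and> y \<in> W \<and> smooth_function M (pts M \<inter> W) ?g"
    proof (cases "y \<in> \<pi> ` K")
      case True
      then show ?thesis using K(2) s1 el_image_open[OF U]
        by (intro exI[of _ "\<pi> ` U"]) (auto intro: smooth_function_subset)
    next
      case False
      then show ?thesis using y s2 compact_openin_diff[OF cK]
        by (intro exI[of _ "pts M - \<pi> ` K"]) (auto intro: smooth_function_subset)
    qed
  qed
  then show "?g \<in> Cc0 M (\<pi> ` U)"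
    unfolding Cc0_def using cK K(2) off by blast
  show "ext_zero XP W g = elem U ?g"
  proof
    fix p
    consider "p \<in> U" | "p \<in> W" "p \<notin> U" | "p \<notin> W" using Uo(3) by blast
    then show "ext_zero XP W g p = elem U ?g p"
    proof cases
      case 1
      have "germ XP p g = germ XP p (?g \<circ> \<pi>)"
        by (rule germ_eqI[OF el_open[OF U] 1]) (simp add: sectn[OF U])
      then show ?thesis using 1 Uo(3) by (auto simp: ext_zero_def elem_fun_def)
    next
      case 2
      have "openin XP (W - K)" using compactin_open_complement[OF Uo(1,2) K(1)] K(2) Uo(3) by blast
      then have "germ XP p g = germ XP p (\<lambda>_. 0)"
        by (rule germ_eqI) (use 2 K in auto)
      then show ?thesis using 2 by (simp add: ext_zero_def elem_fun_def)
    next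
      case 3
      then show ?thesis using Uo(3) by (auto simp: ext_zero_def elem_fun_def)
    qed
  qed
qed

lemma sect_zero: "ext_zero XP {} (\<lambda>_. 0) = sect (\<lambda>_ _. 0)"
  by (simp add: ext_zero_def sect_def)

text \<open>Compactly supported functions split along any fine cover, so arbitrarily small good
  sheets suffice. The predicate \<open>good\<close> stays abstract because the sheets will later
  have to be bisections.\<close>

lemma ext_zero_list:
  fixes f :: "'p \<Rightarrow> 'k::real_normed_field"
  assumes good: "\<And>p W. openin XP W \<Longrightarrow> p \<in> W \<Longrightarrow> \<exists>U. good U \<and> el U \<and> p \<in> U \<and> U \<subseteq> W"
    and W: "openin XP W" "Hausdorff_space (subtopology XP W)" and f: "f \<in> csupp P W W"
  shows "\<exists>L. valid L \<and> (\<forall>(U, f)\<in>set L. good U) \<and> ext_zero XP W f = sect (lsum L)"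
proof (rule csupp_induct[OF P W f, where Q = "\<lambda>f. \<exists>L. valid L \<and> (\<forall>(U, f)\<in>set L. good U) \<and> ext_zero XP W f = sect (lsum L)"])
  have "ext_zero XP W (\<lambda>_. 0 :: 'k) = sect (lsum [])" by (simp add: ext_zero_def sect_def)
  then show "\<exists>L. valid L \<and> (\<forall>(U, f)\<in>set L. good U) \<and> ext_zero XP W (\<lambda>_. 0 :: 'k) = sect (lsum L)"
    by (intro exI[of _ "[]"]) auto
next
  fix f g :: "'p \<Rightarrow> 'k"
  assume "\<exists>L. valid L \<and> (\<forall>(U, f)\<in>set L. good U) \<and> ext_zero XP W f = sect (lsum L)"
    "\<exists>L. valid L \<and> (\<forall>(U, f)\<in>set L. good U) \<and> ext_zero XP W g = sect (lsum L)"
  then obtain L L' where L: "valid L" "\<forall>(U, f)\<in>set L. good U" "ext_zero XP W f = sect (lsum L)"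
    and L': "valid L'" "\<forall>(U, f)\<in>set L'. good U" "ext_zero XP W g = sect (lsum L')" by blast
  have "ext_zero XP W (\<lambda>p. f p + g p) = sec_add XP (ext_zero XP W f) (ext_zero XP W g)"
  proof
    fix p show "ext_zero XP W (\<lambda>p. f p + g p) p = sec_add XP (ext_zero XP W f) (ext_zero XP W g) p"
      unfolding ext_zero_def by (subst sec_add_germ[OF refl refl]) auto
  qed
  also have "\<dots> = sect (lsum (L @ L'))" unfolding L(3) L'(3) sec_add_sect by (simp add: sect_def)
  finally show "\<exists>L. valid L \<and> (\<forall>(U, f)\<in>set L. good U) \<and> ext_zero XP W (\<lambda>p. f p + g p) = sect (lsum L)"
    using L L' by (intro exI[of _ "L @ L'"]) auto
next
  fix p assume "p \<in> W"
  then obtain U where U: "good U" "el U" "p \<in> U" "U \<subseteq> W" using good[OF W(1)] by blast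
  have "\<exists>L. valid L \<and> (\<forall>(U, f)\<in>set L. good U) \<and> ext_zero XP W g = sect (lsum L)" if g: "g \<in> csupp P W U" for g :: "'p \<Rightarrow> 'k"
  proof -
    let ?g = "\<lambda>y. if y \<in> \<pi> ` U then g (sectn U y) else 0"
    have "ext_zero XP W g = sect (lsum [(U, ?g)])"
      using el_fun_Cc0(2)[OF U(2) W U(4) g] unfolding elem_fun_sect by (simp add: sect_def fun_eq_iff)
    then show ?thesis using el_fun_Cc0(1)[OF U(2) W U(4) g] U by (intro exI[of _ "[(U, ?g)]"]) auto
  qed
  then show "\<exists>N. openin XP N \<and> p \<in> N \<and> N \<subseteq> W \<and> (\<forall>g\<in>csupp P W N. \<exists>L. valid L \<and> (\<forall>(U, f)\<in>set L. good U) \<and> ext_zero XP W g = sect (lsum (L :: ('p set \<times> ('x \<Rightarrow> 'k)) list)))"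
    using U el_open by blast
qed

lemma Cc_list:
  fixes c :: "('p, 'k::real_normed_field) germ_section"
  assumes good: "\<And>p W. openin XP W \<Longrightarrow> p \<in> W \<Longrightarrow> \<exists>U. good U \<and> el U \<and> p \<in> U \<and> U \<subseteq> W"
  shows "c \<in> Cc P \<Longrightarrow> \<exists>L. valid L \<and> (\<forall>(U, f)\<in>set L. good U) \<and> c = sect (lsum L)"
proof (induction c rule: Cc.induct)
  case zero
  show ?case unfolding sect_zero by (intro exI[of _ "[]"]) (auto simp: sect_def)
next
  case (add c U f K)
  obtain L where L: "valid L" "\<forall>(U, f)\<in>set L. good U" "c = sect (lsum L)" using add.IH by blast
  \<comment> \<open>In \<open>Cc\<close> the function is constrained on \<open>U\<close> only,
    whereas \<open>csupp\<close> demands the value 0 everywhere off the support; \<open>f'\<close>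
    clears the values outside \<open>K\<close>.\<close>
  define f' where "f' p = (if p \<in> K then f p else 0)" for p
  have ff': "f p = f' p" if "p \<in> U" for p using add that by (auto simp: f'_def)
  have "f' \<in> csupp P U U"
    by (rule csuppI[OF smooth_function_cong[OF add.hyps(4) ff']]) (use add in \<open>auto simp: f'_def\<close>)
  then obtain L' where L': "valid L'" "\<forall>(U, f)\<in>set L'. good U" "ext_zero XP U f' = sect (lsum L')"
    using ext_zero_list[OF good add.hyps(2,3)] by blast
  have "ext_zero XP U f = ext_zero XP U f'"
    unfolding ext_zero_def using germ_eqI[OF add.hyps(2)] ff' by (auto simp: fun_eq_iff)
  then have "sec_add XP c (ext_zero XP U f) = sect (lsum (L @ L'))"
    by (simp only: L(3) L'(3) sec_add_sect lsum_append)
  then show ?case using L L' by (intro exI[of _ "L @ L'"]) (auto simp del: lsum_simps)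
qed

lemma Cc_lists: "c \<in> Cc P \<Longrightarrow> \<exists>L. valid L \<and> c = sect (lsum L)"
  using Cc_list[of "\<lambda>_. True" c] el_exists by blast

lemma elem_fun_Cc_add:
  assumes c: "c \<in> Cc P" and U: "el U" and f: "f \<in> Cc0 M (\<pi> ` U)"
  shows "sec_add XP c (elem U f) \<in> Cc P"
proof -
  obtain K where K: "compactin XM K" "K \<subseteq> \<pi> ` U" "\<forall>x. x \<notin> K \<longrightarrow> f x = 0" using f unfolding Cc0_def by blast
  show ?thesis unfolding elem_fun_def
  proof (rule Cc.add[OF c el_open[OF U] el_Hausdorff[OF U]])
    show "smooth_function P U (f \<circ> \<pi>)"
      using smooth_function_compose[OF M smooth_map_subset[OF smooth_pi el_pts[OF U]] Cc0_smooth[OF f]] pi_pts el_pts[OF U]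
      by (auto simp: o_def)
    have "compactin (subtopology XM (\<pi> ` U)) K" using K by (simp add: compactin_subtopology)
    then show "compactin XP (sectn U ` K)"
      using image_compactin smooth_map_continuous[OF M P smooth_sectn[OF U]] by blast
    show "sectn U ` K \<subseteq> U" using K(2) sectn_in by blast
    show "\<forall>p\<in>U - sectn U ` K. (f \<circ> \<pi>) p = 0"
    proof
      fix p assume p: "p \<in> U - sectn U ` K"
      then have "\<pi> p \<notin> K" using sectn[OF U, of p] by force
      then show "(f \<circ> \<pi>) p = 0" using K by simp
    qed
  qed
qed

lemma sect_lsum_Cc: "valid L \<Longrightarrow> sect (lsum L) \<in> Cc P"
proof (induction L)
  case Nil
  then show ?case using Cc.zero[of P] unfolding sect_zero by (simp add: sect_def)
next
  case (Cons a L)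
  obtain U f where a: "a = (U, f)" by force
  have "sec_add XP (sect (lsum L)) (elem U f) = sect (lsum (a # L))"
    unfolding elem_fun_sect sec_add_sect a sect_eq_iff by (auto intro!: arg_cong[where f = "germ _ _"] simp: fun_eq_iff)
  then show ?case using elem_fun_Cc_add[of "sect (lsum L)" U f] Cons a by (simp del: lsum_simps)
qed

lemma elem_fun_lsum: "elem U f = sect (lsum [(U, f)])"
  unfolding elem_fun_sect sect_eq_iff by (auto intro!: arg_cong[where f = "germ _ _"] simp: fun_eq_iff)

lemma sec_add_lsum: "sec_add XP (sect (lsum L)) (sect (lsum L')) = sect (lsum (L @ L'))"
  unfolding sec_add_sect sect_eq_iff by (auto intro!: arg_cong[where f = "germ _ _"] simp: fun_eq_iff)

lemma elem_fun_Cc: "el U \<Longrightarrow> f \<in> Cc0 M (\<pi> ` U) \<Longrightarrow> elem U f \<in> Cc P"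
  unfolding elem_fun_lsum by (rule sect_lsum_Cc) simp

lemma Cc_add: "c \<in> Cc P \<Longrightarrow> d \<in> Cc P \<Longrightarrow> sec_add XP c d \<in> Cc P"
  using Cc_lists sec_add_lsum sect_lsum_Cc valid_simps(3) by metis


section \<open>The local form of a section\<close>

text \<open>Over a small neighbourhood \<open>W\<close> of \<open>x\<close>, the sum over \<open>L\<close> is carried by finitely many sheets
  \<open>V p\<close>, one for each point \<open>p\<close> of the fibre over \<open>x\<close> that meets \<open>L\<close>. Sheets may intersect.\<close>

definition local_form :: "('p set \<times> ('x \<Rightarrow> 'k::real_normed_field)) list \<Rightarrow> 'x \<Rightarrow> 'x set \<Rightarrow> 'p set \<Rightarrow> ('p \<Rightarrow> 'p set) \<Rightarrow> bool" where
  "local_form L x W F V \<longleftrightarrow> openin XM W \<and> x \<in> W \<and> finite F \<and>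
     (\<forall>p\<in>F. p \<in> V p \<and> el (V p) \<and> \<pi> ` V p = W \<and> \<pi> p = x) \<and>
     (\<forall>U f. (U, f) \<in> set L \<longrightarrow> el U \<and> ((\<exists>p\<in>F. p \<in> U \<and> V p \<subseteq> U) \<or> (\<forall>y\<in>W. f y = 0))) \<and>
     (\<forall>p. \<pi> p = x \<longrightarrow> p \<notin> F \<longrightarrow> (\<forall>U f. (U, f) \<in> set L \<longrightarrow> p \<notin> U))"

lemma local_formD:
  assumes "local_form L x W F V"
  shows "openin XM W" "x \<in> W" "finite F" "\<And>p. p \<in> F \<Longrightarrow> p \<in> V p" "\<And>p. p \<in> F \<Longrightarrow> el (V p)"
    "\<And>p. p \<in> F \<Longrightarrow> \<pi> ` V p = W" "\<And>p. p \<in> F \<Longrightarrow> \<pi> p = x"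
    "\<And>U f. (U, f) \<in> set L \<Longrightarrow> el U" "\<And>U f. (U, f) \<in> set L \<Longrightarrow> (\<exists>p\<in>F. p \<in> U \<and> V p \<subseteq> U) \<or> (\<forall>y\<in>W. f y = 0)"
    "\<And>p U f. \<pi> p = x \<Longrightarrow> p \<notin> F \<Longrightarrow> (U, f) \<in> set L \<Longrightarrow> p \<notin> U"
proof -
  note A = assms[unfolded local_form_def]
  show "openin XM W" "x \<in> W" "finite F" using A by simp_all
  have B: "\<forall>p\<in>F. p \<in> V p \<and> el (V p) \<and> \<pi> ` V p = W \<and> \<pi> p = x" using A by (elim conjE)
  then show "\<And>p. p \<in> F \<Longrightarrow> p \<in> V p" "\<And>p. p \<in> F \<Longrightarrow> el (V p)"
    "\<And>p. p \<in> F \<Longrightarrow> \<pi> ` V p = W" "\<And>p. p \<in> F \<Longrightarrow> \<pi> p = x" by simp_all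
  have C: "\<forall>U f. (U, f) \<in> set L \<longrightarrow> el U \<and> ((\<exists>p\<in>F. p \<in> U \<and> V p \<subseteq> U) \<or> (\<forall>y\<in>W. f y = 0))"
    using A by (elim conjE)
  show "el U" if "(U, f) \<in> set L" for U f using C[rule_format, OF that] by simp
  show "(\<exists>p\<in>F. p \<in> U \<and> V p \<subseteq> U) \<or> (\<forall>y\<in>W. f y = 0)" if "(U, f) \<in> set L" for U f
    using C[rule_format, OF that] by simp
  have D: "\<forall>p. \<pi> p = x \<longrightarrow> p \<notin> F \<longrightarrow> (\<forall>U f. (U, f) \<in> set L \<longrightarrow> p \<notin> U)" using A by (elim conjE)
  show "p \<notin> U" if "\<pi> p = x" "p \<notin> F" "(U, f) \<in> set L" for p U f using D that by blast
qed

text \<open>\<open>F\<close> consists of the points over \<open>x\<close> in sheets of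
  \<open>L\<close>, and \<open>V p\<close> is the intersection of the sheets through
  \<open>p\<close>, trimmed to lie over \<open>W\<close>. A sheet missing the fibre may still have
  \<open>x\<close> in the closure of its image, but the support of its function is compact, hence
  closed in the Hausdorff base, and \<open>W\<close> can avoid it.\<close>

lemma local_form_exists:
  fixes L :: "('p set \<times> ('x \<Rightarrow> 'k::real_normed_field)) list"
  assumes L: "valid L" and x: "x \<in> pts M"
  shows "\<exists>W F V. local_form L x W F V"
proof -
  define S where "S = fst ` set L"
  have elS: "el U" if "U \<in> S" for U using that validD[OF L] by (auto simp: S_def)
  define F where "F = {p \<in> \<Union>S. \<pi> p = x}"
  have "F \<subseteq> (\<lambda>U. sectn U x) ` S"
  proof
    fix p assume "p \<in> F"
    then obtain U where "U \<in> S" "p \<in> U" "\<pi> p = x" by (auto simp: F_def)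
    then show "p \<in> (\<lambda>U. sectn U x) ` S" using sectn[OF elS, of U p] by (intro image_eqI[of _ _ U]) auto
  qed
  moreover have "finite ((\<lambda>U. sectn U x) ` S)" by (simp add: S_def)
  ultimately have F: "finite F" by (rule finite_subset)
  define A where "A p = \<Inter>{U \<in> S. p \<in> U}" for p
  have A: "openin XP (A p)" "p \<in> A p" "el (A p)" if "p \<in> F" for p
  proof -
    have ne: "{U \<in> S. p \<in> U} \<noteq> {}" using that by (auto simp: F_def)
    show o: "openin XP (A p)" unfolding A_def
    proof (rule openin_Inter[OF _ ne])
      show "finite {U \<in> S. p \<in> U}" by (simp add: S_def)
    qed (use el_open elS in blast)
    show "p \<in> A p" by (auto simp: A_def)
    obtain U where "U \<in> S" "p \<in> U" using ne by blast
    then show "el (A p)" using el_subset[OF elS o, of U] by (auto simp: A_def)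
  qed
  have "\<exists>N. openin XM N \<and> x \<in> N \<and> (\<forall>y\<in>N. f y = 0)" if a: "(U, f) \<in> set L" "x \<notin> \<pi> ` U" for U f
  proof -
    obtain K where K: "compactin XM K" "K \<subseteq> \<pi> ` U" "\<forall>y. y \<notin> K \<longrightarrow> f y = 0"
      using validD[OF L a(1)] unfolding Cc0_def by blast
    then show ?thesis using compact_openin_diff[OF K(1)] a(2) x by (intro exI[of _ "pts M - K"]) auto
  qed
  then obtain N where N: "\<And>U f. (U, f) \<in> set L \<Longrightarrow> x \<notin> \<pi> ` U \<Longrightarrow> openin XM (N U f) \<and> x \<in> N U f \<and> (\<forall>y\<in>N U f. f y = 0)"
    by metis
  define Z where "Z = (\<lambda>p. \<pi> ` A p) ` F \<union> (\<lambda>(U, f). N U f) ` {(U, f) \<in> set L. x \<notin> \<pi> ` U}"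
  define W where "W = \<Inter>(insert (pts M) Z)"
  have "finite {(U, f) \<in> set L. x \<notin> \<pi> ` U}" by (rule finite_subset[of _ "set L"]) auto
  then have "finite Z" using F by (simp add: Z_def)
  moreover have "\<forall>T\<in>Z. openin XM T \<and> x \<in> T"
  proof
    fix T assume "T \<in> Z"
    then consider p where "p \<in> F" "T = \<pi> ` A p" | U f where "(U, f) \<in> set L" "x \<notin> \<pi> ` U" "T = N U f"
      unfolding Z_def by auto
    then show "openin XM T \<and> x \<in> T"
    proof cases
      case 1
      then show ?thesis using open_image[OF A(1)] A(2)[of p] by (auto simp: F_def)
    next
      case 2
      then show ?thesis using N by blast
    qed
  qed
  ultimately have Z: "finite Z" "\<And>T. T \<in> Z \<Longrightarrow> openin XM T" "\<And>T. T \<in> Z \<Longrightarrow> x \<in> T" by auto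
  have W: "openin XM W" "x \<in> W" unfolding W_def
    by (rule openin_Inter) (use Z x in auto)
  define V where "V p = A p \<inter> {q \<in> pts P. \<pi> q \<in> W}" for p
  have V: "p \<in> V p \<and> el (V p) \<and> \<pi> ` V p = W \<and> \<pi> p = x" if p: "p \<in> F" for p
  proof -
    have "\<pi> p = x" using p by (auto simp: F_def)
    moreover have "el (V p)" unfolding V_def by (rule el_restrict[OF A(3)[OF p] W(1)])
    moreover have "p \<in> V p" using A(2)[OF p] el_pts[OF A(3)[OF p]] W(2) \<open>\<pi> p = x\<close> by (auto simp: V_def)
    moreover have "W \<subseteq> \<pi> ` A p" using p by (auto simp: W_def Z_def)
    then have "\<pi> ` V p = W" using el_pts[OF A(3)[OF p]] by (auto simp: V_def)
    ultimately show ?thesis by blast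
  qed
  have H1: "el U \<and> ((\<exists>p\<in>F. p \<in> U \<and> V p \<subseteq> U) \<or> (\<forall>y\<in>W. f y = 0))" if a: "(U, f) \<in> set L" for U f
  proof (cases "x \<in> \<pi> ` U")
    case True
    then obtain p where p: "p \<in> U" "\<pi> p = x" by auto
    have US: "U \<in> S" using a by (force simp: S_def)
    then have "p \<in> F" using p by (auto simp: F_def)
    moreover have "V p \<subseteq> U" using US p by (auto simp: V_def A_def)
    ultimately show ?thesis using p elS[OF US] by blast
  next
    case False
    have "N U f \<in> Z" unfolding Z_def using a False by force
    then have "W \<subseteq> N U f" by (auto simp: W_def)
    then show ?thesis using N[OF a False] validD[OF L a] by blast
  qed
  have H2: "p \<notin> U" if "\<pi> p = x" "p \<notin> F" "(U, f) \<in> set L" for p U f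
    using that by (force simp: F_def S_def)
  have "local_form L x W F V"
    unfolding local_form_def by (intro conjI ballI allI impI W F) (use V H1 H2 in simp_all)
  then show ?thesis by blast
qed

text \<open>A term either vanishes on \<open>W\<close> or has a sheet through exactly one point
  \<open>p\<close> of \<open>F\<close>, and over \<open>W\<close> this sheet coincides with
  \<open>V p\<close>. Membership of \<open>q\<close> in the sheet is therefore membership in
  \<open>V p\<close>.\<close>

lemma local_form_term:
  assumes lf: "local_form L x W F V" and a: "(U, f) \<in> set L" and y: "y \<in> W"
  shows "\<pi> q \<in> W \<Longrightarrow> (if q \<in> U then f y else 0) = (\<Sum>p\<in>{p\<in>F. q \<in> V p}. if p \<in> U then f y else 0)"
    and "f y = (\<Sum>p\<in>F. if p \<in> U then f y else 0)"
proof -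
  note D = local_formD[OF lf]
  show "(if q \<in> U then f y else 0) = (\<Sum>p\<in>{p\<in>F. q \<in> V p}. if p \<in> U then f y else 0)" if q: "\<pi> q \<in> W"
  proof (cases "\<exists>p\<in>F. p \<in> U \<and> V p \<subseteq> U")
    case True
    then obtain p where p: "p \<in> F" "p \<in> U" "V p \<subseteq> U" by blast
    have u: "p' \<in> U \<longleftrightarrow> p' = p" if "p' \<in> F" for p'
      using el_injD[OF D(8)[OF a]] p D(7) that by metis
    have "q \<in> U \<longleftrightarrow> q \<in> V p"
    proof
      assume "q \<in> U"
      obtain q' where "q' \<in> V p" "\<pi> q' = \<pi> q" using D(6)[OF p(1)] q by (metis imageE)
      then show "q \<in> V p" using el_injD[OF D(8)[OF a]] p \<open>q \<in> U\<close> by (metis subsetD)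
    qed (use p in auto)
    moreover have "(\<Sum>p'\<in>{p\<in>F. q \<in> V p}. if p' \<in> U then f y else 0) = (\<Sum>p'\<in>{p\<in>F. q \<in> V p}. if p' = p then f y else 0)"
      using u by (intro sum.cong) auto
    ultimately show ?thesis using D(3) p(1) by simp
  next
    case False
    then have "f y = 0" using D(9)[OF a] y by blast
    then show ?thesis by (simp cong: if_cong)
  qed
  show "f y = (\<Sum>p\<in>F. if p \<in> U then f y else 0)"
  proof (cases "\<exists>p\<in>F. p \<in> U \<and> V p \<subseteq> U")
    case True
    then obtain p where p: "p \<in> F" "p \<in> U" by blast
    have u: "p' \<in> U \<longleftrightarrow> p' = p" if "p' \<in> F" for p'
      using el_injD[OF D(8)[OF a]] p D(7) that by metis
    have "(\<Sum>p'\<in>F. if p' \<in> U then f y else 0) = (\<Sum>p'\<in>F. if p' = p then f y else 0)"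
      using u by (intro sum.cong) auto
    then show ?thesis using D(3) p(1) by simp
  next
    case False
    then have "f y = 0" using D(9)[OF a] y by blast
    then show ?thesis by (simp cong: if_cong)
  qed
qed

text \<open>Summation over the fibres of \<open>\<pi>\<close>; this will be the value of the
  counit.\<close>

definition total :: "('p set \<times> ('x \<Rightarrow> 'k::real_normed_field)) list \<Rightarrow> 'x \<Rightarrow> 'k" where
  "total L y = (\<Sum>(U, f)\<leftarrow>L. f y)"

lemma local_form_lsum:
  assumes lf: "local_form L x W F V" and y: "y \<in> W"
  shows "\<pi> q \<in> W \<Longrightarrow> lsum L q y = (\<Sum>p\<in>{p\<in>F. q \<in> V p}. lsum L p y)"
    and "total L y = (\<Sum>p\<in>F. lsum L p y)"
proof -
  have "lsum L' q y = (\<Sum>p\<in>{p\<in>F. q \<in> V p}. lsum L' p y)" if "\<pi> q \<in> W" "set L' \<subseteq> set L" for L'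
    using that(2)
  proof (induction L')
    case (Cons a L')
    obtain U f where a: "a = (U, f)" by force
    have "(U, f) \<in> set L" using Cons.prems a by auto
    from local_form_term(1)[OF lf this y that(1)] Cons show ?case by (simp add: a sum.distrib)
  qed simp
  then show "\<pi> q \<in> W \<Longrightarrow> lsum L q y = (\<Sum>p\<in>{p\<in>F. q \<in> V p}. lsum L p y)" by blast
  have "total L' y = (\<Sum>p\<in>F. lsum L' p y)" if "set L' \<subseteq> set L" for L'
    using that
  proof (induction L')
    case (Cons a L')
    obtain U f where a: "a = (U, f)" by force
    have "(U, f) \<in> set L" using Cons.prems a by auto
    from local_form_term(2)[OF lf this y] Cons show ?case by (simp add: a sum.distrib total_def)
  qed (simp add: total_def)
  then show "total L y = (\<Sum>p\<in>F. lsum L p y)" by blast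
qed

lemma finite_germ_eq:
  assumes "finite F" "\<And>p. p \<in> F \<Longrightarrow> germ XM x (h p) = germ XM x (k p)" "openin XM W" "x \<in> W"
  shows "\<exists>W'. openin XM W' \<and> x \<in> W' \<and> W' \<subseteq> W \<and> (\<forall>p\<in>F. \<forall>y\<in>W'. h p y = k p y)"
  using assms(1,2)
proof (induction F rule: finite_induct)
  case empty
  then show ?case using assms(3,4) by blast
next
  case (insert p F)
  then obtain W' where W': "openin XM W'" "x \<in> W'" "W' \<subseteq> W" "\<forall>p\<in>F. \<forall>y\<in>W'. h p y = k p y" by auto
  have x: "x \<in> pts M" using assms(3,4) openin_subset by blast
  obtain T where T: "openin XM T" "x \<in> T" "\<And>y. y \<in> T \<Longrightarrow> h p y = k p y"
    using germ_eqD[OF insert.prems[of p] x] by blast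
  then show ?case using W' by (intro exI[of _ "W' \<inter> T"]) auto
qed

lemma sect_const_iff:
  "p \<in> pts P \<Longrightarrow> sect h p = germ XP p (\<lambda>_. a) \<longleftrightarrow> germ XM (\<pi> p) (h p) = germ XM (\<pi> p) (\<lambda>_. a)"
  unfolding sect_def by (rule germ_pull[where g = "\<lambda>_. a"])

lemma lsum_local_form_outside: "local_form L x W F V \<Longrightarrow> \<pi> p = x \<Longrightarrow> p \<notin> F \<Longrightarrow> lsum L p y = 0"
proof -
  assume lf: "local_form L x W F V" and p: "\<pi> p = x" "p \<notin> F"
  have "set L' \<subseteq> set L \<Longrightarrow> lsum L' p y = 0" for L'
    by (induction L') (use local_formD(10)[OF lf p] in auto)
  then show ?thesis by blast
qed

text \<open>Over \<open>W\<close> every germ of \<open>c\<close> is a sum of some of the finitely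
  many functions attached to the points of \<open>F\<close>, so vanishing over the single point
  \<open>x\<close> spreads to a neighbourhood in the base, however the sheets intersect.\<close>

lemma vanish_near:
  assumes c: "c \<in> Cc P" and x: "x \<in> pts M" and z: "\<And>p. p \<in> pts P \<Longrightarrow> \<pi> p = x \<Longrightarrow> c p = germ XP p (\<lambda>_. 0)"
  shows "\<exists>W. openin XM W \<and> x \<in> W \<and> (\<forall>p\<in>pts P. \<pi> p \<in> W \<longrightarrow> c p = germ XP p (\<lambda>_. 0))"
proof -
  obtain L where L: "valid L" "c = sect (lsum L)" using Cc_lists[OF c] by blast
  obtain W F V where lf: "local_form L x W F V" using local_form_exists[OF L(1) x] by blast
  note D = local_formD[OF lf]
  have "germ XM x (lsum L p) = germ XM x (\<lambda>_. 0)" if "p \<in> F" for p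
  proof -
    have "p \<in> pts P" using el_pts[OF D(5)[OF that]] D(4)[OF that] by blast
    then show ?thesis using z[of p] sect_const_iff[of p "lsum L" 0] D(7)[OF that] L(2) by simp
  qed
  then obtain W' where W': "openin XM W'" "x \<in> W'" "W' \<subseteq> W" "\<forall>p\<in>F. \<forall>y\<in>W'. lsum L p y = 0"
    using finite_germ_eq[OF D(3) _ D(1,2), where h = "lsum L" and k = "\<lambda>_ _. 0"] by blast
  have "c q = germ XP q (\<lambda>_. 0)" if q: "q \<in> pts P" "\<pi> q \<in> W'" for q
  proof -
    have "lsum L q y = 0" if "y \<in> W'" for y
      using local_form_lsum(1)[OF lf, of y q] W' q that by auto
    then have "germ XM (\<pi> q) (lsum L q) = germ XM (\<pi> q) (\<lambda>_. 0)" by (intro germ_eqI[OF W'(1) q(2)])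
    then show ?thesis using sect_const_iff[OF q(1), of "lsum L" 0] L(2) by simp
  qed
  then show ?thesis using W' by blast
qed

section \<open>Sections concentrated at one point of a fibre\<close>

definition delta :: "('p, 'k::real_normed_field) germ_section \<Rightarrow> 'p \<Rightarrow> bool" where
  "delta c p \<longleftrightarrow> c \<in> Cc P \<and> p \<in> pts P \<and> c p = germ XP p (\<lambda>_. 1) \<and>
     (\<forall>q\<in>pts P. \<pi> q = \<pi> p \<longrightarrow> q \<noteq> p \<longrightarrow> c q = germ XP q (\<lambda>_. 0))"

text \<open>Near \<open>\<pi> p\<close> the functions attached to the points of \<open>F\<close> are
  constant, 1 for \<open>p\<close> and 0 for the others, so over a small base neighbourhood the
  section is the indicator of the sheet \<open>V p\<close>.\<close>

lemma delta_open:
  assumes d: "delta (c :: ('p, 'k::real_normed_field) germ_section) p"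
  shows "\<exists>U. el U \<and> p \<in> U \<and> (\<forall>q\<in>U. delta c q)"
proof -
  have c: "c \<in> Cc P" "p \<in> pts P" "c p = germ XP p (\<lambda>_. 1)"
    "\<And>q. q \<in> pts P \<Longrightarrow> \<pi> q = \<pi> p \<Longrightarrow> q \<noteq> p \<Longrightarrow> c q = germ XP q (\<lambda>_. 0)"
    using d by (auto simp: delta_def)
  obtain L where L: "valid L" "c = sect (lsum L)" using Cc_lists[OF c(1)] by blast
  obtain W F V where lf: "local_form L (\<pi> p) W F V" using local_form_exists[OF L(1) pi_pts[OF c(2)]] by blast
  note D = local_formD[OF lf]
  have lp: "germ XM (\<pi> p) (lsum L p) = germ XM (\<pi> p) (\<lambda>_. 1)" using sect_const_iff[OF c(2), of "lsum L" 1] c(3) L(2) by simp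
  have pF: "p \<in> F"
  proof (rule ccontr)
    assume "p \<notin> F"
    then have "lsum L p (\<pi> p) = 0" using lsum_local_form_outside[OF lf] by blast
    then show False using germ_eq_value[OF lp pi_pts[OF c(2)]] by simp
  qed
  have "germ XM (\<pi> p) (lsum L q) = germ XM (\<pi> p) ((\<lambda>q _. if q = p then 1 else 0) q)" if q: "q \<in> F" for q
  proof (cases "q = p")
    case False
    have "q \<in> pts P" using el_pts[OF D(5)[OF q]] D(4)[OF q] by blast
    then show ?thesis using c(4)[of q] sect_const_iff[of q "lsum L" 0] D(7)[OF q] L(2) False by simp
  qed (simp add: lp)
  then obtain W' where W': "openin XM W'" "\<pi> p \<in> W'" "W' \<subseteq> W" "\<forall>q\<in>F. \<forall>y\<in>W'. lsum L q y = (if q = p then 1 else 0)"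
    using finite_germ_eq[OF D(3) _ D(1,2), where h = "lsum L" and k = "\<lambda>q _. if q = p then 1 else 0"] by blast
  have val: "lsum L q y = (if q \<in> V p then 1 else 0)" if "\<pi> q \<in> W'" "y \<in> W'" for q y
  proof -
    have "lsum L q y = (\<Sum>p'\<in>{p'\<in>F. q \<in> V p'}. lsum L p' y)"
      using local_form_lsum(1)[OF lf, of y q] W' that by blast
    also have "\<dots> = (\<Sum>p'\<in>{p'\<in>F. q \<in> V p'}. if p' = p then 1 else 0)"
      using W'(4) that(2) by (intro sum.cong) auto
    finally show ?thesis using D(3) pF by simp
  qed
  have cq: "c q = germ XP q (\<lambda>_. if q \<in> V p then 1 else 0)" if "q \<in> pts P" "\<pi> q \<in> W'" for q
    unfolding L(2) sect_const_iff[OF that(1)] by (rule germ_eqI[OF W'(1) that(2)]) (use val that(2) in blast)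
  let ?U = "V p \<inter> {q \<in> pts P. \<pi> q \<in> W'}"
  have "delta c q" if q: "q \<in> ?U" for q
    unfolding delta_def
  proof (intro conjI ballI impI)
    fix q' assume q': "q' \<in> pts P" "\<pi> q' = \<pi> q" "q' \<noteq> q"
    then have "q' \<notin> V p" using el_injD[OF D(5)[OF pF]] q by blast
    then show "c q' = germ XP q' (\<lambda>_. 0)" using cq[of q'] q' q by simp
  qed (use c q cq[of q] in auto)
  moreover have "el ?U" by (rule el_restrict[OF D(5)[OF pF] W'(1)])
  moreover have "p \<in> ?U" using D(4)[OF pF] c(2) W'(2) by blast
  ultimately show ?thesis by blast
qed

section \<open>The universal property of compactly supported sections\<close>

lemma Cc0_induct:
  fixes f :: "'x \<Rightarrow> 'k::real_normed_field"
  assumes f: "f \<in> Cc0 M (pts M)" and "Q (\<lambda>_. 0)"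
    and "\<And>f g. f \<in> Cc0 M (pts M) \<Longrightarrow> g \<in> Cc0 M (pts M) \<Longrightarrow> Q f \<Longrightarrow> Q g \<Longrightarrow> Q (\<lambda>p. f p + g p)"
    and "\<And>x. x \<in> pts M \<Longrightarrow> \<exists>N. openin XM N \<and> x \<in> N \<and> (\<forall>g\<in>Cc0 M N. Q g)"
  shows "Q f"
proof (rule csupp_induct[OF M M_local])
  show "f \<in> csupp M (pts M) (pts M)" using f by (simp add: Cc0_csupp)
  show "\<exists>N. openin XM N \<and> x \<in> N \<and> N \<subseteq> pts M \<and> (\<forall>g\<in>csupp M (pts M) N. Q g)" if "x \<in> pts M" for x
    using assms(4)[OF that] unfolding Cc0_csupp using openin_subset by blast
qed (use assms(2,3) in \<open>auto simp: Cc0_csupp\<close>)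

text \<open>Multiplying all terms by a function supported over a small set lets each be moved to a
  sheet \<open>V p\<close> of a local form, where the coefficients of the zero section cancel;
  splitting a function on the base patches these local statements together. This is the core of
  well-definedness for operations specified on elementary functions.\<close>

lemma lsum_zero_null:
  fixes D :: "'p set \<Rightarrow> ('x \<Rightarrow> 'k::real_normed_field) \<Rightarrow> 'z::ab_group_add"
  assumes N0: "0 \<in> N" and Nd: "\<And>s t. s \<in> N \<Longrightarrow> t \<in> N \<Longrightarrow> s - t \<in> N"
    and Dadd: "\<And>U f g. el U \<Longrightarrow> f \<in> Cc0 M (\<pi> ` U) \<Longrightarrow> g \<in> Cc0 M (\<pi> ` U) \<Longrightarrow> D U (\<lambda>y. f y + g y) - D U f - D U g \<in> N"
    and Dres: "\<And>U V f. el U \<Longrightarrow> el V \<Longrightarrow> V \<subseteq> U \<Longrightarrow> f \<in> Cc0 M (\<pi> ` V) \<Longrightarrow> D U f - D V f \<in> N"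
    and L: "valid L" and z: "sect (lsum L) = sect (\<lambda>_ _. 0)"
  shows "(\<Sum>(U, f)\<leftarrow>L. D U f) \<in> N"
proof -
  have Nm: "- s \<in> N" if "s \<in> N" for s using Nd[OF N0 that] by simp
  have Na: "s + t \<in> N" if "s \<in> N" "t \<in> N" for s t using Nd[OF that(1) Nm[OF that(2)]] by simp
  have Nt: "s - u \<in> N" if "s - t \<in> N" "t - u \<in> N" for s t u using Na[OF that] by simp
  have D0: "D U (\<lambda>_. 0) \<in> N" if "el U" for U
    using Nm[OF Dadd[OF that Cc0_zero Cc0_zero]] by simp
  have Nsum: "(\<Sum>i\<in>I. s i) \<in> N" if "\<And>i. i \<in> I \<Longrightarrow> s i \<in> N" for I :: "'p set" and s
    using that by (induction I rule: infinite_finite_induct) (auto intro: N0 Na)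
  \<comment> \<open>The sum weighted by a function \<open>f\<close> on the base. It is additive in
    \<open>f\<close> modulo \<open>N\<close>, so the claim can be proved for small supports and
    assembled by \<open>Cc0_induct\<close>.\<close>
  define Q where "Q f \<longleftrightarrow> (\<Sum>(U, g)\<leftarrow>L. D U (\<lambda>y. f y * g y)) \<in> N" for f
  have Qadd: "Q (\<lambda>y. f y + g y)" if "f \<in> Cc0 M (pts M)" "g \<in> Cc0 M (pts M)" "Q f" "Q g" for f g
  proof -
    have "set L' \<subseteq> set L \<Longrightarrow> (\<Sum>(U, h)\<leftarrow>L'. D U (\<lambda>y. (f y + g y) * h y)) - (\<Sum>(U, h)\<leftarrow>L'. D U (\<lambda>y. f y * h y)) - (\<Sum>(U, h)\<leftarrow>L'. D U (\<lambda>y. g y * h y)) \<in> N" for L'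
    proof (induction L')
      case Nil
      then show ?case using N0 by simp
    next
      case (Cons a L')
      obtain U h where a: "a = (U, h)" by force
      have U: "el U" "h \<in> Cc0 M (\<pi> ` U)" using validD[OF L] Cons.prems a by auto
      have "D U (\<lambda>y. f y * h y + g y * h y) - D U (\<lambda>y. f y * h y) - D U (\<lambda>y. g y * h y) \<in> N"
        by (intro Dadd U Cc0_mult(2)) (use that Cc0_smooth U in auto)
      from Na[OF this Cons.IH] Cons.prems show ?case by (simp add: a algebra_simps)
    qed
    from Na[OF this[OF subset_refl] Na[OF that(3,4)[unfolded Q_def]]] show ?thesis
      unfolding Q_def by (simp add: algebra_simps)
  qed
  have Qall: "Q f" if "f \<in> Cc0 M (pts M)" for f
  proof (rule Cc0_induct[where Q = Q, OF that _ Qadd])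
    have "set L' \<subseteq> set L \<Longrightarrow> (\<Sum>(U, g)\<leftarrow>L'. D U (\<lambda>y. 0)) \<in> N" for L'
    proof (induction L')
      case (Cons a L')
      then show ?case using validD[OF L] by (cases a) (auto intro!: Na D0)
    qed (simp add: N0)
    then show "Q (\<lambda>_. 0)" unfolding Q_def by simp
  next
    fix x assume x: "x \<in> pts M"
    obtain W F V where lf: "local_form L x W F V" using local_form_exists[OF L x] by blast
    note LD = local_formD[OF lf]
    have "germ XM x (lsum L p) = germ XM x (\<lambda>_. 0)" if "p \<in> F" for p
    proof -
      have "p \<in> pts P" using el_pts[OF LD(5)[OF that]] LD(4)[OF that] by blast
      then show ?thesis using z LD(7)[OF that] unfolding sect_eq_iff by blast
    qed
    then obtain W' where W': "openin XM W'" "x \<in> W'" "W' \<subseteq> W" "\<forall>p\<in>F. \<forall>y\<in>W'. lsum L p y = 0"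
      using finite_germ_eq[OF LD(3) _ LD(1,2), where h = "lsum L" and k = "\<lambda>_ _. 0"] by blast
    have "Q f" if f: "f \<in> Cc0 M W'" for f
    proof -
      have fW: "f \<in> Cc0 M W" using f W' Cc0_mono by blast
      \<comment> \<open>Each weighted term moves from its own sheet \<open>U\<close> to the sheet
        \<open>V p\<close> inside \<open>U\<close>; a term without such a sheet vanishes over
        \<open>W\<close>, which contains the support of the weight.\<close>
      have "set L' \<subseteq> set L \<Longrightarrow>
         (\<Sum>(U, g)\<leftarrow>L'. D U (\<lambda>y. f y * g y)) - (\<Sum>p\<in>F. D (V p) (\<lambda>y. f y * lsum L' p y)) \<in> N" for L'
      proof (induction L')
        case Nil
        have "(\<Sum>p\<in>F. D (V p) (\<lambda>y. 0)) \<in> N" using LD(5) by (intro Nsum D0)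
        then show ?case using Nm by simp
      next
        case (Cons a L')
        obtain U g where a: "a = (U, g)" by force
        have U: "(U, g) \<in> set L" "el U" "g \<in> Cc0 M (\<pi> ` U)" using validD[OF L] Cons.prems a by auto
        have vL': "valid L'" using L Cons.prems by (auto simp: valid_def)
        have IH: "(\<Sum>(U, g)\<leftarrow>L'. D U (\<lambda>y. f y * g y)) - (\<Sum>p\<in>F. D (V p) (\<lambda>y. f y * lsum L' p y)) \<in> N"
          using Cons by simp
        have fg: "(\<lambda>y. f y * g y) \<in> Cc0 M W" using Cc0_mult(1)[OF fW Cc0_smooth[OF U(3)]] .
        show ?case
        proof (cases "\<exists>p\<in>F. p \<in> U \<and> V p \<subseteq> U")
          case True
          then obtain p where p: "p \<in> F" "p \<in> U" "V p \<subseteq> U" by blast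
          have u: "p' \<notin> U" if "p' \<in> F - {p}" for p'
            using el_injD[OF U(2)] p LD(7) that by (metis DiffE singletonI)
          have im: "\<pi> ` V p = W" using LD(6)[OF p(1)] .
          have fl: "(\<lambda>y. f y * lsum L' p y) \<in> Cc0 M W"
            by (rule Cc0_mult(1)[OF fW Cc0_smooth[OF lsum_Cc0[OF vL']]])
          have 1: "D U (\<lambda>y. f y * g y) - D (V p) (\<lambda>y. f y * g y) \<in> N"
            by (rule Dres[OF U(2) LD(5)[OF p(1)] p(3)]) (use fg im in simp)
          have 2: "D (V p) (\<lambda>y. f y * g y + f y * lsum L' p y) - D (V p) (\<lambda>y. f y * g y) - D (V p) (\<lambda>y. f y * lsum L' p y) \<in> N"
            by (rule Dadd[OF LD(5)[OF p(1)]]) (use fg fl im in simp_all)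
          have 3: "(\<Sum>p\<in>F. D (V p) (\<lambda>y. f y * lsum (a # L') p y)) =
              D (V p) (\<lambda>y. f y * g y + f y * lsum L' p y) + (\<Sum>p'\<in>F - {p}. D (V p') (\<lambda>y. f y * lsum L' p' y))"
            using u p by (subst sum.remove[OF LD(3) p(1)]) (auto simp: a distrib_left intro!: arg_cong2[where f = "(+)"] sum.cong)
          have 4: "(\<Sum>p\<in>F. D (V p) (\<lambda>y. f y * lsum L' p y)) =
              D (V p) (\<lambda>y. f y * lsum L' p y) + (\<Sum>p'\<in>F - {p}. D (V p') (\<lambda>y. f y * lsum L' p' y))"
            by (rule sum.remove[OF LD(3) p(1)])
          from Nd[OF Na[OF 1 IH] 2] show ?thesis unfolding 3 unfolding 4 by (simp add: a algebra_simps)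
        next
          case False
          then have "\<forall>y\<in>W. g y = 0" using LD(9)[OF U(1)] by blast
          then have fg0: "f y * g y = 0" for y using Cc0_outside[OF fW, of y] by (cases "y \<in> W") auto
          have 1: "D U (\<lambda>y. f y * g y) \<in> N" using D0[OF U(2)] by (simp only: fg0)
          have 2: "f y * lsum (a # L') p y = f y * lsum L' p y" for p y using fg0[of y] by (auto simp: a distrib_left)
          from Na[OF 1 IH] show ?thesis unfolding 2 by (simp add: a add_diff_eq)
        qed
      qed
      from this[OF subset_refl] have
        A: "(\<Sum>(U, g)\<leftarrow>L. D U (\<lambda>y. f y * g y)) - (\<Sum>p\<in>F. D (V p) (\<lambda>y. f y * lsum L p y)) \<in> N" .
      have "(\<lambda>y. f y * lsum L p y) = (\<lambda>y. 0)" if "p \<in> F" for p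
      proof
        fix y show "f y * lsum L p y = 0"
          using W'(4) that Cc0_outside[OF f, of y] by (cases "y \<in> W'") auto
      qed
      then have "(\<Sum>p\<in>F. D (V p) (\<lambda>y. f y * lsum L p y)) = (\<Sum>p\<in>F. D (V p) (\<lambda>y. 0))" by simp
      then have "(\<Sum>p\<in>F. D (V p) (\<lambda>y. f y * lsum L p y)) \<in> N" using LD(5) by (auto intro!: Nsum D0)
      from Na[OF A this] show ?thesis by (simp add: Q_def)
    qed
    then show "\<exists>N. openin XM N \<and> x \<in> N \<and> (\<forall>g\<in>Cc0 M N. Q g)" using W' by blast
  qed
  \<comment> \<open>A weight acting as 1 on every term of \<open>L\<close>, so that the weighted sum
    is the given one.\<close>
  have "\<exists>u. u \<in> Cc0 M (pts M) \<and> (\<forall>(U, g)\<in>set L. \<forall>y. u y * g y = g y)"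
  proof -
    have "\<exists>K. compactin XM K \<and> (\<forall>(U, g)\<in>set L'. \<forall>y. y \<notin> K \<longrightarrow> g y = 0)" if "valid L'" for L' :: "('p set \<times> ('x \<Rightarrow> 'k)) list"
      using that
    proof (induction L')
      case (Cons a L')
      then obtain K where K: "compactin XM K" "\<forall>(U, g)\<in>set L'. \<forall>y. y \<notin> K \<longrightarrow> g y = 0" by (cases a) auto
      obtain K' where "compactin XM K'" "\<forall>y. y \<notin> K' \<longrightarrow> snd a y = 0"
        using Cons.prems by (cases a) (auto simp: Cc0_def)
      then show ?case using K by (intro exI[of _ "K \<union> K'"]) (auto intro: compactin_Un)
    qed auto
    then obtain K where K: "compactin XM K" "\<forall>(U, g)\<in>set L. \<forall>y. y \<notin> K \<longrightarrow> g y = 0" using L by blast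
    obtain u :: "'x \<Rightarrow> 'k" where u: "u \<in> Cc0 M (pts M)" "\<forall>y\<in>K. u y = 1"
      using Cc0_unit[OF K(1) compactin_subset_topspace[OF K(1)] openin_topspace] by blast
    have "u y * g y = g y" if "(U, g) \<in> set L" for U g y using u(2) K(2) that by (cases "y \<in> K") auto
    then show ?thesis using u(1) by blast
  qed
  then obtain u where u: "u \<in> Cc0 M (pts M)" "\<And>U g y. (U, g) \<in> set L \<Longrightarrow> u y * g y = g y" by blast
  have "(\<Sum>(U, g)\<leftarrow>L. D U (\<lambda>y. u y * g y)) = (\<Sum>(U, g)\<leftarrow>L. D U g)"
    by (rule arg_cong[where f = sum_list], rule map_cong) (auto simp: u(2))
  then show ?thesis using Qall[OF u(1)] by (simp add: Q_def)
qed

text \<open>Obtained from the zero case for \<open>L\<close> followed by the negated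
  \<open>L'\<close>. With \<open>N\<close> trivial it serves the counit, with \<open>N\<close> the
  null tensors the comultiplication.\<close>

lemma lsum_eq_null:
  fixes D :: "'p set \<Rightarrow> ('x \<Rightarrow> 'k::real_normed_field) \<Rightarrow> 'z::ab_group_add"
  assumes N0: "0 \<in> N" and Nd: "\<And>s t. s \<in> N \<Longrightarrow> t \<in> N \<Longrightarrow> s - t \<in> N"
    and Dadd: "\<And>U f g. el U \<Longrightarrow> f \<in> Cc0 M (\<pi> ` U) \<Longrightarrow> g \<in> Cc0 M (\<pi> ` U) \<Longrightarrow> D U (\<lambda>y. f y + g y) - D U f - D U g \<in> N"
    and Dres: "\<And>U V f. el U \<Longrightarrow> el V \<Longrightarrow> V \<subseteq> U \<Longrightarrow> f \<in> Cc0 M (\<pi> ` V) \<Longrightarrow> D U f - D V f \<in> N"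
    and L: "valid L" "valid L'" "sect (lsum L) = sect (lsum L')"
  shows "(\<Sum>(U, f)\<leftarrow>L. D U f) - (\<Sum>(U, f)\<leftarrow>L'. D U f) \<in> N"
proof -
  have Nm: "- s \<in> N" if "s \<in> N" for s using Nd[OF N0 that] by simp
  have Na: "s + t \<in> N" if "s \<in> N" "t \<in> N" for s t using Nd[OF that(1) Nm[OF that(2)]] by simp
  define neg where "neg = map (\<lambda>(U, f). (U :: 'p set, \<lambda>y :: 'x. - (f y :: 'k)))"
  have vneg: "valid (neg L')" using L(2) unfolding neg_def by (induction L') (auto intro: Cc0_minus)
  have lneg: "lsum (neg L') p y = - lsum L' p y" for p y unfolding neg_def by (induction L') auto
  have "sect (lsum (L @ neg L')) = sect (\<lambda>_ _. 0)"
    unfolding sect_eq_iff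
  proof
    fix p assume "p \<in> pts P"
    then have "germ XM (\<pi> p) (lsum L p) = germ XM (\<pi> p) (lsum L' p)" using L(3) sect_eq_iff by blast
    from germ_binop[OF this refl, of "\<lambda>a b. a - b" "lsum L' p"]
    show "germ XM (\<pi> p) (lsum (L @ neg L') p) = germ XM (\<pi> p) (\<lambda>_. 0)" by (simp add: lsum_append lneg)
  qed
  then have "(\<Sum>(U, f)\<leftarrow>L @ neg L'. D U f) \<in> N"
    by (intro lsum_zero_null[where D = D and N = N]) (assumption | rule N0 Nd Dadd Dres | simp only: valid_simps L vneg)+
  \<comment> \<open>\<open>D\<close> is odd only modulo \<open>N\<close>, so negating the entries
    negates the sum only up to \<open>N\<close>.\<close>
  moreover have "(\<Sum>(U, f)\<leftarrow>neg L'. D U f) + (\<Sum>(U, f)\<leftarrow>L'. D U f) \<in> N"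
    using L(2)
  proof (induction L')
    case (Cons a L')
    obtain U f where a: "a = (U, f)" by force
    have U: "el U" "f \<in> Cc0 M (\<pi> ` U)" using Cons.prems a by auto
    have "D U (\<lambda>y. f y + - f y) - D U f - D U (\<lambda>y. - f y) \<in> N" by (rule Dadd) (use U in \<open>auto intro: Cc0_minus\<close>)
    moreover have "D U (\<lambda>_. 0) \<in> N" using Nm[OF Dadd[OF U(1) Cc0_zero Cc0_zero]] by simp
    ultimately have "D U (\<lambda>y. - f y) + D U f \<in> N"
      using Nd[of "D U (\<lambda>_. 0)" "D U (\<lambda>y. f y + - f y) - D U f - D U (\<lambda>y. - f y)"] by (simp add: algebra_simps)
    moreover have "(\<Sum>(U, f)\<leftarrow>neg L'. D U f) + (\<Sum>(U, f)\<leftarrow>L'. D U f) \<in> N" using Cons a by simp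
    ultimately have "(D U (\<lambda>y. - f y) + D U f) + ((\<Sum>(U, f)\<leftarrow>neg L'. D U f) + (\<Sum>(U, f)\<leftarrow>L'. D U f)) \<in> N" by (rule Na)
    then show ?case by (simp add: a neg_def add_ac)
  qed (simp add: N0 neg_def)
  ultimately show ?thesis using Nd by fastforce
qed

end

section \<open>Tensor squares\<close>

lemma tensor_null_uminus: "t \<in> tensor_null C \<Longrightarrow> - t \<in> tensor_null C"
  using tensor_null.diff[OF tensor_null.zero, of t C] by simp

lemma tensor_null_add: "s \<in> tensor_null C \<Longrightarrow> t \<in> tensor_null C \<Longrightarrow> s + t \<in> tensor_null C"
  using tensor_null.diff[OF _ tensor_null_uminus, of s C t] by simp

lemma tensor_null_trans: "s - t \<in> tensor_null C \<Longrightarrow> t - u \<in> tensor_null C \<Longrightarrow> s - u \<in> tensor_null C"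
  using tensor_null_add[of "s - t" C "t - u"] by simp

lemma tensor_null_sym: "s - t \<in> tensor_null C \<Longrightarrow> t - s \<in> tensor_null C"
  using tensor_null_uminus[of "s - t" C] by simp

lemma tensor_class_self: "t \<in> tensor_class C t"
  by (simp add: tensor_class_def tensor_null.zero)

lemma tensor_class_eq_iff: "tensor_class C s = tensor_class C t \<longleftrightarrow> s - t \<in> tensor_null C"
proof
  assume "tensor_class C s = tensor_class C t"
  then have "s \<in> tensor_class C t" using tensor_class_self by blast
  then show "s - t \<in> tensor_null C" by (simp add: tensor_class_def)
next
  assume "s - t \<in> tensor_null C"
  then show "tensor_class C s = tensor_class C t"
    unfolding tensor_class_def using tensor_null_trans tensor_null_sym by blast
qed

text \<open>The condition defining \<open>Cc_comult\<close> adds cosets elementwise; this identifies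
  the result with a single coset.\<close>

lemma tensor_class_add: "{s + t |s t. s \<in> tensor_class C a \<and> t \<in> tensor_class C b} = tensor_class C (a + b)"
proof
  show "{s + t |s t. s \<in> tensor_class C a \<and> t \<in> tensor_class C b} \<subseteq> tensor_class C (a + b)"
  proof
    fix r assume "r \<in> {s + t |s t. s \<in> tensor_class C a \<and> t \<in> tensor_class C b}"
    then obtain s t where "r = s + t" "s - a \<in> tensor_null C" "t - b \<in> tensor_null C"
      unfolding tensor_class_def by blast
    then show "r \<in> tensor_class C (a + b)"
      using tensor_null_add[of "s - a" C "t - b"] by (simp add: tensor_class_def algebra_simps)
  qed
  show "tensor_class C (a + b) \<subseteq> {s + t |s t. s \<in> tensor_class C a \<and> t \<in> tensor_class C b}"
  proof
    fix r assume "r \<in> tensor_class C (a + b)"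
    then have "r - a \<in> tensor_class C b" by (simp add: tensor_class_def algebra_simps)
    then show "r \<in> {s + t |s t. s \<in> tensor_class C a \<and> t \<in> tensor_class C b}"
      using tensor_class_self[of a C] by (intro CollectI exI[of _ a] exI[of _ "r - a"]) auto
  qed
qed

lemma tensor_null_subset:
  assumes "scal C = scal C'" "carr C = carr C'" "vadd C = vadd C'" "vsmul C = vsmul C'"
  shows "t \<in> tensor_null C \<Longrightarrow> t \<in> tensor_null C'"
proof (induction t rule: tensor_null.induct)
  case (diff s t)
  then show ?case using tensor_null.diff by blast
next
  case (add_left a b c)
  then show ?case using tensor_null.add_left[of a C' b c] assms by simp
next
  case (add_right a b c)
  then show ?case using tensor_null.add_right[of a C' b c] assms by simp
next
  case (balanced r a b)
  then show ?case using tensor_null.balanced[of r C' a b] assms by simp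
qed (rule tensor_null.zero)

text \<open>A coalgebra and its underlying module are records of different types, so their null
  tensors are compared through the four fields that enter.\<close>

lemma tensor_null_cong:
  assumes "scal C = scal C'" "carr C = carr C'" "vadd C = vadd C'" "vsmul C = vsmul C'"
  shows "tensor_null C = tensor_null C'"
  using tensor_null_subset[of C C'] tensor_null_subset[of C' C] assms by (metis subsetI subset_antisym)

text \<open>Applied to products of germs at two points, this evaluation vanishes on the null tensors.\<close>

definition frag_eval :: "('a \<Rightarrow> 'x \<Rightarrow> 'k::comm_ring_1) \<Rightarrow> ('a \<Rightarrow>\<^sub>0 int) \<Rightarrow> 'x \<Rightarrow> 'k" where
  "frag_eval w t y = (\<Sum>k\<in>Poly_Mapping.keys t. of_int (Poly_Mapping.lookup t k) * w k y)"

lemma frag_eval_superset: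
  assumes "finite S" "Poly_Mapping.keys t \<subseteq> S"
  shows "frag_eval w t y = (\<Sum>k\<in>S. of_int (Poly_Mapping.lookup t k) * w k y)"
  unfolding frag_eval_def using assms by (intro sum.mono_neutral_left) (auto simp: in_keys_iff)

lemma frag_eval_diff: "frag_eval w (s - t) y = frag_eval w s y - frag_eval w t y"
proof -
  let ?S = "Poly_Mapping.keys s \<union> Poly_Mapping.keys t"
  have "Poly_Mapping.keys (s - t) \<subseteq> ?S" by (auto simp: in_keys_iff lookup_minus)
  then show ?thesis
    by (simp add: frag_eval_superset[of ?S] lookup_minus sum_subtractf left_diff_distrib)
qed

lemma frag_eval_zero: "frag_eval w 0 y = 0"
  by (simp add: frag_eval_def)

lemma frag_eval_add: "frag_eval w (s + t) y = frag_eval w s y + frag_eval w t y"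
  using frag_eval_diff[of w s "0 - t" y] frag_eval_diff[of w 0 t y] by (simp add: frag_eval_zero)

lemma frag_eval_of: "frag_eval w (frag_of k) y = w k y"
  by (simp add: frag_eval_def)

lemma germ_zero_iff: "germ X x (\<lambda>y. f y - g y) = germ X x (\<lambda>_. 0 :: 'k::ab_group_add) \<longleftrightarrow> germ X x f = germ X x g"
proof
  assume "germ X x (\<lambda>y. f y - g y) = germ X x (\<lambda>_. 0)"
  from germ_binop[OF this refl, of "(+)" g] show "germ X x f = germ X x g" by simp
next
  assume "germ X x f = germ X x g"
  from germ_binop[OF this refl, of "(-)" g] show "germ X x (\<lambda>y. f y - g y) = germ X x (\<lambda>_. 0)" by simp
qed

text \<open>Both maps are additive and acquire the same scalar factor \<open>sc r\<close>, and
  multiplication is commutative, so a scalar passes from one tensor factor to the other without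
  changing the product. Only germs at \<open>x\<close> are compared, because \<open>e1\<close> and
  \<open>e2\<close> will be arbitrary representatives of germs.\<close>

lemma frag_eval_null:
  fixes C :: "('r, 'c, 'z) rmodule_scheme" and e1 e2 :: "'c \<Rightarrow> 'x \<Rightarrow> 'k::comm_ring_1"
  assumes add: "\<And>a b. a \<in> carr C \<Longrightarrow> b \<in> carr C \<Longrightarrow> germ X x (e1 (vadd C a b)) = germ X x (\<lambda>y. e1 a y + e1 b y)"
      "\<And>a b. a \<in> carr C \<Longrightarrow> b \<in> carr C \<Longrightarrow> germ X x (e2 (vadd C a b)) = germ X x (\<lambda>y. e2 a y + e2 b y)"
    and smul: "\<And>r a. r \<in> scal C \<Longrightarrow> a \<in> carr C \<Longrightarrow> germ X x (e1 (vsmul C r a)) = germ X x (\<lambda>y. sc r y * e1 a y)"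
      "\<And>r a. r \<in> scal C \<Longrightarrow> a \<in> carr C \<Longrightarrow> germ X x (e2 (vsmul C r a)) = germ X x (\<lambda>y. sc r y * e2 a y)"
  shows "t \<in> tensor_null C \<Longrightarrow> germ X x (frag_eval (\<lambda>(a, b) y. e1 a y * e2 b y) t) = germ X x (\<lambda>_. 0)"
proof (induction t rule: tensor_null.induct)
  case zero
  show ?case by (simp add: frag_eval_zero[abs_def])
next
  case (diff s t)
  from germ_binop[OF diff.IH, of "(-)"] show ?case by (simp add: frag_eval_diff[abs_def])
next
  case (add_left a b c)
  from germ_binop[OF add(1)[OF add_left(1,2)] refl, of times "e2 c"]
  have "germ X x (\<lambda>y. e1 (vadd C a b) y * e2 c y) = germ X x (\<lambda>y. e1 a y * e2 c y + e1 b y * e2 c y)"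
    by (simp add: distrib_right)
  then show ?case
    unfolding frag_eval_diff[abs_def] frag_eval_of by (simp add: diff_diff_eq germ_zero_iff)
next
  case (add_right a b c)
  from germ_binop[OF add(2)[OF add_right(2,3)] refl, of "\<lambda>u v. v * u" "e1 a"]
  have "germ X x (\<lambda>y. e1 a y * e2 (vadd C b c) y) = germ X x (\<lambda>y. e1 a y * e2 b y + e1 a y * e2 c y)"
    by (simp add: distrib_left)
  then show ?case
    unfolding frag_eval_diff[abs_def] frag_eval_of by (simp add: diff_diff_eq germ_zero_iff)
next
  case (balanced r a b)
  have "germ X x (\<lambda>y. e1 (vsmul C r a) y * e2 b y) = germ X x (\<lambda>y. (sc r y * e1 a y) * e2 b y)"
    using germ_binop[OF smul(1)[OF balanced(1,2)] refl, of times "e2 b"] .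
  also have "\<dots> = germ X x (\<lambda>y. e1 a y * (sc r y * e2 b y))" by (simp add: mult_ac)
  also have "\<dots> = germ X x (\<lambda>y. e1 a y * e2 (vsmul C r b) y)"
    using germ_binop[OF refl smul(2)[OF balanced(1,3)], of times "e1 a"] by simp
  finally show ?case
    unfolding frag_eval_diff[abs_def] frag_eval_of by (simp add: germ_zero_iff)
qed

context etale_space begin

section \<open>Counit and comultiplication\<close>

lemma Cc_module_simps [simp]:
  "scal cmodl = Cc0 M (pts M)" "carr cmodl = Cc P"
  "vadd cmodl = sec_add XP" "vzero cmodl = sect (\<lambda>_ _. 0)"
  by (simp_all add: Cc_module_def sect_zero)

lemma Cc_coalgebra_simps [simp]:
  "scal coalg = Cc0 M (pts M)" "carr coalg = Cc P"
  "vadd coalg = sec_add XP" "vzero coalg = sect (\<lambda>_ _. 0)"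
  "vsmul coalg = vsmul cmodl"
  "comul coalg = Cc_comult M P \<pi>" "cou coalg = Cc_counit M P \<pi>"
  by (simp_all add: Cc_coalgebra_def rmodule.extend_def coalgebra.fields_def)

lemma tensor_null_Cc: "tensor_null coalg = tensor_null cmodl"
  by (rule tensor_null_cong) simp_all

lemma tensor_class_Cc: "tensor_class coalg = tensor_class cmodl"
  by (simp add: tensor_class_def[abs_def] tensor_null_Cc)

lemma vsmul_sect: "vsmul cmodl r (sect h) = sect (\<lambda>p y. r y * h p y)"
proof
  fix p
  have "sect h p = germ XP p (\<lambda>q. h p (\<pi> q))" by (simp add: sect_def)
  from germ_Union1[OF this, of "\<lambda>q v. r (\<pi> q) * v"]
  show "vsmul cmodl r (sect h) p = sect (\<lambda>p y. r y * h p y) p"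
    by (simp add: Cc_module_def sect_def)
qed

lemma vsmul_elem: "vsmul cmodl r (elem U f) = elem U (\<lambda>y. r y * f y)"
  unfolding elem_fun_sect vsmul_sect sect_eq_iff by (auto intro!: arg_cong[where f = "germ _ _"] simp: fun_eq_iff)

lemma sec_add_elem:
  fixes f g :: "'x \<Rightarrow> 'k::real_normed_field"
  shows "sec_add XP (elem U f) (elem U g) = elem U (\<lambda>y. f y + g y)"
  unfolding elem_fun_sect sec_add_sect sect_eq_iff by (auto intro!: arg_cong[where f = "germ _ _"] simp: fun_eq_iff)

definition smul_list :: "('x \<Rightarrow> 'k::real_normed_field) \<Rightarrow> ('p set \<times> ('x \<Rightarrow> 'k)) list \<Rightarrow> ('p set \<times> ('x \<Rightarrow> 'k)) list" where
  "smul_list r L = map (\<lambda>(U, f). (U, \<lambda>y. r y * f y)) L"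

lemma valid_smul_list: "valid L \<Longrightarrow> smooth_function M (pts M) r \<Longrightarrow> valid (smul_list r L)"
  unfolding smul_list_def by (induction L) (auto intro: Cc0_mult(2))

lemma lsum_smul_list: "lsum (smul_list r L) p y = r y * lsum L p y"
  unfolding smul_list_def by (induction L) (auto simp: distrib_left)

lemma vsmul_lsum: "vsmul cmodl r (sect (lsum L)) = sect (lsum (smul_list r L))"
  unfolding vsmul_sect by (simp add: lsum_smul_list[abs_def] del: lsum_simps)

lemma vsmul_Cc: "r \<in> Cc0 M W \<Longrightarrow> c \<in> Cc P \<Longrightarrow> vsmul cmodl r c \<in> Cc P"
  using Cc_lists[of c] vsmul_lsum sect_lsum_Cc valid_smul_list Cc0_smooth by metis

definition rep :: "('p, 'k::real_normed_field) germ_section \<Rightarrow> ('p set \<times> ('x \<Rightarrow> 'k)) list" where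
  "rep c = (SOME L. valid L \<and> c = sect (lsum L))"

lemma rep:
  assumes "c \<in> Cc P"
  shows "valid (rep c)" "sect (lsum (rep c)) = c"
proof -
  have "valid (rep c) \<and> c = sect (lsum (rep c))"
    unfolding rep_def by (rule someI_ex[OF Cc_lists[OF assms]])
  then show "valid (rep c)" "sect (lsum (rep c)) = c" by simp_all
qed

lemma total_unique:
  assumes "valid L" "valid L'" "sect (lsum L) = sect (lsum L')"
  shows "total L = total L'"
proof
  fix x
  have "(\<Sum>(U, f)\<leftarrow>L. f x) - (\<Sum>(U, f)\<leftarrow>L'. f x) \<in> {0}"
    by (rule lsum_eq_null[where D = "\<lambda>U f. f x", OF _ _ _ _ assms]) auto
  then show "total L x = total L' x" by (simp add: total_def)
qed

text \<open>\<open>SOME\<close> gives information only once a map with the required properties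
  exists; \<open>total\<close> of a chosen formal sum is one, by \<open>total_unique\<close>. The
  defining conditions then determine every value by induction on the list.\<close>

lemma counit_lsum:
  fixes L :: "('p set \<times> ('x \<Rightarrow> 'k::real_normed_field)) list"
  assumes "valid L"
  shows "Cc_counit M P \<pi> (sect (lsum L)) = total L"
proof -
  define \<epsilon>0 :: "('p, 'k) germ_section \<Rightarrow> 'x \<Rightarrow> 'k" where
    "\<epsilon>0 c = total (rep c)" for c
  have \<epsilon>0: "\<epsilon>0 (sect (lsum L)) = total L" if "valid L" for L
    unfolding \<epsilon>0_def by (rule total_unique[OF rep(1) that rep(2)]; rule sect_lsum_Cc[OF that])
  let ?spec = "\<lambda>\<epsilon> :: ('p, 'k) germ_section \<Rightarrow> 'x \<Rightarrow> 'k.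
     (\<forall>c\<in>Cc P. \<forall>d\<in>Cc P. \<epsilon> (sec_add (mtop P) c d) = (\<lambda>x. \<epsilon> c x + \<epsilon> d x)) \<and>
     (\<forall>U f0. elementary P \<pi> U \<and> f0 \<in> Cc0 M (\<pi> ` U) \<longrightarrow> \<epsilon> (elem U f0) = f0)"
  have "?spec \<epsilon>0"
  proof (intro conjI ballI allI impI)
    fix c d :: "('p, 'k) germ_section" assume cd: "c \<in> Cc P" "d \<in> Cc P"
    obtain L where L1: "valid L" "c = sect (lsum L)" using Cc_lists[OF cd(1)] by (elim exE conjE)
    obtain L' where L2: "valid L'" "d = sect (lsum L')" using Cc_lists[OF cd(2)] by (elim exE conjE)
    note L = L1 L2
    show "\<epsilon>0 (sec_add (mtop P) c d) = (\<lambda>x. \<epsilon>0 c x + \<epsilon>0 d x)"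
      unfolding L(2,4) sec_add_lsum using L \<epsilon>0[of "L @ L'"] \<epsilon>0[of L] \<epsilon>0[of L'] by (simp add: total_def fun_eq_iff)
  next
    fix U and f0 :: "'x \<Rightarrow> 'k" assume "elementary P \<pi> U \<and> f0 \<in> Cc0 M (\<pi> ` U)"
    then show "\<epsilon>0 (elem U f0) = f0"
      unfolding elem_fun_lsum using \<epsilon>0[of "[(U, f0)]"] by (simp add: total_def fun_eq_iff)
  qed
  then have spec: "?spec (Cc_counit M P \<pi>)" unfolding Cc_counit_def by (rule someI[of ?spec])
  show ?thesis using assms
  proof (induction L)
    case Nil
    have "Cc_counit M P \<pi> (elem {} (\<lambda>_. 0)) = (\<lambda>_. 0 :: 'k)" using spec el_empty Cc0_zero[of "\<pi> ` {}"] by blast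
    moreover have "elem {} (\<lambda>_. 0) = sect (lsum ([] :: ('p set \<times> ('x \<Rightarrow> 'k)) list))" by (simp add: elem_fun_sect sect_def)
    ultimately show ?case by (simp add: total_def[abs_def] del: lsum_simps)
  next
    case (Cons a L)
    obtain U f where a: "a = (U, f)" by force
    have U: "el U" "f \<in> Cc0 M (\<pi> ` U)" "valid L" using Cons.prems a by auto
    have "sect (lsum (a # L)) = sec_add XP (elem U f) (sect (lsum L))"
      unfolding elem_fun_lsum sec_add_lsum a by (simp only: append.simps)
    moreover have "Cc_counit M P \<pi> (sec_add XP (elem U f) (sect (lsum L))) =
       (\<lambda>x. Cc_counit M P \<pi> (elem U f) x + Cc_counit M P \<pi> (sect (lsum L)) x)"
      using spec elem_fun_Cc[OF U(1,2)] sect_lsum_Cc[OF U(3)] by blast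
    moreover have "Cc_counit M P \<pi> (elem U f) = f" using spec U by blast
    ultimately show ?case using Cons.IH[OF U(3)] by (simp only:) (simp add: a total_def fun_eq_iff)
  qed
qed

lemma counit_elem: "el U \<Longrightarrow> f \<in> Cc0 M (\<pi> ` U) \<Longrightarrow> Cc_counit M P \<pi> (elem U f) = f"
  unfolding elem_fun_lsum by (subst counit_lsum) (simp_all add: total_def fun_eq_iff)

definition unit_of :: "'p set \<Rightarrow> ('x \<Rightarrow> 'k::real_normed_field) \<Rightarrow> 'x \<Rightarrow> 'k" where
  "unit_of U f = (SOME u. u \<in> Cc0 M (\<pi> ` U) \<and> (\<forall>y. u y * f y = f y))"

lemma unit_of:
  assumes "el U" "f \<in> Cc0 M (\<pi> ` U)"
  shows "unit_of U f \<in> Cc0 M (\<pi> ` U)" "unit_of U f y * f y = f y"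
proof -
  have "\<exists>u. u \<in> Cc0 M (\<pi> ` U) \<and> (\<forall>y. u y * f y = f y)"
    using Cc0_unit_of[OF assms(2,2) el_image_open[OF assms(1)]] by blast
  then have "unit_of U f \<in> Cc0 M (\<pi> ` U) \<and> (\<forall>y. unit_of U f y * f y = f y)"
    unfolding unit_of_def by (rule someI_ex)
  then show "unit_of U f \<in> Cc0 M (\<pi> ` U)" "unit_of U f y * f y = f y" by auto
qed

text \<open>A representative of the coproduct with one local unit fixed; by \<open>dcop_unit\<close>
  another unit changes it by a null tensor.\<close>

definition dcop :: "'p set \<Rightarrow> ('x \<Rightarrow> 'k::real_normed_field) \<Rightarrow> (('p, 'k) germ_section \<times> ('p, 'k) germ_section \<Rightarrow>\<^sub>0 int)" where
  "dcop U f = frag_of (elem U f, elem U (unit_of U f))"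

text \<open>Two units are compared through their product: if \<open>w\<close> acts as 1 on
  \<open>f\<close>, moving \<open>w\<close> across the tensor replaces the unit \<open>v\<close> in
  the second factor by \<open>w\<close> times \<open>v\<close>.\<close>

lemma dcop_unit:
  assumes U: "el U" and f: "f \<in> Cc0 M (\<pi> ` U)" and u: "u \<in> Cc0 M (\<pi> ` U)" "\<And>y. u y * f y = f y"
  shows "dcop U f - frag_of (elem U f, elem U u) \<in> tensor_null cmodl"
proof -
  have *: "frag_of (elem U f, elem U v) - frag_of (elem U f, elem U (\<lambda>y. w y * v y)) \<in> tensor_null cmodl"
    if w: "w \<in> Cc0 M (\<pi> ` U)" "\<And>y. w y * f y = f y" and v: "v \<in> Cc0 M (\<pi> ` U)" for v w
    using tensor_null.balanced[of w "cmodl" "elem U f" "elem U v"]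
      Cc0_pts[OF w(1)] elem_fun_Cc[OF U f] elem_fun_Cc[OF U v] by (simp add: vsmul_elem w(2))
  note n = unit_of[OF U f]
  have "frag_of (elem U f, elem U u) - frag_of (elem U f, elem U (\<lambda>y. u y * unit_of U f y)) \<in> tensor_null cmodl"
    using *[OF n u(1)] by (simp add: mult.commute)
  from tensor_null_trans[OF *[OF u n(1)] tensor_null_sym[OF this]] show ?thesis by (simp add: dcop_def)
qed

text \<open>A unit that works for both \<open>f\<close> and \<open>g\<close> gives all three
  coproducts the same second factor.\<close>

lemma dcop_add:
  assumes U: "el U" and f: "f \<in> Cc0 M (\<pi> ` U)" and g: "g \<in> Cc0 M (\<pi> ` U)"
  shows "dcop U (\<lambda>y. f y + g y) - dcop U f - dcop U g \<in> tensor_null cmodl"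
proof -
  obtain u where u: "u \<in> Cc0 M (\<pi> ` U)" "\<And>y. u y * f y = f y" "\<And>y. u y * g y = g y"
    using Cc0_unit_of[OF f g el_image_open[OF U]] by blast
  let ?e = "elem U"
  have fg: "(\<lambda>y. f y + g y) \<in> Cc0 M (\<pi> ` U)" by (rule Cc0_add[OF f g])
  have 1: "dcop U (\<lambda>y. f y + g y) - frag_of (?e (\<lambda>y. f y + g y), ?e u) \<in> tensor_null cmodl"
    by (rule dcop_unit[OF U fg u(1)]) (simp add: distrib_left u)
  have 2: "frag_of (?e (\<lambda>y. f y + g y), ?e u) - frag_of (?e f, ?e u) - frag_of (?e g, ?e u) \<in> tensor_null cmodl"
    using tensor_null.add_left[of "?e f" "cmodl" "?e g" "?e u"]
      elem_fun_Cc[OF U f] elem_fun_Cc[OF U g] elem_fun_Cc[OF U u(1)]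
    by (simp add: sec_add_elem)
  have 3: "dcop U f - frag_of (?e f, ?e u) \<in> tensor_null cmodl" by (rule dcop_unit[OF U f u(1,2)])
  have 4: "dcop U g - frag_of (?e g, ?e u) \<in> tensor_null cmodl" by (rule dcop_unit[OF U g u(1,3)])
  from tensor_null.diff[OF tensor_null.diff[OF tensor_null_add[OF 1 2] 3] 4] show ?thesis by (simp add: algebra_simps)
qed

text \<open>At a point of \<open>U\<close> outside \<open>V\<close> the base point lies outside the
  image of \<open>V\<close> by injectivity, and \<open>f\<close> vanishes near it since its support
  is closed in the Hausdorff base.\<close>

lemma elem_fun_restrict:
  assumes "el U" "el V" "V \<subseteq> U" "f \<in> Cc0 M (\<pi> ` V)"
  shows "elem U f = elem V f"
  unfolding elem_fun_sect sect_eq_iff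
proof
  fix p assume p: "p \<in> pts P"
  show "germ XM (\<pi> p) (if p \<in> U then f else (\<lambda>_. 0)) = germ XM (\<pi> p) (if p \<in> V then f else (\<lambda>_. 0))"
  proof (cases "p \<in> U \<and> p \<notin> V")
    case True
    then have "\<pi> p \<notin> \<pi> ` V" using el_injD[OF assms(1), of p] assms(3) by blast
    obtain K where K: "compactin XM K" "K \<subseteq> \<pi> ` V" "\<forall>y. y \<notin> K \<longrightarrow> f y = 0" using assms(4) unfolding Cc0_def by blast
    have "germ XM (\<pi> p) f = germ XM (\<pi> p) (\<lambda>_. 0)"
      by (rule germ_eqI[OF compact_openin_diff[OF K(1)]]) (use K \<open>\<pi> p \<notin> \<pi> ` V\<close> pi_pts[OF p] in auto)
    then show ?thesis using True by simp
  qed (use assms(3) in auto)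
qed

lemma dcop_restrict:
  assumes U: "el U" and V: "el V" "V \<subseteq> U" and f: "f \<in> Cc0 M (\<pi> ` V)"
  shows "dcop U f - dcop V f \<in> tensor_null cmodl"
proof -
  note n = unit_of[OF V(1) f]
  have VU: "\<pi> ` V \<subseteq> \<pi> ` U" using V(2) by blast
  have "dcop U f - frag_of (elem U f, elem U (unit_of V f)) \<in> tensor_null cmodl"
    by (rule dcop_unit[OF U Cc0_mono[OF f VU] Cc0_mono[OF n(1) VU] n(2)])
  then show ?thesis using elem_fun_restrict[OF U V f] elem_fun_restrict[OF U V n(1)] by (simp add: dcop_def)
qed

lemma dcop_unique:
  assumes "valid L" "valid L'" "sect (lsum L) = sect (lsum L')"
  shows "(\<Sum>(U, f)\<leftarrow>L. dcop U f) - (\<Sum>(U, f)\<leftarrow>L'. dcop U f) \<in> tensor_null cmodl"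
  by (rule lsum_eq_null[where D = dcop, OF tensor_null.zero tensor_null.diff dcop_add dcop_restrict assms])

lemma comult_lsum:
  fixes L :: "('p set \<times> ('x \<Rightarrow> 'k::real_normed_field)) list"
  assumes "valid L"
  shows "Cc_comult M P \<pi> (sect (lsum L)) = tensor_class cmodl (\<Sum>(U, f)\<leftarrow>L. dcop U f)"
proof -
  let ?C = "cmodl :: ('x \<Rightarrow> 'k, ('p, 'k) germ_section) rmodule"
  \<comment> \<open>A witness for the choice behind \<open>Cc_comult\<close>; independence of the
    chosen formal sum is \<open>dcop_unique\<close>.\<close>
  define \<Delta>0 :: "('p, 'k) germ_section \<Rightarrow> (('p, 'k) germ_section \<times> ('p, 'k) germ_section \<Rightarrow>\<^sub>0 int) set" where
    "\<Delta>0 c = tensor_class ?C (\<Sum>(U, f)\<leftarrow>rep c. dcop U f)" for c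
  have \<Delta>0: "\<Delta>0 (sect (lsum L)) = tensor_class ?C (\<Sum>(U, f)\<leftarrow>L. dcop U f)" if "valid L" for L
    unfolding \<Delta>0_def tensor_class_eq_iff by (rule dcop_unique[OF rep(1) that rep(2)]; rule sect_lsum_Cc[OF that])
  let ?spec = "\<lambda>\<Delta> :: ('p, 'k) germ_section \<Rightarrow> (('p, 'k) germ_section \<times> ('p, 'k) germ_section \<Rightarrow>\<^sub>0 int) set.
     (\<forall>c\<in>Cc P. \<forall>d\<in>Cc P. \<Delta> (sec_add (mtop P) c d) = {s + t | s t. s \<in> \<Delta> c \<and> t \<in> \<Delta> d}) \<and>
     (\<forall>U f0 u0. elementary P \<pi> U \<and> f0 \<in> Cc0 M (\<pi> ` U) \<and> u0 \<in> Cc0 M (\<pi> ` U) \<and> (\<forall>x. u0 x * f0 x = f0 x) \<longrightarrow>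
        \<Delta> (elem U f0) = tensor cmodl (elem U f0) (elem U u0))"
  have "?spec \<Delta>0"
  proof (intro conjI ballI allI impI)
    fix c d :: "('p, 'k) germ_section" assume cd: "c \<in> Cc P" "d \<in> Cc P"
    obtain L where L1: "valid L" "c = sect (lsum L)" using Cc_lists[OF cd(1)] by (elim exE conjE)
    obtain L' where L2: "valid L'" "d = sect (lsum L')" using Cc_lists[OF cd(2)] by (elim exE conjE)
    note L = L1 L2
    show "\<Delta>0 (sec_add (mtop P) c d) = {s + t | s t. s \<in> \<Delta>0 c \<and> t \<in> \<Delta>0 d}"
      unfolding L(2,4) sec_add_lsum using L \<Delta>0[of "L @ L'"] \<Delta>0[of L] \<Delta>0[of L'] by (simp add: tensor_class_add del: lsum_simps)
  next
    fix U and f0 u0 :: "'x \<Rightarrow> 'k"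
    assume "elementary P \<pi> U \<and> f0 \<in> Cc0 M (\<pi> ` U) \<and> u0 \<in> Cc0 M (\<pi> ` U) \<and> (\<forall>x. u0 x * f0 x = f0 x)"
    then have A: "el U" "f0 \<in> Cc0 M (\<pi> ` U)" "u0 \<in> Cc0 M (\<pi> ` U)" "\<And>x. u0 x * f0 x = f0 x" by auto
    have "\<Delta>0 (elem U f0) = tensor_class ?C (dcop U f0)"
      unfolding elem_fun_lsum using \<Delta>0[of "[(U, f0)]"] A by (simp del: lsum_simps)
    also have "\<dots> = tensor ?C (elem U f0) (elem U u0)"
      unfolding tensor_def tensor_class_eq_iff by (rule dcop_unit[OF A])
    finally show "\<Delta>0 (elem U f0) = tensor cmodl (elem U f0) (elem U u0)" .
  qed
  then have spec: "?spec (Cc_comult M P \<pi>)" unfolding Cc_comult_def by (rule someI[of ?spec])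
  have gen: "Cc_comult M P \<pi> (elem U f) = tensor_class ?C (dcop U f)" if "el U" "f \<in> Cc0 M (\<pi> ` U)" for U f
    using spec that unit_of[OF that] unfolding dcop_def tensor_def by blast
  show ?thesis using assms
  proof (induction L)
    case Nil
    have z: "(\<lambda>_. 0 :: 'k) \<in> Cc0 M (\<pi> ` {})" by (rule Cc0_zero)
    have "Cc_comult M P \<pi> (elem {} (\<lambda>_. 0)) = tensor_class ?C (dcop {} (\<lambda>_. 0))" by (rule gen[OF el_empty z])
    also have "\<dots> = tensor_class ?C 0"
      unfolding tensor_class_eq_iff using tensor_null_uminus[OF dcop_add[OF el_empty z z]] by simp
    finally show ?case by (simp add: elem_fun_sect sect_def)
  next
    case (Cons a L)
    obtain U f where a: "a = (U, f)" by force
    have U: "el U" "f \<in> Cc0 M (\<pi> ` U)" "valid L" using Cons.prems a by auto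
    have "sect (lsum (a # L)) = sec_add XP (elem U f) (sect (lsum L))"
      unfolding elem_fun_lsum sec_add_lsum a by (simp only: append.simps)
    moreover have "Cc_comult M P \<pi> (sec_add XP (elem U f) (sect (lsum L))) =
       {s + t | s t. s \<in> Cc_comult M P \<pi> (elem U f) \<and> t \<in> Cc_comult M P \<pi> (sect (lsum L))}"
      using spec elem_fun_Cc[OF U(1,2)] sect_lsum_Cc[OF U(3)] by blast
    ultimately show ?case
      using Cons.IH[OF U(3)] gen[OF U(1,2)] by (simp add: a tensor_class_add del: lsum_simps)
  qed
qed

lemma comult_elem:
  assumes "el U" "f \<in> Cc0 M (\<pi> ` U)" "u \<in> Cc0 M (\<pi> ` U)" "\<And>y. u y * f y = f y"
  shows "Cc_comult M P \<pi> (elem U f) = tensor coalg (elem U f) (elem U u)"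
proof -
  have "Cc_comult M P \<pi> (elem U f) = tensor_class cmodl (dcop U f)"
    unfolding elem_fun_lsum using comult_lsum[of "[(U, f)]"] assms by (simp del: lsum_simps)
  then show ?thesis
    unfolding tensor_def tensor_class_Cc by (simp add: tensor_class_eq_iff dcop_unit[OF assms])
qed


section \<open>Localisation at a point\<close>

text \<open>The germs of a section transferred to the base. The function \<open>bg c p\<close>
  depends on the chosen formal sum; only its germ at \<open>\<pi> p\<close> has a meaning.\<close>

definition bg :: "('p, 'k::real_normed_field) germ_section \<Rightarrow> 'p \<Rightarrow> 'x \<Rightarrow> 'k" where
  "bg c = lsum (rep c)"

lemma sect_bg: "c \<in> Cc P \<Longrightarrow> sect (bg c) = c"
  unfolding bg_def by (rule rep(2))

lemma bg_Cc0: "c \<in> Cc P \<Longrightarrow> bg c p \<in> Cc0 M (pts M)"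
  unfolding bg_def by (rule lsum_Cc0[OF rep(1)])

lemma bg_sect: "sect h \<in> Cc P \<Longrightarrow> p \<in> pts P \<Longrightarrow> germ XM (\<pi> p) (bg (sect h) p) = germ XM (\<pi> p) (h p)"
  using sect_at_eq_iff sect_bg by metis

lemma germ_bg_eq_iff: "c \<in> Cc P \<Longrightarrow> d \<in> Cc P \<Longrightarrow> p \<in> pts P \<Longrightarrow> germ XM (\<pi> p) (bg c p) = germ XM (\<pi> p) (bg d p) \<longleftrightarrow> c p = d p"
  using sect_at_eq_iff sect_bg by metis

lemma germ_bg_const_iff: "c \<in> Cc P \<Longrightarrow> p \<in> pts P \<Longrightarrow> germ XM (\<pi> p) (bg c p) = germ XM (\<pi> p) (\<lambda>_. a) \<longleftrightarrow> c p = germ XP p (\<lambda>_. a)"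
  using sect_const_iff sect_bg by metis

lemma germ_bg_add:
  assumes "c \<in> Cc P" "d \<in> Cc P" "p \<in> pts P"
  shows "germ XM (\<pi> p) (bg (sec_add XP c d) p) = germ XM (\<pi> p) (\<lambda>y. bg c p y + bg d p y)"
proof -
  have "sec_add XP c d = sect (\<lambda>p y. bg c p y + bg d p y)"
    using sec_add_sect[of "bg c" "bg d"] sect_bg assms by metis
  then show ?thesis using bg_sect[OF _ assms(3), of "\<lambda>p y. bg c p y + bg d p y"] Cc_add[OF assms(1,2)] by simp
qed

lemma germ_bg_smul:
  assumes "r \<in> Cc0 M W" "c \<in> Cc P" "p \<in> pts P"
  shows "germ XM (\<pi> p) (bg (vsmul cmodl r c) p) = germ XM (\<pi> p) (\<lambda>y. r y * bg c p y)"
proof -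
  have "vsmul cmodl r c = sect (\<lambda>p y. r y * bg c p y)"
    using vsmul_sect[of r "bg c"] sect_bg[OF assms(2)] by simp
  then show ?thesis using bg_sect[OF _ assms(3), of "\<lambda>p y. r y * bg c p y"] vsmul_Cc[OF assms(1,2)] by simp
qed

lemma Cc_difference:
  assumes "c \<in> Cc P" "d \<in> Cc P"
  obtains n where "n \<in> Cc P" "sec_add XP d n = c" "\<And>p. p \<in> pts P \<Longrightarrow> c p = d p \<Longrightarrow> n p = germ XP p (\<lambda>_. 0)"
proof
  let ?L = "rep c @ smul_list (\<lambda>_. -1) (rep d)"
  have "valid ?L" using rep(1)[OF assms(1)] valid_smul_list[OF rep(1)[OF assms(2)] smooth_function_const[OF M openin_topspace]] by simp
  then show "sect (lsum ?L) \<in> Cc P" by (rule sect_lsum_Cc)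
  have l: "lsum ?L = (\<lambda>p y. bg c p y - bg d p y)"
    unfolding lsum_append by (simp add: lsum_smul_list bg_def del: lsum_simps)
  have "sec_add XP (sect (bg d)) (sect (lsum ?L)) = sect (bg c)"
    unfolding sec_add_sect l by simp
  then show "sec_add XP d (sect (lsum ?L)) = c" unfolding sect_bg[OF assms(1)] sect_bg[OF assms(2)] .
  show "sect (lsum ?L) p = germ XP p (\<lambda>_. 0)" if p: "p \<in> pts P" "c p = d p" for p
    unfolding sect_const_iff[OF p(1)] unfolding l germ_zero_iff
    using germ_bg_eq_iff[OF assms p(1)] p(2) by blast
qed

text \<open>A scalar with germ 1 at \<open>x\<close> leaves all germs over \<open>x\<close>
  unchanged, which gives one implication. Conversely, \<open>vanish_near\<close> provides a
  neighbourhood over which \<open>c\<close> vanishes, and a bump supported there annihilates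
  \<open>c\<close>.\<close>

lemma null_at_iff:
  fixes c :: "('p, 'k::real_normed_field) germ_section"
  assumes x: "x \<in> pts M"
  shows "c \<in> null_at coalg XM x \<longleftrightarrow> c \<in> Cc P \<and> (\<forall>p\<in>pts P. \<pi> p = x \<longrightarrow> c p = germ XP p (\<lambda>_. 0))"
proof
  assume "c \<in> null_at coalg XM x"
  then obtain r where c: "c \<in> Cc P" and r: "r \<in> Cc0 M (pts M)" "germ XM x r = germ XM x (\<lambda>_. 1)"
    "vsmul cmodl r c = sect (\<lambda>_ _. 0)" unfolding null_at_def by auto
  have "c p = germ XP p (\<lambda>_. 0)" if p: "p \<in> pts P" "\<pi> p = x" for p
  proof -
    have "sect (\<lambda>p y. r y * bg c p y) = sect (\<lambda>_ _. 0)" using vsmul_sect[of r "bg c"] sect_bg[OF c] r(3) by simp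
    then have "germ XM x (\<lambda>y. r y * bg c p y) = germ XM x (\<lambda>_. 0)"
      using sect_at_eq_iff[OF p(1), of "\<lambda>p y. r y * bg c p y" "\<lambda>_ _. 0"] p(2) by simp
    moreover have "germ XM x (\<lambda>y. r y * bg c p y) = germ XM x (\<lambda>y. 1 * bg c p y)"
      using germ_binop[OF r(2) refl, of times "bg c p"] .
    ultimately show ?thesis using germ_bg_const_iff[OF c p(1), of 0] p(2) by simp
  qed
  then show "c \<in> Cc P \<and> (\<forall>p\<in>pts P. \<pi> p = x \<longrightarrow> c p = germ XP p (\<lambda>_. 0))" using c by blast
next
  assume c: "c \<in> Cc P \<and> (\<forall>p\<in>pts P. \<pi> p = x \<longrightarrow> c p = germ XP p (\<lambda>_. 0))"
  then obtain W where W: "openin XM W" "x \<in> W" "\<forall>p\<in>pts P. \<pi> p \<in> W \<longrightarrow> c p = germ XP p (\<lambda>_. 0)"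
    using vanish_near[of c x] x by blast
  obtain r :: "'x \<Rightarrow> 'k" and N where r: "r \<in> Cc0 M W" "openin XM N" "x \<in> N" "\<forall>y\<in>N. r y = 1"
    using Cc0_local_unit[OF W(1,2)] by blast
  have "germ XM x r = germ XM x (\<lambda>_. 1)" by (rule germ_eqI[OF r(2,3)]) (use r in auto)
  moreover have "vsmul cmodl r c = sect (\<lambda>_ _. 0)"
  proof -
    obtain K where K: "compactin XM K" "K \<subseteq> W" "\<forall>y. y \<notin> K \<longrightarrow> r y = 0" using r(1) unfolding Cc0_def by blast
    have "germ XM (\<pi> p) (\<lambda>y. r y * bg c p y) = germ XM (\<pi> p) (\<lambda>_. 0)" if p: "p \<in> pts P" for p
    proof (cases "\<pi> p \<in> K")
      case True
      then have "c p = germ XP p (\<lambda>_. 0)" using K W p by blast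
      then have "germ XM (\<pi> p) (bg c p) = germ XM (\<pi> p) (\<lambda>_. 0)" using germ_bg_const_iff[OF _ p, of c 0] c by blast
      from germ_binop[OF refl this, of times r] show ?thesis by simp
    next
      case False
      then show ?thesis using compact_openin_diff[OF K(1)] pi_pts[OF p] K(3) by (intro germ_eqI[of _ "pts M - K"]) auto
    qed
    then have "sect (\<lambda>p y. r y * bg c p y) = sect (\<lambda>_ _. 0)" using sect_eq_iff by blast
    then show ?thesis using vsmul_sect[of r "bg c"] sect_bg[OF conjunct1[OF c]] by simp
  qed
  ultimately show "c \<in> null_at coalg XM x"
    using c Cc0_pts[OF r(1)] unfolding null_at_def by auto
qed

abbreviation Cls :: "'x \<Rightarrow> ('p, 'k::real_normed_field) germ_section \<Rightarrow> ('p, 'k) germ_section set" where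
  "Cls x c \<equiv> cls coalg XM x c"

lemma Cls_eq:
  fixes c :: "('p, 'k::real_normed_field) germ_section"
  assumes x: "x \<in> pts M" and c: "c \<in> Cc P"
  shows "Cls x c = {d \<in> Cc P. \<forall>p\<in>pts P. \<pi> p = x \<longrightarrow> d p = c p}"
proof
  show "Cls x c \<subseteq> {d \<in> Cc P. \<forall>p\<in>pts P. \<pi> p = x \<longrightarrow> d p = c p}"
  proof
    fix d assume "d \<in> Cls x c"
    then obtain n where n: "n \<in> null_at coalg XM x" "d = sec_add XP c n" unfolding cls_def by auto
    then have n': "n \<in> Cc P" "\<And>p. p \<in> pts P \<Longrightarrow> \<pi> p = x \<Longrightarrow> n p = germ XP p (\<lambda>_. 0)" using null_at_iff[OF x, of n] by simp_all
    have dC: "d \<in> Cc P" using n(2) Cc_add c n'(1) by blast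
    have "d p = c p" if p: "p \<in> pts P" "\<pi> p = x" for p
    proof -
      have "germ XM (\<pi> p) (bg d p) = germ XM (\<pi> p) (\<lambda>y. bg c p y + bg n p y)"
        using germ_bg_add[OF c n'(1) p(1)] n(2) by simp
      also have "\<dots> = germ XM (\<pi> p) (\<lambda>y. bg c p y + 0)"
        using germ_binop[OF refl germ_bg_const_iff[OF n'(1) p(1), THEN iffD2, OF n'(2)[OF p]], of "(+)" "bg c p"] .
      finally show ?thesis using germ_bg_eq_iff[OF dC c p(1)] by simp
    qed
    then show "d \<in> {d \<in> Cc P. \<forall>p\<in>pts P. \<pi> p = x \<longrightarrow> d p = c p}" using dC by blast
  qed
  show "{d \<in> Cc P. \<forall>p\<in>pts P. \<pi> p = x \<longrightarrow> d p = c p} \<subseteq> Cls x c"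
  proof
    fix d assume d: "d \<in> {d \<in> Cc P. \<forall>p\<in>pts P. \<pi> p = x \<longrightarrow> d p = c p}"
    then have dC: "d \<in> Cc P" by blast
    obtain n where n: "n \<in> Cc P" "sec_add XP c n = d" "\<And>p. p \<in> pts P \<Longrightarrow> d p = c p \<Longrightarrow> n p = germ XP p (\<lambda>_. 0)"
      by (rule Cc_difference[OF dC c]) blast
    then have "n \<in> null_at coalg XM x" using null_at_iff[OF x] d by blast
    then show "d \<in> Cls x c" unfolding cls_def using n(2) by auto
  qed
qed

lemma Cls_eq_iff:
  assumes "x \<in> pts M" "c \<in> Cc P" "d \<in> Cc P"
  shows "Cls x c = Cls x d \<longleftrightarrow> (\<forall>p\<in>pts P. \<pi> p = x \<longrightarrow> c p = d p)"
proof
  assume "Cls x c = Cls x d"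
  moreover have "c \<in> Cls x c" unfolding Cls_eq[OF assms(1,2)] using assms(2) by simp
  ultimately have "c \<in> Cls x d" by simp
  then show "\<forall>p\<in>pts P. \<pi> p = x \<longrightarrow> c p = d p" unfolding Cls_eq[OF assms(1,3)] by simp
next
  assume "\<forall>p\<in>pts P. \<pi> p = x \<longrightarrow> c p = d p"
  then show "Cls x c = Cls x d" unfolding Cls_eq[OF assms(1,2)] Cls_eq[OF assms(1,3)] by auto
qed

lemma Cls_self: "x \<in> pts M \<Longrightarrow> c \<in> Cc P \<Longrightarrow> c \<in> Cls x c"
  by (simp add: Cls_eq)

lemma Cls_mem: "x \<in> pts M \<Longrightarrow> c \<in> Cc P \<Longrightarrow> d \<in> Cls x c \<Longrightarrow> d \<in> Cc P \<and> Cls x d = Cls x c"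
proof -
  assume A: "x \<in> pts M" "c \<in> Cc P" "d \<in> Cls x c"
  then have d: "d \<in> Cc P" "\<forall>p\<in>pts P. \<pi> p = x \<longrightarrow> d p = c p" unfolding Cls_eq[OF A(1,2)] by simp_all
  then show ?thesis using Cls_eq_iff[OF A(1) d(1) A(2)] by blast
qed

lemma local_vadd:
  assumes x: "x \<in> pts M" and c: "c \<in> Cc P" "d \<in> Cc P"
  shows "vadd (local_module coalg XM x) (Cls x c) (Cls x d) = Cls x (sec_add XP c d)"
proof -
  have cd: "sec_add XP c d \<in> Cc P" by (rule Cc_add[OF c])
  have add_at: "sec_add XP a b p = sec_add XP c d p" if "a p = c p" "b p = d p" for a b p
    using that by (simp add: sec_add_def)
  have "{sec_add XP a b |a b. a \<in> Cls x c \<and> b \<in> Cls x d} = Cls x (sec_add XP c d)"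
  proof
    show "{sec_add XP a b |a b. a \<in> Cls x c \<and> b \<in> Cls x d} \<subseteq> Cls x (sec_add XP c d)"
    proof
      fix e assume "e \<in> {sec_add XP a b |a b. a \<in> Cls x c \<and> b \<in> Cls x d}"
      then obtain a b where ab: "e = sec_add XP a b" "a \<in> Cls x c" "b \<in> Cls x d" by blast
      have "a \<in> Cc P" "\<forall>p\<in>pts P. \<pi> p = x \<longrightarrow> a p = c p" using ab(2) unfolding Cls_eq[OF x c(1)] by simp_all
      moreover have "b \<in> Cc P" "\<forall>p\<in>pts P. \<pi> p = x \<longrightarrow> b p = d p" using ab(3) unfolding Cls_eq[OF x c(2)] by simp_all
      ultimately show "e \<in> Cls x (sec_add XP c d)"
        unfolding Cls_eq[OF x cd] ab(1) using Cc_add[of a b] add_at[of a _ b] by simp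
    qed
    show "Cls x (sec_add XP c d) \<subseteq> {sec_add XP a b |a b. a \<in> Cls x c \<and> b \<in> Cls x d}"
    proof
      fix e assume e: "e \<in> Cls x (sec_add XP c d)"
      then have eC: "e \<in> Cc P" "\<And>p. p \<in> pts P \<Longrightarrow> \<pi> p = x \<Longrightarrow> e p = sec_add XP c d p" unfolding Cls_eq[OF x cd] by simp_all
      obtain b where b: "b \<in> Cc P" "sec_add XP c b = e" by (rule Cc_difference[OF eC(1) c(1)]) blast
      have "b p = d p" if p: "p \<in> pts P" "\<pi> p = x" for p
      proof -
        have "germ XM (\<pi> p) (\<lambda>y. bg c p y + bg b p y) = germ XM (\<pi> p) (\<lambda>y. bg c p y + bg d p y)"
          using germ_bg_add[OF c p(1)] germ_bg_add[OF c(1) b(1) p(1)] germ_bg_eq_iff[OF eC(1) cd p(1)] eC(2)[OF p] b(2) by simp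
        from germ_binop[OF this refl, of "(-)" "bg c p"] show ?thesis
          using germ_bg_eq_iff[OF b(1) c(2) p(1)] by simp
      qed
      then have "b \<in> Cls x d" unfolding Cls_eq[OF x c(2)] using b by simp
      then show "e \<in> {sec_add XP a b |a b. a \<in> Cls x c \<and> b \<in> Cls x d}" using b(2) Cls_self[OF x c(1)] by blast
    qed
  qed
  then show ?thesis by (simp add: local_module_def)
qed

lemma vsmul_at_eq:
  assumes "r \<in> Cc0 M (pts M)" "s \<in> Cc0 M (pts M)" "germ XM (\<pi> p) r = germ XM (\<pi> p) s" "c \<in> Cc P" "d \<in> Cc P" "p \<in> pts P" "c p = d p"
  shows "vsmul cmodl r c p = vsmul cmodl s d p"
proof -
  have "germ XM (\<pi> p) (bg c p) = germ XM (\<pi> p) (bg d p)" using germ_bg_eq_iff assms by blast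
  from germ_binop[OF assms(3) this, of times]
  show ?thesis using germ_bg_smul[OF assms(1,4,6)] germ_bg_smul[OF assms(2,5,6)]
      germ_bg_eq_iff[OF vsmul_Cc[OF assms(1,4)] vsmul_Cc[OF assms(2,5)] assms(6)] by simp
qed

lemma local_vsmul:
  assumes x: "x \<in> pts M" and r: "r \<in> Cc0 M (pts M)" and c: "c \<in> Cc P"
  shows "vsmul (local_module coalg XM x) (germ XM x r) (Cls x c) = Cls x (vsmul cmodl r c)"
proof -
  have "Cls x (vsmul cmodl s d) = Cls x (vsmul cmodl r c)"
    if s: "s \<in> germ XM x r \<inter> Cc0 M (pts M)" and d: "d \<in> Cls x c" for s d
  proof -
    have s': "s \<in> Cc0 M (pts M)" using s by blast
    have gs: "germ XM x s = germ XM x r" by (rule germ_memD) (use s in blast)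
    have d': "d \<in> Cc P" "\<And>p. p \<in> pts P \<Longrightarrow> \<pi> p = x \<Longrightarrow> d p = c p" using d unfolding Cls_eq[OF x c] by simp_all
    show ?thesis unfolding Cls_eq_iff[OF x vsmul_Cc[OF s' d'(1)] vsmul_Cc[OF r c]]
      using vsmul_at_eq[OF s' r _ d'(1) c] gs d'(2) by simp
  qed
  moreover have "r \<in> germ XM x r \<inter> Cc0 M (pts M)" using germ_self[of x XM r] x r by simp
  moreover have "c \<in> Cls x c" by (rule Cls_self[OF x c])
  ultimately have "(\<Union>s\<in>germ XM x r \<inter> Cc0 M (pts M). \<Union>d\<in>Cls x c. Cls x (vsmul cmodl s d)) = Cls x (vsmul cmodl r c)"
    by blast
  then show ?thesis by (simp add: local_module_def)
qed

section \<open>The localised coalgebra and its tensor square\<close>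

lemma local_simps [simp]:
  "scal (local_module coalg XM x) = germ XM x ` Cc0 M (pts M)"
  "carr (local_module coalg XM x) = Cls x ` Cc P"
  by (simp_all add: local_module_def)

lemma local_coalgebra_carr [simp]: "carr (local_coalgebra coalg XM x) = Cls x ` Cc P"
  by (simp add: local_coalgebra_def rmodule.extend_def coalgebra.fields_def)

lemma local_coalgebra_comul: "comul (local_coalgebra coalg XM x) \<zeta> =
    (\<Union>c\<in>\<zeta>. \<Union>t\<in>Cc_comult M P \<pi> c. tensor_class (local_module coalg XM x)
          (frag_extend (\<lambda>(a, b). frag_of (Cls x a, Cls x b)) t))"
  by (simp add: local_coalgebra_def rmodule.extend_def coalgebra.fields_def)

lemma local_coalgebra_cou: "cou (local_coalgebra coalg XM x) \<zeta> = (\<Union>c\<in>\<zeta>. germ XM x (Cc_counit M P \<pi> c))"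
  by (simp add: local_coalgebra_def rmodule.extend_def coalgebra.fields_def)

lemma tensor_null_local:
  "tensor_null (local_coalgebra coalg XM x) = tensor_null (local_module coalg XM x)"
  by (rule tensor_null_cong) (simp_all add: local_coalgebra_def rmodule.extend_def coalgebra.fields_def)

lemma tensor_local: "tensor (local_coalgebra coalg XM x) = tensor (local_module coalg XM x)"
  by (simp add: tensor_def fun_eq_iff tensor_class_def tensor_null_local)

definition local_frag :: "'x \<Rightarrow> (('p, 'k::real_normed_field) germ_section \<times> ('p, 'k) germ_section \<Rightarrow>\<^sub>0 int) \<Rightarrow>
    (('p, 'k) germ_section set \<times> ('p, 'k) germ_section set \<Rightarrow>\<^sub>0 int)" where
  "local_frag x = frag_extend (\<lambda>(a, b). frag_of (Cls x a, Cls x b))"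

lemma local_frag_simps: "local_frag x 0 = 0" "local_frag x (s - t) = local_frag x s - local_frag x t"
  "local_frag x (s + t) = local_frag x s + local_frag x t" "local_frag x (frag_of (a, b)) = frag_of (Cls x a, Cls x b)"
  by (simp_all add: local_frag_def frag_extend_diff frag_extend_add)

lemma local_frag_null:
  assumes x: "x \<in> pts M"
  shows "t \<in> tensor_null cmodl \<Longrightarrow> local_frag x t \<in> tensor_null (local_module coalg XM x)"
proof (induction t rule: tensor_null.induct)
  case zero
  show ?case by (simp add: local_frag_simps tensor_null.zero)
next
  case (diff s t)
  then show ?case by (simp add: local_frag_simps tensor_null.diff)
next
  case (add_left a b c)
  then show ?case
    using tensor_null.add_left[of "Cls x a" "local_module coalg XM x" "Cls x b" "Cls x c"]
    by (simp add: local_frag_simps local_vadd[OF x])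
next
  case (add_right a b c)
  then show ?case
    using tensor_null.add_right[of "Cls x a" "local_module coalg XM x" "Cls x b" "Cls x c"]
    by (simp add: local_frag_simps local_vadd[OF x])
next
  case (balanced r a b)
  then show ?case
    using tensor_null.balanced[of "germ XM x r" "local_module coalg XM x" "Cls x a" "Cls x b"]
    by (simp add: local_frag_simps local_vsmul[OF x])
qed

section \<open>Grouplike elements are points\<close>

lemma germ_bg_elem:
  assumes "el U" "f \<in> Cc0 M (\<pi> ` U)" "p \<in> pts P"
  shows "germ XM (\<pi> p) (bg (elem U f) p) = germ XM (\<pi> p) (if p \<in> U then f else (\<lambda>_. 0))"
  using bg_sect[of "\<lambda>p. if p \<in> U then f else (\<lambda>_. 0)", OF _ assms(3)] elem_fun_Cc[OF assms(1,2)]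
  unfolding elem_fun_sect by blast

abbreviation pair_eval :: "'p \<Rightarrow> 'p \<Rightarrow> (('p, 'k::real_normed_field) germ_section \<times> ('p, 'k) germ_section \<Rightarrow>\<^sub>0 int) \<Rightarrow> 'x \<Rightarrow> 'k" where
  "pair_eval p q \<equiv> frag_eval (\<lambda>(a, b) y. bg a p y * bg b q y)"

lemma pair_eval_null:
  assumes "p \<in> pts P" "q \<in> pts P" "\<pi> p = x" "\<pi> q = x" "t \<in> tensor_null cmodl"
  shows "germ XM x (pair_eval p q t) = germ XM x (\<lambda>_. 0)"
  by (rule frag_eval_null[where sc = "\<lambda>r. r", OF _ _ _ _ assms(5)])
    (use germ_bg_add[OF _ _ assms(1), unfolded assms(3)] germ_bg_add[OF _ _ assms(2), unfolded assms(4)]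
      germ_bg_smul[OF _ _ assms(1), unfolded assms(3)] germ_bg_smul[OF _ _ assms(2), unfolded assms(4)] in simp_all)

text \<open>Two different points of one fibre never lie in a common sheet, so a coproduct has no
  off-diagonal germs; on the diagonal the local unit reproduces \<open>f\<close>.\<close>

lemma pair_eval_dcop:
  fixes L :: "('p set \<times> ('x \<Rightarrow> 'k::real_normed_field)) list"
  assumes p: "p \<in> pts P" "q \<in> pts P" "\<pi> p = x" "\<pi> q = x" and L: "valid L"
  shows "germ XM x (pair_eval p q (\<Sum>(U, f)\<leftarrow>L. dcop U f)) = germ XM x (if p = q then lsum L p else (\<lambda>_. 0))"
  using L
proof (induction L)
  case Nil
  then show ?case by (auto simp: frag_eval_zero[abs_def] intro!: arg_cong[where f = "germ _ _"])
next
  case (Cons a L)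
  obtain U f where a: "a = (U, f)" by force
  have U: "el U" "f \<in> Cc0 M (\<pi> ` U)" "valid L" using Cons.prems a by auto
  note n = unit_of[OF U(1,2)]
  let ?e = "elem U"
  have e: "germ XM x (bg (?e f) p) = germ XM x (if p \<in> U then f else (\<lambda>_. 0))"
    "germ XM x (bg (?e (unit_of U f)) q) = germ XM x (if q \<in> U then unit_of U f else (\<lambda>_. 0))"
    using germ_bg_elem[OF U(1,2) p(1)] germ_bg_elem[OF U(1) n(1) p(2)] p(3,4) by simp_all
  have "germ XM x (\<lambda>y. bg (?e f) p y * bg (?e (unit_of U f)) q y) = germ XM x (\<lambda>y. (if p \<in> U then f else (\<lambda>_. 0)) y * (if q \<in> U then unit_of U f else (\<lambda>_. 0)) y)"
    using germ_binop[OF e, of times] .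
  moreover have "(\<lambda>y. (if p \<in> U then f else (\<lambda>_. 0)) y * (if q \<in> U then unit_of U f else (\<lambda>_. 0)) y) =
      (if p = q then lsum [a] p else (\<lambda>_. 0))"
  proof (cases "p = q")
    case True
    then show ?thesis using n(2) by (auto simp: a fun_eq_iff mult.commute)
  next
    case False
    then have "p \<notin> U \<or> q \<notin> U" using el_injD[OF U(1), of p q] p by auto
    then show ?thesis using False by (auto simp: fun_eq_iff)
  qed
  ultimately have 1: "germ XM x (\<lambda>y. bg (?e f) p y * bg (?e (unit_of U f)) q y) = germ XM x (if p = q then lsum [a] p else (\<lambda>_. 0))"
    by (simp only:)
  from germ_binop[OF this Cons.IH[OF U(3)], of "(+)"]
  show ?case by (cases "p = q") (simp_all add: a frag_eval_add[abs_def] frag_eval_of dcop_def)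
qed

lemma Cc0_nonzero_near:
  assumes "f \<in> Cc0 M (pts M)" "x \<in> pts M" "f x \<noteq> 0"
  shows "\<exists>W. openin XM W \<and> x \<in> W \<and> (\<forall>y\<in>W. f y \<noteq> 0)"
proof -
  obtain W where "openin XM W" "x \<in> W" "\<forall>q\<in>pts M \<inter> W. f q \<in> - {0}"
    using smooth_function_continuous_at[OF M Cc0_smooth[OF assms(1)] assms(2), of "- {0}"] assms(3) by auto
  then show ?thesis using openin_subset by blast
qed

lemma germ_cancel:
  assumes "f \<in> Cc0 M (pts M)" "x \<in> pts M" "f x \<noteq> 0" "germ XM x (\<lambda>y. f y * g y) = germ XM x (\<lambda>y. f y * h y)"
  shows "germ XM x g = germ XM x h"
proof -
  obtain W where W: "openin XM W" "x \<in> W" "\<forall>y\<in>W. f y \<noteq> 0" using Cc0_nonzero_near[OF assms(1-3)] by blast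
  obtain V where V: "openin XM V" "x \<in> V" "\<And>y. y \<in> V \<Longrightarrow> f y * g y = f y * h y" using germ_eqD[OF assms(4,2)] by metis
  show ?thesis by (rule germ_eqI[of _ "W \<inter> V"]) (use W V in auto)
qed

text \<open>Both for weakly grouplike and for grouplike elements, \<open>t\<close> below is the second tensor factor.\<close>

lemma delta_from_products:
  fixes c :: "('p, 'k::real_normed_field) germ_section"
  assumes x: "x \<in> pts M" and c: "c \<in> Cc P" and t: "\<And>p. t p \<in> Cc0 M (pts M)"
    and prod: "\<And>p q. p \<in> pts P \<Longrightarrow> q \<in> pts P \<Longrightarrow> \<pi> p = x \<Longrightarrow> \<pi> q = x \<Longrightarrow>
      germ XM x (\<lambda>y. bg c p y * t q y) = germ XM x (if p = q then bg c p else (\<lambda>_. 0))"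
    and cou: "germ XM x (Cc_counit M P \<pi> c) = germ XM x (\<lambda>_. 1)"
  shows "\<exists>p. \<pi> p = x \<and> delta c p"
proof -
  define L where "L = rep c"
  have L: "valid L" "sect (lsum L) = c" "bg c = lsum L" using rep[OF c] by (simp_all add: L_def bg_def)
  obtain W F V where lf: "local_form L x W F V" using local_form_exists[OF L(1) x] by blast
  note D = local_formD[OF lf]
  have FP: "p \<in> pts P" if "p \<in> F" for p using el_pts[OF D(5)[OF that]] D(4)[OF that] by blast
  have tot: "Cc_counit M P \<pi> c y = (\<Sum>p\<in>F. bg c p y)" if "y \<in> W" for y
    using counit_lsum[OF L(1)] local_form_lsum(2)[OF lf that] L by simp
  have "Cc_counit M P \<pi> c x = 1" using germ_eq_value[OF cou x] .
  \<comment> \<open>The fibre sum at \<open>x\<close> is 1, so some germ of \<open>c\<close> over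
    \<open>x\<close> is nonzero at \<open>x\<close> and can be cancelled from its diagonal
    relation.\<close>
  then have "(\<Sum>p\<in>F. bg c p x) \<noteq> 0" using tot D(2) by simp
  then obtain p where p: "p \<in> F" "bg c p x \<noteq> 0" by (meson sum.not_neutral_contains_not_neutral)
  have pP: "p \<in> pts P" "\<pi> p = x" using FP p D(7) by auto
  have "germ XM x (\<lambda>y. bg c p y * t p y) = germ XM x (\<lambda>y. bg c p y * 1)" using prod[OF pP(1) pP(1) pP(2) pP(2)] by simp
  then have tp: "germ XM x (t p) = germ XM x (\<lambda>_. 1)" by (rule germ_cancel[OF bg_Cc0[OF c] x p(2)])
  \<comment> \<open>With \<open>t p\<close> equal to 1 near \<open>x\<close>, the relation for the
    pair \<open>q\<close>, \<open>p\<close> kills the germ of \<open>c\<close> at every other point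
    \<open>q\<close>.\<close>
  have q0: "germ XM x (bg c q) = germ XM x (\<lambda>_. 0)" if q: "q \<in> pts P" "\<pi> q = x" "q \<noteq> p" for q
  proof -
    have "germ XM x (\<lambda>y. bg c q y * t p y) = germ XM x (\<lambda>y. bg c q y * 1)" using germ_binop[OF refl tp, of times "bg c q"] .
    then show ?thesis using prod[OF q(1) pP(1) q(2) pP(2)] q(3) by simp
  qed
  \<comment> \<open>Only the summand at \<open>p\<close> survives in the fibre sum, so the germ at
    \<open>p\<close> is that of the counit, which is 1.\<close>
  have "germ XM x (\<lambda>y. \<Sum>q\<in>F. bg c q y) = germ XM x (\<lambda>y. \<Sum>q\<in>F. (if q = p then bg c p else (\<lambda>_. 0)) y)"
  proof (rule germ_sum)
    fix q assume q: "q \<in> F"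
    show "germ XM x (bg c q) = germ XM x ((if q = p then bg c p else (\<lambda>_. 0)))" using q0[OF FP[OF q] D(7)[OF q]] by auto
  qed
  also have "(\<lambda>y. \<Sum>q\<in>F. (if q = p then bg c p else (\<lambda>_. 0)) y) = bg c p"
  proof
    fix y
    have "(\<Sum>q\<in>F. (if q = p then bg c p else (\<lambda>_. 0)) y) = (\<Sum>q\<in>F. if q = p then bg c p y else 0)" by (rule sum.cong) auto
    then show "(\<Sum>q\<in>F. (if q = p then bg c p else (\<lambda>_. 0)) y) = bg c p y" using D(3) p(1) by simp
  qed
  finally have "germ XM x (\<lambda>y. \<Sum>q\<in>F. bg c q y) = germ XM x (bg c p)" .
  moreover have "germ XM x (Cc_counit M P \<pi> c) = germ XM x (\<lambda>y. \<Sum>q\<in>F. bg c q y)"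
    by (rule germ_eqI[OF D(1,2)]) (rule tot)
  ultimately have "germ XM x (bg c p) = germ XM x (\<lambda>_. 1)" using cou by simp
  then have "c p = germ XP p (\<lambda>_. 1)" using germ_bg_const_iff[OF c pP(1), of 1] pP(2) by simp
  moreover have "c q = germ XP q (\<lambda>_. 0)" if "q \<in> pts P" "\<pi> q = \<pi> p" "q \<noteq> p" for q
    using q0[of q] germ_bg_const_iff[OF c that(1), of 0] that pP(2) by simp
  ultimately have "delta c p" unfolding delta_def using c pP(1) by blast
  then show ?thesis using pP by blast
qed

lemma weakly_grouplike_products:
  fixes c :: "('p, 'k::real_normed_field) germ_section"
  assumes "c \<in> weakly_grouplike coalg"
  shows "c \<in> Cc P" "\<exists>c'\<in>Cc P. \<forall>p\<in>pts P. \<forall>q\<in>pts P. \<pi> q = \<pi> p \<longrightarrow>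
      germ XM (\<pi> p) (\<lambda>y. bg c p y * bg c' q y) = germ XM (\<pi> p) (if p = q then bg c p else (\<lambda>_. 0))"
proof -
  show c: "c \<in> Cc P" using assms by (auto simp: weakly_grouplike_def)
  obtain c' where c': "c' \<in> Cc P" "Cc_comult M P \<pi> c = tensor coalg c c'"
    using assms by (auto simp: weakly_grouplike_def)
  have "tensor_class cmodl (\<Sum>(U, f)\<leftarrow>rep c. dcop U f) = tensor_class cmodl (frag_of (c, c'))"
    using comult_lsum[OF rep(1)[OF c]] rep(2)[OF c] c'(2) by (simp add: tensor_def tensor_class_Cc)
  then have n: "(\<Sum>(U, f)\<leftarrow>rep c. dcop U f) - frag_of (c, c') \<in> tensor_null cmodl" by (simp add: tensor_class_eq_iff)
  have "germ XM (\<pi> p) (\<lambda>y. bg c p y * bg c' q y) = germ XM (\<pi> p) (if p = q then bg c p else (\<lambda>_. 0))"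
    if p: "p \<in> pts P" "q \<in> pts P" "\<pi> q = \<pi> p" for p q
  proof -
    from pair_eval_null[OF p(1,2) refl p(3) n]
    have A: "germ XM (\<pi> p) (pair_eval p q (\<Sum>(U, f)\<leftarrow>rep c. dcop U f)) = germ XM (\<pi> p) (\<lambda>y. bg c p y * bg c' q y)"
      by (simp add: frag_eval_diff[abs_def] frag_eval_of germ_zero_iff)
    from trans[OF A[symmetric] pair_eval_dcop[OF p(1,2) refl p(3) rep(1)[OF c]]]
    show ?thesis by (simp only: bg_def)
  qed
  then show "\<exists>c'\<in>Cc P. \<forall>p\<in>pts P. \<forall>q\<in>pts P. \<pi> q = \<pi> p \<longrightarrow>
      germ XM (\<pi> p) (\<lambda>y. bg c p y * bg c' q y) = germ XM (\<pi> p) (if p = q then bg c p else (\<lambda>_. 0))"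
    using c'(1) by blast
qed

text \<open>By the diagonal relation, germ 1 of \<open>c\<close> at \<open>p\<close> forces germ 1
  of the second factor \<open>c'\<close> at \<open>p\<close>; the relations for pairs
  \<open>q\<close>, \<open>p\<close> then kill \<open>c\<close> at the other points. This yields
  independence of the class from the chosen weakly grouplike element.\<close>

lemma weakly_grouplike_delta:
  fixes c :: "('p, 'k::real_normed_field) germ_section"
  assumes "c \<in> weakly_grouplike coalg" "p \<in> pts P" "c p = germ XP p (\<lambda>_. 1)"
  shows "delta c p"
proof -
  note c = weakly_grouplike_products(1)[OF assms(1)]
  obtain c' where c': "c' \<in> Cc P" "\<And>p q. p \<in> pts P \<Longrightarrow> q \<in> pts P \<Longrightarrow> \<pi> q = \<pi> p \<Longrightarrow>
      germ XM (\<pi> p) (\<lambda>y. bg c p y * bg c' q y) = germ XM (\<pi> p) (if p = q then bg c p else (\<lambda>_. 0))"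
    using weakly_grouplike_products(2)[OF assms(1)] by blast
  have cp: "germ XM (\<pi> p) (bg c p) = germ XM (\<pi> p) (\<lambda>_. 1)" using germ_bg_const_iff[OF c assms(2), of 1] assms(3) by blast
  have "germ XM (\<pi> p) (\<lambda>y. bg c p y * bg c' p y) = germ XM (\<pi> p) (\<lambda>y. 1 * bg c' p y)"
    using germ_binop[OF cp refl, of times "bg c' p"] .
  then have c'p: "germ XM (\<pi> p) (bg c' p) = germ XM (\<pi> p) (\<lambda>_. 1)" using c'(2)[OF assms(2) assms(2) refl] cp by simp
  have "c q = germ XP q (\<lambda>_. 0)" if q: "q \<in> pts P" "\<pi> q = \<pi> p" "q \<noteq> p" for q
  proof -
    have "germ XM (\<pi> p) (\<lambda>y. bg c q y * bg c' p y) = germ XM (\<pi> p) (\<lambda>y. bg c q y * 1)"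
      using germ_binop[OF refl c'p, of times "bg c q"] .
    then have "germ XM (\<pi> q) (bg c q) = germ XM (\<pi> q) (\<lambda>_. 0)"
      using c'(2)[OF q(1) assms(2)] q(2,3) by simp
    then show ?thesis using germ_bg_const_iff[OF c q(1), of 0] by blast
  qed
  then show ?thesis unfolding delta_def using c assms(2,3) by blast
qed

lemma weakly_grouplike_normalised_delta:
  fixes c :: "('p, 'k::real_normed_field) germ_section"
  assumes "c \<in> weakly_grouplike coalg" "normalised_near coalg XM x c"
  shows "\<exists>p. \<pi> p = x \<and> delta c p"
proof -
  obtain c' where c': "c' \<in> Cc P" "\<And>p q. p \<in> pts P \<Longrightarrow> q \<in> pts P \<Longrightarrow> \<pi> q = \<pi> p \<Longrightarrow>
      germ XM (\<pi> p) (\<lambda>y. bg c p y * bg c' q y) = germ XM (\<pi> p) (if p = q then bg c p else (\<lambda>_. 0))"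
    using weakly_grouplike_products(2)[OF assms(1)] by blast
  obtain W where W: "openin XM W" "x \<in> W" "\<And>y. y \<in> W \<Longrightarrow> Cc_counit M P \<pi> c y = 1"
    using assms(2) by (auto simp: normalised_near_def normalised_on_def)
  show ?thesis
  proof (rule delta_from_products[OF _ weakly_grouplike_products(1)[OF assms(1)] bg_Cc0[OF c'(1)]])
    show "x \<in> pts M" using W openin_subset by blast
    show "germ XM x (Cc_counit M P \<pi> c) = germ XM x (\<lambda>_. 1)" by (rule germ_eqI[OF W(1,2)]) (rule W(3))
    show "germ XM x (\<lambda>y. bg c p y * bg c' q y) = germ XM x (if p = q then bg c p else (\<lambda>_. 0))"
      if "p \<in> pts P" "q \<in> pts P" "\<pi> p = x" "\<pi> q = x" for p q
      using c'(2)[of p q] that by simp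
  qed
qed

lemma delta_Cls:
  assumes "delta c p" "delta d p"
  shows "Cls (\<pi> p) c = Cls (\<pi> p) d"
proof -
  have "c q = d q" if "q \<in> pts P" "\<pi> q = \<pi> p" for q
    using assms that unfolding delta_def by (cases "q = p") auto
  then show ?thesis using Cls_eq_iff[of "\<pi> p" c d] assms pi_pts unfolding delta_def by blast
qed

lemma Cls_delta:
  assumes "delta c p" "d \<in> Cc P" "Cls (\<pi> p) c = Cls (\<pi> p) d"
  shows "delta d p"
proof -
  have "c \<in> Cc P" "p \<in> pts P" using assms(1) by (auto simp: delta_def)
  then have "\<forall>q\<in>pts P. \<pi> q = \<pi> p \<longrightarrow> c q = d q" using Cls_eq_iff[OF pi_pts _ assms(2)] assms(3) by blast
  then show ?thesis using assms(1,2) unfolding delta_def by metis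
qed

lemma delta_unique:
  assumes "delta (c :: ('p, 'k::real_normed_field) germ_section) p" "delta c q" "\<pi> p = \<pi> q"
  shows "p = q"
proof (rule ccontr)
  assume "p \<noteq> q"
  then have A: "p \<in> pts P" "c p = germ XP p (\<lambda>_. 1)" "c p = germ XP p (\<lambda>_. 0)" using assms unfolding delta_def by auto
  then have "germ XP p (\<lambda>_. 1 :: 'k) = germ XP p (\<lambda>_. 0)" by simp
  from germ_eq_value[OF this A(1)] show False by simp
qed

lemma elem_weakly_grouplike:
  assumes "el U" "f \<in> Cc0 M (\<pi> ` U)"
  shows "elem U f \<in> weakly_grouplike coalg"
proof -
  note n = unit_of[OF assms]
  show ?thesis unfolding weakly_grouplike_def
    using elem_fun_Cc[OF assms] elem_fun_Cc[OF assms(1) n(1)] comult_elem[OF assms n] by auto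
qed

lemma elem_delta:
  assumes "el U" "f \<in> Cc0 M (\<pi> ` U)" "p \<in> U" "openin XM N" "\<pi> p \<in> N" "\<And>y. y \<in> N \<Longrightarrow> f y = 1"
  shows "delta (elem U f) p"
  unfolding delta_def
proof (intro conjI ballI impI)
  show "elem U f \<in> Cc P" by (rule elem_fun_Cc[OF assms(1,2)])
  show pP: "p \<in> pts P" using el_pts[OF assms(1)] assms(3) by blast
  have "germ XM (\<pi> p) f = germ XM (\<pi> p) (\<lambda>_. 1)" by (rule germ_eqI[OF assms(4,5)]) (rule assms(6))
  then show "elem U f p = germ XP p (\<lambda>_. 1)" unfolding elem_fun_sect
    using sect_const_iff[OF pP, of "\<lambda>p. if p \<in> U then f else (\<lambda>_. 0)" 1] assms(3) by simp
  fix q assume "q \<in> pts P" "\<pi> q = \<pi> p" "q \<noteq> p"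
  then show "elem U f q = germ XP q (\<lambda>_. 0)"
    unfolding elem_fun_sect using sect_const_iff[of q "\<lambda>p. if p \<in> U then f else (\<lambda>_. 0)" 0] el_injD[OF assms(1), of q p] assms(3) by auto
qed

lemma delta_exists:
  assumes "openin XP W" "p \<in> W"
  obtains U and f :: "'x \<Rightarrow> 'k::real_normed_field" and N where "el U" "p \<in> U" "U \<subseteq> W" "f \<in> Cc0 M (\<pi> ` U)"
    "openin XM N" "\<pi> p \<in> N" "N \<subseteq> \<pi> ` U" "\<And>y. y \<in> N \<Longrightarrow> f y = 1"
proof -
  obtain U where U: "el U" "p \<in> U" "U \<subseteq> W" using el_exists[OF assms] by blast
  obtain f :: "'x \<Rightarrow> 'k" and N where f: "f \<in> Cc0 M (\<pi> ` U)" "openin XM N" "\<pi> p \<in> N" "\<forall>y\<in>N. f y = 1"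
    using Cc0_local_unit[OF el_image_open[OF U(1)]] U(2) by blast
  show ?thesis
    using that[OF U f(1), of "N \<inter> \<pi> ` U"] f el_image_open[OF U(1)] U(2) by auto
qed

text \<open>The local comultiplication is a union over all members of a class and all tensors in
  their coproducts, so its collapse to one coset has to be shown. Two members become equal after
  multiplication by a function with germ 1 at \<open>x\<close>, and such a multiplication does not
  affect the localised coproduct.\<close>

lemma local_comul_Cls:
  fixes c :: "('p, 'k::real_normed_field) germ_section"
  assumes x: "x \<in> pts M" and L: "valid L" "c = sect (lsum L)"
  shows "comul (local_coalgebra coalg XM x) (Cls x c) =
     tensor_class (local_module coalg XM x) (local_frag x (\<Sum>(U, f)\<leftarrow>L. dcop U f))"
proof -
  let ?N = "tensor_null (local_module (coalg :: ('x \<Rightarrow> 'k, ('p, 'k) germ_section) coalgebra) XM x)"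
  have c: "c \<in> Cc P" using L sect_lsum_Cc by blast
  \<comment> \<open>Only the first tensor factor is multiplied: the unit of \<open>f\<close> is
    still a unit of \<open>r\<close> times \<open>f\<close>, and the class of the first factor at
    \<open>x\<close> does not see \<open>r\<close>.\<close>
  have loc: "local_frag x (\<Sum>(U, f)\<leftarrow>L. dcop U f) - local_frag x (\<Sum>(U, f)\<leftarrow>smul_list r L. dcop U f) \<in> ?N"
    if r: "r \<in> Cc0 M (pts M)" "germ XM x r = germ XM x (\<lambda>_. 1)" and L: "valid L" for r and L :: "('p set \<times> ('x \<Rightarrow> 'k)) list"
    using L
  proof (induction L)
    case Nil
    then show ?case by (simp add: smul_list_def local_frag_simps tensor_null.zero)
  next
    case (Cons a L)
    obtain U f where a: "a = (U, f)" by force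
    have U: "el U" "f \<in> Cc0 M (\<pi> ` U)" "valid L" using Cons.prems a by auto
    note n = unit_of[OF U(1,2)]
    let ?e = "elem U" and ?rf = "\<lambda>y. r y * f y"
    have rf: "?rf \<in> Cc0 M (\<pi> ` U)" by (rule Cc0_mult(2)[OF U(2) Cc0_smooth[OF r(1)]])
    have "Cls x (?e f) = Cls x (?e ?rf)"
      unfolding Cls_eq_iff[OF x elem_fun_Cc[OF U(1,2)] elem_fun_Cc[OF U(1) rf]]
    proof (intro ballI impI)
      fix p assume p: "p \<in> pts P" "\<pi> p = x"
      have "germ XM x ?rf = germ XM x (\<lambda>y. 1 * f y)" using germ_binop[OF r(2) refl, of times f] .
      then show "?e f p = ?e ?rf p" unfolding elem_fun_sect sect_at_eq_iff[OF p(1)] using p(2) by simp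
    qed
    then have eq: "local_frag x (dcop U f) = local_frag x (frag_of (?e ?rf, ?e (unit_of U f)))"
      by (simp add: dcop_def local_frag_simps)
    have "dcop U ?rf - frag_of (?e ?rf, ?e (unit_of U f)) \<in> tensor_null cmodl"
      by (rule dcop_unit[OF U(1) rf n(1)]) (use n(2) in \<open>metis mult.left_commute\<close>)
    from tensor_null_sym[OF local_frag_null[OF x this, unfolded local_frag_simps(2)]]
    have "local_frag x (dcop U f) - local_frag x (dcop U ?rf) \<in> ?N" unfolding eq .
    from tensor_null_add[OF this Cons.IH[OF U(3)]]
    show ?case by (simp add: a smul_list_def local_frag_simps algebra_simps)
  qed
  have key: "tensor_class (local_module coalg XM x) (local_frag x t) =
      tensor_class (local_module coalg XM x) (local_frag x (\<Sum>(U, f)\<leftarrow>L. dcop U f))"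
    if d: "d \<in> Cls x c" and t: "t \<in> Cc_comult M P \<pi> d" for d t
  proof -
    have d': "d \<in> Cc P" "\<And>p. p \<in> pts P \<Longrightarrow> \<pi> p = x \<Longrightarrow> d p = c p" using d unfolding Cls_eq[OF x c] by simp_all
    note R = rep[OF d'(1)]
    have "t - (\<Sum>(U, f)\<leftarrow>rep d. dcop U f) \<in> tensor_null cmodl"
      using t comult_lsum[OF R(1)] R(2) by (simp add: tensor_class_def)
    from local_frag_null[OF x this]
    have 1: "local_frag x t - local_frag x (\<Sum>(U, f)\<leftarrow>rep d. dcop U f) \<in> ?N" by (simp add: local_frag_simps)
    obtain n where n: "n \<in> Cc P" "sec_add XP c n = d" "\<And>p. p \<in> pts P \<Longrightarrow> d p = c p \<Longrightarrow> n p = germ XP p (\<lambda>_. 0)"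
      by (rule Cc_difference[OF d'(1) c]) blast
    have "n \<in> null_at coalg XM x" using n d'(2) null_at_iff[OF x] by blast
    then obtain r where r: "r \<in> Cc0 M (pts M)" "germ XM x r = germ XM x (\<lambda>_. 1)"
      "vsmul cmodl r n = sect (\<lambda>_ _. 0)" unfolding null_at_def by auto
    have rn: "sect (\<lambda>p y. r y * bg n p y) = sect (\<lambda>_ _. 0)" using vsmul_sect[of r "bg n"] sect_bg[OF n(1)] r(3) by simp
    have "sect (lsum (smul_list r (rep d))) = sect (lsum (smul_list r L))"
      unfolding sect_eq_iff
    proof
      fix p assume p: "p \<in> pts P"
      have "germ XM (\<pi> p) (\<lambda>y. r y * bg n p y) = germ XM (\<pi> p) (\<lambda>_. 0)"
        using rn sect_at_eq_iff[OF p, of "\<lambda>p y. r y * bg n p y" "\<lambda>_ _. 0"] by simp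
      moreover have "germ XM (\<pi> p) (lsum (rep d) p) = germ XM (\<pi> p) (\<lambda>y. bg c p y + bg n p y)"
        using germ_bg_add[OF c n(1) p] n(2) by (simp add: bg_def)
      from germ_binop[OF refl this, of times r]
      have "germ XM (\<pi> p) (\<lambda>y. r y * lsum (rep d) p y) = germ XM (\<pi> p) (\<lambda>y. r y * bg c p y + r y * bg n p y)"
        by (simp add: distrib_left)
      ultimately have "germ XM (\<pi> p) (\<lambda>y. r y * lsum (rep d) p y) = germ XM (\<pi> p) (\<lambda>y. r y * bg c p y + 0)"
        using germ_binop[of XM "\<pi> p" "\<lambda>y. r y * bg c p y" "\<lambda>y. r y * bg c p y" "\<lambda>y. r y * bg n p y" "\<lambda>_. 0" "(+)"] by simp
      moreover have "germ XM (\<pi> p) (bg c p) = germ XM (\<pi> p) (lsum L p)"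
        using bg_sect[OF _ p, of "lsum L"] L(2) c by simp
      from germ_binop[OF refl this, of times r]
      have "germ XM (\<pi> p) (\<lambda>y. r y * bg c p y) = germ XM (\<pi> p) (\<lambda>y. r y * lsum L p y)" .
      ultimately show "germ XM (\<pi> p) (lsum (smul_list r (rep d)) p) = germ XM (\<pi> p) (lsum (smul_list r L) p)"
        by (simp add: lsum_smul_list[abs_def])
    qed
    from local_frag_null[OF x dcop_unique[OF valid_smul_list[OF R(1) Cc0_smooth[OF r(1)]] valid_smul_list[OF L(1) Cc0_smooth[OF r(1)]] this]]
    have 2: "local_frag x (\<Sum>(U, f)\<leftarrow>smul_list r (rep d). dcop U f) - local_frag x (\<Sum>(U, f)\<leftarrow>smul_list r L. dcop U f) \<in> ?N"
      by (simp add: local_frag_simps)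
    show ?thesis unfolding tensor_class_eq_iff
      by (rule tensor_null_trans[OF 1 tensor_null_trans[OF loc[OF r(1,2) R(1)] tensor_null_trans[OF 2 tensor_null_sym[OF loc[OF r(1,2) L(1)]]]]])
  qed
  obtain t0 where t0: "t0 \<in> Cc_comult M P \<pi> c" using comult_lsum[OF L(1)] L(2) tensor_class_self by metis
  have "(\<Union>d\<in>Cls x c. \<Union>t\<in>Cc_comult M P \<pi> d. tensor_class (local_module coalg XM x) (local_frag x t)) =
     tensor_class (local_module coalg XM x) (local_frag x (\<Sum>(U, f)\<leftarrow>L. dcop U f))" (is "?A = ?B")
  proof
    show "?A \<subseteq> ?B"
    proof
      fix z assume "z \<in> ?A"
      then obtain d t where "d \<in> Cls x c" "t \<in> Cc_comult M P \<pi> d"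
        "z \<in> tensor_class (local_module coalg XM x) (local_frag x t)" by (elim UN_E)
      then show "z \<in> ?B" using key by simp
    qed
    show "?B \<subseteq> ?A" unfolding key[OF Cls_self[OF x c] t0, symmetric]
      using Cls_self[OF x c] t0 by (intro subsetI UN_I)
  qed
  then show ?thesis unfolding local_coalgebra_comul local_frag_def .
qed

text \<open>The counit sums the germs over a fibre, and all summands but the one at \<open>p\<close>
  vanish.\<close>

lemma counit_single:
  fixes c :: "('p, 'k::real_normed_field) germ_section"
  assumes c: "c \<in> Cc P" and p: "p \<in> pts P"
    and z: "\<And>q. q \<in> pts P \<Longrightarrow> \<pi> q = \<pi> p \<Longrightarrow> q \<noteq> p \<Longrightarrow> c q = germ XP q (\<lambda>_. 0)"
  shows "germ XM (\<pi> p) (Cc_counit M P \<pi> c) = germ XM (\<pi> p) (bg c p)"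
proof -
  define L where "L = rep c"
  have L: "valid L" "sect (lsum L) = c" "bg c = lsum L" using rep[OF c] by (simp_all add: L_def bg_def)
  obtain W F V where lf: "local_form L (\<pi> p) W F V" using local_form_exists[OF L(1) pi_pts[OF p]] by blast
  note D = local_formD[OF lf]
  have FP: "q \<in> pts P" if "q \<in> F" for q using el_pts[OF D(5)[OF that]] D(4)[OF that] by blast
  have "germ XM (\<pi> p) (Cc_counit M P \<pi> c) = germ XM (\<pi> p) (\<lambda>y. \<Sum>q\<in>F. bg c q y)"
    by (rule germ_eqI[OF D(1,2)]) (use counit_lsum[OF L(1)] local_form_lsum(2)[OF lf] L in simp)
  also have "\<dots> = germ XM (\<pi> p) (\<lambda>y. \<Sum>q\<in>F. if q = p then bg c p y else 0)"
  proof (rule germ_sum)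
    fix q assume q: "q \<in> F"
    show "germ XM (\<pi> p) (bg c q) = germ XM (\<pi> p) (\<lambda>y. if q = p then bg c p y else 0)"
    proof (cases "q = p")
      case False
      then have "c q = germ XP q (\<lambda>_. 0)" using z FP[OF q] D(7)[OF q] by blast
      then show ?thesis using germ_bg_const_iff[OF c FP[OF q], of 0] D(7)[OF q] False by simp
    qed simp
  qed
  also have "(\<lambda>y. \<Sum>q\<in>F. if q = p then bg c p y else 0) = bg c p"
    using D(3) lsum_local_form_outside[OF lf refl] L(3) by (auto simp: fun_eq_iff)
  finally show ?thesis .
qed

lemma delta_counit:
  assumes "delta c p"
  shows "germ XM (\<pi> p) (Cc_counit M P \<pi> c) = germ XM (\<pi> p) (\<lambda>_. 1)"
  using counit_single[of c p] germ_bg_const_iff[of c p 1] assms by (simp add: delta_def)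

definition local_bg :: "'p \<Rightarrow> ('p, 'k::real_normed_field) germ_section set \<Rightarrow> 'x \<Rightarrow> 'k" where
  "local_bg p \<zeta> = bg (SOME c. c \<in> \<zeta>) p"

lemma local_bg:
  assumes "c \<in> Cc P" "p \<in> pts P"
  shows "germ XM (\<pi> p) (local_bg p (Cls (\<pi> p) c)) = germ XM (\<pi> p) (bg c p)"
proof -
  note x = pi_pts[OF assms(2)]
  have "(SOME d. d \<in> Cls (\<pi> p) c) \<in> Cls (\<pi> p) c" unfolding some_in_eq using Cls_self[OF x assms(1)] by blast
  then have "(SOME d. d \<in> Cls (\<pi> p) c) \<in> Cc P" "(SOME d. d \<in> Cls (\<pi> p) c) p = c p"
    using assms(2) unfolding Cls_eq[OF x assms(1)] by simp_all
  then show ?thesis unfolding local_bg_def using germ_bg_eq_iff[OF _ assms] by blast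
qed

lemma local_bg_null:
  fixes t :: "(('p, 'k::real_normed_field) germ_section set \<times> ('p, 'k) germ_section set \<Rightarrow>\<^sub>0 int)"
  assumes p: "p \<in> pts P" "q \<in> pts P" "\<pi> p = x" "\<pi> q = x"
    and t: "t \<in> tensor_null (local_module coalg XM x)"
  shows "germ XM x (frag_eval (\<lambda>(a, b) y. local_bg p a y * local_bg q b y) t) = germ XM x (\<lambda>_. 0)"
proof (rule frag_eval_null[where sc = "\<lambda>\<rho>. SOME f. f \<in> \<rho>", OF _ _ _ _ t])
  have x: "x \<in> pts M" using pi_pts p by blast
  have add: "germ XM x (local_bg p (vadd (local_module coalg XM x) a b)) = germ XM x (\<lambda>y. local_bg p a y + local_bg p b y)"
    if p: "p \<in> pts P" "\<pi> p = x" and ab: "a \<in> carr (local_module coalg XM x)" "b \<in> carr (local_module coalg XM x)"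
    for p and a b :: "('p, 'k) germ_section set"
  proof -
    obtain c d where cd: "c \<in> Cc P" "a = Cls x c" "d \<in> Cc P" "b = Cls x d" using ab by auto
    have "germ XM x (local_bg p (Cls x (sec_add XP c d))) = germ XM x (\<lambda>y. bg c p y + bg d p y)"
      using local_bg[OF Cc_add[OF cd(1,3)] p(1)] germ_bg_add[OF cd(1,3) p(1)] p(2) by simp
    also have "\<dots> = germ XM x (\<lambda>y. local_bg p a y + local_bg p b y)"
      unfolding cd using germ_binop[OF local_bg[OF cd(1) p(1), symmetric] local_bg[OF cd(3) p(1), symmetric], of "(+)"] p(2) by simp
    finally show ?thesis unfolding cd local_vadd[OF x cd(1,3)] .
  qed
  \<comment> \<open>Scalars of the local module are germs, so the scalar factor has to be a chosen
    representative; its germ does not depend on the choice.\<close>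
  have smul: "germ XM x (local_bg p (vsmul (local_module coalg XM x) \<rho> a)) = germ XM x (\<lambda>y. (SOME f. f \<in> \<rho>) y * local_bg p a y)"
    if p: "p \<in> pts P" "\<pi> p = x" and ra: "\<rho> \<in> scal (local_module coalg XM x)" "a \<in> carr (local_module coalg XM x)"
    for p \<rho> and a :: "('p, 'k) germ_section set"
  proof -
    obtain r c where rc: "r \<in> Cc0 M (pts M)" "\<rho> = germ XM x r" "c \<in> Cc P" "a = Cls x c" using ra by auto
    have "(SOME f. f \<in> \<rho>) \<in> \<rho>" unfolding rc(2) some_in_eq using germ_self[OF x] by blast
    then have s: "germ XM x (SOME f. f \<in> \<rho>) = germ XM x r" unfolding rc(2) by (rule germ_memD)
    have "germ XM x (local_bg p (Cls x (vsmul cmodl r c))) = germ XM x (\<lambda>y. r y * bg c p y)"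
      using local_bg[OF vsmul_Cc[OF rc(1,3)] p(1)] germ_bg_smul[OF rc(1,3) p(1)] p(2) by simp
    also have "\<dots> = germ XM x (\<lambda>y. (SOME f. f \<in> \<rho>) y * local_bg p a y)"
      using germ_binop[OF s[symmetric], of "bg c p" "local_bg p a" times] local_bg[OF rc(3) p(1), symmetric] p(2) by (simp add: rc(4))
    finally show ?thesis unfolding rc(2,4) local_vsmul[OF x rc(1,3)] by (simp only: rc(2))
  qed
  show "germ XM x (local_bg p (vadd (local_module coalg XM x) a b)) = germ XM x (\<lambda>y. local_bg p a y + local_bg p b y)"
    if "a \<in> carr (local_module coalg XM x)" "b \<in> carr (local_module coalg XM x)"
    for a b :: "('p, 'k) germ_section set" by (rule add[OF p(1,3) that])
  show "germ XM x (local_bg q (vadd (local_module coalg XM x) a b)) = germ XM x (\<lambda>y. local_bg q a y + local_bg q b y)"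
    if "a \<in> carr (local_module coalg XM x)" "b \<in> carr (local_module coalg XM x)"
    for a b :: "('p, 'k) germ_section set" by (rule add[OF p(2,4) that])
  show "germ XM x (local_bg p (vsmul (local_module coalg XM x) \<rho> a)) = germ XM x (\<lambda>y. (SOME f. f \<in> \<rho>) y * local_bg p a y)"
    if "\<rho> \<in> scal (local_module coalg XM x)" "a \<in> carr (local_module coalg XM x)"
    for \<rho> and a :: "('p, 'k) germ_section set" by (rule smul[OF p(1,3) that])
  show "germ XM x (local_bg q (vsmul (local_module coalg XM x) \<rho> a)) = germ XM x (\<lambda>y. (SOME f. f \<in> \<rho>) y * local_bg q a y)"
    if "\<rho> \<in> scal (local_module coalg XM x)" "a \<in> carr (local_module coalg XM x)"
    for \<rho> and a :: "('p, 'k) germ_section set" by (rule smul[OF p(2,4) that])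
qed

lemma local_bg_dcop:
  assumes p: "p \<in> pts P" "q \<in> pts P" "\<pi> p = x" "\<pi> q = x" and L: "valid L"
  shows "germ XM x (frag_eval (\<lambda>(a, b) y. local_bg p a y * local_bg q b y) (local_frag x (\<Sum>(U, f)\<leftarrow>L. dcop U f))) =
     germ XM x (pair_eval p q (\<Sum>(U, f)\<leftarrow>L. dcop U f))"
  using L
proof (induction L)
  case Nil
  show ?case by (simp add: local_frag_simps frag_eval_zero[abs_def])
next
  case (Cons a L)
  obtain U f where a: "a = (U, f)" by force
  have U: "el U" "f \<in> Cc0 M (\<pi> ` U)" "valid L" using Cons.prems a by auto
  note e = elem_fun_Cc[OF U(1,2)] elem_fun_Cc[OF U(1) unit_of(1)[OF U(1,2)]]
  have "germ XM x (\<lambda>y. local_bg p (Cls x (elem U f)) y * local_bg q (Cls x (elem U (unit_of U f))) y) =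
     germ XM x (\<lambda>y. bg (elem U f) p y * bg (elem U (unit_of U f)) q y)"
    using germ_binop[OF local_bg[OF e(1) p(1), unfolded p(3)] local_bg[OF e(2) p(2), unfolded p(4)], of times] .
  from germ_binop[OF this Cons.IH[OF U(3)], of "(+)"]
  show ?case by (simp add: a dcop_def local_frag_simps frag_eval_add[abs_def] frag_eval_of)
qed

text \<open>In one direction the second factor in \<open>delta_from_products\<close> is
  \<open>c\<close> itself. In the other, a bump that is 1 near the base point and its local unit are
  both deltas at \<open>p\<close>, so their classes coincide and the coproduct becomes a tensor
  square.\<close>

theorem grouplike_at_eq:
  assumes x: "x \<in> pts M"
  shows "grouplike_at (coalg :: ('x \<Rightarrow> 'k::real_normed_field, _) coalgebra) XM x =
    {Cls x c |c p. \<pi> p = x \<and> delta c p}"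
proof
  show "grouplike_at (coalg :: ('x \<Rightarrow> 'k, ('p, 'k) germ_section) coalgebra) XM x \<subseteq> {Cls x c |c p. \<pi> p = x \<and> delta c p}"
  proof
    fix \<zeta> :: "('p, 'k) germ_section set" assume "\<zeta> \<in> grouplike_at coalg XM x"
    then obtain c where c: "c \<in> Cc P" "\<zeta> = Cls x c"
      and com: "comul (local_coalgebra coalg XM x) \<zeta> = tensor (local_module coalg XM x) \<zeta> \<zeta>"
      and cou: "cou (local_coalgebra coalg XM x) \<zeta> = germ XM x (\<lambda>_. 1)"
      unfolding grouplike_at_def tensor_local by auto
    have "tensor_class (local_module coalg XM x) (local_frag x (\<Sum>(U, f)\<leftarrow>rep c. dcop U f)) =
       tensor_class (local_module coalg XM x) (frag_of (\<zeta>, \<zeta>))"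
      using local_comul_Cls[OF x rep[OF c(1), simplified eq_commute[of "sect _"]]] com c(2) by (simp add: tensor_def)
    then have n: "local_frag x (\<Sum>(U, f)\<leftarrow>rep c. dcop U f) - frag_of (\<zeta>, \<zeta>) \<in> tensor_null (local_module coalg XM x)"
      by (simp add: tensor_class_eq_iff)
    have "\<exists>p. \<pi> p = x \<and> delta c p"
    proof (rule delta_from_products[OF x c(1) bg_Cc0[OF c(1)]])
      fix p q assume p: "p \<in> pts P" "q \<in> pts P" "\<pi> p = x" "\<pi> q = x"
      have "germ XM x (\<lambda>y. local_bg p \<zeta> y * local_bg q \<zeta> y) = germ XM x (frag_eval (\<lambda>(a, b) y. local_bg p a y * local_bg q b y) (local_frag x (\<Sum>(U, f)\<leftarrow>rep c. dcop U f)))"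
        using local_bg_null[OF p n] by (simp add: frag_eval_diff[abs_def] frag_eval_of germ_zero_iff)
      moreover have "germ XM x (\<lambda>y. local_bg p \<zeta> y * local_bg q \<zeta> y) = germ XM x (\<lambda>y. bg c p y * bg c q y)"
        using germ_binop[OF local_bg[OF c(1) p(1), unfolded p(3)] local_bg[OF c(1) p(2), unfolded p(4)], of times] c(2) by simp
      ultimately show "germ XM x (\<lambda>y. bg c p y * bg c q y) = germ XM x (if p = q then bg c p else (\<lambda>_. 0))"
        using local_bg_dcop[OF p rep(1)[OF c(1)]] pair_eval_dcop[OF p rep(1)[OF c(1)]] by (simp only: bg_def)
    next
      have "Cc_counit M P \<pi> c \<in> germ XM x (\<lambda>_. 1)"
        using cou germ_self[OF x] Cls_self[OF x c(1)] unfolding local_coalgebra_cou c(2) by blast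
      then show "germ XM x (Cc_counit M P \<pi> c) = germ XM x (\<lambda>_. 1)" by (rule germ_memD)
    qed
    then show "\<zeta> \<in> {Cls x c |c p. \<pi> p = x \<and> delta c p}" using c(2) by blast
  qed
  show "{Cls x c |c p. \<pi> p = x \<and> delta c p} \<subseteq> grouplike_at (coalg :: ('x \<Rightarrow> 'k, ('p, 'k) germ_section) coalgebra) XM x"
  proof
    fix \<zeta> :: "('p, 'k) germ_section set" assume "\<zeta> \<in> {Cls x c |c p. \<pi> p = x \<and> delta c p}"
    then obtain c p where c: "\<zeta> = Cls x c" "\<pi> p = x" "delta c p" by blast
    have pP: "p \<in> pts P" using c(3) by (simp add: delta_def)
    obtain U and f :: "'x \<Rightarrow> 'k" and N where U: "el U" "p \<in> U" "f \<in> Cc0 M (\<pi> ` U)"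
      "openin XM N" "\<pi> p \<in> N" "\<And>y. y \<in> N \<Longrightarrow> f y = 1"
      by (rule delta_exists[OF openin_topspace pP, where ?'k = 'k]) blast
    let ?e = "elem U f" and ?u = "unit_of U f"
    note n = unit_of[OF U(1,3)]
    have u1: "?u y = 1" if "y \<in> N" for y using n(2)[of y] U(6)[OF that] by simp
    have de: "delta ?e p" by (rule elem_delta[OF U(1,3,2,4,5,6)])
    have du: "delta (elem U ?u) p" by (rule elem_delta[OF U(1) n(1) U(2,4,5) u1])
    have \<zeta>: "\<zeta> = Cls x ?e" using delta_Cls[OF c(3) de] c by simp
    have \<zeta>u: "\<zeta> = Cls x (elem U ?u)" using delta_Cls[OF c(3) du] c by simp
    have valid_e: "valid [(U, f)]" using U by simp
    have "comul (local_coalgebra coalg XM x) \<zeta> = tensor_class (local_module coalg XM x) (local_frag x (dcop U f))"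
      unfolding \<zeta> using local_comul_Cls[OF x valid_e elem_fun_lsum] by (simp del: lsum_simps)
    also have "local_frag x (dcop U f) = frag_of (\<zeta>, \<zeta>)" unfolding dcop_def local_frag_simps using \<zeta> \<zeta>u by simp
    finally have 1: "comul (local_coalgebra coalg XM x) \<zeta> = tensor (local_coalgebra coalg XM x) \<zeta> \<zeta>"
      unfolding tensor_local tensor_def .
    have eC: "?e \<in> Cc P" by (rule elem_fun_Cc[OF U(1,3)])
    have "germ XM x (Cc_counit M P \<pi> d) = germ XM x (\<lambda>_. 1)" if "d \<in> \<zeta>" for d
    proof -
      have "d \<in> Cc P \<and> Cls x d = Cls x ?e" using Cls_mem[OF x eC] that \<zeta> by simp
      then have "delta d p" using Cls_delta[OF de, of d] c(2) by simp
      then show ?thesis using delta_counit c(2) by blast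
    qed
    moreover have "?e \<in> \<zeta>" unfolding \<zeta> by (rule Cls_self[OF x eC])
    ultimately have 2: "cou (local_coalgebra coalg XM x) \<zeta> = germ XM x (\<lambda>_. 1)"
      unfolding local_coalgebra_cou by auto
    show "\<zeta> \<in> grouplike_at coalg XM x"
      unfolding grouplike_at_def using 1 2 eC \<zeta> by auto
  qed
qed


section \<open>The spectral manifold\<close>

abbreviation spect :: "('x \<times> ('p, 'k::real_normed_field) germ_section set, 'e) manifold" where
  "spect \<equiv> spectral_manifold coalg M"

definition Phi :: "'p \<Rightarrow> 'x \<times> ('p, 'k::real_normed_field) germ_section set" where
  "Phi p = (\<pi> p, Cls (\<pi> p) (SOME c. delta c p))"

lemma delta_ex:
  assumes "p \<in> pts P"
  shows "\<exists>c :: ('p, 'k::real_normed_field) germ_section. delta c p \<and> c \<in> weakly_grouplike coalg \<and>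
    normalised_near coalg XM (\<pi> p) c"
proof -
  obtain U and f :: "'x \<Rightarrow> 'k" and N where U: "el U" "p \<in> U" "f \<in> Cc0 M (\<pi> ` U)"
    "openin XM N" "\<pi> p \<in> N" "\<And>y. y \<in> N \<Longrightarrow> f y = 1"
    by (rule delta_exists[OF openin_topspace assms, where ?'k = 'k]) blast
  have "normalised_near coalg XM (\<pi> p) (elem U f)"
    unfolding normalised_near_def normalised_on_def using counit_elem[OF U(1,3)] U(4-6) by auto
  then show ?thesis using elem_delta[OF U(1,3,2,4,5,6)] elem_weakly_grouplike[OF U(1,3)] by blast
qed

lemma delta_D: "delta c p \<Longrightarrow> c \<in> Cc P" "delta c p \<Longrightarrow> p \<in> pts P"
  by (simp_all add: delta_def)

lemma Phi_eq:
  assumes "delta (c :: ('p, 'k::real_normed_field) germ_section) p"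
  shows "Phi p = (\<pi> p, Cls (\<pi> p) c)"
proof -
  have "delta (SOME c :: ('p, 'k) germ_section. delta c p) p" by (rule someI[where P = "\<lambda>c. delta c p", OF assms])
  from delta_Cls[OF this assms] show ?thesis by (simp add: Phi_def)
qed

lemma fst_Phi [simp]: "fst (Phi p) = \<pi> p"
  by (simp add: Phi_def)

lemma Phi_eq_iff:
  assumes "c \<in> Cc P" "p \<in> pts P"
  shows "Phi p = (\<pi> p, Cls (\<pi> p) c) \<longleftrightarrow> delta (c :: ('p, 'k::real_normed_field) germ_section) p"
proof
  assume A: "Phi p = (\<pi> p, Cls (\<pi> p) c)"
  obtain d :: "('p, 'k) germ_section" where d: "delta d p" using delta_ex[OF assms(2)] by blast
  show "delta c p" by (rule Cls_delta[OF d assms(1)]) (use Phi_eq[OF d] A in simp)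
qed (rule Phi_eq)

lemma Phi_inj: "inj_on (Phi :: 'p \<Rightarrow> 'x \<times> ('p, 'k::real_normed_field) germ_section set) (pts P)"
proof (rule inj_onI)
  fix p q assume pq: "p \<in> pts P" "q \<in> pts P" "(Phi :: 'p \<Rightarrow> 'x \<times> ('p, 'k) germ_section set) p = Phi q"
  obtain d :: "('p, 'k) germ_section" where d: "delta d p" using delta_ex[OF pq(1)] by blast
  have "\<pi> p = \<pi> q" using arg_cong[OF pq(3), of fst] by simp
  then have "delta d q" using Phi_eq_iff[OF delta_D(1)[OF d] pq(2)] Phi_eq[OF d] pq(3) by simp
  then show "p = q" using delta_unique[OF d] \<open>\<pi> p = \<pi> q\<close> by blast
qed

lemma spectral_space_eq:
  "spectral_space (coalg :: ('x \<Rightarrow> 'k::real_normed_field, _) coalgebra) XM = Phi ` pts P"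
proof
  show "spectral_space (coalg :: ('x \<Rightarrow> 'k, ('p, 'k) germ_section) coalgebra) XM \<subseteq> Phi ` pts P"
  proof
    fix \<xi> assume "\<xi> \<in> spectral_space (coalg :: ('x \<Rightarrow> 'k, ('p, 'k) germ_section) coalgebra) XM"
    then obtain x \<zeta> where x: "\<xi> = (x, \<zeta>)" "x \<in> pts M" "\<zeta> \<in> grouplike_at (coalg :: ('x \<Rightarrow> 'k, ('p, 'k) germ_section) coalgebra) XM x"
      unfolding spectral_space_def by blast
    then obtain c p where c: "\<zeta> = Cls x c" "\<pi> p = x" "delta c p" unfolding grouplike_at_eq[OF x(2)] by blast
    then show "\<xi> \<in> Phi ` pts P" using Phi_eq[OF c(3)] delta_D(2)[OF c(3)] x(1) by (intro image_eqI[of _ _ p]) auto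
  qed
  show "Phi ` pts P \<subseteq> spectral_space (coalg :: ('x \<Rightarrow> 'k, ('p, 'k) germ_section) coalgebra) XM"
  proof (intro image_subsetI)
    fix p assume p: "p \<in> pts P"
    obtain d :: "('p, 'k) germ_section" where d: "delta d p" using delta_ex[OF p] by blast
    show "Phi p \<in> spectral_space (coalg :: ('x \<Rightarrow> 'k, ('p, 'k) germ_section) coalgebra) XM"
      unfolding spectral_space_def Phi_eq[OF d] using d pi_pts[OF p] by (auto simp: grouplike_at_eq)
  qed
qed

text \<open>The set where \<open>c\<close> is a delta is open by \<open>delta_open\<close> and meets
  each fibre at most once by \<open>delta_unique\<close>; normalisation on \<open>W\<close> makes it
  meet every fibre over \<open>W\<close>. Basic sets are thus exactly images of sheets.\<close>

lemma spectral_basic_eq: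
  fixes c :: "('p, 'k::real_normed_field) germ_section"
  assumes W: "openin XM W" and c: "c \<in> weakly_grouplike coalg" "normalised_on coalg W c"
  shows "\<exists>V. el V \<and> \<pi> ` V = W \<and> spectral_basic coalg XM W c = Phi ` V \<and> V = {p. \<pi> p \<in> W \<and> delta c p}"
proof -
  define V where "V = {p. \<pi> p \<in> W \<and> delta c p}"
  have ex: "\<exists>p. \<pi> p = x \<and> delta c p" if "x \<in> W" for x
    using weakly_grouplike_normalised_delta[OF c(1), of x] W c(2) that unfolding normalised_near_def by blast
  have im: "\<pi> ` V = W" using ex by (force simp: V_def)
  have "openin XP V"
  proof (subst openin_subopen, safe)
    fix p assume p: "p \<in> V"
    then obtain U where U: "el U" "p \<in> U" "\<forall>q\<in>U. delta c q" using delta_open[of c p] by (auto simp: V_def)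
    let ?T = "U \<inter> {q \<in> pts P. \<pi> q \<in> W}"
    have "openin XP ?T" by (rule el_open[OF el_restrict[OF U(1) W]])
    moreover have "p \<in> ?T" using p U(2) delta_D(2)[of c p] by (auto simp: V_def)
    moreover have "?T \<subseteq> V" using U(3) by (auto simp: V_def)
    ultimately show "\<exists>T. openin XP T \<and> p \<in> T \<and> T \<subseteq> V" by blast
  qed
  moreover have "inj_on \<pi> V" by (rule inj_onI) (use delta_unique in \<open>auto simp: V_def\<close>)
  ultimately have "el V" by (simp add: elementary_def)
  moreover have "spectral_basic coalg XM W c = Phi ` V"
  proof -
    have "spectral_basic coalg XM W c = (\<lambda>x. (x, Cls x c)) ` \<pi> ` V" by (simp add: spectral_basic_def im)
    also have "\<dots> = Phi ` V" unfolding image_image by (rule image_cong[OF refl]) (use Phi_eq[of c] in \<open>simp add: V_def\<close>)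
    finally show ?thesis .
  qed
  ultimately show ?thesis using im V_def by blast
qed

lemma basic_exists:
  assumes W: "openin XP W" "p \<in> W" and T: "openin XM T" "\<pi> p \<in> T"
  obtains N V and c :: "('p, 'k::real_normed_field) germ_section" where "openin XM N" "N \<subseteq> T"
    "c \<in> weakly_grouplike coalg" "normalised_on coalg N c"
    "spectral_basic coalg XM N c = Phi ` V" "el V" "\<pi> ` V = N" "p \<in> V" "V \<subseteq> W"
proof -
  obtain U and f :: "'x \<Rightarrow> 'k" and N where U: "el U" "p \<in> U" "U \<subseteq> W" "f \<in> Cc0 M (\<pi> ` U)"
    "openin XM N" "\<pi> p \<in> N" "N \<subseteq> \<pi> ` U" "\<And>y. y \<in> N \<Longrightarrow> f y = 1"
    by (rule delta_exists[OF W, where ?'k = 'k]) blast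
  let ?N = "N \<inter> T" and ?c = "elem U f"
  have N: "openin XM ?N" using U(5) T(1) by blast
  have c: "?c \<in> weakly_grouplike coalg" "normalised_on coalg ?N ?c"
    using elem_weakly_grouplike[OF U(1,4)] counit_elem[OF U(1,4)] U(8) by (auto simp: normalised_on_def)
  obtain V where V: "el V" "\<pi> ` V = ?N" "spectral_basic coalg XM ?N ?c = Phi ` V" "V = {p. \<pi> p \<in> ?N \<and> delta ?c p}"
    using spectral_basic_eq[OF N c] by blast
  have "p \<in> V" unfolding V(4) using elem_delta[OF U(1,4,2,5,6,8)] U(6) T(2) by simp
  \<comment> \<open>The sheet of deltas is not placed inside \<open>U\<close> by construction. Over
    \<open>N\<close> the section is also a delta at the point of \<open>U\<close>, and uniqueness in
    the fibre identifies the two points.\<close>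
  moreover have "V \<subseteq> W"
  proof
    fix q assume "q \<in> V"
    then have q: "\<pi> q \<in> N" "delta ?c q" unfolding V(4) by simp_all
    then obtain q' where q': "q' \<in> U" "\<pi> q' = \<pi> q" using U(7) by (metis imageE subsetD)
    have "delta ?c q'" by (rule elem_delta[OF U(1,4) q'(1) U(5) _ U(8)]) (use q q' in simp_all)
    then have "q' = q" using delta_unique q(2) q'(2) by blast
    then show "q \<in> W" using q'(1) U(3) by blast
  qed
  ultimately show ?thesis using that[OF N _ c V(3) V(1,2)] by blast
qed

lemma spect_top: "topspace (mtop (spect :: ('x \<times> ('p, 'k::real_normed_field) germ_section set, 'e) manifold)) = Phi ` pts P"
proof -
  have "spectral_basic coalg XM W c \<subseteq> Phi ` pts P"
    if W: "openin XM W" "c \<in> weakly_grouplike coalg" "normalised_on coalg W c"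
    for W and c :: "('p, 'k) germ_section"
    using spectral_basic_eq[OF W] el_pts by blast
  then show ?thesis
    unfolding spectral_manifold_def by (auto simp: topology_generated_by_topspace spectral_space_eq)
qed

text \<open>Generated sets are images by induction, intersections being preserved because
  \<open>Phi\<close> is injective; conversely, \<open>basic_exists\<close> fills the image of an
  open set with basic sets.\<close>

lemma spect_openin:
  "openin (mtop (spect :: ('x \<times> ('p, 'k::real_normed_field) germ_section set, 'e) manifold)) T \<longleftrightarrow> (\<exists>W. openin XP W \<and> T = Phi ` W)"
proof -
  let ?S = "insert (spectral_space (coalg :: ('x \<Rightarrow> 'k, ('p, 'k) germ_section) coalgebra) XM)
        {spectral_basic coalg XM W c | W c.
           openin XM W \<and> c \<in> weakly_grouplike (coalg :: ('x \<Rightarrow> 'k, ('p, 'k) germ_section) coalgebra) \<and> normalised_on coalg W c}"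
  have mt: "mtop (spect :: ('x \<times> ('p, 'k) germ_section set, 'e) manifold) = topology_generated_by ?S"
    by (simp add: spectral_manifold_def)
  have "\<exists>W. openin XP W \<and> T = Phi ` W" if "generate_topology_on ?S T" for T
    using that
  proof (induction T rule: generate_topology_on.induct)
    case Empty
    show ?case by (intro exI[of _ "{}"]) simp
  next
    case (Int a b)
    then obtain A B where AB: "openin XP A" "a = Phi ` A" "openin XP B" "b = Phi ` B" by blast
    have "Phi ` A \<inter> Phi ` B = Phi ` (A \<inter> B)"
      using inj_on_image_Int[OF Phi_inj] openin_subset[OF AB(1)] openin_subset[OF AB(3)] by metis
    then show ?case using AB by (intro exI[of _ "A \<inter> B"]) auto
  next
    case (UN K)
    then obtain A where A: "\<And>k. k \<in> K \<Longrightarrow> openin XP (A k) \<and> k = Phi ` A k" by metis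
    have "\<Union>K = (\<Union>k\<in>K. Phi ` A k)"
      using SUP_cong[of K K "\<lambda>k. k" "\<lambda>k. Phi ` A k"] A by simp
    then have "\<Union>K = Phi ` (\<Union>k\<in>K. A k)" by (simp add: image_UN)
    then show ?case using A by (intro exI[of _ "\<Union>k\<in>K. A k"]) auto
  next
    case (Basis s)
    show ?case
    proof (cases "s = spectral_space (coalg :: ('x \<Rightarrow> 'k, ('p, 'k) germ_section) coalgebra) XM")
      case True
      then show ?thesis using spectral_space_eq openin_topspace by blast
    next
      case False
      then obtain W and c :: "('p, 'k) germ_section" where W: "openin XM W" "c \<in> weakly_grouplike coalg"
        "normalised_on coalg W c" "s = spectral_basic coalg XM W c" using Basis by blast
      then show ?thesis using spectral_basic_eq[OF W(1-3)] el_open by blast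
    qed
  qed
  moreover have "openin (topology_generated_by ?S) (Phi ` W)" if W: "openin XP W" for W
  proof (subst openin_subopen, intro ballI)
    fix \<xi> assume "\<xi> \<in> (Phi :: 'p \<Rightarrow> 'x \<times> ('p, 'k) germ_section set) ` W"
    then obtain p where p: "p \<in> W" "\<xi> = Phi p" by blast
    have "\<pi> p \<in> pts M" using pi_pts openin_subset[OF W] p(1) by blast
    then obtain N V and c :: "('p, 'k) germ_section" where N: "openin XM N" "c \<in> weakly_grouplike coalg"
      "normalised_on coalg N c" "spectral_basic coalg XM N c = Phi ` V" "p \<in> V" "V \<subseteq> W"
      using basic_exists[OF W p(1) openin_topspace, where ?'k = 'k] by metis
    have "openin (topology_generated_by ?S) (Phi ` V)"
      by (rule topology_generated_by_Basis) (use N in blast)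
    then show "\<exists>T. openin (topology_generated_by ?S) T \<and> \<xi> \<in> T \<and> T \<subseteq> Phi ` W" using N p by blast
  qed
  ultimately show ?thesis unfolding mt
    using openin_topology_generated_by_iff[of ?S T] by (elim iffE) blast
qed

lemma spect_chartD:
  assumes "(B, \<psi>) \<in> atlas (spect :: ('x \<times> ('p, 'k::real_normed_field) germ_section set, 'e) manifold)"
  obtains U \<phi> V where "(U, \<phi>) \<in> atlas M" "el V" "B = Phi ` V" "\<pi> ` V \<subseteq> U" "\<psi> = \<phi> \<circ> fst"
proof -
  obtain W and c :: "('p, 'k) germ_section" and U \<phi> where B: "B = spectral_basic coalg XM W c" "\<psi> = \<phi> \<circ> fst"
    "(U, \<phi>) \<in> atlas M" "W \<subseteq> U" "openin XM W" "c \<in> weakly_grouplike coalg" "normalised_on coalg W c"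
    using assms unfolding spectral_manifold_def by auto
  obtain V where "el V" "\<pi> ` V = W" "spectral_basic coalg XM W c = Phi ` V"
    using spectral_basic_eq[OF B(5-7)] by blast
  then show ?thesis using that[OF B(3), of V] B(1,2,4) by simp
qed

lemma spect_chart_exists:
  assumes p: "p \<in> pts P"
  obtains U \<phi> V where "(U, \<phi>) \<in> atlas M" "el V" "p \<in> V" "\<pi> ` V \<subseteq> U"
    "(Phi ` V, \<phi> \<circ> fst) \<in> atlas (spect :: ('x \<times> ('p, 'k::real_normed_field) germ_section set, 'e) manifold)"
proof -
  obtain U \<phi> where U: "(U, \<phi>) \<in> atlas M" "\<pi> p \<in> U" using chart_exists[OF M pi_pts[OF p]] by blast
  obtain N V and c :: "('p, 'k) germ_section" where N: "openin XM N" "N \<subseteq> U" "c \<in> weakly_grouplike coalg"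
      "normalised_on coalg N c" "spectral_basic coalg XM N c = Phi ` V" "el V" "\<pi> ` V = N" "p \<in> V"
    by (rule basic_exists[OF openin_topspace p chart_openin[OF M U(1)] U(2), where ?'k = 'k]) blast
  have "(Phi ` V, \<phi> \<circ> fst) \<in> atlas (spect :: ('x \<times> ('p, 'k) germ_section set, 'e) manifold)"
    unfolding spectral_manifold_def using N U(1) by (simp flip: N(5)) blast
  then show ?thesis using that[OF U(1) N(6,8)] N(2,7) by blast
qed

lemma Phi_Int: "V \<subseteq> pts P \<Longrightarrow> V' \<subseteq> pts P \<Longrightarrow> Phi ` V \<inter> Phi ` V' = Phi ` (V \<inter> V')"
  using inj_on_image_Int[OF Phi_inj] by metis

lemma spect_chart_inv:
  assumes "(U, \<phi>) \<in> atlas M" "el V" "\<pi> ` V \<subseteq> U" "p \<in> V"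
  shows "inv_into (Phi ` V) (\<phi> \<circ> fst) (\<phi> (\<pi> p)) = (Phi p :: 'x \<times> ('p, 'k::real_normed_field) germ_section set)"
proof -
  have "inj_on (\<phi> \<circ> fst) (Phi ` V :: ('x \<times> ('p, 'k) germ_section set) set)"
  proof (rule inj_onI)
    fix \<xi> \<zeta> :: "'x \<times> ('p, 'k) germ_section set"
    assume A: "\<xi> \<in> Phi ` V" "\<zeta> \<in> Phi ` V" "(\<phi> \<circ> fst) \<xi> = (\<phi> \<circ> fst) \<zeta>"
    then obtain q r where qr: "q \<in> V" "\<xi> = Phi q" "r \<in> V" "\<zeta> = Phi r" by blast
    then have "\<phi> (\<pi> q) = \<phi> (\<pi> r)" using A(3) by simp
    then have "\<pi> q = \<pi> r" using chart_inj[OF M assms(1)] assms(3) qr by (auto dest: inj_onD)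
    then show "\<xi> = \<zeta>" using el_injD[OF assms(2) qr(1,3)] qr by simp
  qed
  then have "inv_into (Phi ` V) (\<phi> \<circ> fst) ((\<phi> \<circ> fst) (Phi p :: 'x \<times> ('p, 'k) germ_section set)) = (Phi p :: 'x \<times> ('p, 'k) germ_section set)" using assms(4) by (intro inv_into_f_f) auto
  then show ?thesis by simp
qed

text \<open>Every spectral chart is a chart of \<open>M\<close> applied to the projection of a sheet
  \<open>V\<close>, so openness, the homeomorphism property and transition maps are all read off on
  the base.\<close>

lemma spect_manifold: "is_manifold (spect :: ('x \<times> ('p, 'k::real_normed_field) germ_section set, 'e) manifold)"
  unfolding is_manifold_def
proof (intro conjI)
  let ?Q = "spect :: ('x \<times> ('p, 'k) germ_section set, 'e) manifold"
  show "\<exists>B :: 'e set. finite B \<and> span B = UNIV" using M unfolding is_manifold_def by simp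
  show "\<forall>(B, \<psi>)\<in>atlas ?Q. openin (mtop ?Q) B \<and> open (\<psi> ` B) \<and>
        homeomorphic_map (subtopology (mtop ?Q) B) (top_of_set (\<psi> ` B)) \<psi>"
  proof safe
    fix B \<psi> assume B: "(B, \<psi>) \<in> atlas ?Q"
    obtain U \<phi> V where V: "(U, \<phi>) \<in> atlas M" "el V" "B = Phi ` V" "\<pi> ` V \<subseteq> U" "\<psi> = \<phi> \<circ> fst"
      by (rule spect_chartD[OF B])
    have op: "open (\<psi> ` Phi ` W)" if "openin XP W" "W \<subseteq> V" for W
    proof -
      have "\<psi> ` Phi ` W = \<phi> ` (U \<inter> \<pi> ` W)" using V(4,5) that(2) by (auto simp: image_image)
      then show ?thesis using chart_open_image[OF M V(1) open_image[OF that(1)]] by simp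
    qed
    show oB: "openin (mtop ?Q) B" unfolding spect_openin using V(3) el_open[OF V(2)] by blast
    show oP: "open (\<psi> ` B)" unfolding V(3) by (rule op[OF el_open[OF V(2)] subset_refl])
    have tB: "topspace (subtopology (mtop ?Q) B) = B" using openin_subset[OF oB] by (simp add: inf_absorb2)
    have openB: "openin (subtopology (mtop ?Q) B) T \<longleftrightarrow> (\<exists>W. openin XP W \<and> W \<subseteq> V \<and> T = Phi ` W)" for T
    proof
      assume "openin (subtopology (mtop ?Q) B) T"
      then obtain W where W: "openin XP W" "T = Phi ` W \<inter> B" unfolding openin_subtopology spect_openin by blast
      then have "T = Phi ` (W \<inter> V)" using Phi_Int openin_subset[OF W(1)] el_pts[OF V(2)] V(3) by metis
      then show "\<exists>W. openin XP W \<and> W \<subseteq> V \<and> T = Phi ` W" using W(1) el_open[OF V(2)] by blast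
    next
      assume "\<exists>W. openin XP W \<and> W \<subseteq> V \<and> T = Phi ` W"
      then obtain W where W: "openin XP W" "W \<subseteq> V" "T = Phi ` W" by blast
      then have "openin (mtop ?Q) T" "T = T \<inter> B" using spect_openin V(3) by blast+
      then show "openin (subtopology (mtop ?Q) B) T" unfolding openin_subtopology by blast
    qed
    show "homeomorphic_map (subtopology (mtop ?Q) B) (top_of_set (\<psi> ` B)) \<psi>"
    proof (rule bijective_open_imp_homeomorphic_map)
      show "continuous_map (subtopology (mtop ?Q) B) (top_of_set (\<psi> ` B)) \<psi>"
        unfolding continuous_map_in_subtopology tB
      proof (intro conjI)
        show "continuous_map (subtopology (mtop ?Q) B) euclidean \<psi>"
          unfolding continuous_map_def tB
        proof (intro conjI allI impI)
          fix S :: "'e set" assume "openin euclidean S"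
          then have S: "open S" using open_openin by blast
          have "{q \<in> U. \<phi> q \<in> S} \<subseteq> pts M" using chart_subset[OF M V(1)] by blast
          have "openin XP (V \<inter> {p \<in> pts P. \<pi> p \<in> {q \<in> U. \<phi> q \<in> S}})"
            by (rule el_open[OF el_restrict[OF V(2) chart_open_preimage[OF M V(1) S]]])
          moreover have "V \<inter> {p \<in> pts P. \<pi> p \<in> {q \<in> U. \<phi> q \<in> S}} = {p \<in> V. \<psi> (Phi p) \<in> S}"
            using V(4,5) el_pts[OF V(2)] by auto
          moreover have "{\<xi> \<in> B. \<psi> \<xi> \<in> S} = Phi ` {p \<in> V. \<psi> (Phi p) \<in> S}" unfolding V(3) by blast
          ultimately show "openin (subtopology (mtop ?Q) B) {x \<in> B. \<psi> x \<in> S}"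
            unfolding openB by (intro exI[of _ "{p \<in> V. \<psi> (Phi p) \<in> S}"]) auto
        qed simp
      qed simp
      show "open_map (subtopology (mtop ?Q) B) (top_of_set (\<psi> ` B)) \<psi>"
        unfolding open_map_def
      proof (intro allI impI)
        fix T assume "openin (subtopology (mtop ?Q) B) T"
        then obtain W where W: "openin XP W" "W \<subseteq> V" "T = Phi ` W" unfolding openB by blast
        then have "open (\<psi> ` T)" "\<psi> ` T \<subseteq> \<psi> ` B" using op V(3) by auto
        then show "openin (top_of_set (\<psi> ` B)) (\<psi> ` T)" by (simp add: openin_open_eq oP)
      qed
      show "\<psi> ` topspace (subtopology (mtop ?Q) B) = topspace (top_of_set (\<psi> ` B))" unfolding tB by simp
      show "inj_on \<psi> (topspace (subtopology (mtop ?Q) B))"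
        unfolding tB
      proof (rule inj_onI)
        fix \<xi> \<zeta> assume A: "\<xi> \<in> B" "\<zeta> \<in> B" "\<psi> \<xi> = \<psi> \<zeta>"
        then obtain p q where pq: "p \<in> V" "\<xi> = Phi p" "q \<in> V" "\<zeta> = Phi q" using V(3) by blast
        then show "\<xi> = \<zeta>" using A(3) V(5) spect_chart_inv[OF V(1,2,4) pq(1)] spect_chart_inv[OF V(1,2,4) pq(3)] by (metis comp_apply fst_Phi)
      qed
    qed
  qed
  show "(\<Union>(B, \<psi>)\<in>atlas ?Q. B) = pts ?Q"
  proof
    show "(\<Union>(B, \<psi>)\<in>atlas ?Q. B) \<subseteq> pts ?Q"
    proof safe
      fix \<xi>1 \<xi>2 B \<psi> assume B: "(B, \<psi>) \<in> atlas ?Q" "(\<xi>1, \<xi>2) \<in> B"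
      show "(\<xi>1, \<xi>2) \<in> pts ?Q"
        by (rule spect_chartD[OF B(1)]) (use B(2) el_pts spect_top in blast)
    qed
    show "pts ?Q \<subseteq> (\<Union>(B, \<psi>)\<in>atlas ?Q. B)"
      unfolding spect_top
    proof (intro image_subsetI)
      fix p assume p: "p \<in> pts P"
      obtain U \<phi> V where "p \<in> V" "(Phi ` V, \<phi> \<circ> fst) \<in> atlas ?Q" by (rule spect_chart_exists[OF p, where ?'k = 'k])
      then show "Phi p \<in> (\<Union>(B, \<psi>)\<in>atlas ?Q. B)" by blast
    qed
  qed
  show "\<forall>(B, \<psi>)\<in>atlas ?Q. \<forall>(B', \<psi>')\<in>atlas ?Q. smooth_on (\<psi> ` (B \<inter> B')) (\<psi>' \<circ> inv_into B \<psi>)"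
  proof safe
    fix B \<psi> B' \<psi>' assume B: "(B, \<psi>) \<in> atlas ?Q" "(B', \<psi>') \<in> atlas ?Q"
    obtain U \<phi> V where V: "(U, \<phi>) \<in> atlas M" "el V" "B = Phi ` V" "\<pi> ` V \<subseteq> U" "\<psi> = \<phi> \<circ> fst"
      by (rule spect_chartD[OF B(1)])
    obtain U' \<phi>' V' where V': "(U', \<phi>') \<in> atlas M" "el V'" "B' = Phi ` V'" "\<pi> ` V' \<subseteq> U'" "\<psi>' = \<phi>' \<circ> fst"
      by (rule spect_chartD[OF B(2)])
    have "B \<inter> B' = Phi ` (V \<inter> V')" unfolding V(3) V'(3) by (rule Phi_Int[OF el_pts[OF V(2)] el_pts[OF V'(2)]])
    then have im: "\<psi> ` (B \<inter> B') = \<phi> ` (U \<inter> \<pi> ` (V \<inter> V'))" using V(4,5) by (auto simp: image_image)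
    have o: "openin XP (V \<inter> V')" using el_open V(2) V'(2) by blast
    show "smooth_on (\<psi> ` (B \<inter> B')) (\<psi>' \<circ> inv_into B \<psi>)"
      unfolding im
    proof (rule smooth_on_cong[OF chart_open_image[OF M V(1) open_image[OF o]]])
      show "smooth_on (\<phi> ` (U \<inter> \<pi> ` (V \<inter> V'))) (\<phi>' \<circ> inv_into U \<phi>)"
        by (rule smooth_on_subset[OF chart_transition[OF M V(1) V'(1)]]) (use V'(4) in auto)
      fix y assume "y \<in> \<phi> ` (U \<inter> \<pi> ` (V \<inter> V'))"
      then obtain p where p: "p \<in> V" "p \<in> V'" "\<pi> p \<in> U" "y = \<phi> (\<pi> p)" by auto
      then show "(\<phi>' \<circ> inv_into U \<phi>) y = (\<psi>' \<circ> inv_into B \<psi>) y"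
        using chart_inv[OF M V(1) p(3)] spect_chart_inv[OF V(1,2,4) p(1), where ?'k = 'k] by (simp add: V(3,5) V'(5))
    qed
  qed
qed

lemma smooth_fst: "smooth_map (spect :: ('x \<times> ('p, 'k::real_normed_field) germ_section set, 'e) manifold) (pts spect) M fst"
proof (rule smooth_mapI[OF spect_manifold subset_refl])
  let ?Q = "spect :: ('x \<times> ('p, 'k) germ_section set, 'e) manifold"
  show "fst ` pts ?Q \<subseteq> pts M" unfolding spect_top using pi_pts by auto
  fix \<xi> assume "\<xi> \<in> pts ?Q"
  then obtain p where p: "p \<in> pts P" "\<xi> = Phi p" unfolding spect_top by blast
  obtain U \<phi> V where V: "(U, \<phi>) \<in> atlas M" "el V" "p \<in> V" "\<pi> ` V \<subseteq> U" "(Phi ` V, \<phi> \<circ> fst) \<in> atlas ?Q"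
    by (rule spect_chart_exists[OF p(1), where ?'k = 'k])
  have "smooth_function ?Q (Phi ` V) (\<lambda>x. \<phi> (fst x))"
    using smooth_function_of_chart[OF spect_manifold V(5)] by (simp add: o_def)
  then have "smooth_function ?Q (pts ?Q \<inter> Phi ` V) (\<lambda>x. \<phi> (fst x))" by (rule smooth_function_subset) blast
  moreover have "fst ` (pts ?Q \<inter> Phi ` V) \<subseteq> U" using V(4) by auto
  ultimately show "\<exists>W V \<psi>. openin (mtop ?Q) W \<and> \<xi> \<in> W \<and> (V, \<psi>) \<in> atlas M \<and> fst ` (pts ?Q \<inter> W) \<subseteq> V \<and>
      smooth_function ?Q (pts ?Q \<inter> W) (\<lambda>x. \<psi> (fst x))"
    using chart_openin[OF spect_manifold V(5)] V(1,3) p(2) by blast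
qed

text \<open>Between a spectral chart and the chart of \<open>M\<close> from which it comes, the
  projection is the identity.\<close>

lemma submersion_fst: "submersion (spect :: ('x \<times> ('p, 'k::real_normed_field) germ_section set, 'e) manifold) M fst"
  unfolding submersion_def
proof (intro conjI smooth_fst ballI)
  let ?Q = "spect :: ('x \<times> ('p, 'k) germ_section set, 'e) manifold"
  fix \<xi> assume "\<xi> \<in> pts ?Q"
  then obtain p where p: "p \<in> pts P" "\<xi> = Phi p" unfolding spect_top by blast
  obtain U \<phi> V where V: "(U, \<phi>) \<in> atlas M" "el V" "p \<in> V" "\<pi> ` V \<subseteq> U" "(Phi ` V, \<phi> \<circ> fst) \<in> atlas ?Q"
    by (rule spect_chart_exists[OF p(1), where ?'k = 'k])
  have o: "open (\<phi> ` (U \<inter> \<pi> ` V))" by (rule chart_open_image[OF M V(1) el_image_open[OF V(2)]])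
  let ?B = "Phi ` V :: ('x \<times> ('p, 'k) germ_section set) set"
  have "((\<phi> \<circ> fst \<circ> inv_into ?B (\<phi> \<circ> fst)) has_derivative (\<lambda>v. v)) (at (\<phi> (\<pi> p)))"
  proof (rule has_derivative_transform_within_open[OF has_derivative_ident o])
    show "\<phi> (\<pi> p) \<in> \<phi> ` (U \<inter> \<pi> ` V)" using V by blast
    fix y assume "y \<in> \<phi> ` (U \<inter> \<pi> ` V)"
    then obtain q where "q \<in> V" "y = \<phi> (\<pi> q)" by blast
    then show "y = (\<phi> \<circ> fst \<circ> inv_into ?B (\<phi> \<circ> fst)) y" using spect_chart_inv[OF V(1,2,4), where ?'k = 'k] by simp
  qed
  then have "(Phi ` V, \<phi> \<circ> fst) \<in> atlas ?Q \<and> (U, \<phi>) \<in> atlas M \<and> \<xi> \<in> Phi ` V \<and> fst \<xi> \<in> U \<and>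
      (\<exists>D. ((\<phi> \<circ> fst \<circ> inv_into ?B (\<phi> \<circ> fst)) has_derivative D) (at ((\<phi> \<circ> fst) \<xi>)) \<and> surj D)"
    using V p(2) by (auto intro!: exI[of _ "\<lambda>v. v"])
  then show "\<exists>(B, \<psi>)\<in>atlas ?Q. \<exists>(U, \<phi>)\<in>atlas M. \<xi> \<in> B \<and> fst \<xi> \<in> U \<and>
      (\<exists>D. ((\<phi> \<circ> fst \<circ> inv_into B \<psi>) has_derivative D) (at (\<psi> \<xi>)) \<and> surj D)"
    by blast
qed

lemma smooth_Phi: "smooth_map P (pts P) (spect :: ('x \<times> ('p, 'k::real_normed_field) germ_section set, 'e) manifold) Phi"
proof (rule smooth_mapI[OF P subset_refl])
  let ?Q = "spect :: ('x \<times> ('p, 'k) germ_section set, 'e) manifold"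
  show "Phi ` pts P \<subseteq> pts ?Q" by (simp add: spect_top)
  fix p assume p: "p \<in> pts P"
  obtain U \<phi> V where V: "(U, \<phi>) \<in> atlas M" "el V" "p \<in> V" "\<pi> ` V \<subseteq> U" "(Phi ` V, \<phi> \<circ> fst) \<in> atlas ?Q"
    by (rule spect_chart_exists[OF p, where ?'k = 'k])
  have "smooth_function P (pts P \<inter> V) (\<lambda>x. \<phi> (\<pi> x))"
    by (rule smooth_function_compose[OF M smooth_map_subset[OF smooth_pi] smooth_function_of_chart[OF M V(1)]]) (use V(4) in auto)
  then have "smooth_function P (pts P \<inter> V) (\<lambda>x. (\<phi> \<circ> fst) (Phi x :: 'x \<times> ('p, 'k) germ_section set))" by simp
  moreover have "Phi ` (pts P \<inter> V) \<subseteq> Phi ` V" by blast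
  ultimately show "\<exists>W V \<psi>. openin XP W \<and> p \<in> W \<and> (V, \<psi>) \<in> atlas ?Q \<and> Phi ` (pts P \<inter> W) \<subseteq> V \<and>
      smooth_function P (pts P \<inter> W) (\<lambda>x. \<psi> (Phi x))"
    using V(3,5) el_open[OF V(2)] by blast
qed

text \<open>Over a sheet \<open>V\<close> the inverse is the projection to the base followed by
  \<open>sectn V\<close>.\<close>

lemma smooth_Phi_inv:
  "smooth_map (spect :: ('x \<times> ('p, 'k::real_normed_field) germ_section set, 'e) manifold) (pts spect) P (inv_into (pts P) Phi)"
proof (rule smooth_map_local[OF spect_manifold P subset_refl])
  let ?Q = "spect :: ('x \<times> ('p, 'k) germ_section set, 'e) manifold"
  fix \<xi> assume "\<xi> \<in> pts ?Q"
  then obtain p where p: "p \<in> pts P" "\<xi> = Phi p" unfolding spect_top by blast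
  obtain V where V: "el V" "p \<in> V" using el_exists[OF openin_topspace p(1)] by blast
  have oV: "openin (mtop ?Q) (Phi ` V)" unfolding spect_openin using el_open[OF V(1)] by blast
  have "smooth_map ?Q (Phi ` V) P (\<lambda>\<xi>. sectn V (fst \<xi>))"
    by (rule smooth_map_compose[OF spect_manifold M P smooth_map_subset[OF smooth_fst] smooth_sectn[OF V(1)]])
      (use openin_subset[OF oV] in auto)
  then have "smooth_map ?Q (pts ?Q \<inter> Phi ` V) P (inv_into (pts P) Phi)"
  proof (rule smooth_map_subset_cong)
    fix \<zeta> assume "\<zeta> \<in> pts ?Q \<inter> Phi ` V"
    then obtain q where q: "q \<in> V" "\<zeta> = Phi q" by blast
    then show "sectn V (fst \<zeta>) = inv_into (pts P) Phi \<zeta>"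
      using sectn[OF V(1) q(1)] inv_into_f_f[OF Phi_inj[where ?'k = 'k], of q] el_pts[OF V(1)] by auto
  qed blast
  then show "\<exists>W. openin (mtop ?Q) W \<and> \<xi> \<in> W \<and> smooth_map ?Q (pts ?Q \<inter> W) P (inv_into (pts P) Phi)"
    using oV V(2) p(2) by blast
qed

lemma diffeo_Phi: "diffeo P (pts P) (spect :: ('x \<times> ('p, 'k::real_normed_field) germ_section set, 'e) manifold) (pts spect) Phi"
  unfolding diffeo_def using smooth_Phi smooth_Phi_inv Phi_inj spect_top by (auto simp: bij_betw_def)

end

section \<open>Convolution along a composition\<close>

text \<open>The common form of the left and right actions: \<open>A\<close> and \<open>B\<close> are etale over \<open>M\<close> and \<open>N\<close>, \<open>A\<close> has a
  moment map to \<open>N\<close>, and \<open>\<mu>\<close> composes matching pairs to points of \<open>Z\<close> over the base point of the first factor.\<close>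

locale composition = A: etale_space M A \<alpha> + B: etale_space N B \<gamma> + Z: etale_space M Z \<zeta>
  for M :: "('x, 'e::real_inner) manifold" and A :: "('a, 'ea::real_inner) manifold" and \<alpha> :: "'a \<Rightarrow> 'x"
    and N :: "('y, 'f::real_inner) manifold" and B :: "('b, 'eb::real_inner) manifold" and \<gamma> :: "'b \<Rightarrow> 'y"
    and Z :: "('z, 'ez::real_inner) manifold" and \<zeta> :: "'z \<Rightarrow> 'x" +
  fixes \<beta> :: "'a \<Rightarrow> 'y" and \<mu> :: "'a \<Rightarrow> 'b \<Rightarrow> 'z"
  assumes beta: "smooth_map A (pts A) N \<beta>"
    and mu_pts: "\<And>a b. a \<in> pts A \<Longrightarrow> b \<in> pts B \<Longrightarrow> \<beta> a = \<gamma> b \<Longrightarrow> \<mu> a b \<in> pts Z \<and> \<zeta> (\<mu> a b) = \<alpha> a"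
    and mu_inj: "\<And>a b b'. a \<in> pts A \<Longrightarrow> b \<in> pts B \<Longrightarrow> b' \<in> pts B \<Longrightarrow> \<beta> a = \<gamma> b \<Longrightarrow> \<beta> a = \<gamma> b' \<Longrightarrow> \<mu> a b = \<mu> a b' \<Longrightarrow> b = b'"
    and mu_open: "\<And>U V. A.el U \<Longrightarrow> B.el V \<Longrightarrow> openin (mtop Z) {\<mu> a b |a b. a \<in> U \<and> b \<in> V \<and> \<beta> a = \<gamma> b}"
begin

definition cmp :: "'a set \<Rightarrow> 'b set \<Rightarrow> 'z set" where
  "cmp U V = {\<mu> a b |a b. a \<in> U \<and> b \<in> V \<and> \<beta> a = \<gamma> b}"

text \<open>The common shape of both module formulas: for the left action
  \<open>\<beta> (A.sectn U y)\<close> is the source of the arrow of \<open>U\<close> with target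
  \<open>y\<close>, for the right action the moment of the point of \<open>U\<close> over
  \<open>y\<close>.\<close>

definition wgt :: "'a set \<Rightarrow> ('x \<Rightarrow> 'k::real_normed_field) \<Rightarrow> ('y \<Rightarrow> 'k) \<Rightarrow> 'x \<Rightarrow> 'k" where
  "wgt U u f y = (if y \<in> \<alpha> ` U then u y * f (\<beta> (A.sectn U y)) else 0)"

lemma cmp_el:
  assumes U: "A.el U" and V: "B.el V"
  shows "Z.el (cmp U V)"
proof -
  have "inj_on \<zeta> (cmp U V)"
  proof (rule inj_onI)
    fix z z' assume zz: "z \<in> cmp U V" "z' \<in> cmp U V" "\<zeta> z = \<zeta> z'"
    then obtain a b a' b' where ab: "z = \<mu> a b" "a \<in> U" "b \<in> V" "\<beta> a = \<gamma> b" "z' = \<mu> a' b'" "a' \<in> U" "b' \<in> V" "\<beta> a' = \<gamma> b'"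
      unfolding cmp_def by blast
    note P = subsetD[OF A.el_pts[OF U]] subsetD[OF B.el_pts[OF V]]
    have "\<alpha> a = \<alpha> a'" using zz(3) ab(1,5) mu_pts[OF P(1)[OF ab(2)] P(2)[OF ab(3)] ab(4)] mu_pts[OF P(1)[OF ab(6)] P(2)[OF ab(7)] ab(8)] by simp
    then have "a = a'" using A.el_injD[OF U ab(2,6)] by simp
    then have "b = b'" using B.el_injD[OF V ab(3,7)] ab(4,8) by simp
    with \<open>a = a'\<close> show "z = z'" using ab by simp
  qed
  then show ?thesis using mu_open[OF U V] by (simp add: elementary_def cmp_def)
qed

lemma cmp_image:
  assumes U: "A.el U" and V: "B.el V"
  shows "\<zeta> ` cmp U V = {\<alpha> a |a. a \<in> U \<and> \<beta> a \<in> \<gamma> ` V}"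
proof -
  have "\<zeta> (\<mu> a b) = \<alpha> a" if "a \<in> U" "b \<in> V" "\<beta> a = \<gamma> b" for a b
    using mu_pts that A.el_pts[OF U] B.el_pts[OF V] by blast
  then show ?thesis unfolding cmp_def by (auto simp: image_def) metis
qed

lemma wgt_Cc0:
  fixes u :: "'x \<Rightarrow> 'k::real_normed_field"
  assumes U: "A.el U" and V: "B.el V" and u: "u \<in> Cc0 M (\<alpha> ` U)" and f: "f \<in> Cc0 N (\<gamma> ` V)"
  shows "wgt U u f \<in> Cc0 M (\<zeta> ` cmp U V)"
proof -
  obtain K where K: "compactin (mtop M) K" "K \<subseteq> \<alpha> ` U" "\<forall>y. y \<notin> K \<longrightarrow> u y = 0" using u unfolding Cc0_def by blast
  obtain L where L: "compactin (mtop N) L" "L \<subseteq> \<gamma> ` V" "\<forall>y. y \<notin> L \<longrightarrow> f y = 0" using f unfolding Cc0_def by blast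
  have sb: "smooth_map M (\<alpha> ` U) N (\<lambda>y. \<beta> (A.sectn U y))"
    by (rule smooth_map_compose[OF A.M A.P B.M A.smooth_sectn[OF U] beta]) (use A.sectn_in[of _ U] A.el_pts[OF U] in blast)
  have oU: "openin (mtop M) (\<alpha> ` U)" by (rule A.el_image_open[OF U])
  have s1: "smooth_function M (\<alpha> ` U) (\<lambda>y. u y * f (\<beta> (A.sectn U y)))"
    by (rule smooth_function_mult[OF A.M oU smooth_function_subset[OF A.Cc0_smooth[OF u] openin_subset[OF oU]]
        smooth_function_compose[OF B.M sb B.Cc0_smooth[OF f] smooth_map_subset_pts(2)[OF sb]]])
  have "smooth_function M (pts M) (wgt U u f)"
  proof (rule smooth_function_local[OF A.M subset_refl])
    fix y assume y: "y \<in> pts M"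
    show "\<exists>W. openin (mtop M) W \<and> y \<in> W \<and> smooth_function M (pts M \<inter> W) (wgt U u f)"
    proof (cases "y \<in> K")
      case True
      have "smooth_function M (pts M \<inter> \<alpha> ` U) (wgt U u f)"
        by (rule smooth_function_subset_cong[OF s1]) (auto simp: wgt_def)
      then show ?thesis using True K(2) oU by blast
    next
      case False
      have o: "openin (mtop M) (pts M - K)" by (rule A.compact_openin_diff[OF K(1)])
      have "smooth_function M (pts M \<inter> (pts M - K)) (wgt U u f)"
        by (rule smooth_function_subset_cong[OF smooth_function_const[OF A.M o, of 0]]) (use K(3) in \<open>auto simp: wgt_def\<close>)
      then show ?thesis using False y o by blast
    qed
  qed
  \<comment> \<open>An open set on which the second factor vanishes because its argument misses the
    support \<open>L\<close>; removing it from \<open>K\<close> leaves a compact set over which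
    composites exist.\<close>
  moreover define T where "T = {y \<in> \<alpha> ` U. \<beta> (A.sectn U y) \<in> pts N - L}"
  have "openin (subtopology (mtop M) (\<alpha> ` U)) {y \<in> topspace (subtopology (mtop M) (\<alpha> ` U)). \<beta> (A.sectn U y) \<in> pts N - L}"
    by (rule openin_continuous_map_preimage[OF smooth_map_continuous[OF A.M B.M sb] B.compact_openin_diff[OF L(1)]])
  moreover have "topspace (subtopology (mtop M) (\<alpha> ` U)) = \<alpha> ` U" using openin_subset[OF oU] by (simp add: inf_absorb2)
  ultimately have "openin (mtop M) T" unfolding T_def using oU openin_trans_full by metis
  then have "compactin (mtop M) (K - T)" by (rule compactin_diff_open[OF K(1)])
  moreover have "K - T \<subseteq> \<zeta> ` cmp U V"
  proof
    fix y assume y: "y \<in> K - T"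
    then have yU: "y \<in> \<alpha> ` U" using K(2) by blast
    moreover from this have "\<beta> (A.sectn U y) \<in> pts N" using smooth_map_subset_pts(2)[OF sb] by blast
    ultimately have "\<beta> (A.sectn U y) \<in> \<gamma> ` V" using y L(2) by (auto simp: T_def)
    then show "y \<in> \<zeta> ` cmp U V" unfolding cmp_image[OF U V] using A.sectn_in[OF yU] by (intro CollectI exI[of _ "A.sectn U y"]) simp
  qed
  moreover have "wgt U u f y = 0" if "y \<notin> K - T" for y
    using that K(3) L(3) by (auto simp: wgt_def T_def)
  ultimately show ?thesis
    using \<open>smooth_function M (pts M) (wgt U u f)\<close> unfolding Cc0_def by blast
qed

definition plist :: "('a set \<times> ('x \<Rightarrow> 'k::real_normed_field)) list \<Rightarrow> ('b set \<times> ('y \<Rightarrow> 'k)) list \<Rightarrow> ('z set \<times> ('x \<Rightarrow> 'k)) list" where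
  "plist L L' = concat (map (\<lambda>(U, u). map (\<lambda>(V, f). (cmp U V, wgt U u f)) L') L)"

lemma plist_simps [simp]: "plist [] L' = []"
  "plist ((U, u) # L) L' = map (\<lambda>(V, f). (cmp U V, wgt U u f)) L' @ plist L L'"
  "plist (L @ L2) L' = plist L L' @ plist L2 L'"
  by (simp_all add: plist_def)

lemma valid_plist:
  assumes "A.valid L" "B.valid L'"
  shows "Z.valid (plist L L')"
  using assms(1)
proof (induction L)
  case (Cons a L)
  obtain U u where a: "a = (U, u)" by force
  have U: "A.el U" "u \<in> Cc0 M (\<alpha> ` U)" "A.valid L" using Cons.prems a by auto
  have "Z.valid (map (\<lambda>(V, f). (cmp U V, wgt U u f)) L')"
    using assms(2) by (induction L') (use U in \<open>auto intro: cmp_el wgt_Cc0\<close>)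
  then show ?case using Cons.IH[OF U(3)] by (simp add: a)
qed simp

text \<open>Follows \<open>\<beta>\<close> along a sheet through \<open>a\<close>. Another sheet
  gives a map that agrees near \<open>\<alpha> a\<close>, so the germ there is intrinsic.\<close>

definition rho :: "'a \<Rightarrow> 'x \<Rightarrow> 'y" where
  "rho a = (\<lambda>y. \<beta> (A.sectn (SOME U. A.el U \<and> a \<in> U) y))"

lemma rho:
  assumes U: "A.el U" "a \<in> U"
  shows "germ (mtop M) (\<alpha> a) (\<lambda>y. F y (rho a y)) = germ (mtop M) (\<alpha> a) (\<lambda>y. F y (\<beta> (A.sectn U y)))" "rho a (\<alpha> a) = \<beta> a"
proof -
  define U' where "U' = (SOME U. A.el U \<and> a \<in> U)"
  have U': "A.el U' \<and> a \<in> U'" unfolding U'_def by (rule someI[where P = "\<lambda>U. A.el U \<and> a \<in> U"]) (use U in blast)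
  then show "rho a (\<alpha> a) = \<beta> a" by (simp add: rho_def A.sectn flip: U'_def)
  have "openin (mtop A) (U \<inter> U')" using A.el_open U U' by blast
  then have o: "openin (mtop M) (\<alpha> ` (U \<inter> U'))" by (rule A.open_image)
  show "germ (mtop M) (\<alpha> a) (\<lambda>y. F y (rho a y)) = germ (mtop M) (\<alpha> a) (\<lambda>y. F y (\<beta> (A.sectn U y)))"
  proof (rule germ_eqI[OF o])
    show "\<alpha> a \<in> \<alpha> ` (U \<inter> U')" using U U' by blast
    fix y assume "y \<in> \<alpha> ` (U \<inter> U')"
    then obtain b where "b \<in> U" "b \<in> U'" "y = \<alpha> b" by blast
    then show "F y (rho a y) = F y (\<beta> (A.sectn U y))" using A.sectn U(1) U' by (simp add: rho_def flip: U'_def)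
  qed
qed

lemma rho_germ:
  assumes a: "a \<in> pts A" and k: "germ (mtop N) (\<beta> a) k = germ (mtop N) (\<beta> a) k'"
  shows "germ (mtop M) (\<alpha> a) (\<lambda>y. k (rho a y)) = germ (mtop M) (\<alpha> a) (\<lambda>y. k' (rho a y))"
proof -
  obtain U where U: "A.el U" "a \<in> U" using A.el_exists[OF openin_topspace a] by blast
  have bN: "\<beta> a \<in> pts N" using smooth_map_subset_pts(2)[OF beta] a by blast
  obtain W where W: "openin (mtop N) W" "\<beta> a \<in> W" "\<And>y. y \<in> W \<Longrightarrow> k y = k' y" using germ_eqD[OF k bN] by metis
  have sb: "smooth_map M (\<alpha> ` U) N (\<lambda>y. \<beta> (A.sectn U y))"
    by (rule smooth_map_compose[OF A.M A.P B.M A.smooth_sectn[OF U(1)] beta]) (use A.sectn_in[of _ U] A.el_pts[OF U(1)] in blast)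
  obtain T where T: "openin (mtop M) T" "\<alpha> a \<in> T" "\<forall>y\<in>\<alpha> ` U \<inter> T. \<beta> (A.sectn U y) \<in> W"
    using smooth_map_continuous_at[OF A.M B.M sb, of "\<alpha> a" W] W(1,2) U A.sectn[OF U] by auto
  have "germ (mtop M) (\<alpha> a) (\<lambda>y. k (\<beta> (A.sectn U y))) = germ (mtop M) (\<alpha> a) (\<lambda>y. k' (\<beta> (A.sectn U y)))"
    by (rule germ_eqI[of _ "\<alpha> ` U \<inter> T"]) (use T W(3) U(2) A.el_image_open[OF U(1)] in auto)
  then show ?thesis using rho(1)[OF U, of "\<lambda>_. k"] rho(1)[OF U, of "\<lambda>_. k'"] by simp
qed

section \<open>Factorisations of a point and the convolution formula\<close>

definition fib :: "'z \<Rightarrow> ('a \<times> 'b) set" where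
  "fib q = {(a, b). a \<in> pts A \<and> b \<in> pts B \<and> \<beta> a = \<gamma> b \<and> \<mu> a b = q}"

lemma fibD: "(a, b) \<in> fib q \<Longrightarrow> a \<in> pts A" "(a, b) \<in> fib q \<Longrightarrow> b \<in> pts B" "(a, b) \<in> fib q \<Longrightarrow> \<beta> a = \<gamma> b"
  "(a, b) \<in> fib q \<Longrightarrow> \<mu> a b = q" "(a, b) \<in> fib q \<Longrightarrow> \<alpha> a = \<zeta> q"
  using mu_pts by (auto simp: fib_def)

lemma fib_unique: "(a, b) \<in> fib q \<Longrightarrow> (a, b') \<in> fib q \<Longrightarrow> b = b'"
  using mu_inj by (auto simp: fib_def)

definition lfib :: "('a set \<times> 'c) list \<Rightarrow> 'z \<Rightarrow> ('a \<times> 'b) set" where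
  "lfib L q = {(a, b) \<in> fib q. \<exists>(U, u)\<in>set L. a \<in> U}"

text \<open>A factorisation of \<open>q\<close> is determined by its first factor, and the first
  factor by any sheet of \<open>L\<close> that contains it.\<close>

lemma finite_lfib:
  assumes "A.valid L"
  shows "finite (lfib L q)"
proof (rule inj_on_finite[where f = fst])
  show "inj_on fst (lfib L q)" by (rule inj_onI) (use fib_unique in \<open>auto simp: lfib_def\<close>)
  show "fst ` lfib L q \<subseteq> (\<lambda>(U, u). A.sectn U (\<zeta> q)) ` set L"
  proof
    fix a assume "a \<in> fst ` lfib L q"
    then obtain b U u where "(a, b) \<in> fib q" "(U, u) \<in> set L" "a \<in> U" unfolding lfib_def by auto
    then have "a = A.sectn U (\<zeta> q)" using fibD(5) A.sectn[of U a] A.validD[OF assms] by simp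
    then show "a \<in> (\<lambda>(U, u). A.sectn U (\<zeta> q)) ` set L" using \<open>(U, u) \<in> set L\<close> by (intro image_eqI[of _ _ "(U, u)"]) auto
  qed
qed simp

text \<open>A sheet \<open>U\<close> contains at most one point over the base point of
  \<open>q\<close>, so at most one factorisation contributes. The index set \<open>S\<close> is left
  open so that different formal sums can be expanded over a common set.\<close>

lemma term_germ:
  fixes u :: "'x \<Rightarrow> 'k::real_normed_field"
  assumes U: "A.el U" and V: "B.el V" and S: "finite S" "S \<subseteq> fib q" "\<And>a b. (a, b) \<in> fib q \<Longrightarrow> a \<in> U \<Longrightarrow> (a, b) \<in> S"
  shows "germ (mtop M) (\<zeta> q) (\<lambda>y. if q \<in> cmp U V then wgt U u f y else 0) =
    germ (mtop M) (\<zeta> q) (\<lambda>y. \<Sum>(a, b)\<in>S. (if a \<in> U then u y else 0) * (if b \<in> V then f (rho a y) else 0))"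
proof (cases "q \<in> cmp U V")
  case True
  then obtain a b where ab: "q = \<mu> a b" "a \<in> U" "b \<in> V" "\<beta> a = \<gamma> b" unfolding cmp_def by blast
  have fab: "(a, b) \<in> fib q" using ab A.el_pts[OF U] B.el_pts[OF V] unfolding fib_def by blast
  then have abS: "(a, b) \<in> S" using S(3) ab(2) by blast
  have other: "a' \<notin> U" if "(a', b') \<in> S - {(a, b)}" for a' b'
  proof
    assume "a' \<in> U"
    have f': "(a', b') \<in> fib q" using that S(2) by blast
    then have "a' = a" using A.el_injD[OF U \<open>a' \<in> U\<close> ab(2)] fibD(5)[OF f'] fibD(5)[OF fab] by simp
    then show False using fib_unique[of a b q b'] fab f' that by blast
  qed
  have "(\<Sum>(a, b)\<in>S. (if a \<in> U then u y else 0) * (if b \<in> V then f (rho a y) else 0)) = u y * f (rho a y)" for y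
  proof -
    have "(\<Sum>(a, b)\<in>S - {(a, b)}. (if a \<in> U then u y else 0) * (if b \<in> V then f (rho a y) else 0)) = 0"
    proof (rule sum.neutral, rule ballI)
      fix i assume i: "i \<in> S - {(a, b)}"
      obtain a' b' where "i = (a', b')" by force
      with other[of a' b'] i show "(case i of (a, b) \<Rightarrow> (if a \<in> U then u y else 0) * (if b \<in> V then f (rho a y) else 0)) = 0" by simp
    qed
    then show ?thesis using sum.remove[OF S(1) abS, of "\<lambda>(a, b). (if a \<in> U then u y else 0) * (if b \<in> V then f (rho a y) else 0)"] ab by simp
  qed
  then have "germ (mtop M) (\<zeta> q) (\<lambda>y. \<Sum>(a, b)\<in>S. (if a \<in> U then u y else 0) * (if b \<in> V then f (rho a y) else 0)) =
      germ (mtop M) (\<alpha> a) (\<lambda>y. u y * f (\<beta> (A.sectn U y)))"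
    using rho(1)[OF U ab(2), of "\<lambda>y z. u y * f z"] fibD(5)[OF fab] by simp
  also have "\<dots> = germ (mtop M) (\<alpha> a) (wgt U u f)"
    by (rule germ_eqI[OF A.el_image_open[OF U]]) (use ab(2) in \<open>auto simp: wgt_def\<close>)
  finally show ?thesis using True fibD(5)[OF fab] by simp
next
  case False
  have "(if a \<in> U then u y else 0) * (if b \<in> V then f (rho a y) else 0) = 0" if "(a, b) \<in> S" for a b y
    using that S(2) False unfolding fib_def cmp_def by auto
  then have "(\<Sum>(a, b)\<in>S. (if a \<in> U then u y else 0) * (if b \<in> V then f (rho a y) else 0)) = 0" for y
    by (intro sum.neutral) auto
  then show ?thesis using False by simp
qed

text \<open>The convolution formula, by bilinear expansion one sheet at a time. Its right-hand side
  involves the formal sums only through germs at the points of the factorisations.\<close>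

lemma plist_germ:
  fixes L :: "('a set \<times> ('x \<Rightarrow> 'k::real_normed_field)) list"
  assumes L: "A.valid L" "B.valid L'" and S: "finite S" "S \<subseteq> fib q" "lfib L q \<subseteq> S"
  shows "germ (mtop M) (\<zeta> q) (Z.lsum (plist L L') q) = germ (mtop M) (\<zeta> q) (\<lambda>y. \<Sum>(a, b)\<in>S. A.lsum L a y * B.lsum L' b (rho a y))"
  using L(1) S(3)
proof (induction L)
  case Nil
  then show ?case by (auto intro!: arg_cong[where f = "germ _ _"])
next
  case (Cons a0 L)
  obtain U u where a: "a0 = (U, u)" by force
  have U: "A.el U" "u \<in> Cc0 M (\<alpha> ` U)" "A.valid L" using Cons.prems a by auto
  have sub: "lfib L q \<subseteq> S" using Cons.prems(2) by (auto simp: lfib_def)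
  have US: "(a, b) \<in> S" if "(a, b) \<in> fib q" "a \<in> U" for a b using that Cons.prems(2) a by (auto simp: lfib_def)
  have "germ (mtop M) (\<zeta> q) (Z.lsum (map (\<lambda>(V, f). (cmp U V, wgt U u f)) L') q) =
     germ (mtop M) (\<zeta> q) (\<lambda>y. \<Sum>(a, b)\<in>S. (if a \<in> U then u y else 0) * B.lsum L' b (rho a y))"
    using L(2)
  proof (induction L')
    case Nil
    then show ?case by (auto intro!: arg_cong[where f = "germ _ _"])
  next
    case (Cons b0 L')
    obtain V f where b: "b0 = (V, f)" by force
    have V: "B.el V" "B.valid L'" using Cons.prems b by auto
    from germ_binop[OF term_germ[OF U(1) V(1) S(1,2) US, of u f] Cons.IH[OF V(2)], of "(+)"]
    have "germ (mtop M) (\<zeta> q) (\<lambda>y. (if q \<in> cmp U V then wgt U u f y else 0) + Z.lsum (map (\<lambda>(V, f). (cmp U V, wgt U u f)) L') q y) =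
      germ (mtop M) (\<zeta> q) (\<lambda>y. (\<Sum>(a, b)\<in>S. (if a \<in> U then u y else 0) * (if b \<in> V then f (rho a y) else 0)) +
          (\<Sum>(a, b)\<in>S. (if a \<in> U then u y else 0) * B.lsum L' b (rho a y)))" by simp
    also have "(\<lambda>y. (\<Sum>(a, b)\<in>S. (if a \<in> U then u y else 0) * (if b \<in> V then f (rho a y) else 0)) +
          (\<Sum>(a, b)\<in>S. (if a \<in> U then u y else 0) * B.lsum L' b (rho a y))) =
       (\<lambda>y. \<Sum>(a, b)\<in>S. (if a \<in> U then u y else 0) * B.lsum (b0 # L') b (rho a y))"
      unfolding b by (rule ext) (simp add: distrib_left case_prod_unfold flip: sum.distrib)
    finally show ?case by (simp add: b Z.lsum_def)
  qed
  from germ_binop[OF this Cons.IH[OF U(3) sub], of "(+)"]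
  have "germ (mtop M) (\<zeta> q) (\<lambda>y. Z.lsum (map (\<lambda>(V, f). (cmp U V, wgt U u f)) L') q y + Z.lsum (plist L L') q y) =
     germ (mtop M) (\<zeta> q) (\<lambda>y. (\<Sum>(a, b)\<in>S. (if a \<in> U then u y else 0) * B.lsum L' b (rho a y)) + (\<Sum>(a, b)\<in>S. A.lsum L a y * B.lsum L' b (rho a y)))" .
  also have "(\<lambda>y. (\<Sum>(a, b)\<in>S. (if a \<in> U then u y else 0) * B.lsum L' b (rho a y)) + (\<Sum>(a, b)\<in>S. A.lsum L a y * B.lsum L' b (rho a y))) =
     (\<lambda>y. \<Sum>(a, b)\<in>S. A.lsum (a0 # L) a y * B.lsum L' b (rho a y))"
    unfolding a by (rule ext) (simp add: distrib_right case_prod_unfold flip: sum.distrib)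
  finally show ?case by (simp add: a Z.lsum_append del: Z.lsum_simps)
qed

definition act :: "('a, 'k::real_normed_field) germ_section \<Rightarrow> ('b, 'k) germ_section \<Rightarrow> ('z, 'k) germ_section" where
  "act c d = Z.sect (Z.lsum (plist (A.rep c) (B.rep d)))"

text \<open>By the convolution formula both sides depend only on germs of the two sections, which do
  not change with the formal sums. The factorisations seen by either left list are put into one
  finite index set.\<close>

lemma act_lsum:
  fixes L :: "('a set \<times> ('x \<Rightarrow> 'k::real_normed_field)) list"
  assumes L: "A.valid L" "B.valid L'"
  shows "act (A.sect (A.lsum L)) (B.sect (B.lsum L')) = Z.sect (Z.lsum (plist L L'))"
  unfolding act_def Z.sect_eq_iff
proof
  fix q assume q: "q \<in> pts Z"
  let ?R = "A.rep (A.sect (A.lsum L))" and ?R' = "B.rep (B.sect (B.lsum L'))"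
  note R = A.rep[OF A.sect_lsum_Cc[OF L(1)]]
  note R' = B.rep[OF B.sect_lsum_Cc[OF L(2)]]
  define S where "S = lfib L q \<union> lfib ?R q"
  have S: "finite S" "S \<subseteq> fib q" "lfib L q \<subseteq> S" "lfib ?R q \<subseteq> S"
    using finite_lfib[OF L(1)] finite_lfib[OF R(1)] by (auto simp: S_def lfib_def)
  have "germ (mtop M) (\<zeta> q) (\<lambda>y. \<Sum>i\<in>S. A.lsum ?R (fst i) y * B.lsum ?R' (snd i) (rho (fst i) y)) =
    germ (mtop M) (\<zeta> q) (\<lambda>y. \<Sum>i\<in>S. A.lsum L (fst i) y * B.lsum L' (snd i) (rho (fst i) y))"
  proof (rule germ_sum)
    fix i assume "i \<in> S"
    then obtain a b where i: "i = (a, b)" "(a, b) \<in> fib q" using S(2) by (metis prod.collapse subsetD)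
    note F = fibD[OF i(2)]
    have "germ (mtop M) (\<alpha> a) (A.lsum ?R a) = germ (mtop M) (\<alpha> a) (A.lsum L a)" using R(2) F(1) A.sect_eq_iff by blast
    moreover have "germ (mtop N) (\<gamma> b) (B.lsum ?R' b) = germ (mtop N) (\<gamma> b) (B.lsum L' b)" using R'(2) F(2) B.sect_eq_iff by blast
    then have "germ (mtop M) (\<alpha> a) (\<lambda>y. B.lsum ?R' b (rho a y)) = germ (mtop M) (\<alpha> a) (\<lambda>y. B.lsum L' b (rho a y))"
      using rho_germ[OF F(1)] F(3) by simp
    ultimately show "germ (mtop M) (\<zeta> q) (\<lambda>y. A.lsum ?R (fst i) y * B.lsum ?R' (snd i) (rho (fst i) y)) =
       germ (mtop M) (\<zeta> q) (\<lambda>y. A.lsum L (fst i) y * B.lsum L' (snd i) (rho (fst i) y))"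
      using germ_binop[of "mtop M" "\<alpha> a" _ _ _ _ times] F(5) i(1) by simp
  qed
  then show "germ (mtop M) (\<zeta> q) (Z.lsum (plist ?R ?R') q) = germ (mtop M) (\<zeta> q) (Z.lsum (plist L L') q)"
    using plist_germ[OF R(1) R'(1) S(1,2,4)] plist_germ[OF L S(1-3)] by (simp add: case_prod_unfold)
qed

lemma act_Cc: "c \<in> Cc A \<Longrightarrow> d \<in> Cc B \<Longrightarrow> act c d \<in> Cc Z"
  unfolding act_def by (intro Z.sect_lsum_Cc valid_plist A.rep B.rep)

lemma act_add_left:
  assumes "c \<in> Cc A" "c' \<in> Cc A" "d \<in> Cc B"
  shows "act (sec_add (mtop A) c c') d = sec_add (mtop Z) (act c d) (act c' d)"
proof -
  note R = A.rep[OF assms(1)] A.rep[OF assms(2)] B.rep[OF assms(3)]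
  have "act (A.sect (A.lsum (A.rep c @ A.rep c'))) (B.sect (B.lsum (B.rep d))) = Z.sect (Z.lsum (plist (A.rep c @ A.rep c') (B.rep d)))"
    by (rule act_lsum) (simp_all add: R)
  also have "\<dots> = sec_add (mtop Z) (act c d) (act c' d)" unfolding act_def Z.sec_add_lsum by (simp only: plist_simps)
  finally show ?thesis unfolding A.sec_add_lsum[symmetric] R(2,4,6) .
qed

lemma act_add_right:
  assumes "c \<in> Cc A" "d \<in> Cc B" "d' \<in> Cc B"
  shows "act c (sec_add (mtop B) d d') = sec_add (mtop Z) (act c d) (act c d')"
proof -
  note R = A.rep[OF assms(1)] B.rep[OF assms(2)] B.rep[OF assms(3)]
  have "Z.lsum (plist L (L1 @ L2)) q y = Z.lsum (plist L L1) q y + Z.lsum (plist L L2) q y" for L L1 L2 q y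
    by (induction L) auto
  then have l: "Z.lsum (plist L (L1 @ L2)) = (\<lambda>q y. Z.lsum (plist L L1) q y + Z.lsum (plist L L2) q y)" for L L1 L2
    by (intro ext)
  have "act (A.sect (A.lsum (A.rep c))) (B.sect (B.lsum (B.rep d @ B.rep d'))) = Z.sect (Z.lsum (plist (A.rep c) (B.rep d @ B.rep d')))"
    by (rule act_lsum) (simp_all add: R)
  also have "\<dots> = sec_add (mtop Z) (act c d) (act c d')" unfolding act_def Z.sec_add_sect l ..
  finally show ?thesis unfolding B.sec_add_lsum[symmetric] R(2,4,6) .
qed

lemma act_elem:
  assumes "A.el U" "u \<in> Cc0 M (\<alpha> ` U)" "B.el V" "f \<in> Cc0 N (\<gamma> ` V)"
  shows "act (A.elem U u) (B.elem V f) = Z.elem (cmp U V) (wgt U u f)"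
proof -
  have "act (A.sect (A.lsum [(U, u)])) (B.sect (B.lsum [(V, f)])) = Z.sect (Z.lsum (plist [(U, u)] [(V, f)]))"
    by (rule act_lsum) (simp_all add: assms)
  then show ?thesis unfolding A.elem_fun_lsum B.elem_fun_lsum Z.elem_fun_lsum by (simp only: plist_simps list.map append.simps case_prod_conv)
qed

text \<open>The module actions are specified on bisections of the groupoids only, hence the
  restriction to good sheets; every section is a sum over good sheets and biadditivity does the
  rest. The empty sheet must be good because it represents the empty sum.\<close>

lemma act_unique:
  assumes bi: "biadditive_on (Cc A) (sec_add (mtop A)) (Cc B) (sec_add (mtop B)) (sec_add (mtop Z)) F"
    and gen: "\<And>U u V f. goodA U \<Longrightarrow> A.el U \<Longrightarrow> u \<in> Cc0 M (\<alpha> ` U) \<Longrightarrow> B.el V \<Longrightarrow> f \<in> Cc0 N (\<gamma> ` V) \<Longrightarrow> goodB V \<Longrightarrow>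
      F (A.elem U u) (B.elem V f) = Z.elem (cmp U V) (wgt U u f)"
    and goodA: "\<And>p W. openin (mtop A) W \<Longrightarrow> p \<in> W \<Longrightarrow> \<exists>U. goodA U \<and> A.el U \<and> p \<in> U \<and> U \<subseteq> W" "goodA {}"
    and goodB: "\<And>p W. openin (mtop B) W \<Longrightarrow> p \<in> W \<Longrightarrow> \<exists>U. goodB U \<and> B.el U \<and> p \<in> U \<and> U \<subseteq> W" "goodB {}"
    and c: "c \<in> Cc A" and d: "d \<in> Cc B"
  shows "F c d = act c (d :: ('b, 'k::real_normed_field) germ_section)"
proof -
  have addL: "F (sec_add (mtop A) c c') d = sec_add (mtop Z) (F c d) (F c' d)" if "c \<in> Cc A" "c' \<in> Cc A" "d \<in> Cc B" for c c' d
    using bi that unfolding biadditive_on_def by simp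
  have addR: "F c (sec_add (mtop B) d d') = sec_add (mtop Z) (F c d) (F c d')" if "c \<in> Cc A" "d \<in> Cc B" "d' \<in> Cc B" for c d d'
    using bi that unfolding biadditive_on_def by simp
  obtain L where L: "A.valid L" "\<forall>(U, f)\<in>set L. goodA U" "c = A.sect (A.lsum L)" using A.Cc_list[OF goodA(1) c] by blast
  obtain L' where L': "B.valid L'" "\<forall>(U, f)\<in>set L'. goodB U" "d = B.sect (B.lsum L')" using B.Cc_list[OF goodB(1) d] by blast
  have zA: "A.sect (A.lsum ([] :: ('a set \<times> ('x \<Rightarrow> 'k)) list)) = A.elem {} (\<lambda>_. 0)" by (simp add: A.elem_fun_sect A.sect_def)
  have zB: "B.sect (B.lsum ([] :: ('b set \<times> ('y \<Rightarrow> 'k)) list)) = B.elem {} (\<lambda>_. 0)" by (simp add: B.elem_fun_sect B.sect_def)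
  have one: "F (A.elem U u) (B.sect (B.lsum L')) = act (A.elem U u) (B.sect (B.lsum L'))"
    if U: "goodA U" "A.el U" "u \<in> Cc0 M (\<alpha> ` U)" for U u
    using L'(1,2)
  proof (induction L')
    case Nil
    have z: "(\<lambda>_. 0 :: 'k) \<in> Cc0 N (\<gamma> ` {})" by (rule B.Cc0_zero)
    show ?case unfolding zB using gen[OF U B.el_empty z goodB(2)] act_elem[OF U(2,3) B.el_empty z] by simp
  next
    case (Cons b L')
    obtain V f where b: "b = (V, f)" by force
    have V: "B.el V" "f \<in> Cc0 N (\<gamma> ` V)" "B.valid L'" "goodB V" "\<forall>(U, f)\<in>set L'. goodB U" using Cons.prems b by auto
    have "B.sect (B.lsum (b # L')) = sec_add (mtop B) (B.elem V f) (B.sect (B.lsum L'))"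
      unfolding B.elem_fun_lsum B.sec_add_lsum b by (simp only: append.simps)
    then show ?case
      using Cons.IH[OF V(3,5)] addR[OF A.elem_fun_Cc[OF U(2,3)] B.elem_fun_Cc[OF V(1,2)] B.sect_lsum_Cc[OF V(3)]]
        act_add_right[OF A.elem_fun_Cc[OF U(2,3)] B.elem_fun_Cc[OF V(1,2)] B.sect_lsum_Cc[OF V(3)]]
        gen[OF U V(1,2,4)] act_elem[OF U(2,3) V(1,2)] by (simp del: B.lsum_simps)
  qed
  show ?thesis unfolding L(3) L'(3) using L(1,2)
  proof (induction L)
    case Nil
    show ?case unfolding zA by (rule one[OF goodA(2) A.el_empty A.Cc0_zero])
  next
    case (Cons a L)
    obtain U u where a: "a = (U, u)" by force
    have U: "A.el U" "u \<in> Cc0 M (\<alpha> ` U)" "A.valid L" "goodA U" "\<forall>(U, f)\<in>set L. goodA U" using Cons.prems a by auto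
    have "A.sect (A.lsum (a # L)) = sec_add (mtop A) (A.elem U u) (A.sect (A.lsum L))"
      unfolding A.elem_fun_lsum A.sec_add_lsum a by (simp only: append.simps)
    then show ?case
      using Cons.IH[OF U(3,5)] addL[OF A.elem_fun_Cc[OF U(1,2)] A.sect_lsum_Cc[OF U(3)] B.sect_lsum_Cc[OF L'(1)]]
        act_add_left[OF A.elem_fun_Cc[OF U(1,2)] A.sect_lsum_Cc[OF U(3)] B.sect_lsum_Cc[OF L'(1)]]
        one[OF U(4,1,2)] by (simp del: A.lsum_simps B.lsum_simps)
  qed
qed

text \<open>As the germs of \<open>c\<close> at the other points over the same base point vanish,
  the convolution formula reduces to the factorisation through \<open>a0\<close>, if there is
  one.\<close>

lemma act_germ:
  fixes c :: "('a, 'k::real_normed_field) germ_section"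
  assumes c: "c \<in> Cc A" and d: "d \<in> Cc B" and a0: "a0 \<in> pts A"
    and z: "\<And>a. a \<in> pts A \<Longrightarrow> \<alpha> a = \<alpha> a0 \<Longrightarrow> a \<noteq> a0 \<Longrightarrow> c a = germ (mtop A) a (\<lambda>_. 0)"
    and q: "q \<in> pts Z" "\<zeta> q = \<alpha> a0"
  shows "(a0, b) \<in> fib q \<Longrightarrow> germ (mtop M) (\<zeta> q) (Z.bg (act c d) q) = germ (mtop M) (\<zeta> q) (\<lambda>y. A.bg c a0 y * B.bg d b (rho a0 y))"
    and "(\<And>b. (a0, b) \<notin> fib q) \<Longrightarrow> act c d q = germ (mtop Z) q (\<lambda>_. 0)"
proof -
  define S where "S = lfib (A.rep c) q \<union> {(a, b) \<in> fib q. a = a0}"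
  have "finite {(a, b) \<in> fib q. a = a0}"
  proof (rule inj_on_finite[where f = fst and B = "{a0}"])
    show "inj_on fst {(a, b) \<in> fib q. a = a0}" by (rule inj_onI) (use fib_unique in auto)
  qed auto
  then have S: "finite S" "S \<subseteq> fib q" "lfib (A.rep c) q \<subseteq> S"
    using finite_lfib[OF A.rep(1)[OF c], of q] by (auto simp: S_def lfib_def)
  have "germ (mtop M) (\<zeta> q) (Z.bg (act c d) q) = germ (mtop M) (\<zeta> q) (Z.lsum (plist (A.rep c) (B.rep d)) q)"
    using Z.bg_sect[OF _ q(1)] act_Cc[OF c d] unfolding act_def by blast
  also have "\<dots> = germ (mtop M) (\<zeta> q) (\<lambda>y. \<Sum>i\<in>S. A.bg c (fst i) y * B.bg d (snd i) (rho (fst i) y))"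
    using plist_germ[OF A.rep(1)[OF c] B.rep(1)[OF d] S] by (simp add: case_prod_unfold A.bg_def B.bg_def)
  also have "\<dots> = germ (mtop M) (\<zeta> q) (\<lambda>y. \<Sum>i\<in>S. if fst i = a0 then A.bg c a0 y * B.bg d (snd i) (rho a0 y) else 0)"
  proof (rule germ_sum)
    fix i assume "i \<in> S"
    then obtain a b where i: "i = (a, b)" "(a, b) \<in> fib q" using S(2) by (metis prod.collapse subsetD)
    show "germ (mtop M) (\<zeta> q) (\<lambda>y. A.bg c (fst i) y * B.bg d (snd i) (rho (fst i) y)) =
       germ (mtop M) (\<zeta> q) (\<lambda>y. if fst i = a0 then A.bg c a0 y * B.bg d (snd i) (rho a0 y) else 0)"
    proof (cases "a = a0")
      case False
      have a: "a \<in> pts A" "\<alpha> a = \<zeta> q" using fibD[OF i(2)] by simp_all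
      then have "c a = germ (mtop A) a (\<lambda>_. 0)" using z False q(2) by simp
      then have "germ (mtop M) (\<zeta> q) (A.bg c a) = germ (mtop M) (\<zeta> q) (\<lambda>_. 0)" using A.germ_bg_const_iff[OF c a(1), of 0] a(2) by simp
      from germ_binop[OF this refl, of times "\<lambda>y. B.bg d b (rho a y)"] show ?thesis using False i(1) by simp
    qed (simp add: i)
  qed
  finally have main: "germ (mtop M) (\<zeta> q) (Z.bg (act c d) q) =
      germ (mtop M) (\<zeta> q) (\<lambda>y. \<Sum>i\<in>S. if fst i = a0 then A.bg c a0 y * B.bg d (snd i) (rho a0 y) else 0)" .
  show "germ (mtop M) (\<zeta> q) (Z.bg (act c d) q) = germ (mtop M) (\<zeta> q) (\<lambda>y. A.bg c a0 y * B.bg d b (rho a0 y))"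
    if b: "(a0, b) \<in> fib q"
  proof -
    have "(\<Sum>i\<in>S. if fst i = a0 then A.bg c a0 y * B.bg d (snd i) (rho a0 y) else 0) = A.bg c a0 y * B.bg d b (rho a0 y)" for y
    proof -
      have "(a0, b) \<in> S" using b by (simp add: S_def)
      have "(\<Sum>i\<in>S. if fst i = a0 then A.bg c a0 y * B.bg d (snd i) (rho a0 y) else 0) =
         (\<Sum>i\<in>S. if i = (a0, b) then A.bg c a0 y * B.bg d b (rho a0 y) else 0)"
      proof (rule sum.cong[OF refl])
        fix i assume "i \<in> S"
        then have "fst i = a0 \<longleftrightarrow> i = (a0, b)" using S(2) fib_unique[OF b] by (metis fst_conv prod.collapse subsetD)
        then show "(if fst i = a0 then A.bg c a0 y * B.bg d (snd i) (rho a0 y) else 0) = (if i = (a0, b) then A.bg c a0 y * B.bg d b (rho a0 y) else 0)"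
          by auto
      qed
      then show ?thesis using S(1) \<open>(a0, b) \<in> S\<close> by simp
    qed
    then show ?thesis using main by simp
  qed
  show "act c d q = germ (mtop Z) q (\<lambda>_. 0)" if "\<And>b. (a0, b) \<notin> fib q"
  proof -
    have "(\<Sum>i\<in>S. if fst i = a0 then A.bg c a0 y * B.bg d (snd i) (rho a0 y) else 0) = 0" for y
    proof (rule sum.neutral, rule ballI)
      fix i assume "i \<in> S"
      then have "(fst i, snd i) \<in> fib q" using S(2) by auto
      then have "fst i \<noteq> a0" using that by metis
      then show "(if fst i = a0 then A.bg c a0 y * B.bg d (snd i) (rho a0 y) else 0) = 0" by simp
    qed
    then show ?thesis using main Z.germ_bg_const_iff[OF act_Cc[OF c d] q(1), of 0] by simp
  qed
qed

lemma act_value: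
  fixes c :: "('a, 'k::real_normed_field) germ_section"
  assumes "c \<in> Cc A" "d \<in> Cc B" "a0 \<in> pts A" "b \<in> pts B" "\<beta> a0 = \<gamma> b"
    and "\<And>a. a \<in> pts A \<Longrightarrow> \<alpha> a = \<alpha> a0 \<Longrightarrow> a \<noteq> a0 \<Longrightarrow> c a = germ (mtop A) a (\<lambda>_. 0)"
  shows "Z.bg (act c d) (\<mu> a0 b) (\<alpha> a0) = A.bg c a0 (\<alpha> a0) * B.bg d b (\<gamma> b)"
proof -
  have m: "\<mu> a0 b \<in> pts Z" "\<zeta> (\<mu> a0 b) = \<alpha> a0" using mu_pts[OF assms(3-5)] by simp_all
  have f: "(a0, b) \<in> fib (\<mu> a0 b)" using assms(3-5) by (simp add: fib_def)
  obtain U where U: "A.el U" "a0 \<in> U" using A.el_exists[OF openin_topspace assms(3)] by blast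
  from germ_eq_value[OF act_germ(1)[OF assms(1-3,6) m f], simplified m(2)]
  show ?thesis using A.pi_pts[OF assms(3)] rho(2)[OF U] assms(5) by simp
qed

lemma act_zero:
  fixes c :: "('a, 'k::real_normed_field) germ_section"
  assumes c: "c \<in> Cc A" and d: "d \<in> Cc B" and a0: "a0 \<in> pts A" and b0: "b0 \<in> pts B" "\<beta> a0 = \<gamma> b0"
    and zc: "\<And>a. a \<in> pts A \<Longrightarrow> \<alpha> a = \<alpha> a0 \<Longrightarrow> a \<noteq> a0 \<Longrightarrow> c a = germ (mtop A) a (\<lambda>_. 0)"
    and zd: "\<And>b. b \<in> pts B \<Longrightarrow> \<gamma> b = \<gamma> b0 \<Longrightarrow> b \<noteq> b0 \<Longrightarrow> d b = germ (mtop B) b (\<lambda>_. 0)"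
    and q: "q \<in> pts Z" "\<zeta> q = \<alpha> a0" "q \<noteq> \<mu> a0 b0"
  shows "act c d q = germ (mtop Z) q (\<lambda>_. 0)"
proof (cases "\<exists>b. (a0, b) \<in> fib q")
  case True
  then obtain b where b: "(a0, b) \<in> fib q" by blast
  note F = fibD[OF b]
  have "d b = germ (mtop B) b (\<lambda>_. 0)" by (rule zd) (use F b0 q(3) in auto)
  then have "germ (mtop N) (\<beta> a0) (B.bg d b) = germ (mtop N) (\<beta> a0) (\<lambda>_. 0)" using B.germ_bg_const_iff[OF d F(2), of 0] F(3) by simp
  from germ_binop[OF refl rho_germ[OF a0 this], of times "A.bg c a0"]
  have "germ (mtop M) (\<zeta> q) (\<lambda>y. A.bg c a0 y * B.bg d b (rho a0 y)) = germ (mtop M) (\<zeta> q) (\<lambda>_. 0)" using q(2) by simp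
  then show ?thesis using act_germ(1)[OF c d a0 zc q(1,2) b] Z.germ_bg_const_iff[OF act_Cc[OF c d] q(1), of 0] by simp
next
  case False
  then show ?thesis using act_germ(2)[OF c d a0 zc q(1,2)] by blast
qed

text \<open>Only the factorisation with factors \<open>a0\<close> and \<open>b0\<close> survives,
  and there both germs are 1; at the other points \<open>act_zero\<close> applies.\<close>

lemma act_delta:
  fixes c :: "('a, 'k::real_normed_field) germ_section"
  assumes c: "A.delta c a0" and d: "B.delta d b0" and ab: "\<beta> a0 = \<gamma> b0"
  shows "Z.delta (act c d) (\<mu> a0 b0)"
proof -
  note D = A.delta_D[OF c] B.delta_D[OF d]
  have zc: "\<And>a. a \<in> pts A \<Longrightarrow> \<alpha> a = \<alpha> a0 \<Longrightarrow> a \<noteq> a0 \<Longrightarrow> c a = germ (mtop A) a (\<lambda>_. 0)" using c by (simp add: A.delta_def)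
  have zd: "\<And>b. b \<in> pts B \<Longrightarrow> \<gamma> b = \<gamma> b0 \<Longrightarrow> b \<noteq> b0 \<Longrightarrow> d b = germ (mtop B) b (\<lambda>_. 0)" using d by (simp add: B.delta_def)
  have m: "\<mu> a0 b0 \<in> pts Z" "\<zeta> (\<mu> a0 b0) = \<alpha> a0" using mu_pts[OF D(2,4) ab] by simp_all
  have f: "(a0, b0) \<in> fib (\<mu> a0 b0)" using D ab by (simp add: fib_def)
  have "germ (mtop N) (\<beta> a0) (B.bg d b0) = germ (mtop N) (\<beta> a0) (\<lambda>_. 1)"
    using B.germ_bg_const_iff[OF D(3,4), of 1] d ab by (simp add: B.delta_def)
  from rho_germ[OF D(2) this]
  have 1: "germ (mtop M) (\<alpha> a0) (\<lambda>y. B.bg d b0 (rho a0 y)) = germ (mtop M) (\<alpha> a0) (\<lambda>_. 1)" .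
  have 2: "germ (mtop M) (\<alpha> a0) (A.bg c a0) = germ (mtop M) (\<alpha> a0) (\<lambda>_. 1)"
    using A.germ_bg_const_iff[OF D(1,2), of 1] c by (simp add: A.delta_def)
  from germ_binop[OF 2 1, of times]
  have "germ (mtop M) (\<alpha> a0) (Z.bg (act c d) (\<mu> a0 b0)) = germ (mtop M) (\<alpha> a0) (\<lambda>_. 1)"
    using act_germ(1)[OF D(1,3,2) zc m f] m(2) by simp
  then have "act c d (\<mu> a0 b0) = germ (mtop Z) (\<mu> a0 b0) (\<lambda>_. 1)"
    using Z.germ_bg_const_iff[OF act_Cc[OF D(1,3)] m(1), of 1] m(2) by simp
  moreover have "act c d q = germ (mtop Z) q (\<lambda>_. 0)" if "q \<in> pts Z" "\<zeta> q = \<zeta> (\<mu> a0 b0)" "q \<noteq> \<mu> a0 b0" for q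
  proof -
    have eq: "\<zeta> q = \<alpha> a0" using that(2) m(2) by simp
    show ?thesis by (rule act_zero[OF D(1,3,2,4) ab]) ((rule zc zd; assumption) | rule that eq)+
  qed
  ultimately show ?thesis unfolding Z.delta_def using act_Cc[OF D(1,3)] m(1) by blast
qed

end

section \<open>Products of manifolds\<close>

lemma span_prod_UNIV:
  fixes B1 :: "'e::real_inner set" and B2 :: "'f::real_inner set"
  assumes "span B1 = UNIV" "span B2 = UNIV"
  shows "span ((\<lambda>x. (x, 0)) ` B1 \<union> (\<lambda>y. (0, y)) ` B2) = (UNIV :: ('e \<times> 'f) set)"
proof -
  have l: "linear (\<lambda>x::'e. (x, 0::'f))" "linear (\<lambda>y::'f. (0::'e, y))" by (auto intro!: linearI)
  have "(x, y) \<in> span ((\<lambda>x. (x, 0)) ` B1 \<union> (\<lambda>y. (0, y)) ` B2)" for x :: 'e and y :: 'f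
  proof -
    have "(x, 0 :: 'f) \<in> span ((\<lambda>x. (x, 0)) ` B1)" "(0 :: 'e, y) \<in> span ((\<lambda>y. (0, y)) ` B2)"
      using linear_span_image[OF l(1), of B1] linear_span_image[OF l(2), of B2] assms by auto
    from span_add[OF subsetD[OF span_mono this(1)] subsetD[OF span_mono this(2)]] show ?thesis
      by (metis Un_upper1 Un_upper2 add.left_neutral add.right_neutral add_Pair)
  qed
  then show ?thesis by auto
qed

lemma prod_manifold_simps [simp]:
  "mtop (prod_manifold M N) = prod_topology (mtop M) (mtop N)"
  "pts (prod_manifold M N) = pts M \<times> pts N"
  by (simp_all add: prod_manifold_def)

lemma prod_chart: "(U, \<phi>) \<in> atlas M \<Longrightarrow> (V, \<psi>) \<in> atlas N \<Longrightarrow> (U \<times> V, map_prod \<phi> \<psi>) \<in> atlas (prod_manifold M N)"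
  by (auto simp: prod_manifold_def)

lemma prod_manifold:
  fixes M :: "('a, 'e::real_inner) manifold" and N :: "('b, 'f::real_inner) manifold"
  assumes M: "is_manifold M" and N: "is_manifold N"
  shows "is_manifold (prod_manifold M N)"
proof -
  obtain C1 :: "'e set" where C1: "frame C1" using manifold_frame[OF M] by blast
  obtain C2 :: "'f set" where C2: "frame C2" using manifold_frame[OF N] by blast
  obtain B1 :: "'e set" where B1: "finite B1" "span B1 = UNIV" using M by (auto simp: is_manifold_def)
  obtain B2 :: "'f set" where B2: "finite B2" "span B2 = UNIV" using N by (auto simp: is_manifold_def)
  have 1: "\<exists>B :: ('e \<times> 'f) set. finite B \<and> span B = UNIV"
    using span_prod_UNIV[OF B1(2) B2(2)] B1(1) B2(1) by (metis finite_UnI finite_imageI)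
  have im: "map_prod \<phi> \<psi> ` (U \<times> V) = \<phi> ` U \<times> \<psi> ` V" for \<phi> :: "'a \<Rightarrow> 'e" and \<psi> :: "'b \<Rightarrow> 'f" and U V by auto
  have 2: "openin (mtop (prod_manifold M N)) (U \<times> V) \<and> open (map_prod \<phi> \<psi> ` (U \<times> V)) \<and>
      homeomorphic_map (subtopology (mtop (prod_manifold M N)) (U \<times> V)) (top_of_set (map_prod \<phi> \<psi> ` (U \<times> V))) (map_prod \<phi> \<psi>)"
    if U: "(U, \<phi>) \<in> atlas M" and V: "(V, \<psi>) \<in> atlas N" for U \<phi> V \<psi>
  proof -
    obtain f where f: "homeomorphic_maps (subtopology (mtop M) U) (top_of_set (\<phi> ` U)) \<phi> f"
      using chart_homeomorphic[OF M U] unfolding homeomorphic_map_maps by blast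
    obtain g where g: "homeomorphic_maps (subtopology (mtop N) V) (top_of_set (\<psi> ` V)) \<psi> g"
      using chart_homeomorphic[OF N V] unfolding homeomorphic_map_maps by blast
    have "homeomorphic_maps (prod_topology (subtopology (mtop M) U) (subtopology (mtop N) V))
        (prod_topology (top_of_set (\<phi> ` U)) (top_of_set (\<psi> ` V))) (\<lambda>(x, y). (\<phi> x, \<psi> y)) (\<lambda>(x, y). (f x, g y))"
      using f g unfolding homeomorphic_maps_prod by blast
    moreover have "(\<lambda>(x, y). (\<phi> x, \<psi> y)) = map_prod \<phi> \<psi>" by auto
    ultimately have "homeomorphic_map (subtopology (mtop (prod_manifold M N)) (U \<times> V)) (top_of_set (map_prod \<phi> \<psi> ` (U \<times> V))) (map_prod \<phi> \<psi>)"
      unfolding im homeomorphic_map_maps prod_manifold_simps by (metis prod_topology_subtopology_eu subtopology_Times)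
    then show ?thesis
      unfolding im using chart_openin[OF M U] chart_openin[OF N V] chart_open_range[OF M U] chart_open_range[OF N V]
      by (simp add: openin_prod_Times_iff open_Times)
  qed
  have 3: "(\<Union>(U, \<phi>)\<in>atlas (prod_manifold M N). U) = pts (prod_manifold M N)"
  proof
    show "(\<Union>(U, \<phi>)\<in>atlas (prod_manifold M N). U) \<subseteq> pts (prod_manifold M N)"
      using chart_subset[OF M] chart_subset[OF N] by (fastforce simp: prod_manifold_def)
    show "pts (prod_manifold M N) \<subseteq> (\<Union>(U, \<phi>)\<in>atlas (prod_manifold M N). U)"
    proof
      fix z assume "z \<in> pts (prod_manifold M N)"
      then obtain x y where z: "z = (x, y)" "x \<in> pts M" "y \<in> pts N" by auto
      obtain U \<phi> V \<psi> where U: "(U, \<phi>) \<in> atlas M" "x \<in> U" "(V, \<psi>) \<in> atlas N" "y \<in> V"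
        using chart_exists[OF M z(2)] chart_exists[OF N z(3)] by blast
      show "z \<in> (\<Union>(U, \<phi>)\<in>atlas (prod_manifold M N). U)"
        using prod_chart[OF U(1,3)] U(2,4) z(1) by (intro UN_I[of "(U \<times> V, map_prod \<phi> \<psi>)"]) auto
    qed
  qed
  have 4: "smooth_on (map_prod \<phi> \<psi> ` (U \<times> V \<inter> U' \<times> V')) (map_prod \<phi>' \<psi>' \<circ> inv_into (U \<times> V) (map_prod \<phi> \<psi>))"
    if U: "(U, \<phi>) \<in> atlas M" and V: "(V, \<psi>) \<in> atlas N" and U': "(U', \<phi>') \<in> atlas M" and V': "(V', \<psi>') \<in> atlas N"
    for U \<phi> V \<psi> U' \<phi>' V' \<psi>'
  proof -
    let ?S = "\<phi> ` (U \<inter> U') \<times> \<psi> ` (V \<inter> V')"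
    have o: "open ?S"
      by (rule open_Times[OF chart_open_image[OF M U chart_openin[OF M U']] chart_open_image[OF N V chart_openin[OF N V']]])
    have S: "map_prod \<phi> \<psi> ` (U \<times> V \<inter> U' \<times> V') = ?S" unfolding Times_Int_Times by (rule im)
    have a: "smooth_on ?S (\<lambda>z. (\<phi>' \<circ> inv_into U \<phi>) (fst z))"
      by (rule smooth_on_compose[OF C1 o smooth_on_bounded_linear_comp[OF bounded_linear_fst smooth_on_id] _ chart_transition[OF M U U']]) auto
    have b: "smooth_on ?S (\<lambda>z. (\<psi>' \<circ> inv_into V \<psi>) (snd z))"
      by (rule smooth_on_compose[OF C2 o smooth_on_bounded_linear_comp[OF bounded_linear_snd smooth_on_id] _ chart_transition[OF N V V']]) auto
    have inj: "inj_on (map_prod \<phi> \<psi>) (U \<times> V)" using chart_inj[OF M U] chart_inj[OF N V] by (rule map_prod_inj_on)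
    show ?thesis unfolding S
    proof (rule smooth_on_cong[OF o smooth_on_Pair[OF a b]])
      fix z assume "z \<in> ?S"
      then obtain x y where z: "z = map_prod \<phi> \<psi> (x, y)" "x \<in> U" "y \<in> V" by auto
      show "((\<phi>' \<circ> inv_into U \<phi>) (fst z), (\<psi>' \<circ> inv_into V \<psi>) (snd z)) = (map_prod \<phi>' \<psi>' \<circ> inv_into (U \<times> V) (map_prod \<phi> \<psi>)) z"
        using inv_into_f_f[OF inj, of "(x, y)"] chart_inv[OF M U z(2)] chart_inv[OF N V z(3)] z by simp
    qed
  qed
  show ?thesis unfolding is_manifold_def using 1 2 3 4 by (auto simp: prod_manifold_def)
qed

text \<open>The two functions come with local extensions in different charts; a transition map
  carries the second to the chart of the first.\<close>

lemma smooth_function_Pair: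
  fixes M :: "('a, 'e::real_inner) manifold"
  assumes M: "is_manifold M" and f: "smooth_function M A f" and g: "smooth_function M A g"
  shows "smooth_function M A (\<lambda>x. (f x, g x))"
proof (rule smooth_functionI)
  show "A \<subseteq> pts M" using f by (simp add: smooth_function_def)
  fix p assume p: "p \<in> A"
  obtain C :: "'e set" where C: "frame C" using manifold_frame[OF M] by blast
  obtain U \<phi> S F where 1: "(U, \<phi>) \<in> atlas M" "p \<in> U" "open S" "\<phi> p \<in> S" "smooth_on S F"
    "\<And>q. q \<in> A \<Longrightarrow> q \<in> U \<Longrightarrow> \<phi> q \<in> S \<Longrightarrow> f q = F (\<phi> q)" by (rule smooth_functionD[OF f p]) blast
  obtain U' \<phi>' S' F' where 2: "(U', \<phi>') \<in> atlas M" "p \<in> U'" "open S'" "\<phi>' p \<in> S'" "smooth_on S' F'"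
    "\<And>q. q \<in> A \<Longrightarrow> q \<in> U' \<Longrightarrow> \<phi>' q \<in> S' \<Longrightarrow> g q = F' (\<phi>' q)" by (rule smooth_functionD[OF g p]) blast
  define W where "W = {q \<in> U'. \<phi>' q \<in> S'}"
  define T where "T = S \<inter> \<phi> ` (U \<inter> W)"
  have oW: "openin (mtop M) W" unfolding W_def by (rule chart_open_preimage[OF M 2(1,3)])
  have o: "open T" unfolding T_def by (intro open_Int 1 chart_open_image[OF M 1(1) oW])
  have "smooth_on T (\<phi>' \<circ> inv_into U \<phi>)"
    by (rule smooth_on_subset[OF chart_transition[OF M 1(1) 2(1)]]) (auto simp: T_def W_def)
  then have "smooth_on T (\<lambda>x. F' ((\<phi>' \<circ> inv_into U \<phi>) x))"
    by (rule smooth_on_compose[OF C o _ _ 2(5)]) (auto simp: T_def W_def chart_inv[OF M 1(1)])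
  then have "smooth_on T (\<lambda>x. (F x, F' ((\<phi>' \<circ> inv_into U \<phi>) x)))"
    using smooth_on_Pair[OF smooth_on_subset[OF 1(5), of T]] by (auto simp: T_def)
  moreover have "(f q, g q) = (F (\<phi> q), F' ((\<phi>' \<circ> inv_into U \<phi>) (\<phi> q)))" if q: "q \<in> A" "q \<in> U" "\<phi> q \<in> T" for q
  proof -
    obtain r where r: "r \<in> U" "r \<in> W" "\<phi> q = \<phi> r" using q(3) by (auto simp: T_def)
    then have "q = r" using chart_inj[OF M 1(1)] q(2) by (metis inj_onD)
    then show ?thesis using 1(6)[OF q(1,2)] 2(6)[OF q(1)] q(3) r(2) chart_inv[OF M 1(1) q(2)] by (auto simp: T_def W_def)
  qed
  moreover have "\<phi> p \<in> T" using 1 2 by (auto simp: T_def W_def)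
  ultimately show "\<exists>U \<phi> S F. (U, \<phi>) \<in> atlas M \<and> p \<in> U \<and> open S \<and> \<phi> p \<in> S \<and> smooth_on S F \<and>
    (\<forall>q. q \<in> A \<longrightarrow> q \<in> U \<longrightarrow> \<phi> q \<in> S \<longrightarrow> (f q, g q) = F (\<phi> q))"
    using 1(1,2) o by (intro exI[of _ U] exI[of _ \<phi>] exI[of _ T] exI[of _ "\<lambda>x. (F x, F' ((\<phi>' \<circ> inv_into U \<phi>) x))"]) simp
qed

lemma smooth_map_Pair:
  assumes L: "is_manifold L" and M: "is_manifold M" and N: "is_manifold N"
    and f: "smooth_map L A M f" and g: "smooth_map L A N g"
  shows "smooth_map L A (prod_manifold M N) (\<lambda>x. (f x, g x))"
proof (rule smooth_mapI[OF L])
  note sp = smooth_map_subset_pts[OF f] smooth_map_subset_pts[OF g]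
  show "A \<subseteq> pts L" "(\<lambda>x. (f x, g x)) ` A \<subseteq> pts (prod_manifold M N)" using sp by auto
  fix p assume p: "p \<in> A"
  have "f p \<in> pts M" "g p \<in> pts N" using p sp by auto
  then obtain U \<phi> V \<psi> where U: "(U, \<phi>) \<in> atlas M" "f p \<in> U" and V: "(V, \<psi>) \<in> atlas N" "g p \<in> V"
    using chart_exists[OF M] chart_exists[OF N] by blast
  obtain W1 where W1: "openin (mtop L) W1" "p \<in> W1" "\<forall>q\<in>A \<inter> W1. f q \<in> U"
    using smooth_map_continuous_at[OF L M f p chart_openin[OF M U(1)] U(2)] by blast
  obtain W2 where W2: "openin (mtop L) W2" "p \<in> W2" "\<forall>q\<in>A \<inter> W2. g q \<in> V"
    using smooth_map_continuous_at[OF L N g p chart_openin[OF N V(1)] V(2)] by blast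
  let ?A = "A \<inter> (W1 \<inter> W2)"
  have "smooth_function L ?A (\<lambda>x. \<phi> (f x))" by (rule smooth_map_chart[OF M f U(1)]) (use W1 in auto)
  moreover have "smooth_function L ?A (\<lambda>x. \<psi> (g x))" by (rule smooth_map_chart[OF N g V(1)]) (use W2 in auto)
  ultimately have "smooth_function L ?A (\<lambda>x. map_prod \<phi> \<psi> (f x, g x))" using smooth_function_Pair[OF L] by simp
  then show "\<exists>W V \<psi>. openin (mtop L) W \<and> p \<in> W \<and> (V, \<psi>) \<in> atlas (prod_manifold M N) \<and> (\<lambda>x. (f x, g x)) ` (A \<inter> W) \<subseteq> V \<and>
      smooth_function L (A \<inter> W) (\<lambda>x. \<psi> (f x, g x))"
    using W1 W2 prod_chart[OF U(1) V(1)]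
    by (intro exI[of _ "W1 \<inter> W2"] exI[of _ "U \<times> V"] exI[of _ "map_prod \<phi> \<psi>"]) auto
qed

lemma smooth_map_fst_snd:
  assumes M: "is_manifold M" and N: "is_manifold N" and A: "A \<subseteq> pts M \<times> pts N"
  shows "smooth_map (prod_manifold M N) A M fst" "smooth_map (prod_manifold M N) A N snd"
proof -
  note P = prod_manifold[OF M N]
  have *: "\<exists>U \<phi> V \<psi>. (U, \<phi>) \<in> atlas M \<and> (V, \<psi>) \<in> atlas N \<and> openin (mtop (prod_manifold M N)) (U \<times> V) \<and> p \<in> U \<times> V \<and>
     smooth_function (prod_manifold M N) (A \<inter> U \<times> V) (\<lambda>x. \<phi> (fst x)) \<and> smooth_function (prod_manifold M N) (A \<inter> U \<times> V) (\<lambda>x. \<psi> (snd x))"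
    if "p \<in> A" for p
  proof -
    have "fst p \<in> pts M" "snd p \<in> pts N" using that A by auto
    then obtain U \<phi> V \<psi> where U: "(U, \<phi>) \<in> atlas M" "fst p \<in> U" and V: "(V, \<psi>) \<in> atlas N" "snd p \<in> V"
      using chart_exists[OF M] chart_exists[OF N] by blast
    note c = prod_chart[OF U(1) V(1)]
    have "smooth_function (prod_manifold M N) (U \<times> V) (\<lambda>x. fst (map_prod \<phi> \<psi> x))" "smooth_function (prod_manifold M N) (U \<times> V) (\<lambda>x. snd (map_prod \<phi> \<psi> x))"
      using smooth_function_bounded_linear[OF P chart_openin[OF P c] _ smooth_function_of_chart[OF P c]] bounded_linear_fst bounded_linear_snd by blast+
    then have "smooth_function (prod_manifold M N) (A \<inter> U \<times> V) (\<lambda>x. \<phi> (fst x))" "smooth_function (prod_manifold M N) (A \<inter> U \<times> V) (\<lambda>x. \<psi> (snd x))"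
      by (auto elim!: smooth_function_subset_cong)
    then show ?thesis using U V chart_openin[OF P c] by (metis mem_Times_iff)
  qed
  show "smooth_map (prod_manifold M N) A M fst"
  proof (rule smooth_mapI[OF P])
    fix p assume "p \<in> A"
    from *[OF this] obtain U \<phi> V where "(U, \<phi>) \<in> atlas M" "openin (mtop (prod_manifold M N)) (U \<times> V)" "p \<in> U \<times> V"
      "smooth_function (prod_manifold M N) (A \<inter> U \<times> V) (\<lambda>x. \<phi> (fst x))" by blast
    then show "\<exists>W V \<psi>. openin (mtop (prod_manifold M N)) W \<and> p \<in> W \<and> (V, \<psi>) \<in> atlas M \<and> fst ` (A \<inter> W) \<subseteq> V \<and>
      smooth_function (prod_manifold M N) (A \<inter> W) (\<lambda>x. \<psi> (fst x))"
      by (intro exI[of _ "U \<times> V"] exI[of _ U] exI[of _ \<phi>]) auto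
  qed (use A in auto)
  show "smooth_map (prod_manifold M N) A N snd"
  proof (rule smooth_mapI[OF P])
    fix p assume "p \<in> A"
    from *[OF this] obtain U V \<psi> where "(V, \<psi>) \<in> atlas N" "openin (mtop (prod_manifold M N)) (U \<times> V)" "p \<in> U \<times> V"
      "smooth_function (prod_manifold M N) (A \<inter> U \<times> V) (\<lambda>x. \<psi> (snd x))" by blast
    then show "\<exists>W V \<psi>. openin (mtop (prod_manifold M N)) W \<and> p \<in> W \<and> (V, \<psi>) \<in> atlas N \<and> snd ` (A \<inter> W) \<subseteq> V \<and>
      smooth_function (prod_manifold M N) (A \<inter> W) (\<lambda>x. \<psi> (snd x))"
      by (intro exI[of _ "U \<times> V"] exI[of _ V] exI[of _ \<psi>]) auto
  qed (use A in auto)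
qed

text \<open>No equality of dimensions is assumed. A linear right inverse of the derivative gives an
  affine slice along which \<open>f\<close> has derivative the identity, and
  \<open>smooth_local_inverse\<close> turns the slice into a smooth local section. Local injectivity
  then makes the section an inverse of \<open>f\<close>.\<close>

lemma submersion_local_diffeo:
  fixes M :: "('a, 'e::real_inner) manifold" and N :: "('b, 'f::real_inner) manifold"
  assumes M: "is_manifold M" and N: "is_manifold N" and f: "submersion M N f"
    and inj: "\<And>p. p \<in> pts M \<Longrightarrow> \<exists>W. openin (mtop M) W \<and> p \<in> W \<and> inj_on f W"
  shows "local_diffeo M (pts M) N f"
  unfolding local_diffeo_def
proof
  fix p assume p: "p \<in> pts M"
  obtain CM :: "'e set" where CM: "frame CM" using manifold_frame[OF M] by blast
  obtain CN :: "'f set" where CN: "frame CN" using manifold_frame[OF N] by blast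
  have fs: "smooth_map M (pts M) N f" using f by (simp add: submersion_def)
  obtain U \<phi> V \<psi> D where U: "(U, \<phi>) \<in> atlas M" "p \<in> U" and V: "(V, \<psi>) \<in> atlas N" "f p \<in> V"
    and D: "((\<psi> \<circ> f \<circ> inv_into U \<phi>) has_derivative D) (at (\<phi> p))" "surj D"
    using f p unfolding submersion_def bex_pair_iff by blast
  obtain W0 where W0: "openin (mtop M) W0" "p \<in> W0" "inj_on f W0" using inj[OF p] by blast
  obtain W1 where W1: "openin (mtop M) W1" "p \<in> W1" "\<forall>q\<in>pts M \<inter> W1. f q \<in> V"
    using smooth_map_continuous_at[OF M N fs p chart_openin[OF N V(1)] V(2)] by blast
  define U0 where "U0 = U \<inter> (W0 \<inter> W1)"
  have U0: "openin (mtop M) U0" "p \<in> U0" "U0 \<subseteq> U" "inj_on f U0" "\<And>q. q \<in> U0 \<Longrightarrow> f q \<in> V"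
    using W0 W1 U chart_openin[OF M U(1)] chart_subset[OF M U(1)] by (auto simp: U0_def intro: inj_on_subset)
  have U0p: "U0 \<subseteq> pts M" using openin_subset[OF U0(1)] .
  define A0 where "A0 = \<phi> ` (U \<inter> U0)"
  have oA: "open A0" unfolding A0_def by (rule chart_open_image[OF M U(1) U0(1)])
  have "smooth_function M U0 (\<lambda>x. \<psi> (f x))" by (rule smooth_map_chart[OF N fs V(1)]) (use U0 U0p in auto)
  then have sF: "smooth_on A0 (\<lambda>x. \<psi> (f (inv_into U \<phi> x)))" unfolding A0_def by (rule smooth_function_chart[OF M U0(1) _ U(1)])
  obtain R where R: "linear R" "D \<circ> R = id"
    using linear_surjective_right_inverse[OF has_derivative_linear[OF D(1)] D(2)] by blast
  have Rb: "bounded_linear R" by (rule frame_bounded_linear[OF CN R(1)])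
  define a where "a = \<psi> (f p)"
  \<comment> \<open>The slice: an affine map sending \<open>a\<close> to \<open>\<phi> p\<close>,
    with directions given by the right inverse \<open>R\<close> and parametrised by the target
    chart.\<close>
  define l where "l = (\<lambda>v. \<phi> p + R (v - a))"
  have sl: "smooth_on X l" for X
  proof -
    have "smooth_on X (\<lambda>v. v - a)" using smooth_on_add[OF smooth_on_id smooth_on_const[of X "- a"]] by simp
    then show ?thesis unfolding l_def by (intro smooth_on_add smooth_on_const smooth_on_bounded_linear_comp[OF Rb])
  qed
  have la: "l a = \<phi> p" using linear_0[OF R(1)] by (simp add: l_def)
  define S where "S = l -` A0"
  have oS: "open S" unfolding S_def using smooth_on_continuous[OF sl] oA by (simp add: open_vimage)
  have aS: "a \<in> S" using U U0 la by (auto simp: S_def A0_def)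
  define h where "h = (\<lambda>v. \<psi> (f (inv_into U \<phi> (l v))))"
  have sh: "smooth_on S h" unfolding h_def by (rule smooth_on_compose[OF CM oS sl _ sF]) (auto simp: S_def)
  have ha: "h a = a" using chart_inv[OF M U] la by (simp add: h_def a_def)
  have "(l has_derivative R) (at a)"
    unfolding l_def by (auto intro!: derivative_eq_intros bounded_linear.has_derivative[OF Rb])
  then have "((\<psi> \<circ> f \<circ> inv_into U \<phi>) \<circ> l has_derivative D \<circ> R) (at a)" using D(1) la by (intro diff_chain_at) simp_all
  then have dh: "(h has_derivative (\<lambda>v. v)) (at a)" using R(2) by (simp add: h_def comp_def id_def)
  obtain T g where T: "open T" "h a \<in> T" "smooth_on T g" "g (h a) = a" "g ` T \<subseteq> S" "\<forall>y\<in>T. h (g y) = y"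
    using smooth_local_inverse[OF CN oS aS sh dh] by blast
  define N0 where "N0 = {y \<in> V. \<psi> y \<in> T}"
  define \<sigma> where "\<sigma> = (\<lambda>y. inv_into U \<phi> (l (g (\<psi> y))))"
  have oN: "openin (mtop N) N0" unfolding N0_def by (rule chart_open_preimage[OF N V(1) T(1)])
  have \<sigma>: "\<sigma> y \<in> U0" "f (\<sigma> y) = y" "\<phi> (\<sigma> y) = l (g (\<psi> y))" if y: "y \<in> N0" for y
  proof -
    have "l (g (\<psi> y)) \<in> A0" using T(5) y by (auto simp: N0_def S_def)
    then obtain q where q: "q \<in> U0" "l (g (\<psi> y)) = \<phi> q" by (auto simp: A0_def)
    have qU: "q \<in> U" using q(1) U0(3) by blast
    have s: "\<sigma> y = q" unfolding \<sigma>_def q(2) by (rule chart_inv[OF M U(1) qU])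
    then show "\<sigma> y \<in> U0" "\<phi> (\<sigma> y) = l (g (\<psi> y))" using q by simp_all
    have "\<psi> (f (\<sigma> y)) = \<psi> y" using T(6) y by (simp add: \<sigma>_def h_def N0_def)
    then show "f (\<sigma> y) = y" using chart_inj[OF N V(1)] U0(5)[OF q(1)] y s by (simp add: inj_on_def N0_def)
  qed
  \<comment> \<open>An open condition on the source; injectivity of \<open>f\<close> on
    \<open>U0\<close> makes this set the image of the section \<open>\<sigma>\<close>.\<close>
  define U1 where "U1 = {q \<in> U0. f q \<in> N0}"
  have o1: "openin (mtop M) U1"
  proof -
    have "openin (mtop M) {q \<in> pts M. f q \<in> N0}"
      using openin_continuous_map_preimage[OF smooth_map_continuous[OF M N fs] oN] by simp
    moreover have "U1 = U0 \<inter> {q \<in> pts M. f q \<in> N0}" using U0p by (auto simp: U1_def)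
    ultimately show ?thesis using U0(1) by auto
  qed
  have bij: "bij_betw f U1 N0"
    unfolding bij_betw_def using inj_on_subset[OF U0(4), of U1] \<sigma> by (auto simp: U1_def image_iff) metis
  have inv: "inv_into U1 f y = \<sigma> y" if "y \<in> N0" for y
    by (rule inv_into_f_eq) (use bij \<sigma>[OF that] that in \<open>auto simp: bij_betw_def U1_def\<close>)
  have "smooth_map N N0 M \<sigma>"
  proof (rule smooth_mapI[OF N])
    show "N0 \<subseteq> pts N" using openin_subset[OF oN] .
    show "\<sigma> ` N0 \<subseteq> pts M" using \<sigma> U0p by auto
    have "smooth_function N N0 (\<lambda>y. l (g (\<psi> y)))"
    proof (rule smooth_functionI[OF openin_subset[OF oN]])
      fix y assume y: "y \<in> N0"
      have "smooth_on T (\<lambda>x. l (g x))" by (rule smooth_on_compose[OF CN T(1,3) _ sl]) blast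
      then show "\<exists>U \<phi> S F. (U, \<phi>) \<in> atlas N \<and> y \<in> U \<and> open S \<and> \<phi> y \<in> S \<and> smooth_on S F \<and>
          (\<forall>q. q \<in> N0 \<longrightarrow> q \<in> U \<longrightarrow> \<phi> q \<in> S \<longrightarrow> l (g (\<psi> q)) = F (\<phi> q))"
        using V(1) T(1) y by (intro exI[of _ V] exI[of _ \<psi>] exI[of _ T] exI[of _ "\<lambda>x. l (g x)"]) (auto simp: N0_def)
    qed
    then have "smooth_function N N0 (\<lambda>y. \<phi> (\<sigma> y))" by (rule smooth_function_subset_cong) (auto simp: \<sigma>)
    then show "\<exists>W V \<psi>. openin (mtop N) W \<and> y \<in> W \<and> (V, \<psi>) \<in> atlas M \<and> \<sigma> ` (N0 \<inter> W) \<subseteq> V \<and>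
      smooth_function N (N0 \<inter> W) (\<lambda>x. \<psi> (\<sigma> x))" if "y \<in> N0" for y
      using that oN U(1) \<sigma>(1) U0(3) by (intro exI[of _ N0] exI[of _ U] exI[of _ \<phi>]) auto
  qed
  then have "smooth_map N N0 M (inv_into U1 f)" by (rule smooth_map_subset_cong) (auto simp: inv)
  moreover have "smooth_map M U1 N f" by (rule smooth_map_subset_cong[OF fs]) (use U0p in \<open>auto simp: U1_def\<close>)
  ultimately have "diffeo M U1 N N0 f" using bij by (simp add: diffeo_def)
  moreover have "p \<in> U1" using U0(2) V(2) T(2) ha by (simp add: U1_def N0_def flip: a_def)
  ultimately show "\<exists>U V. openin (subtopology (mtop M) (pts M)) U \<and> p \<in> U \<and> openin (mtop N) V \<and> diffeo M U N V f"
    using o1 oN by auto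
qed

section \<open>Transport of principal bundles\<close>

text \<open>The structure of \<open>Q\<close> is that of \<open>P\<close> conjugated by the
  diffeomorphism, so axioms and smoothness are read off after applying \<open>?\<Psi>\<close>. The
  submersion property is a hypothesis because for the spectral projection it is immediate in
  charts.\<close>

lemma principal_bundle_transport:
  fixes G :: "('x, 'e::real_inner, 'g, 'd::real_inner) groupoid" and H :: "('y, 'f::real_inner, 'h, 'c::real_inner) groupoid"
    and P :: "('p, 'q::real_inner, 'x, 'g, 'y, 'h) bibundle" and Q :: "('r, 's::real_inner, 'x, 'g, 'y, 'h) bibundle"
  assumes mG: "is_manifold (arrs G)" "is_groupoid G" and gH: "is_groupoid H" and mH: "is_manifold (arrs H)" "is_manifold (objs H)"
    and P: "principal_bundle G H P" and mQ: "is_manifold (bspace Q)"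
    and sQ: "submersion (bspace Q) (objs G) (bproj Q)"
    and \<Phi>: "diffeo (bspace P) (pts (bspace P)) (bspace Q) (pts (bspace Q)) \<Phi>"
    and pr: "\<And>p. p \<in> pts (bspace P) \<Longrightarrow> bproj Q (\<Phi> p) = bproj P p" "\<And>p. p \<in> pts (bspace P) \<Longrightarrow> bmom Q (\<Phi> p) = bmom P p"
    and la: "\<And>g p. (g, p) \<in> left_fibre_product G P \<Longrightarrow> \<Phi> (lact P g p) = lact Q g (\<Phi> p)"
    and ra: "\<And>p h. (p, h) \<in> right_fibre_product H P \<Longrightarrow> \<Phi> (ract P p h) = ract Q (\<Phi> p) h"
  shows "principal_bundle_iso G H P Q \<Phi>"
proof -
  let ?P = "bspace P" and ?Q = "bspace Q" and ?\<Psi> = "inv_into (pts (bspace P)) \<Phi>"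
  have mP: "is_manifold ?P" and momP: "smooth_map ?P (pts ?P) (objs H) (bmom P)"
    and lP: "left_action G P" and rP: "right_action H P"
    and surjP: "bproj P ` pts ?P = pts (objs G)"
    and inv: "\<And>g p. (g, p) \<in> left_fibre_product G P \<Longrightarrow> bmom P (lact P g p) = bmom P p"
      "\<And>p h. (p, h) \<in> right_fibre_product H P \<Longrightarrow> bproj P (ract P p h) = bproj P p"
    and com: "\<And>g p h. (g, p) \<in> left_fibre_product G P \<Longrightarrow> (p, h) \<in> right_fibre_product H P \<Longrightarrow>
        lact P g (ract P p h) = ract P (lact P g p) h"
    and dP: "diffeo (prod_manifold ?P (arrs H)) (right_fibre_product H P) (prod_manifold ?P ?P)
       {(p, p'). p \<in> pts ?P \<and> p' \<in> pts ?P \<and> bproj P p = bproj P p'} (\<lambda>(p, h). (p, ract P p h))"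
    using P unfolding principal_bundle_def by blast+
  have s\<Phi>: "smooth_map ?P (pts ?P) ?Q \<Phi>" and s\<Psi>: "smooth_map ?Q (pts ?Q) ?P ?\<Psi>" and bij: "bij_betw \<Phi> (pts ?P) (pts ?Q)"
    using \<Phi> by (auto simp: diffeo_def)
  have \<Phi>pts: "\<Phi> p \<in> pts ?Q" "?\<Psi> (\<Phi> p) = p" if "p \<in> pts ?P" for p
    using that bij by (auto simp: bij_betw_def)
  have \<Psi>: "?\<Psi> q \<in> pts ?P" "\<Phi> (?\<Psi> q) = q" "bproj P (?\<Psi> q) = bproj Q q" "bmom P (?\<Psi> q) = bmom Q q" if "q \<in> pts ?Q" for q
  proof -
    have "q \<in> \<Phi> ` pts ?P" using that bij by (simp add: bij_betw_def)
    then show *: "?\<Psi> q \<in> pts ?P" "\<Phi> (?\<Psi> q) = q" by (rule inv_into_into, rule f_inv_into_f)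
    then show "bproj P (?\<Psi> q) = bproj Q q" "bmom P (?\<Psi> q) = bmom Q q" using pr[OF *(1)] by simp_all
  qed
  have lfp: "(g, q) \<in> left_fibre_product G Q \<longleftrightarrow> q \<in> pts ?Q \<and> (g, ?\<Psi> q) \<in> left_fibre_product G P" for g q
    using \<Psi> by (auto simp: left_fibre_product_def)
  have rfp: "(q, h) \<in> right_fibre_product H Q \<longleftrightarrow> q \<in> pts ?Q \<and> (?\<Psi> q, h) \<in> right_fibre_product H P" for h q
    using \<Psi> by (auto simp: right_fibre_product_def)
  have lpts: "lact P g p \<in> pts ?P \<and> bproj P (lact P g p) = tgt G g" if "(g, p) \<in> left_fibre_product G P" for g p
    using that lP smooth_map_subset_pts(2) unfolding left_action_def by fastforce
  have rpts: "ract P p h \<in> pts ?P \<and> bmom P (ract P p h) = src H h" if "(p, h) \<in> right_fibre_product H P" for p h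
    using that rP smooth_map_subset_pts(2) unfolding right_action_def by fastforce
  have laQ: "lact Q g q = \<Phi> (lact P g (?\<Psi> q))" if "(g, q) \<in> left_fibre_product G Q" for g q
    using that la[of g "?\<Psi> q"] \<Psi> by (simp add: lfp)
  have raQ: "ract Q q h = \<Phi> (ract P (?\<Psi> q) h)" if "(q, h) \<in> right_fibre_product H Q" for h q
    using that ra[of "?\<Psi> q" h] \<Psi> by (simp add: rfp)
  have lQpts: "lact Q g q \<in> pts ?Q" "?\<Psi> (lact Q g q) = lact P g (?\<Psi> q)" if "(g, q) \<in> left_fibre_product G Q" for g q
    using laQ[OF that] lpts[of g "?\<Psi> q"] that \<Phi>pts by (auto simp: lfp)
  have rQpts: "ract Q q h \<in> pts ?Q" "?\<Psi> (ract Q q h) = ract P (?\<Psi> q) h" if "(q, h) \<in> right_fibre_product H Q" for h q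
    using raQ[OF that] rpts[of "?\<Psi> q" h] that \<Phi>pts by (auto simp: rfp)
  have lPu: "lact P (unt G (bproj P p)) p = p" and rPu: "ract P p (unt H (bmom P p)) = p" if "p \<in> pts ?P" for p
    using that lP rP by (simp_all add: left_action_def right_action_def)
  have lPm: "lact P g' (lact P g p) = lact P (mlt G g' g) p" if "(g', g) \<in> composable G" "(g, p) \<in> left_fibre_product G P" for g' g p
    using that lP unfolding left_action_def by blast
  have rPm: "ract P (ract P p h) h' = ract P p (mlt H h h')" if "(p, h) \<in> right_fibre_product H P" "(h, h') \<in> composable H" for p h h'
    using that rP unfolding right_action_def by blast
  have unitsG: "unt G x \<in> pts (arrs G)" "src G (unt G x) = x" if "x \<in> pts (objs G)" for x
    using that mG(2) by (simp_all add: is_groupoid_def)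
  have unitsH: "unt H x \<in> pts (arrs H)" "tgt H (unt H x) = x" if "x \<in> pts (objs H)" for x
    using that gH by (simp_all add: is_groupoid_def)
  have multG: "mlt G g' g \<in> pts (arrs G)" "src G (mlt G g' g) = src G g" if "(g', g) \<in> composable G" for g' g
    using that mG(2) unfolding is_groupoid_def by blast+
  have multH: "mlt H g' g \<in> pts (arrs H)" "tgt H (mlt H g' g) = tgt H g'" if "(g', g) \<in> composable H" for g' g
    using that gH unfolding is_groupoid_def by blast+
  note mGP = prod_manifold[OF mG(1) mP] and mGQ = prod_manifold[OF mG(1) mQ] and mPH = prod_manifold[OF mP mH(1)]
    and mQH = prod_manifold[OF mQ mH(1)] and mPP = prod_manifold[OF mP mP] and mQQ = prod_manifold[OF mQ mQ]
  have subl: "left_fibre_product G Q \<subseteq> pts (arrs G) \<times> pts ?Q" and subr: "right_fibre_product H Q \<subseteq> pts ?Q \<times> pts (arrs H)"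
    by (auto simp: left_fibre_product_def right_fibre_product_def)
  have cl: "smooth_map (prod_manifold (arrs G) ?Q) (left_fibre_product G Q) (prod_manifold (arrs G) ?P) (\<lambda>z. (fst z, ?\<Psi> (snd z)))"
    by (rule smooth_map_Pair[OF mGQ mG(1) mP smooth_map_fst_snd(1)[OF mG(1) mQ subl] smooth_map_compose[OF mGQ mQ mP smooth_map_fst_snd(2)[OF mG(1) mQ subl] s\<Psi>]])
      (use subl in auto)
  have cr: "smooth_map (prod_manifold ?Q (arrs H)) (right_fibre_product H Q) (prod_manifold ?P (arrs H)) (\<lambda>z. (?\<Psi> (fst z), snd z))"
    by (rule smooth_map_Pair[OF mQH mP mH(1) smooth_map_compose[OF mQH mQ mP smooth_map_fst_snd(1)[OF mQ mH(1) subr] s\<Psi>] smooth_map_fst_snd(2)[OF mQ mH(1) subr]])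
      (use subr in auto)
  have slP: "smooth_map (prod_manifold (arrs G) ?P) (left_fibre_product G P) ?P (\<lambda>(g, p). lact P g p)"
    and srP: "smooth_map (prod_manifold ?P (arrs H)) (right_fibre_product H P) ?P (\<lambda>(p, h). ract P p h)"
    using lP rP by (simp_all add: left_action_def right_action_def)
  have "smooth_map (prod_manifold (arrs G) ?Q) (left_fibre_product G Q) ?P (\<lambda>z. (\<lambda>(g, p). lact P g p) (fst z, ?\<Psi> (snd z)))"
    by (rule smooth_map_compose[OF mGQ mGP mP cl slP]) (auto simp: lfp)
  then have "smooth_map (prod_manifold (arrs G) ?Q) (left_fibre_product G Q) ?Q (\<lambda>z. \<Phi> ((\<lambda>(g, p). lact P g p) (fst z, ?\<Psi> (snd z))))"
    by (rule smooth_map_compose[OF mGQ mP mQ _ s\<Phi>]) (auto simp: lfp lpts)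
  then have slQ: "smooth_map (prod_manifold (arrs G) ?Q) (left_fibre_product G Q) ?Q (\<lambda>(g, p). lact Q g p)"
    by (rule smooth_map_subset_cong) (auto simp: laQ)
  have "smooth_map (prod_manifold ?Q (arrs H)) (right_fibre_product H Q) ?P (\<lambda>z. (\<lambda>(p, h). ract P p h) (?\<Psi> (fst z), snd z))"
    by (rule smooth_map_compose[OF mQH mPH mP cr srP]) (auto simp: rfp)
  then have "smooth_map (prod_manifold ?Q (arrs H)) (right_fibre_product H Q) ?Q (\<lambda>z. \<Phi> ((\<lambda>(p, h). ract P p h) (?\<Psi> (fst z), snd z)))"
    by (rule smooth_map_compose[OF mQH mP mQ _ s\<Phi>]) (auto simp: rfp rpts)
  then have srQ: "smooth_map (prod_manifold ?Q (arrs H)) (right_fibre_product H Q) ?Q (\<lambda>(p, h). ract Q p h)"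
    by (rule smooth_map_subset_cong) (auto simp: raQ)
  have lQ: "left_action G Q"
    unfolding left_action_def
  proof (intro conjI allI impI ballI)
    show "case z of (g, p) \<Rightarrow> bproj Q (lact Q g p) = tgt G g" if "z \<in> left_fibre_product G Q" for z
    proof -
      obtain g q where z: "z = (g, q)" by force
      then have gq: "(g, q) \<in> left_fibre_product G Q" "(g, ?\<Psi> q) \<in> left_fibre_product G P" using that lfp by simp_all
      show ?thesis using \<Psi>(3)[OF lQpts(1)[OF gq(1)]] lpts[OF gq(2)] lQpts(2)[OF gq(1)] z by simp
    qed
    show "lact Q (unt G (bproj Q q)) q = q" if q: "q \<in> pts ?Q" for q
    proof -
      note p = \<Psi>[OF q]
      have "bproj P (?\<Psi> q) \<in> pts (objs G)" using surjP p(1) by blast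
      then have "(unt G (bproj P (?\<Psi> q)), ?\<Psi> q) \<in> left_fibre_product G P" using unitsG p by (simp add: left_fibre_product_def)
      from la[OF this] show ?thesis using lPu[OF p(1)] p by simp
    qed
    show "lact Q g' (lact Q g q) = lact Q (mlt G g' g) q" if z: "(g', g) \<in> composable G \<and> (g, q) \<in> left_fibre_product G Q" for g' g q
    proof -
      have q: "(g, ?\<Psi> q) \<in> left_fibre_product G P" "q \<in> pts ?Q" using z by (auto simp: lfp)
      have "(g', lact Q g q) \<in> left_fibre_product G Q"
        using z lQpts[of g q] lpts[OF q(1)] by (simp add: lfp) (simp add: left_fibre_product_def composable_def)
      moreover have "(mlt G g' g, q) \<in> left_fibre_product G Q"
        using z q multG by (simp add: lfp) (simp add: left_fibre_product_def composable_def)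
      ultimately show ?thesis using laQ lQpts(2)[OF conjunct2[OF z]] lPm[OF conjunct1[OF z] q(1)] by simp
    qed
  qed (rule slQ)
  have rQ: "right_action H Q"
    unfolding right_action_def
  proof (intro conjI allI impI ballI)
    show "case z of (q, h) \<Rightarrow> bmom Q (ract Q q h) = src H h" if "z \<in> right_fibre_product H Q" for z
    proof -
      obtain q h where z: "z = (q, h)" by force
      then have gq: "(q, h) \<in> right_fibre_product H Q" "(?\<Psi> q, h) \<in> right_fibre_product H P" using that rfp by simp_all
      show ?thesis using \<Psi>(4)[OF rQpts(1)[OF gq(1)]] rpts[OF gq(2)] rQpts(2)[OF gq(1)] z by simp
    qed
    show "ract Q q (unt H (bmom Q q)) = q" if q: "q \<in> pts ?Q" for q
    proof -
      note p = \<Psi>[OF q]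
      have "bmom P (?\<Psi> q) \<in> pts (objs H)" using smooth_map_subset_pts(2)[OF momP] p(1) by blast
      then have "(?\<Psi> q, unt H (bmom P (?\<Psi> q))) \<in> right_fibre_product H P" using unitsH p by (simp add: right_fibre_product_def)
      from ra[OF this] show ?thesis using rPu[OF p(1)] p by simp
    qed
    show "ract Q (ract Q q h) h' = ract Q q (mlt H h h')" if z: "(q, h) \<in> right_fibre_product H Q \<and> (h, h') \<in> composable H" for h h' q
    proof -
      have q: "(?\<Psi> q, h) \<in> right_fibre_product H P" "q \<in> pts ?Q" using z by (auto simp: rfp)
      have "(ract Q q h, h') \<in> right_fibre_product H Q"
        using z rQpts[of q h] rpts[OF q(1)] by (simp add: rfp) (simp add: right_fibre_product_def composable_def)
      moreover have "(q, mlt H h h') \<in> right_fibre_product H Q"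
        using z q multH by (simp add: rfp) (simp add: right_fibre_product_def composable_def)
      ultimately show ?thesis using raQ rQpts(2)[OF conjunct1[OF z]] rPm[OF q(1) conjunct2[OF z]] by simp
    qed
  qed (rule srQ)
  have sm: "smooth_map ?Q (pts ?Q) (objs H) (bmom Q)"
    by (rule smooth_map_subset_cong[OF smooth_map_compose[OF mQ mP mH(2) s\<Psi> momP]]) (use \<Psi> in auto)
  have surjQ: "bproj Q ` pts ?Q = pts (objs G)"
  proof -
    have "pts ?Q = \<Phi> ` pts ?P" using bij by (simp add: bij_betw_def)
    then show ?thesis using pr(1) surjP by (simp add: image_image)
  qed
  let ?F = "{(p, p'). p \<in> pts ?P \<and> p' \<in> pts ?P \<and> bproj P p = bproj P p'}"
  let ?F' = "{(p, p'). p \<in> pts ?Q \<and> p' \<in> pts ?Q \<and> bproj Q p = bproj Q p'}"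
  let ?\<theta> = "\<lambda>(p, h). (p, ract P p h)" and ?\<theta>' = "\<lambda>(p, h). (p, ract Q p h)"
  let ?\<kappa> = "inv_into (right_fibre_product H P) ?\<theta>"
  have bP: "inj_on ?\<theta> (right_fibre_product H P)" "?\<theta> ` right_fibre_product H P = ?F" and s\<kappa>: "smooth_map (prod_manifold ?P ?P) ?F (prod_manifold ?P (arrs H)) ?\<kappa>"
    using dP by (simp_all add: diffeo_def bij_betw_def)
  \<comment> \<open>The second component of \<open>?\<kappa>\<close> is the division map of
    \<open>P\<close>; on the transported pair it also solves the division problem in
    \<open>Q\<close>.\<close>
  have \<kappa>: "(?\<Psi> q, snd (?\<kappa> (?\<Psi> q, ?\<Psi> q'))) \<in> right_fibre_product H P \<and> ract P (?\<Psi> q) (snd (?\<kappa> (?\<Psi> q, ?\<Psi> q'))) = ?\<Psi> q'"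
    if "(q, q') \<in> ?F'" for q q'
  proof -
    have "(?\<Psi> q, ?\<Psi> q') \<in> ?\<theta> ` right_fibre_product H P" using that \<Psi> unfolding bP(2) by simp
    then obtain p h where h: "(p, h) \<in> right_fibre_product H P" "?\<Psi> q = p" "?\<Psi> q' = ract P p h" by auto
    show ?thesis using inv_into_f_f[OF bP(1) h(1)] h by simp
  qed
  have \<theta>'inj: "inj_on ?\<theta>' (right_fibre_product H Q)"
  proof (rule inj_onI)
    fix z z' assume z: "z \<in> right_fibre_product H Q" "z' \<in> right_fibre_product H Q" "?\<theta>' z = ?\<theta>' z'"
    then obtain q h h' where h: "z = (q, h)" "z' = (q, h')" "(q, h) \<in> right_fibre_product H Q" "(q, h') \<in> right_fibre_product H Q" "ract Q q h = ract Q q h'"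
      by (cases z, cases z') auto
    then have "ract P (?\<Psi> q) h = ract P (?\<Psi> q) h'" using rQpts by metis
    then show "z = z'" using inj_onD[OF bP(1), of "(?\<Psi> q, h)" "(?\<Psi> q, h')"] h by (simp add: rfp)
  qed
  have \<theta>'\<kappa>: "(q, snd (?\<kappa> (?\<Psi> q, ?\<Psi> q'))) \<in> right_fibre_product H Q \<and> ?\<theta>' (q, snd (?\<kappa> (?\<Psi> q, ?\<Psi> q'))) = (q, q')" if "(q, q') \<in> ?F'" for q q'
    using \<kappa>[OF that] that \<Psi> raQ by (simp add: rfp)
  have \<theta>'im: "?\<theta>' ` right_fibre_product H Q = ?F'"
  proof
    show "?\<theta>' ` right_fibre_product H Q \<subseteq> ?F'"
    proof clarify
      fix q h assume h: "(q, h) \<in> right_fibre_product H Q"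
      then have "(?\<Psi> q, h) \<in> right_fibre_product H P" "q \<in> pts ?Q" by (auto simp: rfp)
      then show "q \<in> pts ?Q \<and> ract Q q h \<in> pts ?Q \<and> bproj Q q = bproj Q (ract Q q h)"
        using rQpts[OF h] inv(2)[of "?\<Psi> q" h] \<Psi>(3) by metis
    qed
    show "?F' \<subseteq> ?\<theta>' ` right_fibre_product H Q" using \<theta>'\<kappa> by (force intro: image_eqI[rotated])
  qed
  have subF: "?F' \<subseteq> pts ?Q \<times> pts ?Q" by auto
  have "smooth_map (prod_manifold ?Q ?Q) ?F' (prod_manifold ?P ?P) (\<lambda>z. (?\<Psi> (fst z), ?\<Psi> (snd z)))"
    by (rule smooth_map_Pair[OF mQQ mP mP smooth_map_compose[OF mQQ mQ mP smooth_map_fst_snd(1)[OF mQ mQ subF] s\<Psi>]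
        smooth_map_compose[OF mQQ mQ mP smooth_map_fst_snd(2)[OF mQ mQ subF] s\<Psi>]]) auto
  then have s1: "smooth_map (prod_manifold ?Q ?Q) ?F' (prod_manifold ?P (arrs H)) (\<lambda>z. ?\<kappa> (?\<Psi> (fst z), ?\<Psi> (snd z)))"
    by (rule smooth_map_compose[OF mQQ mPP mPH _ s\<kappa>]) (use \<Psi> in auto)
  then have "smooth_map (prod_manifold ?Q ?Q) ?F' (arrs H) (\<lambda>z. snd (?\<kappa> (?\<Psi> (fst z), ?\<Psi> (snd z))))"
    by (rule smooth_map_compose[OF mQQ mPH mH(1) _ smooth_map_fst_snd(2)[OF mP mH(1) subset_refl]]) (use smooth_map_subset_pts(2)[OF s1] in simp)
  from smooth_map_Pair[OF mQQ mQ mH(1) smooth_map_fst_snd(1)[OF mQ mQ subF] this]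
  have "smooth_map (prod_manifold ?Q ?Q) ?F' (prod_manifold ?Q (arrs H)) (inv_into (right_fibre_product H Q) ?\<theta>')"
  proof (rule smooth_map_subset_cong[OF _ subset_refl])
    fix z assume "z \<in> ?F'"
    then obtain q q' where z: "z = (q, q')" "(q, q') \<in> ?F'" by blast
    from inv_into_f_f[OF \<theta>'inj conjunct1[OF \<theta>'\<kappa>[OF z(2)]]] \<theta>'\<kappa>[OF z(2)] z(1)
    show "(fst z, snd (?\<kappa> (?\<Psi> (fst z), ?\<Psi> (snd z)))) = inv_into (right_fibre_product H Q) ?\<theta>' z" by simp
  qed
  moreover have "smooth_map (prod_manifold ?Q (arrs H)) (right_fibre_product H Q) (prod_manifold ?Q ?Q) ?\<theta>'"
    using smooth_map_Pair[OF mQH mQ mQ smooth_map_fst_snd(1)[OF mQ mH(1) subr] srQ] by (simp add: case_prod_unfold)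
  ultimately have dQ: "diffeo (prod_manifold ?Q (arrs H)) (right_fibre_product H Q) (prod_manifold ?Q ?Q) ?F' ?\<theta>'"
    using \<theta>'inj \<theta>'im by (simp add: diffeo_def bij_betw_def)
  have invQ: "bmom Q (lact Q g q) = bmom Q q" if "(g, q) \<in> left_fibre_product G Q" for g q
    using that inv(1)[of g "?\<Psi> q"] \<Psi>(4) lQpts[OF that] by (metis lfp)
  have invQ': "bproj Q (ract Q q h) = bproj Q q" if "(q, h) \<in> right_fibre_product H Q" for q h
    using that inv(2)[of "?\<Psi> q" h] \<Psi>(3) rQpts[OF that] by (metis rfp)
  have comQ: "lact Q g (ract Q q h) = ract Q (lact Q g q) h" if z: "(g, q) \<in> left_fibre_product G Q" "(q, h) \<in> right_fibre_product H Q" for g q h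
  proof -
    have 1: "(g, ?\<Psi> q) \<in> left_fibre_product G P" "(?\<Psi> q, h) \<in> right_fibre_product H P" using z by (simp_all add: lfp rfp)
    have "(g, ract Q q h) \<in> left_fibre_product G Q" "(lact Q g q, h) \<in> right_fibre_product H Q"
      using z rQpts[OF z(2)] lQpts[OF z(1)] invQ[OF z(1)] invQ'[OF z(2)] by (auto simp: left_fibre_product_def right_fibre_product_def)
    from laQ[OF this(1)] raQ[OF this(2)] show ?thesis using lQpts(2)[OF z(1)] rQpts(2)[OF z(2)] com[OF 1] by simp
  qed
  have "principal_bundle G H Q"
    unfolding principal_bundle_def using mQ sQ surjQ sm lQ rQ invQ invQ' comQ dQ by blast
  then show ?thesis unfolding principal_bundle_iso_def using P \<Phi> pr la ra by blast
qed

section \<open>Etale groupoids\<close>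

text \<open>The pulled-back support is compact, hence closed in the Hausdorff manifold
  \<open>M\<close>, so extension by 0 outside \<open>V\<close> stays smooth.\<close>

lemma Cc0_pullback:
  fixes u :: "'b \<Rightarrow> 'k::real_normed_field"
  assumes M: "is_manifold M" "Hausdorff_space (mtop M)" and N: "is_manifold N"
    and V: "openin (mtop M) V" and \<tau>: "diffeo M V N W \<tau>" and u: "u \<in> Cc0 N W"
  shows "(\<lambda>x. if x \<in> V then u (\<tau> x) else 0) \<in> Cc0 M V"
proof -
  obtain K where K: "compactin (mtop N) K" "K \<subseteq> W" "\<forall>x. x \<notin> K \<longrightarrow> u x = 0" and su: "smooth_function N (pts N) u"
    using u unfolding Cc0_def by blast
  have s\<tau>: "smooth_map M V N \<tau>" and si: "smooth_map N W M (inv_into V \<tau>)" and b: "inj_on \<tau> V" "\<tau> ` V = W"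
    using \<tau> by (auto simp: diffeo_def bij_betw_def)
  define K' where "K' = inv_into V \<tau> ` K"
  have "compactin (subtopology (mtop N) W) K" using K by (simp add: compactin_subtopology)
  then have cK: "compactin (mtop M) K'" unfolding K'_def by (rule image_compactin[OF _ smooth_map_continuous[OF N M(1) si]])
  have KV: "K' \<subseteq> V" unfolding K'_def using K(2) b inv_into_into[of _ \<tau> V] by (auto simp: subset_iff)
  have z: "u (\<tau> x) = 0" if "x \<in> V" "x \<notin> K'" for x
    using that K(3) inv_into_f_f[OF b(1) that(1)] by (metis K'_def imageI)
  have "smooth_function M (pts M) (\<lambda>x. if x \<in> V then u (\<tau> x) else 0)"
  proof (rule smooth_function_local[OF M(1) subset_refl])
    fix x assume x: "x \<in> pts M"
    show "\<exists>Y. openin (mtop M) Y \<and> x \<in> Y \<and> smooth_function M (pts M \<inter> Y) (\<lambda>x. if x \<in> V then u (\<tau> x) else 0)"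
    proof (cases "x \<in> K'")
      case True
      have "smooth_function M V (\<lambda>x. u (\<tau> x))"
        by (rule smooth_function_compose[OF N s\<tau> su smooth_map_subset_pts(2)[OF s\<tau>]])
      then have "smooth_function M (pts M \<inter> V) (\<lambda>x. if x \<in> V then u (\<tau> x) else 0)"
        by (rule smooth_function_subset_cong) auto
      then show ?thesis using True KV V by blast
    next
      case False
      have o: "openin (mtop M) (pts M - K')" using compactin_imp_closedin[OF M(2) cK] by blast
      have "smooth_function M (pts M \<inter> (pts M - K')) (\<lambda>x. if x \<in> V then u (\<tau> x) else 0)"
        by (rule smooth_function_subset_cong[OF smooth_function_const[OF M(1) o, of 0]]) (use z in auto)
      then show ?thesis using False x o by blast
    qed
  qed
  then show ?thesis unfolding Cc0_def using cK KV z by auto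
qed

context etale_space
begin

lemma elem_fun_cong: "el U \<Longrightarrow> (\<And>p. p \<in> U \<Longrightarrow> f (\<pi> p) = g (\<pi> p)) \<Longrightarrow> elem U f = elem U g"
  unfolding elem_fun_def ext_zero_def by (rule ext) (simp add: germ_eqI[OF el_open, of U _ "f \<circ> \<pi>" "g \<circ> \<pi>"])

lemma elem_fun_zero:
  assumes "el U" "q \<in> U" "\<pi> p = \<pi> q" "p \<noteq> q"
  shows "elem U f p = germ XP p (\<lambda>_. 0)"
  using assms el_injD[OF assms(1), of p q] by (auto simp: elem_fun_def ext_zero_def)

lemma bg_elem:
  assumes "el U" "f \<in> Cc0 M (\<pi> ` U)" "p \<in> U"
  shows "bg (elem U f) p (\<pi> p) = f (\<pi> p)"
proof -
  have p: "p \<in> pts P" using assms(3) el_pts[OF assms(1)] by blast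
  show ?thesis using germ_eq_value[OF germ_bg_elem[OF assms(1,2) p] pi_pts[OF p]] assms(3) by simp
qed

lemma bg_delta: "delta c p \<Longrightarrow> bg c p (\<pi> p) = 1"
  using germ_eq_value[OF iffD2[OF germ_bg_const_iff, of c p 1] pi_pts] by (simp add: delta_def)

lemma delta_other: "delta c p \<Longrightarrow> q \<in> pts P \<Longrightarrow> \<pi> q = \<pi> p \<Longrightarrow> q \<noteq> p \<Longrightarrow> c q = germ XP q (\<lambda>_. 0)"
  by (simp add: delta_def)

text \<open>As \<open>u\<close> is a unit for \<open>f\<close>, the first factor is the scalar
  \<open>f\<close> times the second, and this scalar moves across the tensor. The condition on the
  antipode in \<open>S_weakly_grouplike\<close> has its factors in the opposite order.\<close>

lemma tensor_elem_swap:
  fixes f u :: "'x \<Rightarrow> 'k::real_normed_field"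
  assumes U: "el U" and f: "f \<in> Cc0 M (\<pi> ` U)" and u: "u \<in> Cc0 M (\<pi> ` U)" "\<And>y. u y * f y = f y"
  shows "tensor (coalg) (elem U f) (elem U u) = tensor (coalg) (elem U u) (elem U f)"
proof -
  have "(\<lambda>y. f y * u y) = f" by (rule ext) (metis u(2) mult.commute)
  then have "vsmul (coalg) f (elem U u) = elem U f" by (simp add: vsmul_elem)
  moreover have "frag_of (vsmul (coalg) f (elem U u), elem U u) -
      frag_of (elem U u, vsmul (coalg) f (elem U u)) \<in> tensor_null (coalg)"
    by (rule tensor_null.balanced) (use elem_fun_Cc[OF U u(1)] Cc0_pts[OF f] in simp_all)
  ultimately show ?thesis by (simp add: tensor_def tensor_class_eq_iff)
qed

text \<open>The point \<open>y\<close> may lie outside the carrier: it will be the value of a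
  diffeomorphism at an argument not yet known to lie in its domain.\<close>

lemma Cc0_separate:
  assumes "x \<in> pts M" "W = pts M \<or> openin XM W \<and> x \<in> W" "y \<noteq> x"
  obtains u :: "'x \<Rightarrow> 'k::real_normed_field" where "u \<in> Cc0 M W" "u x = 1" "u y = 0"
proof -
  have "openin XM (W - {y})"
  proof (cases "y \<in> pts M")
    case True
    then have "openin XM (pts M - {y})" by (intro compact_openin_diff) simp
    moreover have "W - {y} = W \<inter> (pts M - {y})" using assms(2) openin_subset by blast
    ultimately show ?thesis using assms(2) by auto
  next
    case False
    then have "W - {y} = W" using assms(2) openin_subset by blast
    then show ?thesis using assms(2) by auto
  qed
  then obtain u :: "'x \<Rightarrow> 'k" and N where u: "u \<in> Cc0 M (W - {y})" "x \<in> N" "\<forall>z\<in>N. u z = 1"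
    using Cc0_local_unit[of "W - {y}" x] assms by blast
  show thesis by (rule that[of u]) (use u Cc0_mono[OF u(1), of W] Cc0_outside[OF u(1), of y] in auto)
qed

end

locale etale_gpd =
  fixes G :: "('x, 'e::real_inner, 'g, 'd::real_inner) groupoid"
  assumes etale: "etale_groupoid G"
begin

lemma gpd: "is_groupoid G" "is_manifold (objs G)" "Hausdorff_space (mtop (objs G))" "is_manifold (arrs G)"
  "smooth_map (arrs G) (pts (arrs G)) (arrs G) (ivs G)" "smooth_map (objs G) (pts (objs G)) (arrs G) (unt G)"
  "smooth_map (prod_manifold (arrs G) (arrs G)) (composable G) (arrs G) (\<lambda>(g', g). mlt G g' g)"
  using etale by (simp_all add: etale_groupoid_def lie_groupoid_def)

sublocale T: etale_space "objs G" "arrs G" "tgt G"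
  using etale by unfold_locales (simp_all add: etale_groupoid_def lie_groupoid_def)

sublocale S: etale_space "objs G" "arrs G" "src G"
  using etale by unfold_locales (simp_all add: etale_groupoid_def lie_groupoid_def)

lemma unt [simp]: "x \<in> pts (objs G) \<Longrightarrow> unt G x \<in> pts (arrs G)" "x \<in> pts (objs G) \<Longrightarrow> src G (unt G x) = x"
  "x \<in> pts (objs G) \<Longrightarrow> tgt G (unt G x) = x"
  using gpd(1) by (simp_all add: is_groupoid_def)

lemma ivs [simp]: "g \<in> pts (arrs G) \<Longrightarrow> ivs G g \<in> pts (arrs G)" "g \<in> pts (arrs G) \<Longrightarrow> src G (ivs G g) = tgt G g"
  "g \<in> pts (arrs G) \<Longrightarrow> tgt G (ivs G g) = src G g" "g \<in> pts (arrs G) \<Longrightarrow> mlt G g (ivs G g) = unt G (tgt G g)"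
  "g \<in> pts (arrs G) \<Longrightarrow> mlt G (ivs G g) g = unt G (src G g)"
  using gpd(1) by (simp_all add: is_groupoid_def)

lemma mlt_unt [simp]: "g \<in> pts (arrs G) \<Longrightarrow> mlt G g (unt G (src G g)) = g" "g \<in> pts (arrs G) \<Longrightarrow> mlt G (unt G (tgt G g)) g = g"
  using gpd(1) by (simp_all add: is_groupoid_def)

lemma mlt: "(g', g) \<in> composable G \<Longrightarrow> mlt G g' g \<in> pts (arrs G) \<and> src G (mlt G g' g) = src G g \<and> tgt G (mlt G g' g) = tgt G g'"
  using gpd(1) unfolding is_groupoid_def by blast

lemma mlt_assoc: "(g'', g') \<in> composable G \<Longrightarrow> (g', g) \<in> composable G \<Longrightarrow> mlt G g'' (mlt G g' g) = mlt G (mlt G g'' g') g"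
  using gpd(1) unfolding is_groupoid_def by blast

lemma ivs_ivs [simp]:
  assumes g: "g \<in> pts (arrs G)"
  shows "ivs G (ivs G g) = g"
proof -
  have "g = mlt G g (mlt G (ivs G g) (ivs G (ivs G g)))" using g by simp
  also have "\<dots> = mlt G (mlt G g (ivs G g)) (ivs G (ivs G g))" by (rule mlt_assoc) (use g in \<open>simp_all add: composable_def\<close>)
  also have "\<dots> = ivs G (ivs G g)" using g mlt_unt(2)[of "ivs G (ivs G g)"] by simp
  finally show ?thesis by simp
qed

lemma bisection_el: "bisection G U \<Longrightarrow> T.el U" "bisection G U \<Longrightarrow> S.el U"
  by (simp_all add: bisection_def elementary_def)

lemma bisection_exists:
  assumes "openin (mtop (arrs G)) W" "p \<in> W"
  shows "\<exists>U. bisection G U \<and> T.el U \<and> p \<in> U \<and> U \<subseteq> W"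
proof -
  obtain U where U: "T.el U" "p \<in> U" "U \<subseteq> W" using T.el_exists[OF assms] by blast
  obtain U' where "S.el U'" "p \<in> U'" "U' \<subseteq> U" using S.el_exists[OF T.el_open[OF U(1)] U(2)] by blast
  moreover from this have "T.el U'" using T.el_subset[OF U(1)] S.el_open by blast
  ultimately show ?thesis using U by (intro exI[of _ U']) (auto simp: bisection_def elementary_def)
qed

lemma bisection_empty: "bisection G {}" by (simp add: bisection_def)

lemma bisection_map: "bisection G U \<Longrightarrow> h \<in> U \<Longrightarrow> bisection_map G U (src G h) = tgt G h"
  using S.sectn[OF bisection_el(2)] by (simp add: bisection_map_def S.sectn_def)

lemma bisection_inv: "bisection G U \<Longrightarrow> h \<in> U \<Longrightarrow> inv_into (src G ` U) (bisection_map G U) (tgt G h) = src G h"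
  by (rule inv_into_f_eq) (auto simp: bisection_map inj_on_def dest: T.el_injD[OF bisection_el(1)])

lemma bisection_diffeo:
  assumes U: "bisection G U"
  shows "diffeo (objs G) (src G ` U) (objs G) (tgt G ` U) (bisection_map G U)"
proof -
  note e = bisection_el[OF U]
  have "bij_betw (bisection_map G U) (src G ` U) (tgt G ` U)"
    using bisection_map[OF U] T.el_injD[OF e(1)] by (auto simp: bij_betw_def inj_on_def image_image)
  moreover have "smooth_map (objs G) (src G ` U) (objs G) (bisection_map G U)"
    unfolding bisection_map_def comp_def S.sectn_def[symmetric]
    by (rule smooth_map_compose[OF gpd(2,4,2) S.smooth_sectn[OF e(2)] T.smooth_pi]) (use S.sectn_in(1) S.el_pts[OF e(2)] in blast)
  moreover have "smooth_map (objs G) (tgt G ` U) (objs G) (\<lambda>y. src G (T.sectn U y))"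
    by (rule smooth_map_compose[OF gpd(2,4,2) T.smooth_sectn[OF e(1)] S.smooth_pi]) (use T.sectn_in(1) T.el_pts[OF e(1)] in blast)
  then have "smooth_map (objs G) (tgt G ` U) (objs G) (inv_into (src G ` U) (bisection_map G U))"
    by (rule smooth_map_subset_cong[OF _ subset_refl]) (auto simp: bisection_inv[OF U] T.sectn[OF e(1)])
  ultimately show ?thesis by (simp add: diffeo_def)
qed

section \<open>The antipode on elementary functions and arrows as classes\<close>

definition flip :: "'g set \<Rightarrow> ('x \<Rightarrow> 'k::real_normed_field) \<Rightarrow> 'x \<Rightarrow> 'k" where
  "flip U f x = (if x \<in> src G ` U then f (bisection_map G U x) else 0)"

lemma flip_src: "bisection G U \<Longrightarrow> h \<in> U \<Longrightarrow> flip U f (src G h) = f (tgt G h)"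
  by (simp add: flip_def bisection_map)

lemma flip_Cc0: "bisection G U \<Longrightarrow> f \<in> Cc0 (objs G) (tgt G ` U) \<Longrightarrow> flip U f \<in> Cc0 (objs G) (src G ` U)"
  using Cc0_pullback[OF gpd(2,3,2) S.el_image_open[OF bisection_el(2)] bisection_diffeo] by (simp add: flip_def[abs_def])

lemma ivs_image: "U \<subseteq> pts (arrs G) \<Longrightarrow> ivs G ` U = {g \<in> pts (arrs G). ivs G g \<in> U}"
  by (auto simp: image_iff subset_iff) (metis ivs_ivs)

lemma tgt_ivs_image: "U \<subseteq> pts (arrs G) \<Longrightarrow> tgt G ` ivs G ` U = src G ` U"
  by (force simp: image_image)

lemma ivs_bisection:
  assumes U: "bisection G U"
  shows "bisection G (ivs G ` U)"
proof -
  have Up: "U \<subseteq> pts (arrs G)" using T.el_pts[OF bisection_el(1)[OF U]] .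
  have "openin (mtop (arrs G)) (ivs G ` U)"
    unfolding ivs_image[OF Up] using openin_continuous_map_preimage[OF smooth_map_continuous[OF gpd(4,4,5)]] U
    by (simp add: bisection_def)
  moreover have "inj_on (src G \<circ> ivs G) U" "inj_on (tgt G \<circ> ivs G) U" using U Up by (auto simp: bisection_def inj_on_def subset_iff)
  ultimately show ?thesis by (simp add: bisection_def inj_on_imageI)
qed

lemma antipode_elem:
  fixes f :: "'x \<Rightarrow> 'k::real_normed_field"
  assumes U: "bisection G U"
  shows "antipode G (T.elem U f) = T.elem (ivs G ` U) (flip U f)"
proof
  fix g
  let ?X = "mtop (arrs G)"
  have Up: "U \<subseteq> pts (arrs G)" using T.el_pts[OF bisection_el(1)[OF U]] .
  show "antipode G (T.elem U f) g = T.elem (ivs G ` U) (flip U f) g"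
  proof (cases "g \<in> pts (arrs G)")
    case False
    then show ?thesis by (simp add: antipode_def elem_fun_def ext_zero_def germ_outside)
  next
    case g: True
    define k0 where "k0 = (if ivs G g \<in> U then f \<circ> tgt G else (\<lambda>_. 0))"
    \<comment> \<open>Inversion is continuous, so all representatives at the inverse of
      \<open>g\<close> induce the same germ at \<open>g\<close>; this collapses the union in
      \<open>antipode\<close>.\<close>
    have "germ ?X g (k \<circ> ivs G) = germ ?X g (k0 \<circ> ivs G)" if "k \<in> germ ?X (ivs G g) k0" for k
    proof -
      obtain V where V: "openin ?X V" "ivs G g \<in> V" "\<forall>q\<in>V. k q = k0 q" using \<open>k \<in> _\<close> by (auto simp: germ_def)
      have "openin ?X {q \<in> pts (arrs G). ivs G q \<in> V}"
        using openin_continuous_map_preimage[OF smooth_map_continuous[OF gpd(4,4,5)] V(1)] by simp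
      then show ?thesis by (rule germ_eqI) (use g V in auto)
    qed
    then have "(\<Union>k\<in>germ ?X (ivs G g) k0. germ ?X g (k \<circ> ivs G)) = germ ?X g (k0 \<circ> ivs G)"
      by (intro UN_constant_eq[of k0] germ_self ivs g) simp
    then have "antipode G (T.elem U f) g = germ ?X g (k0 \<circ> ivs G)"
      by (simp add: antipode_def elem_fun_def ext_zero_def k0_def)
    also have "\<dots> = T.elem (ivs G ` U) (flip U f) g"
    proof (cases "ivs G g \<in> U")
      case True
      have "openin ?X (ivs G ` U)" using ivs_bisection[OF U] by (simp add: bisection_def)
      moreover have gU: "g \<in> ivs G ` U" using True g by (simp add: ivs_image[OF Up])
      ultimately have "germ ?X g (k0 \<circ> ivs G) = germ ?X g (flip U f \<circ> tgt G)"
      proof (rule germ_eqI)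
        fix q assume "q \<in> ivs G ` U"
        then obtain h where h: "q = ivs G h" "h \<in> U" by blast
        then have "h \<in> pts (arrs G)" using Up by blast
        then show "(k0 \<circ> ivs G) q = (flip U f \<circ> tgt G) q" using h True flip_src[OF U h(2), of f] by (simp add: k0_def)
      qed
      then show ?thesis using gU by (simp add: elem_fun_def ext_zero_def)
    next
      case False
      then have "g \<notin> ivs G ` U" by (simp add: ivs_image[OF Up])
      then show ?thesis using False by (simp add: k0_def elem_fun_def ext_zero_def comp_def)
    qed
    finally show ?thesis .
  qed
qed

text \<open>A local unit \<open>u\<close> of \<open>f\<close> on the target side becomes a local
  unit \<open>flip U u\<close> of \<open>flip U f\<close> on the source side. The antipode thus
  respects the coproduct up to the order of the factors, which \<open>tensor_elem_swap\<close>
  repairs.\<close>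

lemma elem_S_weakly_grouplike:
  fixes f :: "'x \<Rightarrow> 'k::real_normed_field"
  assumes U: "bisection G U" and f: "f \<in> Cc0 (objs G) (tgt G ` U)"
  shows "T.elem U f \<in> S_weakly_grouplike G"
proof -
  note e = bisection_el(1)[OF U] and e' = bisection_el(1)[OF ivs_bisection[OF U]]
  obtain u :: "'x \<Rightarrow> 'k" where u: "u \<in> Cc0 (objs G) (tgt G ` U)" "\<forall>y. u y * f y = f y"
    using T.Cc0_unit_of[OF f f T.el_image_open[OF e]] by blast
  have im: "tgt G ` ivs G ` U = src G ` U" by (rule tgt_ivs_image[OF T.el_pts[OF e]])
  have ff: "flip U f \<in> Cc0 (objs G) (tgt G ` ivs G ` U)" "flip U u \<in> Cc0 (objs G) (tgt G ` ivs G ` U)"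
    unfolding im by (rule flip_Cc0[OF U f], rule flip_Cc0[OF U u(1)])
  have uf: "flip U u y * flip U f y = flip U f y" for y using u(2) by (simp add: flip_def)
  let ?C = "groupoid_coalgebra G :: ('x \<Rightarrow> 'k, ('g, 'k) germ_section) coalgebra"
  have "comul ?C (T.elem U f) = tensor ?C (T.elem U f) (T.elem U u)"
    using T.comult_elem[OF e f u(1)] u(2) by simp
  moreover have "comul ?C (antipode G (T.elem U f)) =
      tensor ?C (antipode G (T.elem U u)) (antipode G (T.elem U f))"
    unfolding antipode_elem[OF U] using T.comult_elem[OF e' ff uf] T.tensor_elem_swap[OF e' ff uf] by simp
  ultimately show ?thesis
    unfolding S_weakly_grouplike_def using T.elem_fun_Cc[OF e f] T.elem_fun_Cc[OF e u(1)] by blast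
qed

lemma S_weakly_grouplike: "a \<in> S_weakly_grouplike G \<Longrightarrow> a \<in> weakly_grouplike (groupoid_coalgebra G)"
  by (auto simp: S_weakly_grouplike_def weakly_grouplike_def)

lemma arrow_exists:
  assumes g: "g \<in> pts (arrs G)"
  obtains U N and f :: "'x \<Rightarrow> 'k::real_normed_field" where "bisection G U" "g \<in> U" "f \<in> Cc0 (objs G) (tgt G ` U)"
    "openin (mtop (objs G)) N" "tgt G g \<in> N" "N \<subseteq> tgt G ` U" "\<And>y. y \<in> N \<Longrightarrow> f y = 1"
    "T.delta (T.elem U f) g" "T.elem U f \<in> S_weakly_grouplike G"
proof -
  obtain U0 where U0: "bisection G U0" "g \<in> U0" using bisection_exists[OF openin_topspace g] by blast
  obtain U and f :: "'x \<Rightarrow> 'k" and N where U: "T.el U" "g \<in> U" "U \<subseteq> U0" "f \<in> Cc0 (objs G) (tgt G ` U)"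
    "openin (mtop (objs G)) N" "tgt G g \<in> N" "N \<subseteq> tgt G ` U" "\<And>y. y \<in> N \<Longrightarrow> f y = 1"
    using T.delta_exists[OF T.el_open[OF bisection_el(1)[OF U0(1)]] U0(2)] by metis
  have b: "bisection G U" using U0(1) T.el_open[OF U(1)] U(3) by (auto simp: bisection_def intro: inj_on_subset)
  show thesis
    by (rule that[OF b U(2,4-8) T.elem_delta[OF U(1,4,2,5,6,8)] elem_S_weakly_grouplike[OF b U(4)]])
qed

lemma natural_iso:
  assumes g: "g \<in> pts (arrs G)"
  shows "natural_iso G g = (T.Phi g :: ('x, 'g, 'k::real_normed_field) spectral_point)"
proof -
  have *: "T.Phi g = arrow_class G (tgt G g) u" if "u \<in> S_weakly_grouplike G" "u g = germ (mtop (arrs G)) g (\<lambda>_. 1)" for u :: "('g, 'k) germ_section"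
    by (rule T.Phi_eq[OF T.weakly_grouplike_delta[OF S_weakly_grouplike[OF that(1)] g that(2)]])
  obtain U N and f :: "'x \<Rightarrow> 'k" where a: "T.delta (T.elem U f) g" "T.elem U f \<in> S_weakly_grouplike G"
    by (rule arrow_exists[OF g])
  then have e: "T.elem U f g = germ (mtop (arrs G)) g (\<lambda>_. 1)" by (simp add: T.delta_def)
  show ?thesis unfolding natural_iso_def
  proof (rule the_equality)
    show "\<exists>u\<in>S_weakly_grouplike G. u g = germ (mtop (arrs G)) g (\<lambda>_. 1) \<and> T.Phi g = arrow_class G (tgt G g) (u :: ('g, 'k) germ_section)"
      by (rule bexI[OF _ a(2)]) (use e *[OF a(2) e] in simp)
    fix \<alpha> assume "\<exists>u\<in>S_weakly_grouplike G. u g = germ (mtop (arrs G)) g (\<lambda>_. 1) \<and> \<alpha> = arrow_class G (tgt G g) (u :: ('g, 'k) germ_section)"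
    then obtain u :: "('g, 'k) germ_section" where "u \<in> S_weakly_grouplike G" "u g = germ (mtop (arrs G)) g (\<lambda>_. 1)" "\<alpha> = arrow_class G (tgt G g) u" by blast
    then show "\<alpha> = T.Phi g" using * by simp
  qed
qed

lemma represents_arrow_delta:
  assumes g: "g \<in> pts (arrs G)" and a: "represents_arrow G a (T.Phi g :: ('x, 'g, 'k::real_normed_field) spectral_point)"
  shows "T.delta a g"
  using a T.Phi_eq_iff[OF _ g, of a] by (simp add: represents_arrow_def S_weakly_grouplike_def)

lemma represents_arrowI:
  fixes a :: "('g, 'k::real_normed_field) germ_section"
  assumes a: "T.delta a g" "a \<in> S_weakly_grouplike G"
  shows "represents_arrow G a (T.Phi g)"
proof -
  have "tgt G g \<in> pts (objs G)" using T.pi_pts[OF T.delta_D(2)[OF a(1)]] .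
  from germ_eqD[OF T.delta_counit[OF a(1)] this] obtain V where "openin (mtop (objs G)) V" "tgt G g \<in> V" "\<And>y. y \<in> V \<Longrightarrow> Cc_counit (objs G) (arrs G) (tgt G) a y = 1"
    by blast
  then have "normalised_near (groupoid_coalgebra G) (mtop (objs G)) (tgt G g) a"
    unfolding normalised_near_def normalised_on_def by auto
  then show ?thesis using a(2) T.Phi_eq[OF a(1)] by (simp add: represents_arrow_def)
qed

end

lemma smooth_map_ident:
  assumes M: "is_manifold M" and A: "A \<subseteq> pts M"
  shows "smooth_map M A M (\<lambda>x. x)"
proof (rule smooth_mapI[OF M A])
  fix p assume "p \<in> A"
  then obtain U \<phi> where U: "(U, \<phi>) \<in> atlas M" "p \<in> U" using chart_exists[OF M] A by blast
  have "smooth_function M (A \<inter> U) \<phi>" by (rule smooth_function_subset_cong[OF smooth_function_of_chart[OF M U(1)]]) auto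
  then show "\<exists>W V \<psi>. openin (mtop M) W \<and> p \<in> W \<and> (V, \<psi>) \<in> atlas M \<and> (\<lambda>x. x) ` (A \<inter> W) \<subseteq> V \<and> smooth_function M (A \<inter> W) (\<lambda>x. \<psi> x)"
    using U chart_openin[OF M U(1)] by (intro exI[of _ U] exI[of _ \<phi>]) auto
qed (use A in simp)

text \<open>Only a left action is assumed, so that the convolution product is covered as well, with
  the translation bundle as \<open>P\<close>.\<close>

locale left_space = etale_gpd G + Z: etale_space "objs G" "bspace P" "bproj P"
  for G :: "('x, 'e::real_inner, 'g, 'd::real_inner) groupoid" and P :: "('p, 'q::real_inner, 'x, 'g, 'y, 'h) bibundle" +
  assumes left: "left_action G P"
begin

lemma lact: "g \<in> pts (arrs G) \<Longrightarrow> p \<in> pts (bspace P) \<Longrightarrow> src G g = bproj P p \<Longrightarrow> lact P g p \<in> pts (bspace P) \<and> bproj P (lact P g p) = tgt G g"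
  using left smooth_map_subset_pts(2) unfolding left_action_def left_fibre_product_def by fastforce

lemma smooth_lact: "smooth_map (prod_manifold (arrs G) (bspace P)) (left_fibre_product G P) (bspace P) (\<lambda>(g, p). lact P g p)"
  using left by (simp add: left_action_def)

lemma lact_ivs:
  assumes g: "g \<in> pts (arrs G)" and p: "p \<in> pts (bspace P)" "src G g = bproj P p"
  shows "lact P (ivs G g) (lact P g p) = p"
proof -
  have "(ivs G g, g) \<in> composable G" "(g, p) \<in> left_fibre_product G P" using assms by (simp_all add: composable_def left_fibre_product_def)
  then have "lact P (ivs G g) (lact P g p) = lact P (mlt G (ivs G g) g) p" using left unfolding left_action_def by blast
  then show ?thesis using left p g by (simp add: left_action_def)
qed

text \<open>A point over the image of \<open>U\<close> lies in the product set exactly if the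
  inverse of the arrow of \<open>U\<close> ending at its base point carries it into
  \<open>V\<close>; so the set is a preimage of \<open>V\<close> under a continuous map.\<close>

lemma left_open:
  assumes U: "T.el U" and V: "Z.el V"
  shows "openin (mtop (bspace P)) {lact P g p |g p. g \<in> U \<and> p \<in> V \<and> src G g = bproj P p}"
proof -
  let ?A = "{q \<in> pts (bspace P). bproj P q \<in> tgt G ` U}"
  let ?s = "\<lambda>q. T.sectn U (bproj P q)"
  have oA: "openin (mtop (bspace P)) ?A" by (rule Z.open_preimage[OF T.el_image_open[OF U]])
  have s: "?s q \<in> U" "tgt G (?s q) = bproj P q" "?s q \<in> pts (arrs G)" if "q \<in> ?A" for q
    using that T.sectn_in[of "bproj P q" U] T.el_pts[OF U] by auto
  have "smooth_map (bspace P) ?A (arrs G) ?s"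
    by (rule smooth_map_compose[OF Z.P gpd(2,4) smooth_map_subset_cong[OF Z.smooth_pi] T.smooth_sectn[OF U]]) auto
  from smooth_map_compose[OF Z.P gpd(4,4) this gpd(5)]
  have "smooth_map (bspace P) ?A (arrs G) (\<lambda>q. ivs G (?s q))" using s by blast
  moreover have "smooth_map (bspace P) ?A (bspace P) (\<lambda>q. q)"
    by (rule smooth_map_ident[OF Z.P]) auto
  ultimately have "smooth_map (bspace P) ?A (prod_manifold (arrs G) (bspace P)) (\<lambda>q. (ivs G (?s q), q))"
    by (rule smooth_map_Pair[OF Z.P gpd(4) Z.P])
  from smooth_map_compose[OF Z.P prod_manifold[OF gpd(4) Z.P] Z.P this smooth_lact]
  have "(\<lambda>q. (ivs G (?s q), q)) ` ?A \<subseteq> left_fibre_product G P \<Longrightarrow> smooth_map (bspace P) ?A (bspace P) (\<lambda>q. lact P (ivs G (?s q)) q)" by simp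
  moreover have "(\<lambda>q. (ivs G (?s q), q)) ` ?A \<subseteq> left_fibre_product G P"
  proof (rule image_subsetI)
    fix q assume q: "q \<in> ?A"
    show "(ivs G (?s q), q) \<in> left_fibre_product G P" using s[OF q] q by (simp add: left_fibre_product_def)
  qed
  ultimately have "smooth_map (bspace P) ?A (bspace P) (\<lambda>q. lact P (ivs G (?s q)) q)" by blast
  from openin_continuous_map_preimage[OF smooth_map_continuous[OF Z.P Z.P this] Z.el_open[OF V]]
  have "openin (subtopology (mtop (bspace P)) ?A) {q \<in> ?A. lact P (ivs G (?s q)) q \<in> V}" using openin_subset[OF oA] by (simp add: inf_absorb2)
  then have "openin (mtop (bspace P)) {q \<in> ?A. lact P (ivs G (?s q)) q \<in> V}" using oA openin_trans_full by blast
  moreover have "{q \<in> ?A. lact P (ivs G (?s q)) q \<in> V} = {lact P g p |g p. g \<in> U \<and> p \<in> V \<and> src G g = bproj P p}"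
  proof (intro set_eqI iffI)
    fix q assume "q \<in> {q \<in> ?A. lact P (ivs G (?s q)) q \<in> V}"
    then have q: "q \<in> ?A" "lact P (ivs G (?s q)) q \<in> V" by auto
    note sq = s[OF q(1)]
    have "lact P (?s q) (lact P (ivs G (?s q)) q) = q" using lact_ivs[of "ivs G (?s q)" q] sq q(1) by simp
    moreover have "bproj P (lact P (ivs G (?s q)) q) = src G (?s q)" using lact[of "ivs G (?s q)" q] sq q(1) by simp
    ultimately show "q \<in> {lact P g p |g p. g \<in> U \<and> p \<in> V \<and> src G g = bproj P p}" using sq(1) q(2)
      by (intro CollectI exI[of _ "?s q"] exI[of _ "lact P (ivs G (?s q)) q"]) simp
  next
    fix q assume "q \<in> {lact P g p |g p. g \<in> U \<and> p \<in> V \<and> src G g = bproj P p}"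
    then obtain g p where gp: "q = lact P g p" "g \<in> U" "p \<in> V" "src G g = bproj P p" by blast
    have pt: "g \<in> pts (arrs G)" "p \<in> pts (bspace P)" using gp T.el_pts[OF U] Z.el_pts[OF V] by auto
    have "?s q = g" using lact[OF pt gp(4)] gp T.sectn[OF U gp(2)] by simp
    then show "q \<in> {q \<in> ?A. lact P (ivs G (?s q)) q \<in> V}" using lact[OF pt gp(4)] lact_ivs[OF pt gp(4)] gp by simp
  qed
  ultimately show ?thesis by simp
qed

lemma left_composition: "composition (objs G) (arrs G) (tgt G) (objs G) (bspace P) (bproj P) (bspace P) (bproj P) (src G) (lact P)"
proof unfold_locales
  show "smooth_map (arrs G) (pts (arrs G)) (objs G) (src G)" by (rule S.smooth_pi)
  show "lact P a b \<in> pts (bspace P) \<and> bproj P (lact P a b) = tgt G a" if "a \<in> pts (arrs G)" "b \<in> pts (bspace P)" "src G a = bproj P b" for a b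
    using lact that by blast
  show "b = b'" if "a \<in> pts (arrs G)" "b \<in> pts (bspace P)" "b' \<in> pts (bspace P)" "src G a = bproj P b" "src G a = bproj P b'" "lact P a b = lact P a b'" for a b b'
    using trans[OF sym[OF lact_ivs[OF that(1,2,4)]] trans[OF arg_cong[OF that(6), of "lact P (ivs G a)"] lact_ivs[OF that(1,3,5)]]] .
qed (rule left_open)

sublocale L: composition "objs G" "arrs G" "tgt G" "objs G" "bspace P" "bproj P" "bspace P" "bproj P" "src G" "lact P"
  by (rule left_composition)

text \<open>\<open>L.act\<close> shows that the conditions behind \<open>SOME\<close> can be met,
  and \<open>L.act_unique\<close> that they leave no choice on the function spaces.\<close>

lemma left_module_act:
  fixes c :: "('g, 'k::real_normed_field) germ_section"
  assumes c: "c \<in> Cc (arrs G)" and d: "d \<in> Cc (bspace P)"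
  shows "left_module_act G P c d = L.act c d"
proof -
  let ?Q = "\<lambda>F :: ('g, 'k) germ_section \<Rightarrow> ('p, 'k) germ_section \<Rightarrow> ('p, 'k) germ_section.
    biadditive_on (Cc (arrs G)) (sec_add (mtop (arrs G))) (Cc (bspace P)) (sec_add (mtop (bspace P)))
       (sec_add (mtop (bspace P))) F \<and>
     (\<forall>U' u0 U f0. bisection G U' \<and> u0 \<in> Cc0 (objs G) (tgt G ` U') \<and>
        elementary (bspace P) (bproj P) U \<and> f0 \<in> Cc0 (objs G) (bproj P ` U) \<longrightarrow>
        F (T.elem U' u0) (Z.elem U f0) =
        Z.elem
          {lact P g p | g p. g \<in> U' \<and> p \<in> U \<and> src G g = bproj P p}
          (\<lambda>y. if y \<in> tgt G ` U' then u0 y * f0 (inv_into (src G ` U') (bisection_map G U') y) else 0))"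
  \<comment> \<open>The inverse of the bisection map sends the target of an arrow of
    \<open>U\<close> to its source, which identifies the prescribed coefficient with
    \<open>L.wgt\<close>.\<close>
  have w: "(\<lambda>y. if y \<in> tgt G ` U then u y * f (inv_into (src G ` U) (bisection_map G U) y) else 0) = L.wgt U u f"
    if U: "bisection G U" for U and u f :: "'x \<Rightarrow> 'k"
    by (rule ext) (auto simp: L.wgt_def bisection_inv[OF U] T.sectn[OF bisection_el(1)[OF U]])
  have "?Q L.act"
  proof (intro conjI allI impI)
    show "biadditive_on (Cc (arrs G)) (sec_add (mtop (arrs G))) (Cc (bspace P)) (sec_add (mtop (bspace P)))
       (sec_add (mtop (bspace P))) (L.act :: ('g, 'k) germ_section \<Rightarrow> ('p, 'k) germ_section \<Rightarrow> ('p, 'k) germ_section)"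
      unfolding biadditive_on_def by (intro conjI ballI L.act_add_left L.act_add_right)
    fix U' U and u0 f0 :: "'x \<Rightarrow> 'k"
    assume a: "bisection G U' \<and> u0 \<in> Cc0 (objs G) (tgt G ` U') \<and> Z.el U \<and> f0 \<in> Cc0 (objs G) (bproj P ` U)"
    show "L.act (T.elem U' u0) (Z.elem U f0) =
        Z.elem {lact P g p | g p. g \<in> U' \<and> p \<in> U \<and> src G g = bproj P p}
          (\<lambda>y. if y \<in> tgt G ` U' then u0 y * f0 (inv_into (src G ` U') (bisection_map G U') y) else 0)"
      unfolding w[OF conjunct1[OF a]] L.cmp_def[symmetric] using a by (intro L.act_elem bisection_el(1)) auto
  qed
  then have F: "?Q (left_module_act G P)" unfolding left_module_act_def by (rule someI[where P = ?Q])
  show ?thesis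
  proof (rule L.act_unique[OF conjunct1[OF F], where goodA = "bisection G" and goodB = "\<lambda>_. True"])
    show "left_module_act G P (T.elem U u) (Z.elem V f) = Z.elem (L.cmp U V) (L.wgt U u f)"
      if "bisection G U" "u \<in> Cc0 (objs G) (tgt G ` U)" "Z.el V" "f \<in> Cc0 (objs G) (bproj P ` V)" for U V and u f :: "'x \<Rightarrow> 'k"
      using F that unfolding L.cmp_def w[OF that(1), symmetric] by blast
  qed (use c d bisection_exists bisection_empty Z.el_exists in auto)
qed

end

section \<open>Convolution with functions on the units and the source of a spectral arrow\<close>

lemma (in etale_gpd) translation_left_space: "left_space G (translation_bundle G)"
proof unfold_locales
  have c: "left_fibre_product G (translation_bundle G) = composable G"
    by (simp add: left_fibre_product_def composable_def translation_bundle_def)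
  show "left_action G (translation_bundle G)"
    unfolding left_action_def c using gpd(7) mlt mlt_assoc by (auto simp: translation_bundle_def)
qed (use T.M T.haus T.P T.ld in \<open>simp_all add: translation_bundle_def\<close>)

context etale_gpd
begin

sublocale C: composition "objs G" "arrs G" "tgt G" "objs G" "arrs G" "tgt G" "arrs G" "tgt G" "src G" "mlt G"
  using left_space.left_composition[OF translation_left_space] by (simp add: translation_bundle_def)

lemma conv: "c \<in> Cc (arrs G) \<Longrightarrow> d \<in> Cc (arrs G) \<Longrightarrow> conv G c d = C.act c d"
  using left_space.left_module_act[OF translation_left_space] by (simp add: conv_def translation_bundle_def)

abbreviation "units \<equiv> unt G ` pts (objs G)"

text \<open>The unit map is a local diffeomorphism, so its image is open; source and target both
  invert it.\<close>

lemma units: "bisection G units" "tgt G ` units = pts (objs G)"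
proof -
  have "\<exists>T. openin (mtop (arrs G)) T \<and> g \<in> T \<and> T \<subseteq> units" if g: "g \<in> units" for g
  proof -
    obtain x where x: "x \<in> pts (objs G)" "g = unt G x" using g by blast
    have "local_diffeo (objs G) (pts (objs G)) (arrs G) (unt G)" using etale by (simp add: etale_groupoid_def)
    then obtain U V where "openin (mtop (objs G)) U" "x \<in> U" "openin (mtop (arrs G)) V" "diffeo (objs G) U (arrs G) V (unt G)"
      using x(1) unfolding local_diffeo_def subtopology_topspace by blast
    then show ?thesis using x openin_subset by (intro exI[of _ V]) (auto simp: diffeo_def bij_betw_def)
  qed
  then have "openin (mtop (arrs G)) units" using openin_subopen by blast
  then show "bisection G units" by (auto simp: bisection_def inj_on_def)
  show "tgt G ` units = pts (objs G)" by (force simp: image_image)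
qed

lemma base_incl:
  assumes u: "u \<in> Cc0 (objs G) (pts (objs G))"
  shows "base_incl G u \<in> Cc (arrs G)"
    and "x \<in> pts (objs G) \<Longrightarrow> T.bg (base_incl G u) (unt G x) x = u x"
    and "x \<in> pts (objs G) \<Longrightarrow> h \<in> pts (arrs G) \<Longrightarrow> tgt G h = x \<Longrightarrow> h \<noteq> unt G x \<Longrightarrow> base_incl G u h = germ (mtop (arrs G)) h (\<lambda>_. 0)"
proof -
  note e = bisection_el(1)[OF units(1)]
  have u': "u \<in> Cc0 (objs G) (tgt G ` units)" using u units(2) by simp
  show "base_incl G u \<in> Cc (arrs G)" unfolding base_incl_def by (rule T.elem_fun_Cc[OF e u'])
  show "T.bg (base_incl G u) (unt G x) x = u x" if "x \<in> pts (objs G)"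
    using T.bg_elem[OF e u', of "unt G x"] that by (simp add: base_incl_def)
  show "base_incl G u h = germ (mtop (arrs G)) h (\<lambda>_. 0)" if "x \<in> pts (objs G)" "h \<in> pts (arrs G)" "tgt G h = x" "h \<noteq> unt G x"
    unfolding base_incl_def by (rule T.elem_fun_zero[OF e, of "unt G x"]) (use that in auto)
qed

text \<open>Functions on the units act from the left through their value at the target and from the
  right through their value at the source; this is how the algebra remembers the source of an
  arrow.\<close>

lemma conv_base:
  fixes a :: "('g, 'k::real_normed_field) germ_section"
  assumes a: "T.delta a g" and u: "u \<in> Cc0 (objs G) (pts (objs G))"
  shows "T.bg (conv G (base_incl G u) a) g (tgt G g) = u (tgt G g)" "T.bg (conv G a (base_incl G u)) g (tgt G g) = u (src G g)"
proof -
  note D = T.delta_D[OF a]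
  have p: "tgt G g \<in> pts (objs G)" "src G g \<in> pts (objs G)" using T.pi_pts[OF D(2)] S.pi_pts[OF D(2)] .
  have "T.bg (C.act (base_incl G u) a) (mlt G (unt G (tgt G g)) g) (tgt G (unt G (tgt G g))) =
      T.bg (base_incl G u) (unt G (tgt G g)) (tgt G (unt G (tgt G g))) * T.bg a g (tgt G g)"
    by (rule C.act_value[OF base_incl(1)[OF u] D(1) unt(1)[OF p(1)] D(2)]) (use p base_incl(3)[OF u p(1)] in simp_all)
  then show "T.bg (conv G (base_incl G u) a) g (tgt G g) = u (tgt G g)"
    using conv[OF base_incl(1)[OF u] D(1)] p(1) D(2) base_incl(2)[OF u p(1)] T.bg_delta[OF a] by simp
  have "T.bg (C.act a (base_incl G u)) (mlt G g (unt G (src G g))) (tgt G g) =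
      T.bg a g (tgt G g) * T.bg (base_incl G u) (unt G (src G g)) (tgt G (unt G (src G g)))"
    by (rule C.act_value[OF D(1) base_incl(1)[OF u] D(2) unt(1)[OF p(2)]]) (use p T.delta_other[OF a] in simp_all)
  then show "T.bg (conv G a (base_incl G u)) g (tgt G g) = u (src G g)"
    using conv[OF D(1) base_incl(1)[OF u]] p(2) D(2) base_incl(2)[OF u p(2)] T.bg_delta[OF a] by simp
qed

text \<open>Composition with units does not move arrows, so both products live on \<open>U\<close>
  and their coefficients are compared arrow by arrow. Off \<open>U'\<close> both vanish, since
  \<open>u\<close> and \<open>flip U' u\<close> do.\<close>

lemma conv_base_flip:
  fixes f u :: "'x \<Rightarrow> 'k::real_normed_field"
  assumes U: "bisection G U" and f: "f \<in> Cc0 (objs G) (tgt G ` U)"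
    and U': "bisection G U'" "U' \<subseteq> U" and u: "u \<in> Cc0 (objs G) (tgt G ` U')"
  shows "conv G (base_incl G u) (T.elem U f) = conv G (T.elem U f) (base_incl G (flip U' u))"
proof -
  note e = bisection_el(1)[OF U] and e0 = bisection_el(1)[OF units(1)]
  have Up: "U \<subseteq> pts (arrs G)" using T.el_pts[OF e] .
  have p: "src G h \<in> pts (objs G)" "tgt G h \<in> pts (objs G)" if "h \<in> U" for h
    using that S.pi_pts[of h] T.pi_pts[of h] Up by auto
  have u0: "u \<in> Cc0 (objs G) (tgt G ` units)" "flip U' u \<in> Cc0 (objs G) (tgt G ` units)"
    unfolding units(2) using T.Cc0_pts u T.Cc0_pts[OF flip_Cc0[OF U'(1) u]] by blast+
  have c1: "C.cmp units U = U"
  proof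
    show "C.cmp units U \<subseteq> U" using Up by (auto simp: C.cmp_def)
    show "U \<subseteq> C.cmp units U" unfolding C.cmp_def
    proof
      fix h assume h: "h \<in> U"
      then show "h \<in> {mlt G a b |a b. a \<in> units \<and> b \<in> U \<and> src G a = tgt G b}"
        using Up p[OF h] by (intro CollectI exI[of _ "unt G (tgt G h)"] exI[of _ h]) auto
    qed
  qed
  have c2: "C.cmp U units = U"
  proof
    show "C.cmp U units \<subseteq> U" using Up by (auto simp: C.cmp_def) (metis mlt_unt(1) subsetD)
    show "U \<subseteq> C.cmp U units" unfolding C.cmp_def
    proof
      fix h assume h: "h \<in> U"
      then show "h \<in> {mlt G a b |a b. a \<in> U \<and> b \<in> units \<and> src G a = tgt G b}"
        using Up p[OF h] by (intro CollectI exI[of _ h] exI[of _ "unt G (src G h)"]) auto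
    qed
  qed
  have "C.wgt units u f (tgt G h) = C.wgt U f (flip U' u) (tgt G h)" if h: "h \<in> U" for h
  proof -
    have l: "C.wgt units u f (tgt G h) = u (tgt G h) * f (tgt G h)"
      using T.sectn[OF e0, of "unt G (tgt G h)"] p[OF h] units(2) by (simp add: C.wgt_def)
    have r: "C.wgt U f (flip U' u) (tgt G h) = f (tgt G h) * flip U' u (src G h)"
      using T.sectn[OF e h] h by (simp add: C.wgt_def)
    show ?thesis
    proof (cases "h \<in> U'")
      case True
      then show ?thesis using l r flip_src[OF U'(1) True, of u] by simp
    next
      case False
      have "tgt G h \<notin> tgt G ` U'" using False T.el_injD[OF e h] U'(2) by blast
      moreover have "src G h \<notin> src G ` U'" using False S.el_injD[OF bisection_el(2)[OF U] h] U'(2) by blast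
      ultimately show ?thesis using l r T.Cc0_outside[OF u] by (simp add: flip_def)
    qed
  qed
  then have "T.elem U (C.wgt units u f) = T.elem U (C.wgt U f (flip U' u))" by (rule T.elem_fun_cong[OF e])
  then show ?thesis
    using conv[OF T.elem_fun_Cc[OF e0 u0(1)] T.elem_fun_Cc[OF e f]] C.act_elem[OF e0 u0(1) e f]
      conv[OF T.elem_fun_Cc[OF e f] T.elem_fun_Cc[OF e0 u0(2)]] C.act_elem[OF e f e0 u0(2)]
    by (simp add: base_incl_def c1 c2)
qed

text \<open>Existence comes from a bump on a bisection through \<open>g\<close> and
  \<open>conv_base_flip\<close>. For uniqueness the commutation rule is evaluated at
  \<open>g\<close>: it compares values of functions at the target with their values at
  \<open>\<tau>\<close> of the source, and functions supported in \<open>W\<close> separate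
  points.\<close>

lemma spectral_src:
  assumes g: "g \<in> pts (arrs G)"
  shows "spectral_src G (T.Phi g :: ('x, 'g, 'k::real_normed_field) spectral_point) = src G g"
proof -
  let ?Q = "\<lambda>x. \<exists>(a :: ('g, 'k) germ_section) W V \<tau>.
     represents_arrow G a (T.Phi g) \<and> openin (mtop (objs G)) W \<and> fst (T.Phi g :: ('x, 'g, 'k) spectral_point) \<in> W \<and>
     normalised_on (groupoid_coalgebra G) W a \<and>
     openin (mtop (objs G)) V \<and> diffeo (objs G) V (objs G) W \<tau> \<and>
     (\<forall>u0\<in>Cc0 (objs G) W.
        conv G (base_incl G u0) a = conv G a (base_incl G (\<lambda>x'. if x' \<in> V then u0 (\<tau> x') else 0))) \<and>
     x = inv_into V \<tau> (fst (T.Phi g :: ('x, 'g, 'k) spectral_point))"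
  have ex: "?Q (src G g)"
  proof -
    obtain U N and f :: "'x \<Rightarrow> 'k" where U: "bisection G U" "g \<in> U" "f \<in> Cc0 (objs G) (tgt G ` U)"
      and N: "openin (mtop (objs G)) N" "tgt G g \<in> N" "N \<subseteq> tgt G ` U" "\<And>y. y \<in> N \<Longrightarrow> f y = 1"
      and a: "T.delta (T.elem U f) g" "T.elem U f \<in> S_weakly_grouplike G"
      by (rule arrow_exists[OF g]) blast
    note e = bisection_el(1)[OF U(1)]
    define U' where "U' = U \<inter> {h \<in> pts (arrs G). tgt G h \<in> N}"
    have U': "bisection G U'" "U' \<subseteq> U" "g \<in> U'" and im: "tgt G ` U' = N"
      using U(1,2) T.el_open[OF T.el_restrict[OF e N(1)]] g N(2,3) T.el_pts[OF e] unfolding U'_def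
      by (auto simp: bisection_def intro: inj_on_subset)
    have "\<forall>u\<in>Cc0 (objs G) N. conv G (base_incl G u) (T.elem U f) =
      conv G (T.elem U f) (base_incl G (\<lambda>x'. if x' \<in> src G ` U' then u (bisection_map G U' x') else 0))"
      using conv_base_flip[OF U(1,3) U'(1,2)] unfolding im flip_def[abs_def] by blast
    moreover have "normalised_on (groupoid_coalgebra G) N (T.elem U f)"
      using T.counit_elem[OF e U(3)] N(4) by (simp add: normalised_on_def)
    moreover have "src G g = inv_into (src G ` U') (bisection_map G U') (tgt G g)" using bisection_inv[OF U'(1,3)] by simp
    ultimately show ?thesis
      using represents_arrowI[OF a] N(1,2) bisection_diffeo[OF U'(1)] S.el_image_open[OF bisection_el(2)[OF U'(1)]]
      unfolding im T.fst_Phi by (intro exI[of _ "T.elem U f"] exI[of _ N] exI[of _ "src G ` U'"] exI[of _ "bisection_map G U'"]) simp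
  qed
  have un: "x = src G g" if Q: "?Q x" for x
  proof -
    obtain a :: "('g, 'k) germ_section" and W V \<tau> where r: "represents_arrow G a (T.Phi g)" and W: "openin (mtop (objs G)) W" "tgt G g \<in> W"
      and V: "openin (mtop (objs G)) V" and \<tau>: "diffeo (objs G) V (objs G) W \<tau>"
      and eq: "\<And>u0. u0 \<in> Cc0 (objs G) W \<Longrightarrow> conv G (base_incl G u0) a = conv G a (base_incl G (\<lambda>x'. if x' \<in> V then u0 (\<tau> x') else 0))"
      and x: "x = inv_into V \<tau> (tgt G g)"
      using Q unfolding T.fst_Phi by blast
    have d: "T.delta a g" by (rule represents_arrow_delta[OF g r])
    have tp: "tgt G g \<in> pts (objs G)" by (rule T.pi_pts[OF g])
    have key: "u (tgt G g) = (if src G g \<in> V then u (\<tau> (src G g)) else 0)" if u: "u \<in> Cc0 (objs G) W" for u :: "'x \<Rightarrow> 'k"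
      using conv_base(1)[OF d T.Cc0_pts[OF u]] conv_base(2)[OF d T.Cc0_pts[OF Cc0_pullback[OF gpd(2,3,2) V \<tau> u]]] eq[OF u] by simp
    have t: "\<tau> (src G g) = tgt G g"
    proof (rule ccontr)
      assume "\<tau> (src G g) \<noteq> tgt G g"
      then obtain u :: "'x \<Rightarrow> 'k" where "u \<in> Cc0 (objs G) W" "u (tgt G g) = 1" "u (\<tau> (src G g)) = 0"
        using T.Cc0_separate[OF tp, of W "\<tau> (src G g)"] W by blast
      then show False using key[of u] by (simp split: if_splits)
    qed
    \<comment> \<open>A function that is 1 at the target excludes the default value 0 in
      \<open>key\<close>, so the source lies in \<open>V\<close>.\<close>
    obtain u :: "'x \<Rightarrow> 'k" and N where u: "u \<in> Cc0 (objs G) W" "tgt G g \<in> N" "\<forall>y\<in>N. u y = 1" using T.Cc0_local_unit[OF W] by blast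
    then have "src G g \<in> V" using key[of u] by (auto split: if_splits)
    moreover have "inj_on \<tau> V" using \<tau> by (simp add: diffeo_def bij_betw_def)
    ultimately show ?thesis unfolding x t[symmetric] by (intro inv_into_f_f)
  qed
  show ?thesis unfolding spectral_src_def by (rule the_equality[where P = ?Q, OF ex un])
qed

end

section \<open>Principal bundles of etale groupoids\<close>

locale etale_bundle = G: etale_gpd G + H: etale_gpd H
  for G :: "('x, 'e::real_inner, 'g, 'd::real_inner) groupoid" and H :: "('y, 'f::real_inner, 'h, 'c::real_inner) groupoid" +
  fixes P :: "('p, 'q::real_inner, 'x, 'g, 'y, 'h) bibundle"
  assumes principal: "principal_bundle G H P"
begin

abbreviation F where "F \<equiv> {(p, p'). p \<in> pts (bspace P) \<and> p' \<in> pts (bspace P) \<and> bproj P p = bproj P p'}"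
abbreviation rfp where "rfp \<equiv> right_fibre_product H P"

text \<open>The division map of the principal bundle: \<open>dv (p, p')\<close> is the arrow
  carrying \<open>p\<close> to \<open>p'\<close>.\<close>

definition dv :: "'p \<times> 'p \<Rightarrow> 'h" where "dv z = snd (inv_into rfp (\<lambda>(p, h). (p, ract P p h)) z)"

lemma mP: "is_manifold (bspace P)"
  and subm: "submersion (bspace P) (objs G) (bproj P)"
  and mom: "smooth_map (bspace P) (pts (bspace P)) (objs H) (bmom P)"
  and lP: "left_action G P" and rP: "right_action H P"
  and ract_proj: "\<And>p h. (p, h) \<in> rfp \<Longrightarrow> bproj P (ract P p h) = bproj P p"
  and division: "diffeo (prod_manifold (bspace P) (arrs H)) rfp (prod_manifold (bspace P) (bspace P)) F (\<lambda>(p, h). (p, ract P p h))"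
  using principal unfolding principal_bundle_def by blast+

lemma ract_pts: "(p, h) \<in> rfp \<Longrightarrow> ract P p h \<in> pts (bspace P)"
  using rP smooth_map_subset_pts(2) unfolding right_action_def by fastforce

lemma ract_unt: "p \<in> pts (bspace P) \<Longrightarrow> ract P p (unt H (bmom P p)) = p"
  using rP by (simp add: right_action_def)

lemma mom_pts: "p \<in> pts (bspace P) \<Longrightarrow> bmom P p \<in> pts (objs H)"
  using smooth_map_subset_pts(2)[OF mom] by blast

lemma dv_ract:
  assumes "(p, h) \<in> rfp"
  shows "dv (p, ract P p h) = h"
proof -
  have "inj_on (\<lambda>(p, h). (p, ract P p h)) rfp" using division by (simp add: diffeo_def bij_betw_def)
  from inv_into_f_f[OF this assms] show ?thesis by (simp add: dv_def)
qed

lemma ract_dv: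
  assumes "(p, p') \<in> F"
  shows "(p, dv (p, p')) \<in> rfp" "ract P p (dv (p, p')) = p'"
proof -
  have "(\<lambda>(p, h). (p, ract P p h)) ` rfp = F" using division by (simp add: diffeo_def bij_betw_def)
  then obtain z where "z \<in> rfp" "(p, p') = (\<lambda>(p, h). (p, ract P p h)) z" using assms by blast
  then obtain h where "(p, h) \<in> rfp" "p' = ract P p h" by (cases z) auto
  then show "(p, dv (p, p')) \<in> rfp" "ract P p (dv (p, p')) = p'" using dv_ract by auto
qed

lemma smooth_dv: "smooth_map (prod_manifold (bspace P) (bspace P)) F (arrs H) dv"
proof -
  have s: "smooth_map (prod_manifold (bspace P) (bspace P)) F (prod_manifold (bspace P) (arrs H)) (inv_into rfp (\<lambda>(p, h). (p, ract P p h)))"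
    using division by (simp add: diffeo_def)
  show ?thesis unfolding dv_def[abs_def]
    by (rule smooth_map_compose[OF prod_manifold[OF mP mP] prod_manifold[OF mP H.gpd(4)] H.gpd(4) s smooth_map_fst_snd(2)[OF mP H.gpd(4) subset_refl]])
      (use smooth_map_subset_pts(2)[OF s] in simp)
qed

text \<open>Near \<open>(p, p)\<close> the division map takes values in the open set of units, so two nearby points of a
  fibre agree.\<close>

lemma proj_local_inj:
  assumes p: "p \<in> pts (bspace P)"
  shows "\<exists>W. openin (mtop (bspace P)) W \<and> p \<in> W \<and> inj_on (bproj P) W"
proof -
  have u: "(p, unt H (bmom P p)) \<in> rfp" using p mom_pts[OF p] by (simp add: right_fibre_product_def)
  have pF: "(p, p) \<in> F" using p by simp
  have "dv (p, p) \<in> H.units" using dv_ract[OF u] ract_unt[OF p] mom_pts[OF p] by simp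
  then obtain W where W: "openin (mtop (prod_manifold (bspace P) (bspace P))) W" "(p, p) \<in> W" "\<forall>z\<in>F \<inter> W. dv z \<in> H.units"
    using smooth_map_continuous_at[OF prod_manifold[OF mP mP] H.gpd(4) smooth_dv pF] H.units(1) unfolding bisection_def by blast
  obtain U V where UV: "openin (mtop (bspace P)) U" "openin (mtop (bspace P)) V" "p \<in> U" "p \<in> V" "U \<times> V \<subseteq> W"
    using W(1)[unfolded prod_manifold_simps openin_prod_topology_alt, rule_format, OF W(2)] by blast
  have "inj_on (bproj P) (U \<inter> V)"
  proof (rule inj_onI)
    fix q q' assume q: "q \<in> U \<inter> V" "q' \<in> U \<inter> V" "bproj P q = bproj P q'"
    then have qF: "(q, q') \<in> F" using openin_subset[OF UV(1)] by auto
    then have "dv (q, q') \<in> H.units" using W(3) UV(5) q by blast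
    then obtain y where y: "y \<in> pts (objs H)" "dv (q, q') = unt H y" by blast
    then have "bmom P q = y" using ract_dv(1)[OF qF] by (simp add: right_fibre_product_def)
    then show "q = q'" using ract_dv(2)[OF qF] ract_unt[of q] qF y(2) by simp
  qed
  then show ?thesis using UV by (intro exI[of _ "U \<inter> V"]) auto
qed

text \<open>Here the projection of the bundle, given as a submersion, becomes a local
  diffeomorphism, which makes the function space theory available for \<open>P\<close>.\<close>

sublocale left_space G P
  by unfold_locales (rule G.gpd(2), rule G.gpd(3), rule mP, rule submersion_local_diffeo[OF mP G.gpd(2) subm proj_local_inj], assumption, rule lP)

text \<open>The point of \<open>U\<close> in the fibre of \<open>q\<close> and the factor carrying
  it to \<open>q\<close> are both determined by \<open>q\<close>, the latter by division; so the
  product set is a preimage of \<open>V\<close> under a smooth map.\<close>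

lemma right_open:
  assumes U: "Z.el U" and V: "H.T.el V"
  shows "openin (mtop (bspace P)) {ract P p h |p h. p \<in> U \<and> h \<in> V \<and> bmom P p = tgt H h}"
proof -
  let ?A = "{q \<in> pts (bspace P). bproj P q \<in> bproj P ` U}"
  let ?s = "\<lambda>q. Z.sectn U (bproj P q)"
  have oA: "openin (mtop (bspace P)) ?A" by (rule Z.open_preimage[OF Z.el_image_open[OF U]])
  have s: "?s q \<in> U" "(?s q, q) \<in> F" if "q \<in> ?A" for q
    using that Z.sectn_in[of "bproj P q" U] Z.el_pts[OF U] by auto
  have "smooth_map (bspace P) ?A (bspace P) ?s"
    by (rule smooth_map_compose[OF mP G.gpd(2) mP smooth_map_subset_cong[OF Z.smooth_pi] Z.smooth_sectn[OF U]]) auto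
  moreover have "smooth_map (bspace P) ?A (bspace P) (\<lambda>q. q)" by (rule smooth_map_ident[OF mP]) auto
  ultimately have sp: "smooth_map (bspace P) ?A (prod_manifold (bspace P) (bspace P)) (\<lambda>q. (?s q, q))"
    by (rule smooth_map_Pair[OF mP mP mP])
  have "(\<lambda>q. (?s q, q)) ` ?A \<subseteq> F" using s(2) by (rule image_subsetI)
  from smooth_map_compose[OF mP prod_manifold[OF mP mP] H.gpd(4) sp smooth_dv this]
  have "smooth_map (bspace P) ?A (arrs H) (\<lambda>q. dv (?s q, q))" .
  from openin_continuous_map_preimage[OF smooth_map_continuous[OF mP H.gpd(4) this] H.T.el_open[OF V]]
  have "openin (subtopology (mtop (bspace P)) ?A) {q \<in> ?A. dv (?s q, q) \<in> V}" using openin_subset[OF oA] by (simp add: inf_absorb2)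
  then have "openin (mtop (bspace P)) {q \<in> ?A. dv (?s q, q) \<in> V}" using oA openin_trans_full by blast
  moreover have "{q \<in> ?A. dv (?s q, q) \<in> V} = {ract P p h |p h. p \<in> U \<and> h \<in> V \<and> bmom P p = tgt H h}"
  proof (intro set_eqI iffI)
    fix q assume "q \<in> {q \<in> ?A. dv (?s q, q) \<in> V}"
    then have q: "q \<in> ?A" "dv (?s q, q) \<in> V" by auto
    show "q \<in> {ract P p h |p h. p \<in> U \<and> h \<in> V \<and> bmom P p = tgt H h}" using s(1)[OF q(1)] ract_dv[OF s(2)[OF q(1)]] q(2)
      by (intro CollectI exI[of _ "?s q"] exI[of _ "dv (?s q, q)"]) (simp add: right_fibre_product_def)
  next
    fix q assume "q \<in> {ract P p h |p h. p \<in> U \<and> h \<in> V \<and> bmom P p = tgt H h}"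
    then obtain p h where ph: "q = ract P p h" "p \<in> U" "h \<in> V" "bmom P p = tgt H h" by blast
    have r: "(p, h) \<in> rfp" using ph Z.el_pts[OF U] H.T.el_pts[OF V] by (auto simp: right_fibre_product_def)
    have "?s q = p" using ract_proj[OF r] ph Z.sectn[OF U ph(2)] by simp
    then show "q \<in> {q \<in> ?A. dv (?s q, q) \<in> V}" using ract_proj[OF r] ract_pts[OF r] dv_ract[OF r] ph by simp
  qed
  ultimately show ?thesis by simp
qed

sublocale R: composition "objs G" "bspace P" "bproj P" "objs H" "arrs H" "tgt H" "bspace P" "bproj P" "bmom P" "ract P"
proof unfold_locales
  show "ract P a b \<in> pts (bspace P) \<and> bproj P (ract P a b) = bproj P a" if "a \<in> pts (bspace P)" "b \<in> pts (arrs H)" "bmom P a = tgt H b" for a b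
    using ract_pts[of a b] ract_proj[of a b] that by (simp add: right_fibre_product_def)
  show "b = b'" if "a \<in> pts (bspace P)" "b \<in> pts (arrs H)" "b' \<in> pts (arrs H)" "bmom P a = tgt H b" "bmom P a = tgt H b'" "ract P a b = ract P a b'" for a b b'
    using dv_ract[of a b] dv_ract[of a b'] that by (simp add: right_fibre_product_def)
qed (rule mom, rule right_open)

lemma right_module_act:
  fixes c :: "('p, 'k::real_normed_field) germ_section"
  assumes c: "c \<in> Cc (bspace P)" and d: "d \<in> Cc (arrs H)"
  shows "right_module_act G H P c d = R.act c d"
proof -
  let ?Q = "\<lambda>F :: ('p, 'k) germ_section \<Rightarrow> ('h, 'k) germ_section \<Rightarrow> ('p, 'k) germ_section.
     biadditive_on (Cc (bspace P)) (sec_add (mtop (bspace P))) (Cc (arrs H)) (sec_add (mtop (arrs H)))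
       (sec_add (mtop (bspace P))) F \<and>
     (\<forall>U f0 V v0. elementary (bspace P) (bproj P) U \<and> f0 \<in> Cc0 (objs G) (bproj P ` U) \<and>
        bisection H V \<and> v0 \<in> Cc0 (objs H) (tgt H ` V) \<longrightarrow>
        F (Z.elem U f0) (H.T.elem V v0) =
        Z.elem
          {ract P p h | p h. p \<in> U \<and> h \<in> V \<and> bmom P p = tgt H h}
          (\<lambda>y. if y \<in> bproj P ` U then f0 y * v0 (bmom P (inv_into U (bproj P) y)) else 0))"
  have w: "(\<lambda>y. if y \<in> bproj P ` U then u y * f (bmom P (inv_into U (bproj P) y)) else 0) = R.wgt U u f" for U and u f :: "_ \<Rightarrow> 'k"
    by (rule ext) (simp add: R.wgt_def Z.sectn_def)
  have "?Q R.act"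
  proof (intro conjI allI impI)
    show "biadditive_on (Cc (bspace P)) (sec_add (mtop (bspace P))) (Cc (arrs H)) (sec_add (mtop (arrs H)))
       (sec_add (mtop (bspace P))) (R.act :: ('p, 'k) germ_section \<Rightarrow> ('h, 'k) germ_section \<Rightarrow> ('p, 'k) germ_section)"
      unfolding biadditive_on_def by (intro conjI ballI R.act_add_left R.act_add_right)
    fix U V and f0 :: "'x \<Rightarrow> 'k" and v0 :: "'y \<Rightarrow> 'k"
    assume a: "Z.el U \<and> f0 \<in> Cc0 (objs G) (bproj P ` U) \<and> bisection H V \<and> v0 \<in> Cc0 (objs H) (tgt H ` V)"
    show "R.act (Z.elem U f0) (H.T.elem V v0) =
        Z.elem {ract P p h | p h. p \<in> U \<and> h \<in> V \<and> bmom P p = tgt H h}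
          (\<lambda>y. if y \<in> bproj P ` U then f0 y * v0 (bmom P (inv_into U (bproj P) y)) else 0)"
      unfolding w R.cmp_def[symmetric] using a by (intro R.act_elem H.bisection_el(1)) auto
  qed
  then have F: "?Q (right_module_act G H P)" unfolding right_module_act_def by (rule someI[where P = ?Q])
  show ?thesis
  proof (rule R.act_unique[OF conjunct1[OF F], where goodA = "\<lambda>_. True" and goodB = "bisection H"])
    show "right_module_act G H P (Z.elem U u) (H.T.elem V f) = Z.elem (R.cmp U V) (R.wgt U u f)"
      if "Z.el U" "u \<in> Cc0 (objs G) (bproj P ` U)" "f \<in> Cc0 (objs H) (tgt H ` V)" "bisection H V" for U V and u :: "'x \<Rightarrow> 'k" and f :: "'y \<Rightarrow> 'k"
      using F that unfolding R.cmp_def w[symmetric] by blast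
  qed (use c d H.bisection_exists H.bisection_empty Z.el_exists in auto)
qed

section \<open>Moment map and actions of the spectral bundle\<close>

lemma represents_point_delta:
  assumes p: "p \<in> pts (bspace P)" and m: "represents_point G P m (Z.Phi p :: ('x, 'p, 'k::real_normed_field) spectral_point)"
  shows "Z.delta m p"
  using m Z.Phi_eq_iff[OF _ p, of m] by (simp add: represents_point_def weakly_grouplike_def)

lemma represents_point_exists:
  assumes p: "p \<in> pts (bspace P)"
  obtains m :: "('p, 'k::real_normed_field) germ_section" where "represents_point G P m (Z.Phi p)"
proof -
  obtain m :: "('p, 'k) germ_section" where m: "Z.delta m p" "m \<in> weakly_grouplike (bundle_coalgebra G P)"
    "normalised_near (bundle_coalgebra G P) (mtop (objs G)) (bproj P p) m" using Z.delta_ex[OF p] by blast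
  show thesis by (rule that[of m]) (use m Z.Phi_eq[OF m(1)] in \<open>simp add: represents_point_def\<close>)
qed

text \<open>Units do not move points, so over the base point of \<open>p\<close> the product has
  zero germ away from \<open>p\<close>; the counit is its value at \<open>p\<close>, where
  \<open>m\<close> contributes 1 and the unit at the moment of \<open>p\<close> contributes
  \<open>v\<close>.\<close>

lemma counit_right:
  fixes m :: "('p, 'k::real_normed_field) germ_section"
  assumes m: "Z.delta m p" and v: "v \<in> Cc0 (objs H) (pts (objs H))"
  shows "cou (bundle_coalgebra G P) (right_module_act G H P m (base_incl H v)) (bproj P p) = v (bmom P p)"
proof -
  note D = Z.delta_D[OF m] and b = H.base_incl[OF v]
  note z = mom_pts[OF D(2)]
  let ?u = "unt H (bmom P p)"
  have zd: "\<And>h. h \<in> pts (arrs H) \<Longrightarrow> tgt H h = tgt H ?u \<Longrightarrow> h \<noteq> ?u \<Longrightarrow> base_incl H v h = germ (mtop (arrs H)) h (\<lambda>_. 0)"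
    using b(3)[OF z] z by simp
  have c: "R.act m (base_incl H v) \<in> Cc (bspace P)" by (rule R.act_Cc[OF D(1) b(1)])
  have "Z.bg (R.act m (base_incl H v)) (ract P p ?u) (bproj P p) = Z.bg m p (bproj P p) * H.T.bg (base_incl H v) ?u (tgt H ?u)"
    by (rule R.act_value[OF D(1) b(1) D(2)]) (use z Z.delta_other[OF m] in simp_all)
  then have val: "Z.bg (R.act m (base_incl H v)) p (bproj P p) = v (bmom P p)"
    using ract_unt[OF D(2)] Z.bg_delta[OF m] b(2)[OF z] z by simp
  have "R.act m (base_incl H v) q = germ (mtop (bspace P)) q (\<lambda>_. 0)"
    if "q \<in> pts (bspace P)" "bproj P q = bproj P p" "q \<noteq> p" for q
    by (rule R.act_zero[OF D(1) b(1) D(2), of ?u]) (use z zd that ract_unt[OF D(2)] Z.delta_other[OF m] in simp_all)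
  from germ_eq_value[OF Z.counit_single[OF c D(2) this] Z.pi_pts[OF D(2)]]
  show ?thesis using val right_module_act[OF D(1) b(1)] by simp
qed

text \<open>Every representative is a delta at \<open>p\<close>, so \<open>counit_right\<close>
  applies to all of them; functions with compact support separate the points of
  \<open>objs H\<close>, which gives uniqueness.\<close>

lemma spectral_moment:
  assumes p: "p \<in> pts (bspace P)"
  shows "spectral_moment G H P (Z.Phi p :: ('x, 'p, 'k::real_normed_field) spectral_point) = bmom P p"
  unfolding spectral_moment_def Z.fst_Phi
proof (rule the_equality)
  obtain m :: "('p, 'k) germ_section" where m: "represents_point G P m (Z.Phi p)" by (rule represents_point_exists[OF p])
  then show "bmom P p \<in> pts (objs H) \<and> (\<exists>m. represents_point G P m (Z.Phi p) \<and>
        (\<forall>v0\<in>Cc0 (objs H) (pts (objs H)).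
           cou (bundle_coalgebra G P) (right_module_act G H P m (base_incl H v0)) (bproj P p) = (v0 (bmom P p) :: 'k)))"
    using counit_right[OF represents_point_delta[OF p m]] mom_pts[OF p] by blast
next
  fix z assume z: "z \<in> pts (objs H) \<and> (\<exists>m. represents_point G P m (Z.Phi p) \<and>
        (\<forall>v0\<in>Cc0 (objs H) (pts (objs H)).
           cou (bundle_coalgebra G P) (right_module_act G H P m (base_incl H v0)) (bproj P p) = (v0 z :: 'k)))"
  then obtain m :: "('p, 'k) germ_section" where m: "represents_point G P m (Z.Phi p)"
    "\<And>v0. v0 \<in> Cc0 (objs H) (pts (objs H)) \<Longrightarrow> cou (bundle_coalgebra G P) (right_module_act G H P m (base_incl H v0)) (bproj P p) = v0 z" by blast
  have eq: "v0 z = v0 (bmom P p)" if "v0 \<in> Cc0 (objs H) (pts (objs H))" for v0 :: "'y \<Rightarrow> 'k"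
    using m(2)[OF that] counit_right[OF represents_point_delta[OF p m(1)] that] by simp
  show "z = bmom P p"
  proof (rule ccontr)
    assume "z \<noteq> bmom P p"
    then obtain u :: "'y \<Rightarrow> 'k" where "u \<in> Cc0 (objs H) (pts (objs H))" "u (bmom P p) = 1" "u z = 0"
      using H.T.Cc0_separate[OF mom_pts[OF p], of "pts (objs H)" z] by blast
    then show False using eq[of u] by simp
  qed
qed

text \<open>Representatives of the arrow and of the point are deltas, so by
  \<open>L.act_delta\<close> every admissible pair has as its product a delta at
  \<open>lact P g p\<close>, and the description by \<open>THE\<close> has exactly one
  solution.\<close>

lemma spectral_lact:
  assumes "(g, p) \<in> left_fibre_product G P"
  shows "lact (associated_bundle G H P) g (Z.Phi p :: ('x, 'p, 'k::real_normed_field) spectral_point) = Z.Phi (lact P g p)"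
proof -
  have g: "g \<in> pts (arrs G)" and p: "p \<in> pts (bspace P)" and gp: "src G g = bproj P p"
    using assms by (simp_all add: left_fibre_product_def)
  have *: "Z.Phi (lact P g p) = point_class G P (tgt G g) (left_module_act G P a m)"
    if "represents_arrow G a (G.T.Phi g)" "represents_point G P m (Z.Phi p)" for a m :: "(_, 'k) germ_section"
  proof -
    note d = G.represents_arrow_delta[OF g that(1)] represents_point_delta[OF p that(2)]
    show ?thesis
      using Z.Phi_eq[OF L.act_delta[OF d gp]] lact[OF g p gp] left_module_act[OF G.T.delta_D(1)[OF d(1)] Z.delta_D(1)[OF d(2)]] by simp
  qed
  obtain U N and f :: "'x \<Rightarrow> 'k" where a: "G.T.delta (G.T.elem U f) g" "G.T.elem U f \<in> S_weakly_grouplike G"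
    by (rule G.arrow_exists[OF g])
  obtain m :: "('p, 'k) germ_section" where m: "represents_point G P m (Z.Phi p)" by (rule represents_point_exists[OF p])
  let ?Q = "\<lambda>\<theta>. \<exists>(a :: ('g, 'k) germ_section) (m :: ('p, 'k) germ_section). represents_arrow G a (G.T.Phi g) \<and> represents_point G P m (Z.Phi p) \<and>
                spectral_src G (G.T.Phi g :: ('x, 'g, 'k) spectral_point) = bproj P p \<and> \<theta> = point_class G P (tgt G g) (left_module_act G P a m)"
  have the: "lact (associated_bundle G H P) g (Z.Phi p :: ('x, 'p, 'k) spectral_point) = (THE \<theta>. ?Q \<theta>)"
    by (simp add: associated_bundle_def pull_bundle_def spectral_bundle_def spectral_groupoid_def G.natural_iso[OF g])
  have ex: "?Q (Z.Phi (lact P g p))"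
    using G.represents_arrowI[OF a] m G.spectral_src[OF g, where ?'k = 'k] gp *[OF G.represents_arrowI[OF a] m]
    by (intro exI[of _ "G.T.elem U f"] exI[of _ m]) simp
  have un: "\<theta> = Z.Phi (lact P g p)" if "?Q \<theta>" for \<theta>
    using that * by (elim exE conjE) simp
  show ?thesis unfolding the by (rule the_equality[where P = ?Q, OF ex un])
qed

lemma spectral_ract:
  assumes "(p, h) \<in> rfp"
  shows "ract (associated_bundle G H P) (Z.Phi p :: ('x, 'p, 'k::real_normed_field) spectral_point) h = Z.Phi (ract P p h)"
proof -
  have p: "p \<in> pts (bspace P)" and h: "h \<in> pts (arrs H)" and ph: "bmom P p = tgt H h"
    using assms by (simp_all add: right_fibre_product_def)
  have *: "Z.Phi (ract P p h) = point_class G P (bproj P p) (right_module_act G H P m b)"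
    if "represents_point G P m (Z.Phi p)" "represents_arrow H b (H.T.Phi h)" for b m :: "(_, 'k) germ_section"
  proof -
    note d = represents_point_delta[OF p that(1)] H.represents_arrow_delta[OF h that(2)]
    show ?thesis
      using Z.Phi_eq[OF R.act_delta[OF d ph]] ract_proj[OF assms] right_module_act[OF Z.delta_D(1)[OF d(1)] H.T.delta_D(1)[OF d(2)]] by simp
  qed
  obtain U N and f :: "'y \<Rightarrow> 'k" where b: "H.T.delta (H.T.elem U f) h" "H.T.elem U f \<in> S_weakly_grouplike H"
    by (rule H.arrow_exists[OF h])
  obtain m :: "('p, 'k) germ_section" where m: "represents_point G P m (Z.Phi p)" by (rule represents_point_exists[OF p])
  let ?Q = "\<lambda>\<theta>. \<exists>(m :: ('p, 'k) germ_section) (b :: ('h, 'k) germ_section). represents_point G P m (Z.Phi p) \<and> represents_arrow H b (H.T.Phi h) \<and>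
                spectral_moment G H P (Z.Phi p :: ('x, 'p, 'k) spectral_point) = tgt H h \<and> \<theta> = point_class G P (bproj P p) (right_module_act G H P m b)"
  have the: "ract (associated_bundle G H P) (Z.Phi p :: ('x, 'p, 'k) spectral_point) h = (THE \<theta>. ?Q \<theta>)"
    by (simp add: associated_bundle_def pull_bundle_def spectral_bundle_def spectral_groupoid_def H.natural_iso[OF h])
  have ex: "?Q (Z.Phi (ract P p h))"
    using H.represents_arrowI[OF b] m spectral_moment[OF p, where ?'k = 'k] ph *[OF m H.represents_arrowI[OF b]]
    by (intro exI[of _ m] exI[of _ "H.T.elem U f"]) simp
  have un: "\<theta> = Z.Phi (ract P p h)" if "?Q \<theta>" for \<theta>
    using that * by (elim exE conjE) simp
  show ?thesis unfolding the by (rule the_equality[where P = ?Q, OF ex un])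
qed

lemma Phi_iso: "principal_bundle_iso G H P (associated_bundle G H P) (Z.Phi :: 'p \<Rightarrow> ('x, 'p, 'k::real_normed_field) spectral_point)"
proof -
  let ?Q = "associated_bundle G H P :: (('x, 'p, 'k) spectral_point, 'e, 'x, 'g, 'y, 'h) bibundle"
  have Q: "bspace ?Q = spectral_manifold (bundle_coalgebra G P) (objs G)" "bproj ?Q = fst" "bmom ?Q = spectral_moment G H P"
    by (simp_all add: associated_bundle_def pull_bundle_def spectral_bundle_def)
  show ?thesis
  proof (rule principal_bundle_transport[OF G.gpd(4,1) H.gpd(1,4,2) principal])
    show "is_manifold (bspace ?Q)" unfolding Q by (rule Z.spect_manifold)
    show "submersion (bspace ?Q) (objs G) (bproj ?Q)" unfolding Q by (rule Z.submersion_fst)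
    show "diffeo (bspace P) (pts (bspace P)) (bspace ?Q) (pts (bspace ?Q)) Z.Phi" unfolding Q by (rule Z.diffeo_Phi)
    show "bproj ?Q (Z.Phi p) = bproj P p" for p unfolding Q by (rule Z.fst_Phi)
    show "bmom ?Q (Z.Phi p) = bmom P p" if "p \<in> pts (bspace P)" for p unfolding Q by (rule spectral_moment[OF that])
    show "Z.Phi (lact P g p) = lact ?Q g (Z.Phi p)" if "(g, p) \<in> left_fibre_product G P" for g p by (rule spectral_lact[OF that, symmetric])
    show "Z.Phi (ract P p h) = ract ?Q (Z.Phi p) h" if "(p, h) \<in> rfp" for p h by (rule spectral_ract[OF that, symmetric])
  qed
qed

lemma Phi_germ:
  assumes p: "p \<in> pts (bspace P)"
  shows "\<exists>f\<in>weakly_grouplike (bundle_coalgebra G P :: ('x \<Rightarrow> 'k::real_normed_field, ('p, 'k) germ_section) coalgebra). f p = germ (mtop (bspace P)) p (\<lambda>_. 1)"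
    and "f \<in> weakly_grouplike (bundle_coalgebra G P :: ('x \<Rightarrow> 'k, ('p, 'k) germ_section) coalgebra) \<Longrightarrow> f p = germ (mtop (bspace P)) p (\<lambda>_. 1) \<Longrightarrow>
      Z.Phi p = point_class G P (bproj P p) f"
proof -
  obtain c :: "('p, 'k) germ_section" where c: "Z.delta c p" "c \<in> weakly_grouplike (bundle_coalgebra G P)" using Z.delta_ex[OF p] by blast
  show "\<exists>f\<in>weakly_grouplike (bundle_coalgebra G P :: ('x \<Rightarrow> 'k, ('p, 'k) germ_section) coalgebra). f p = germ (mtop (bspace P)) p (\<lambda>_. 1)"
    by (rule bexI[OF _ c(2)]) (use c(1) in \<open>simp add: Z.delta_def\<close>)
  show "Z.Phi p = point_class G P (bproj P p) f"
    if "f \<in> weakly_grouplike (bundle_coalgebra G P :: ('x \<Rightarrow> 'k, ('p, 'k) germ_section) coalgebra)" "f p = germ (mtop (bspace P)) p (\<lambda>_. 1)"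
    by (rule Z.Phi_eq[OF Z.weakly_grouplike_delta[OF that(1) p that(2)]])
qed

end

theorem lemma5p3:
  fixes G :: "('x, 'e::real_inner, 'g, 'd::real_inner) groupoid"
    and H :: "('y, 'f::real_inner, 'h, 'c::real_inner) groupoid"
    and P :: "('p, 'q::real_inner, 'x, 'g, 'y, 'h) bibundle"
  assumes "etale_groupoid G" and "etale_groupoid H" and "principal_bundle G H P"
  shows "\<exists>\<Phi> :: 'p \<Rightarrow> ('x, 'p, 'k::real_normed_field) spectral_point.
    (\<forall>p\<in>pts (bspace P).
       (\<exists>f\<in>weakly_grouplike (bundle_coalgebra G P :: ('x \<Rightarrow> 'k, ('p, 'k) germ_section) coalgebra). f p = germ (mtop (bspace P)) p (\<lambda>_. 1)) \<and>
       (\<forall>f\<in>weakly_grouplike (bundle_coalgebra G P). f p = germ (mtop (bspace P)) p (\<lambda>_. 1) \<longrightarrow>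
          \<Phi> p = point_class G P (bproj P p) f)) \<and>
    principal_bundle_iso G H P (associated_bundle G H P) \<Phi>"
proof -
  interpret etale_bundle G H P using assms by unfold_locales
  show ?thesis
    by (intro exI[of _ Z.Phi] conjI ballI impI Phi_iso Phi_germ)
qed

end
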